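(* Let $d$ be an odd positive integer. For every $\varepsilon>0$ there is a constant $s_3(\varepsilon)>0$ with the following property. Let $\mathcal{W}=(\mathcal{V}_1,\dots,\mathcal{V}_n)$ be any $\varepsilon$-separated frameset in $\mathbb{R}^{d+1,d}$, and let $G=\langle g_1,\dots,g_n\rangle$ be any $s_3(\varepsilon)$-contracting group based on $\mathcal{W}$. Then: (i) the group $G$ is free; (ii) there is a nonempty open set $\mathbf{T}\subset(\mathbb{R}^{d+1,d})^n$ (depending on $G$) such that for every $\mathbf{t}\in\mathbf{T}$, the affine deformation $G(\mathbf{t})$ of $G$ acts properly discontinuously on $\mathbb{R}^{d+1,d}$; (iii) for every $\mathbf{t}\in\mathbf{T}$, the quotient space $\mathbb{R}^{d+1,d}/G(\mathbf{t})$ is homeomorphic to a solid $(2d+1)$-dimensional handlebody with $n$ handles.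
   Context: The odd positive integer $d$ is fixed; constants may depend on it. $\mathbb{R}^{d+1,d}$ is $\mathbb{R}^{2d+1}$ equipped with a quadratic form $Q$ of signature $(d+1,d)$; $\perp$ refers to $Q$. $O(d+1,d)$ is the group of linear automorphisms preserving $Q$, $SO(d+1,d)$ its subgroup of elements of determinant $1$, and $SO^+(d+1,d)$ the identity component. Fix a maximal positive definite subspace $S$, let $T=S^\perp$, let $\pi_S,\pi_T$ be the corresponding orthogonal projections, and let $N_0(x)=Q(\pi_S(x))-Q(\pi_T(x))$, a positive definite form with norm $\|\cdot\|_{N_0}$ (also used for operator norms). MTIS means maximal totally isotropic subspace of $\mathbb{R}^{d+1,d}$ (it has dimension $d$). Two MTIS's are transversal if their intersection is $\{0\}$. Fix once and for all orientations on all MTIS's $V$ and on all their orthogonals $V^\perp$ such that every $f\in SO^+(d+1,d)$ induces orientation-preserving isomorphisms $V\to f(V)$ and $V^\perp\to f(V^\perp)$ (such a choice exists). The positive wing of an MTIS $V$ is the half-space $V^{\mathsf{L}}=\{v+xe: v\in V,\ x\ge 0\}$, where $e\in V^\perp$ is any vector such that whenever $(e_1,\dots,e_d)$ is a direct basis of $V$, $(e_1,\dots,e_d,e)$ is a direct basis of $V^\perp$. For nonzero $x,y$, $\alpha_{N_0}(x,y)\in[0,\pi]$ is the angle between $x$ and $y$ for $N_0$; for sets $X,Y$, $\alpha_{N_0}(X,Y)$ is the infimum of $\alpha_{N_0}(x,y)$ over nonzero $x\in X$, $y\in Y$. A frame is an ordered pair $\mathcal{V}=(V_<,V_>)$ of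 transversal MTIS's. Its separation is $\alpha_{N_0}(V_<^{\mathsf{L}},V_>^{\mathsf{L}})$. A frameset is a tuple $\mathcal{W}=(\mathcal{V}_1,\dots,\mathcal{V}_n)$ of frames whose $2n$ components are pairwise transversal MTIS's; its separation is the minimum of $\alpha_{N_0}(V^{\mathsf{L}},V'^{\mathsf{L}})$ over all pairs of these $2n$ MTIS's. It is $\varepsilon$-separated if its separation is $\ge\varepsilon$. For $g\in GL(\mathbb{R}^{d+1,d})$, let $V_<(g)$, $V_=(g)$, $V_>(g)$ be the $g$-invariant subspaces, with direct sum $\mathbb{R}^{d+1,d}$, on which all eigenvalues of $g$ have modulus $<1$, $=1$, $>1$ respectively. $g$ is pseudohyperbolic if $g\in O(d+1,d)$, $\dim V_=(g)=1$ and the eigenvalue of $g$ on $V_=(g)$ is $1$; then $g\in SO(d+1,d)$ and $(V_<(g),V_>(g))$ is a frame, called the frame of $g$. Its strength of contraction is $s(g)=\max(\|g|_{V_<(g)}\|_{N_0},\ \|(g|_{V_>(g)})^{-1}\|_{N_0})$. For $s>0$, $g$ is $s$-contracting if $s(g)\le s$. A group based on $\mathcal{W}$ is a group $G$ generated by pseudohyperbolic maps $g_1,\dots,g_n$ with respective frames $\mathcal{V}_1,\dots,\mathcal{V}_n$; it is $s$-contracting if all $g_i$ are. An affine deformation of a linear group $G\subset SO(d+1,d)$ is a group $\Gamma$ of affine transformations of $\mathbb{R}^{d+1,d}$ with linear parts in $SO(d+1,d)$ such that taking the linear part induces an isomorphism $\Gamma\to G$. For $\mathbf{t}=(t_1,\dots,t_n)\in(\mathbb{R}^{d+1,d})^n$,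 $G(\mathbf{t})$ is the group generated by the affine maps $\gamma_i:x\mapsto g_i(x)+t_i$, $1\le i\le n$ (an affine deformation of $G$ when $G$ is free on $g_1,\dots,g_n$). Since the quotient in (iii) is a manifold without boundary, the solid handlebody is understood without its boundary: the interior of the compact orientable manifold obtained from a closed $(2d+1)$-ball by attaching $n$ one-handles. *)

theory Defs
  imports
    "HOL-Analysis.Analysis"
    "HOL-Algebra.Bij"
    "HOL-Algebra.Generated_Groups"
begin

section \<open>The space of signature \<open>(d + 1, d)\<close>\<close>

text \<open>The existence of the isomorphism \<open>f\<close> (Sylvester normal form) also forces \<open>Q\<close> to be a
  nondegenerate quadratic form and \<open>p + q\<close> to be the dimension.\<close>

definition has_signature :: "(real ^ 'n \<Rightarrow> real) \<Rightarrow> nat \<Rightarrow> nat \<Rightarrow> bool" where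
  "has_signature Q p q \<longleftrightarrow>
    (\<exists>(I :: 'n set) (f :: real ^ 'n \<Rightarrow> real ^ 'n). card I = p \<and> card (- I) = q \<and> linear f \<and> bij f \<and>
      (\<forall>x. Q (f x) = (\<Sum>i\<in>I. (x $ i)\<^sup>2) - (\<Sum>i\<in>- I. (x $ i)\<^sup>2)))"

definition polar :: "(real ^ 'n \<Rightarrow> real) \<Rightarrow> real ^ 'n \<Rightarrow> real ^ 'n \<Rightarrow> real" where
  "polar Q x y = (Q (x + y) - Q x - Q y) / 2"

definition perp :: "(real ^ 'n \<Rightarrow> real) \<Rightarrow> (real ^ 'n) set \<Rightarrow> (real ^ 'n) set" where
  "perp Q V = {y. \<forall>x\<in>V. polar Q x y = 0}"

definition O_grp :: "(real ^ 'n \<Rightarrow> real) \<Rightarrow> (real ^ 'n \<Rightarrow> real ^ 'n) set" where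
  "O_grp Q = {f. linear f \<and> bij f \<and> (\<forall>x. Q (f x) = Q x)}"

definition SO_grp :: "(real ^ 'n \<Rightarrow> real) \<Rightarrow> (real ^ 'n \<Rightarrow> real ^ 'n) set" where
  "SO_grp Q = {f \<in> O_grp Q. det (matrix f) = 1}"

definition SO_plus :: "(real ^ 'n \<Rightarrow> real) \<Rightarrow> (real ^ 'n \<Rightarrow> real ^ 'n) set" where
  "SO_plus Q = {f \<in> SO_grp Q. matrix f \<in> connected_component_set (matrix ` SO_grp Q) (mat 1)}"


section \<open>The positive definite form \<open>N\<^sub>0\<close>\<close>

definition positive_definite_subspace :: "(real ^ 'n \<Rightarrow> real) \<Rightarrow> (real ^ 'n) set \<Rightarrow> bool" where
  "positive_definite_subspace Q S \<longleftrightarrow> subspace S \<and> (\<forall>x\<in>S. x \<noteq> 0 \<longrightarrow> Q x > 0)"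

definition maximal_positive_definite :: "(real ^ 'n \<Rightarrow> real) \<Rightarrow> (real ^ 'n) set \<Rightarrow> bool" where
  "maximal_positive_definite Q S \<longleftrightarrow> positive_definite_subspace Q S \<and>
    (\<forall>S'. positive_definite_subspace Q S' \<and> S \<subseteq> S' \<longrightarrow> S' = S)"

definition orth_proj :: "(real ^ 'n \<Rightarrow> real) \<Rightarrow> (real ^ 'n) set \<Rightarrow> real ^ 'n \<Rightarrow> real ^ 'n" where
  "orth_proj Q U x = (THE u. u \<in> U \<and> x - u \<in> perp Q U)"

definition N0 :: "(real ^ 'n \<Rightarrow> real) \<Rightarrow> (real ^ 'n) set \<Rightarrow> real ^ 'n \<Rightarrow> real" where
  "N0 Q S x = Q (orth_proj Q S x) - Q (orth_proj Q (perp Q S) x)"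

text \<open>In the following, \<open>N\<close> is an arbitrary positive definite quadratic form.\<close>

definition form_norm :: "(real ^ 'n \<Rightarrow> real) \<Rightarrow> real ^ 'n \<Rightarrow> real" where
  "form_norm N x = sqrt (N x)"

definition form_opnorm ::
    "(real ^ 'n \<Rightarrow> real) \<Rightarrow> (real ^ 'n) set \<Rightarrow> (real ^ 'n \<Rightarrow> real ^ 'n) \<Rightarrow> real" where
  "form_opnorm N U f = Sup {form_norm N (f x) / form_norm N x | x. x \<in> U \<and> x \<noteq> 0}"

definition form_angle :: "(real ^ 'n \<Rightarrow> real) \<Rightarrow> real ^ 'n \<Rightarrow> real ^ 'n \<Rightarrow> real" where
  "form_angle N x y = arccos (polar N x y / (form_norm N x * form_norm N y))"

definition set_angle :: "(real ^ 'n \<Rightarrow> real) \<Rightarrow> (real ^ 'n) set \<Rightarrow> (real ^ 'n) set \<Rightarrow> real" where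
  "set_angle N X Y = Inf {form_angle N x y | x y. x \<in> X \<and> x \<noteq> 0 \<and> y \<in> Y \<and> y \<noteq> 0}"


section \<open>Maximal totally isotropic subspaces, orientations and positive wings\<close>

definition totally_isotropic :: "(real ^ 'n \<Rightarrow> real) \<Rightarrow> (real ^ 'n) set \<Rightarrow> bool" where
  "totally_isotropic Q V \<longleftrightarrow> subspace V \<and> (\<forall>x\<in>V. \<forall>y\<in>V. polar Q x y = 0)"

definition MTIS :: "(real ^ 'n \<Rightarrow> real) \<Rightarrow> (real ^ 'n) set \<Rightarrow> bool" where
  "MTIS Q V \<longleftrightarrow> totally_isotropic Q V \<and>
    (\<forall>V'. totally_isotropic Q V' \<and> V \<subseteq> V' \<longrightarrow> V' = V)"

definition transversal :: "(real ^ 'n) set \<Rightarrow> (real ^ 'n) set \<Rightarrow> bool" where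
  "transversal V V' \<longleftrightarrow> V \<inter> V' = {0}"

definition ordered_basis :: "(real ^ 'n) list \<Rightarrow> (real ^ 'n) set \<Rightarrow> bool" where
  "ordered_basis bs V \<longleftrightarrow> distinct bs \<and> independent (set bs) \<and> span (set bs) = V"

text \<open>The change of basis matrix \<open>C\<close> has size \<open>length bs\<close>, which is not the cardinality of a type;
  its determinant is therefore written out by the Leibniz formula.\<close>

definition same_orientation :: "(real ^ 'n) list \<Rightarrow> (real ^ 'n) list \<Rightarrow> bool" where
  "same_orientation bs cs \<longleftrightarrow> length cs = length bs \<and>
    (\<exists>C :: nat \<Rightarrow> nat \<Rightarrow> real.
      (\<forall>j < length bs. cs ! j = (\<Sum>i < length bs. C i j *\<^sub>R bs ! i)) \<and>
      (\<Sum>p | p permutes {..<length bs}. of_int (sign p) * (\<Prod>i < length bs. C i (p i))) > 0)"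

text \<open>An orientation of a subspace is represented by the set of its direct bases.\<close>

definition is_orientation :: "(real ^ 'n) set \<Rightarrow> (real ^ 'n) list set \<Rightarrow> bool" where
  "is_orientation V B \<longleftrightarrow>
    (\<exists>bs. ordered_basis bs V \<and> B = {cs. ordered_basis cs V \<and> same_orientation bs cs})"

definition orientation_choice ::
    "(real ^ 'n \<Rightarrow> real) \<Rightarrow> ((real ^ 'n) set \<Rightarrow> (real ^ 'n) list set) \<Rightarrow> bool" where
  "orientation_choice Q ori \<longleftrightarrow>
    (\<forall>V. MTIS Q V \<longrightarrow>
      is_orientation V (ori V) \<and> is_orientation (perp Q V) (ori (perp Q V)) \<and>
      (\<forall>f \<in> SO_plus Q.
        map f ` ori V = ori (f ` V) \<and> map f ` ori (perp Q V) = ori (f ` perp Q V)))"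

text \<open>The half-space does not depend on the choice of \<open>e\<close>, so the union over all admissible
  \<open>e\<close> is the half-space obtained from any one of them.\<close>

definition positive_wing ::
    "(real ^ 'n \<Rightarrow> real) \<Rightarrow> ((real ^ 'n) set \<Rightarrow> (real ^ 'n) list set) \<Rightarrow>
     (real ^ 'n) set \<Rightarrow> (real ^ 'n) set" where
  "positive_wing Q ori V = {v + x *\<^sub>R e | v x e. v \<in> V \<and> x \<ge> 0 \<and> e \<in> perp Q V \<and>
    (\<forall>bs \<in> ori V. bs @ [e] \<in> ori (perp Q V))}"


section \<open>Frames and framesets\<close>

type_synonym 'n subspace_pair = "(real ^ 'n) set \<times> (real ^ 'n) set"

definition is_frame :: "(real ^ 'n \<Rightarrow> real) \<Rightarrow> 'n subspace_pair \<Rightarrow> bool" where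
  "is_frame Q P \<longleftrightarrow> MTIS Q (fst P) \<and> MTIS Q (snd P) \<and> transversal (fst P) (snd P)"

text \<open>The \<open>2 n\<close> components of a tuple \<open>W 0, \<dots>, W (n - 1)\<close> of pairs are indexed by
  \<open>{..<n} \<times> UNIV\<close>.\<close>

fun component :: "(nat \<Rightarrow> 'n subspace_pair) \<Rightarrow> nat \<times> bool \<Rightarrow> (real ^ 'n) set" where
  "component W (i, b) = (if b then snd (W i) else fst (W i))"

definition is_frameset :: "(real ^ 'n \<Rightarrow> real) \<Rightarrow> nat \<Rightarrow> (nat \<Rightarrow> 'n subspace_pair) \<Rightarrow> bool" where
  "is_frameset Q n W \<longleftrightarrow> (\<forall>i<n. is_frame Q (W i)) \<and>
    (\<forall>k \<in> {..<n} \<times> UNIV. \<forall>l \<in> {..<n} \<times> UNIV. k \<noteq> l \<longrightarrow>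
      transversal (component W k) (component W l))"

definition separation ::
    "(real ^ 'n \<Rightarrow> real) \<Rightarrow> (real ^ 'n) set \<Rightarrow> ((real ^ 'n) set \<Rightarrow> (real ^ 'n) list set) \<Rightarrow>
     nat \<Rightarrow> (nat \<Rightarrow> 'n subspace_pair) \<Rightarrow> real" where
  "separation Q S ori n W =
    Min {set_angle (N0 Q S) (positive_wing Q ori (component W k)) (positive_wing Q ori (component W l))
      | k l. k \<in> {..<n} \<times> UNIV \<and> l \<in> {..<n} \<times> UNIV \<and> k \<noteq> l}"


section \<open>Pseudohyperbolic maps\<close>

text \<open>\<open>z\<close> is an eigenvalue, with eigenvector \<open>u + \<i> v\<close>, of the complexification of \<open>g\<close> restricted to
  the invariant subspace \<open>U\<close>.\<close>

definition eigenvalue_on :: "(real ^ 'n \<Rightarrow> real ^ 'n) \<Rightarrow> (real ^ 'n) set \<Rightarrow> complex \<Rightarrow> bool" where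
  "eigenvalue_on g U z \<longleftrightarrow> (\<exists>u\<in>U. \<exists>v\<in>U. (u \<noteq> 0 \<or> v \<noteq> 0) \<and>
    g u = Re z *\<^sub>R u - Im z *\<^sub>R v \<and> g v = Im z *\<^sub>R u + Re z *\<^sub>R v)"

definition invariant_subspace :: "(real ^ 'n \<Rightarrow> real ^ 'n) \<Rightarrow> (real ^ 'n) set \<Rightarrow> bool" where
  "invariant_subspace g U \<longleftrightarrow> subspace U \<and> g ` U \<subseteq> U"

definition modulus_splitting ::
    "(real ^ 'n \<Rightarrow> real ^ 'n) \<Rightarrow> (real ^ 'n) set \<Rightarrow> (real ^ 'n) set \<Rightarrow> (real ^ 'n) set \<Rightarrow> bool" where
  "modulus_splitting g U1 U2 U3 \<longleftrightarrow>
    invariant_subspace g U1 \<and> invariant_subspace g U2 \<and> invariant_subspace g U3 \<and>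
    (\<forall>x. \<exists>!(a, b, c). a \<in> U1 \<and> b \<in> U2 \<and> c \<in> U3 \<and> x = a + b + c) \<and>
    (\<forall>z. eigenvalue_on g U1 z \<longrightarrow> cmod z < 1) \<and>
    (\<forall>z. eigenvalue_on g U2 z \<longrightarrow> cmod z = 1) \<and>
    (\<forall>z. eigenvalue_on g U3 z \<longrightarrow> cmod z > 1)"

definition V_lt :: "(real ^ 'n \<Rightarrow> real ^ 'n) \<Rightarrow> (real ^ 'n) set" where
  "V_lt g = (THE U1. \<exists>U2 U3. modulus_splitting g U1 U2 U3)"

definition V_eq :: "(real ^ 'n \<Rightarrow> real ^ 'n) \<Rightarrow> (real ^ 'n) set" where
  "V_eq g = (THE U2. \<exists>U1 U3. modulus_splitting g U1 U2 U3)"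

definition V_gt :: "(real ^ 'n \<Rightarrow> real ^ 'n) \<Rightarrow> (real ^ 'n) set" where
  "V_gt g = (THE U3. \<exists>U1 U2. modulus_splitting g U1 U2 U3)"

definition pseudohyperbolic :: "(real ^ 'n \<Rightarrow> real) \<Rightarrow> (real ^ 'n \<Rightarrow> real ^ 'n) \<Rightarrow> bool" where
  "pseudohyperbolic Q g \<longleftrightarrow> g \<in> O_grp Q \<and> dim (V_eq g) = 1 \<and> (\<forall>x \<in> V_eq g. g x = x)"

definition frame_of :: "(real ^ 'n \<Rightarrow> real ^ 'n) \<Rightarrow> 'n subspace_pair" where
  "frame_of g = (V_lt g, V_gt g)"

definition contraction_strength ::
    "(real ^ 'n \<Rightarrow> real) \<Rightarrow> (real ^ 'n) set \<Rightarrow> (real ^ 'n \<Rightarrow> real ^ 'n) \<Rightarrow> real" where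
  "contraction_strength Q S g =
    max (form_opnorm (N0 Q S) (V_lt g) g) (form_opnorm (N0 Q S) (V_gt g) (inv_into (V_gt g) g))"


section \<open>Groups of transformations\<close>

text \<open>A group of transformations is given by its set of elements, a subgroup of
  \<open>BijGroup UNIV\<close>.\<close>

abbreviation transformation_group :: "('a \<Rightarrow> 'a) set \<Rightarrow> ('a \<Rightarrow> 'a) monoid" where
  "transformation_group \<Gamma> \<equiv> (BijGroup UNIV)\<lparr>carrier := \<Gamma>\<rparr>"

definition generated_group :: "nat \<Rightarrow> (nat \<Rightarrow> 'a \<Rightarrow> 'a) \<Rightarrow> ('a \<Rightarrow> 'a) set" where
  "generated_group n g = generate (BijGroup UNIV) (g ` {..<n})"

definition affine_generated_group ::
    "nat \<Rightarrow> (nat \<Rightarrow> real ^ 'n \<Rightarrow> real ^ 'n) \<Rightarrow> (nat \<Rightarrow> real ^ 'n) \<Rightarrow> (real ^ 'n \<Rightarrow> real ^ 'n) set" where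
  "affine_generated_group n g t = generated_group n (\<lambda>i x. g i x + t i)"

text \<open>The letter \<open>(x, True)\<close> stands for \<open>x\<close> and \<open>(x, False)\<close> for the inverse of \<open>x\<close>.\<close>

definition reduced_word :: "('a \<times> bool) list \<Rightarrow> bool" where
  "reduced_word w \<longleftrightarrow> successively (\<lambda>(x, b) (y, c). \<not> (x = y \<and> b \<noteq> c)) w"

definition word_value :: "('a, 'm) monoid_scheme \<Rightarrow> ('a \<times> bool) list \<Rightarrow> 'a" where
  "word_value G w =
    foldr (\<lambda>(x, b) y. (if b then x else inv\<^bsub>G\<^esub> x) \<otimes>\<^bsub>G\<^esub> y) w \<one>\<^bsub>G\<^esub>"

definition free_group :: "('a, 'm) monoid_scheme \<Rightarrow> bool" where
  "free_group G \<longleftrightarrow> group G \<and>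
    (\<exists>X \<subseteq> carrier G. generate G X = carrier G \<and>
      (\<forall>w. w \<noteq> [] \<and> set w \<subseteq> X \<times> UNIV \<and> reduced_word w \<longrightarrow> word_value G w \<noteq> \<one>\<^bsub>G\<^esub>))"

text \<open>\<open>\<gamma>\<close> is affine with linear part \<open>f\<close> iff \<open>f = linear_part \<gamma>\<close> and \<open>f\<close> is linear.\<close>

definition linear_part :: "(real ^ 'n \<Rightarrow> real ^ 'n) \<Rightarrow> real ^ 'n \<Rightarrow> real ^ 'n" where
  "linear_part \<gamma> = (\<lambda>x. \<gamma> x - \<gamma> 0)"

definition affine_deformation ::
    "(real ^ 'n \<Rightarrow> real) \<Rightarrow> (real ^ 'n \<Rightarrow> real ^ 'n) set \<Rightarrow> (real ^ 'n \<Rightarrow> real ^ 'n) set \<Rightarrow> bool" where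
  "affine_deformation Q \<Gamma> G \<longleftrightarrow>
    subgroup \<Gamma> (BijGroup UNIV) \<and> (\<forall>\<gamma>\<in>\<Gamma>. linear_part \<gamma> \<in> SO_grp Q) \<and>
    linear_part \<in> iso (transformation_group \<Gamma>) (transformation_group G)"

definition acts_properly_discontinuously :: "('a::topological_space \<Rightarrow> 'a) set \<Rightarrow> bool" where
  "acts_properly_discontinuously \<Gamma> \<longleftrightarrow>
    (\<forall>K. compact K \<longrightarrow> finite {\<gamma>\<in>\<Gamma>. \<gamma> ` K \<inter> K \<noteq> {}})"

definition orbit_of :: "('a \<Rightarrow> 'a) set \<Rightarrow> 'a \<Rightarrow> 'a set" where
  "orbit_of \<Gamma> x = {\<gamma> x | \<gamma>. \<gamma> \<in> \<Gamma>}"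

definition orbit_space :: "('a::topological_space \<Rightarrow> 'a) set \<Rightarrow> 'a set topology" where
  "orbit_space \<Gamma> = topology (\<lambda>U. U \<subseteq> range (orbit_of \<Gamma>) \<and> open (orbit_of \<Gamma> -` U))"

lemma openin_orbit_space:
  "openin (orbit_space \<Gamma>) U \<longleftrightarrow> U \<subseteq> range (orbit_of \<Gamma>) \<and> open (orbit_of \<Gamma> -` U)"
proof -
  have "istopology (\<lambda>U. U \<subseteq> range (orbit_of \<Gamma>) \<and> open (orbit_of \<Gamma> -` U))"
    unfolding istopology_def by (auto simp: vimage_Union)
  then show ?thesis
    unfolding orbit_space_def by (simp add: topology_inverse')
qed

lemma quotient_map_orbit_space: "quotient_map euclidean (orbit_space \<Gamma>) (orbit_of \<Gamma>)"
proof -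
  have "topspace (orbit_space \<Gamma>) = range (orbit_of \<Gamma>)"
  proof
    show "topspace (orbit_space \<Gamma>) \<subseteq> range (orbit_of \<Gamma>)"
      using openin_orbit_space openin_topspace by blast
    show "range (orbit_of \<Gamma>) \<subseteq> topspace (orbit_space \<Gamma>)"
      by (rule openin_subset) (simp add: openin_orbit_space vimage_def)
  qed
  then show ?thesis
    by (auto simp: quotient_map_def openin_orbit_space vimage_def)
qed


section \<open>Handlebodies\<close>

text \<open>A closed ball of dimension \<open>m = CARD('n)\<close> with \<open>n\<close> one-handles \<open>[-1, 1] \<times> D\<close>, where \<open>D\<close> is the closed
  \<open>(m - 1)\<close>-disc, attached along the end discs \<open>{-1, 1} \<times> D\<close>. The body is realised as a codimension \<open>0\<close> subset
  of \<open>\<real>\<^sup>m\<close>: this is what makes it orientable, and its interior as a manifold is its topological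
  interior in \<open>\<real>\<^sup>m\<close>. For \<open>m \<ge> 3\<close> every orientable handlebody has such a realisation.\<close>

definition is_handlebody :: "nat \<Rightarrow> (real ^ 'n) set \<Rightarrow> bool" where
  "is_handlebody n X \<longleftrightarrow>
    (\<exists>(k :: 'n) (h :: nat \<Rightarrow> real \<times> (real ^ 'n) \<Rightarrow> real ^ 'n). let D = {y. norm y \<le> 1 \<and> y $ k = 0} in
      (\<forall>i<n. continuous_on ({-1..1} \<times> D) (h i) \<and> inj_on (h i) ({-1..1} \<times> D) \<and>
        h i ` ({-1, 1} \<times> D) \<subseteq> sphere 0 1 \<and>
        h i ` ({-1<..<1} \<times> D) \<inter> cball 0 1 = {}) \<and>
      (\<forall>i<n. \<forall>j<n. i \<noteq> j \<longrightarrow> h i ` ({-1..1} \<times> D) \<inter> h j ` ({-1..1} \<times> D) = {}) \<and>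
      X = cball 0 1 \<union> (\<Union>i<n. h i ` ({-1..1} \<times> D)))"

end

theory Submission
  imports Defs "HOL-Computational_Algebra.Fundamental_Theorem_Algebra"
begin

text \<open>The linear theory reduces to a ping-pong. Write \<open>k\<close> for one of the \<open>2 n\<close> components \<open>V\<^sub>k\<close> of the
  frameset, \<open>bar k\<close> for the other component of the same frame and \<open>g\<^sub>k\<close> for the generator (or inverse of a generator)
  attracting towards \<open>V\<^sub>k\<close>. The neutral line of \<open>g\<^sub>k\<close> is spanned by a vector \<open>e\<^sub>k = - e\<^bsub>bar k\<^esub>\<close> with
  \<open>V\<^sub>k + \<real>\<^sub>+ e\<^sub>k\<close> contained in the positive wing, and around this half-space there is a cone \<open>F\<^sub>k \<le> 0\<close> with
  \<open>F\<^sub>k \<circ> g\<^sub>k \<le> - F\<^bsub>bar k\<^esub>\<close>. Separation of the wings makes the cones meet only in \<open>0\<close>, so \<open>G\<close> is free. A translation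
  part close to \<open>3 e\<^sub>k\<close> gains enough room to shrink the cones to disjoint closed sets \<open>P\<^sub>k \<le> 0\<close> that the affine
  maps pair exactly: \<open>P\<^sub>k \<circ> \<gamma>\<^sub>k = - P\<^bsub>bar k\<^esub>\<close>.

  That the images of \<open>D = \<Inter> {P\<^sub>k \<ge> 0}\<close> cover the space locally finitely is a Margulis-type drift argument: for a
  reduced word there is a vector \<open>p\<close> with \<open>Q p = 1\<close>, orthogonal both to the first repelling subspace and to the image of
  the last attracting one; along the word all its images stay bounded, so a point deep in a nested sequence can be
  pushed by \<open>- \<theta> p\<close>, with \<open>\<theta>\<close> proportional to the length, without leaving the first set, while the first \<open>F\<^sub>k\<close> grows like
  \<open>\<theta>\<close>.

  Finally \<open>D\<close> with its sides glued by the \<open>\<gamma>\<^sub>k\<close> is the interior of a handlebody. Moving points along the \<open>e\<^sub>k\<close> replaces the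
  sets \<open>P\<^sub>k \<ge> 0\<close> by the complements of round cones; the part far from the cones becomes the open ball, and the collars of the
  two sides of a pair become the two halves of a handle. The side pairing acts on the normal
  space of \<open>e\<^sub>k\<close> with positive determinant, so it can be isotoped to the identity inside the collar.\<close>

section \<open>The cones around the wings\<close>

text \<open>The obstacle is the neutral direction: \<open>g k\<close> fixes \<open>e k\<close>, so
  no letter contracts a whole cone, and ping-pong alone does not bound how long a nested sequence
  can stay near a compact set. Hence the constants of the drift argument (\<open>Lip\<close>,
  \<open>\<eta>\<close>, the bound \<open>1 + 4 / \<sigma>\<close> for \<open>p\<close>) must not
  depend on the word. They all come from one number: an angle of at least \<epsilon> between the
  wings gives \<open>\<sigma> * \<nu> x \<le> \<nu> (x - y)\<close> with
  \<open>\<sigma>\<^sup>2 = 1 - cos (min \<epsilon> (pi / 2))\<close>, and both the width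
  \<open>\<delta> = \<sigma>\<^sup>2 / 100\<close> of the cones and the strength
  \<open>s = \<delta>\<^sup>2\<close> are powers of it. That \<open>e k\<close> and
  \<open>e (bar k)\<close> are opposite is also forced by separation: otherwise the two wings of a
  frame would share a half-line. On the topological side no charts are used. The image of the glued
  domain is open by invariance of domain, and this openness is what identifies it with the interior
  of the closed handlebody.\<close>

text \<open>The letter \<open>(i, False)\<close> stands for the contracted subspace of \<open>g\<^sub>i\<close> and for the inverse of \<open>g\<^sub>i\<close>, the letter
  \<open>(i, True)\<close> for the expanded subspace and for \<open>g\<^sub>i\<close> itself.\<close>

definition bar :: "nat \<times> bool \<Rightarrow> nat \<times> bool" where
  "bar k = (fst k, \<not> snd k)"

lemma bar_bar [simp]: "bar (bar k) = k"
  and bar_neq [simp]: "bar k \<noteq> k" "k \<noteq> bar k"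
  and fst_bar [simp]: "fst (bar k) = fst k"
  by (auto simp: bar_def prod_eq_iff)

lemma bar_in_iff [simp]: "bar k \<in> {..<n} \<times> UNIV \<longleftrightarrow> k \<in> {..<n} \<times> UNIV"
  by (cases k) (auto simp: bar_def)

text \<open>\<open>x\<close> lies in the image of \<open>{P\<^bsub>last\<^esub> \<le> 0}\<close> under the product of all letters but the last.\<close>

fun nested :: "(nat \<times> bool \<Rightarrow> 'a \<Rightarrow> real) \<Rightarrow> (nat \<times> bool \<Rightarrow> 'a \<Rightarrow> 'a) \<Rightarrow> (nat \<times> bool) list \<Rightarrow> 'a \<Rightarrow> bool" where
  "nested P \<alpha> [] x = True"
| "nested P \<alpha> [k] x = (P k x \<le> 0)"
| "nested P \<alpha> (k # l # ks) x = nested P \<alpha> (l # ks) (\<alpha> (bar k) x)"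

text \<open>Rank-nullity for the map sending \<open>p\<close> to the sum of
  \<open>B p v *\<^sub>R v\<close> over a basis of \<open>V\<close>: it goes from \<open>P\<close>
  into the smaller space \<open>V\<close>, so it has a kernel, where by independence of the basis
  every coefficient \<open>B p v\<close> vanishes.\<close>

lemma orthogonal_vector_exists:
  fixes B :: "'a::euclidean_space \<Rightarrow> 'a \<Rightarrow> real"
  assumes B: "bilinear B" and P: "subspace P" and V: "subspace V" and d: "dim V < dim P"
  obtains p where "p \<in> P" "p \<noteq> 0" "\<And>v. v \<in> V \<Longrightarrow> B p v = 0"
proof -
  obtain bs where bs: "bs \<subseteq> V" "independent bs" "V \<subseteq> span bs" "card bs = dim V"
    using basis_exists by blast
  have fin: "finite bs" using bs(2) finiteI_independent by blast
  define F where "F p = (\<Sum>v\<in>bs. B p v *\<^sub>R v)" for p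
  have linF: "linear F"
    unfolding F_def
    by (intro linear_compose_sum ballI linearI)
       (auto simp: bilinear_ladd[OF B] bilinear_lmul[OF B] scaleR_left_distrib)
  have sub: "F ` P \<subseteq> V"
    unfolding F_def using bs(1) by (auto intro!: subspace_sum[OF V] subspace_scale[OF V])
  have "\<not> inj_on F (span P)"
  proof
    assume "inj_on F (span P)"
    then have "dim (F ` P) = dim P" using dim_image_eq[OF linF] by blast
    moreover have "dim (F ` P) \<le> dim V" using sub by (rule dim_subset)
    ultimately show False using d by simp
  qed
  then have "\<exists>p\<in>P. F p = 0 \<and> p \<noteq> 0"
    using linear_inj_on_iff_eq_0[OF linF P] span_eq_iff[of P] P by metis
  then obtain p where p: "p \<in> P" "F p = 0" "p \<noteq> 0" by blast
  have z: "B p v = 0" if "v \<in> bs" for v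
    using bs(2) fin p(2) that unfolding F_def
    using independentD by blast
  have "B p v = 0" if "v \<in> V" for v
  proof -
    have "v \<in> span bs" using bs(3) that by auto
    then show ?thesis
      by (induction rule: span_induct_alt)
         (auto simp: bilinear_radd[OF B] bilinear_rmul[OF B] bilinear_rzero[OF B] z)
  qed
  with p show ?thesis using that by blast
qed

text \<open>Here \<open>g k\<close> expands \<open>V k\<close> and contracts
  \<open>V (bar k)\<close>. All information on the wings is in \<open>sep\<close>; as
  \<open>V k\<close> is a subspace, only the coefficient of \<open>e k\<close> carries a sign there.
  \<open>proj\<close> expresses maximality of isotropic subspaces of dimension \<open>d\<close>:
  modulo such a subspace, a vector orthogonal to it is no longer for \<nu> than for
  \<open>B\<close>.\<close>

locale schottky_data =
  fixes n :: nat and \<nu> :: "'a::euclidean_space \<Rightarrow> real" and B :: "'a \<Rightarrow> 'a \<Rightarrow> real"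
    and V :: "nat \<times> bool \<Rightarrow> 'a set" and e :: "nat \<times> bool \<Rightarrow> 'a" and g :: "nat \<times> bool \<Rightarrow> 'a \<Rightarrow> 'a"
    and \<sigma> s :: real and d :: nat
  assumes nu_add: "\<nu> (x + y) \<le> \<nu> x + \<nu> y"
    and nu_scale: "\<nu> (c *\<^sub>R x) = \<bar>c\<bar> * \<nu> x"
    and nu_pos: "x \<noteq> 0 \<Longrightarrow> \<nu> x > 0"
    and sig: "0 < \<sigma>" "\<sigma> \<le> 1"
    and s: "s = (\<sigma>\<^sup>2 / 100)\<^sup>2"
    and bil: "bilinear B"
    and Bsym: "B x y = B y x"
    and B_le: "B x x \<le> (\<nu> x)\<^sup>2"
    and subV: "k \<in> {..<n} \<times> UNIV \<Longrightarrow> subspace (V k)"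
    and dimV: "k \<in> {..<n} \<times> UNIV \<Longrightarrow> dim (V k) = d"
    and isoV: "k \<in> {..<n} \<times> UNIV \<Longrightarrow> v \<in> V k \<Longrightarrow> w \<in> V k \<Longrightarrow> B v w = 0"
    and eV: "k \<in> {..<n} \<times> UNIV \<Longrightarrow> v \<in> V k \<Longrightarrow> B v (e k) = 0"
    and nu_e: "k \<in> {..<n} \<times> UNIV \<Longrightarrow> \<nu> (e k) = 1"
    and B_e: "k \<in> {..<n} \<times> UNIV \<Longrightarrow> B (e k) (e k) > 0"
    and e_bar: "k \<in> {..<n} \<times> UNIV \<Longrightarrow> e (bar k) = - e k"
    and lin_g: "k \<in> {..<n} \<times> UNIV \<Longrightarrow> linear (g k)"
    and g_bar: "k \<in> {..<n} \<times> UNIV \<Longrightarrow> g k (g (bar k) x) = x"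
    and g_e: "k \<in> {..<n} \<times> UNIV \<Longrightarrow> g k (e k) = e k"
    and g_B: "k \<in> {..<n} \<times> UNIV \<Longrightarrow> B (g k x) (g k y) = B x y"
    and g_V: "k \<in> {..<n} \<times> UNIV \<Longrightarrow> v \<in> V k \<Longrightarrow> g k v \<in> V k"
    and g_V_bar: "k \<in> {..<n} \<times> UNIV \<Longrightarrow> v \<in> V (bar k) \<Longrightarrow> g k v \<in> V (bar k)"
    and contr: "k \<in> {..<n} \<times> UNIV \<Longrightarrow> v \<in> V (bar k) \<Longrightarrow> \<nu> (g k v) \<le> s * \<nu> v"
    and decomp: "k \<in> {..<n} \<times> UNIV \<Longrightarrow> \<exists>a b c. a \<in> V (bar k) \<and> c \<in> V k \<and> x = a + b *\<^sub>R e k + c"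
    and sep: "k \<in> {..<n} \<times> UNIV \<Longrightarrow> l \<in> {..<n} \<times> UNIV \<Longrightarrow> k \<noteq> l \<Longrightarrow> v \<in> V k \<Longrightarrow> w \<in> V l \<Longrightarrow>
        b \<ge> 0 \<Longrightarrow> c \<ge> 0 \<Longrightarrow> \<sigma> * \<nu> (v + b *\<^sub>R e k) \<le> \<nu> ((v + b *\<^sub>R e k) - (w + c *\<^sub>R e l))"
    and proj: "subspace V' \<Longrightarrow> dim V' = d \<Longrightarrow> (\<And>v w. v \<in> V' \<Longrightarrow> w \<in> V' \<Longrightarrow> B v w = 0) \<Longrightarrow>
        (\<And>v. v \<in> V' \<Longrightarrow> B x v = 0) \<Longrightarrow> \<exists>v\<in>V'. (\<nu> (x - v))\<^sup>2 \<le> B x x"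
begin

abbreviation K :: "(nat \<times> bool) set" where "K \<equiv> {..<n} \<times> UNIV"

section \<open>The norm, and coordinates with respect to a frame\<close>

lemma nu_0 [simp]: "\<nu> 0 = 0" using nu_scale[of 0 0] by simp
lemma nu_minus [simp]: "\<nu> (- x) = \<nu> x" using nu_scale[of "-1" x] by simp
lemma nu_ge0 [simp]: "0 \<le> \<nu> x" using nu_pos[of x] by (cases "x = 0") auto
lemma nu_diff: "\<nu> (x - y) \<le> \<nu> x + \<nu> y" using nu_add[of x "- y"] by simp
lemma nu_diff_comm: "\<nu> (x - y) = \<nu> (y - x)" using nu_minus[of "x - y"] by simp
lemma nu_diff2: "\<nu> x - \<nu> y \<le> \<nu> (x - y)" using nu_add[of "x - y" y] by simp
lemma nu_eq0: "\<nu> x = 0 \<longleftrightarrow> x = 0" using nu_pos[of x] by (cases "x = 0") auto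

text \<open>The vector is a difference of points of the half-spaces at \<open>k\<close> and at
  \<open>bar k\<close>. For \<open>b \<ge> 0\<close> the neutral term is put on the side of
  \<open>bar k\<close>, where \<open>e (bar k) = - e k\<close> gives it the right sign; for
  \<open>b < 0\<close> the whole vector is negated first.\<close>

lemma bound_V:
  assumes k: "k \<in> K" and a: "a \<in> V (bar k)" and c: "c \<in> V k"
  shows "\<sigma> * \<nu> c \<le> \<nu> (a + b *\<^sub>R e k + c)"
proof -
  have kb: "bar k \<in> K" using k by simp
  show ?thesis
  proof (cases "b \<ge> 0")
    case True
    have "\<sigma> * \<nu> (c + 0 *\<^sub>R e k) \<le> \<nu> ((c + 0 *\<^sub>R e k) - (- a + b *\<^sub>R e (bar k)))"
      by (rule sep[OF k kb]) (use a c subV[OF kb] True in \<open>auto simp: subspace_neg\<close>)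
    then show ?thesis using e_bar[OF k] by (simp add: algebra_simps)
  next
    case False
    have "\<sigma> * \<nu> (- c + 0 *\<^sub>R e k) \<le> \<nu> ((- c + 0 *\<^sub>R e k) - (a + (- b) *\<^sub>R e (bar k)))"
      by (rule sep[OF k kb]) (use a c subV[OF k] False in \<open>auto simp: subspace_neg\<close>)
    moreover have "(- c + 0 *\<^sub>R e k) - (a + (- b) *\<^sub>R e (bar k)) = - (a + b *\<^sub>R e k + c)"
      using e_bar[OF k] by simp
    ultimately show ?thesis by (metis nu_minus scale_zero_left add.right_neutral)
  qed
qed

lemma bound_V_bar:
  assumes k: "k \<in> K" and a: "a \<in> V (bar k)" and c: "c \<in> V k"
  shows "\<sigma> * \<nu> a \<le> \<nu> (a + b *\<^sub>R e k + c)"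
  using bound_V[of "bar k" c a "- b"] assms e_bar[of k] by (simp add: algebra_simps)

text \<open>Now the neutral term stays on the side of \<open>k\<close>. Combined with
  \<open>bound_V\<close> this bounds the coefficient \<open>b\<close> in
  \<open>bound_e\<close>.\<close>

lemma bound_e0:
  assumes k: "k \<in> K" and a: "a \<in> V (bar k)" and c: "c \<in> V k"
  shows "\<sigma> * \<nu> (b *\<^sub>R e k + c) \<le> \<nu> (a + b *\<^sub>R e k + c)"
proof -
  have kb: "bar k \<in> K" using k by simp
  show ?thesis
  proof (cases "b \<ge> 0")
    case True
    have "\<sigma> * \<nu> (c + b *\<^sub>R e k) \<le> \<nu> ((c + b *\<^sub>R e k) - (- a + 0 *\<^sub>R e (bar k)))"
      by (rule sep[OF k kb]) (use a c subV[OF kb] True in \<open>auto simp: subspace_neg\<close>)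
    then show ?thesis by (simp add: algebra_simps)
  next
    case False
    have "\<sigma> * \<nu> (- c + (- b) *\<^sub>R e k) \<le> \<nu> ((- c + (- b) *\<^sub>R e k) - (a + 0 *\<^sub>R e (bar k)))"
      by (rule sep[OF k kb]) (use a c subV[OF k] False in \<open>auto simp: subspace_neg\<close>)
    moreover have "(- c + (- b) *\<^sub>R e k) - (a + 0 *\<^sub>R e (bar k)) = - (a + b *\<^sub>R e k + c)"
      "- c + (- b) *\<^sub>R e k = - (b *\<^sub>R e k + c)" by simp_all
    ultimately show ?thesis by (metis nu_minus)
  qed
qed

lemma bound_e:
  assumes k: "k \<in> K" and a: "a \<in> V (bar k)" and c: "c \<in> V k"
  shows "\<sigma> * \<bar>b\<bar> \<le> 2 * \<nu> (a + b *\<^sub>R e k + c)"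
proof -
  have "\<bar>b\<bar> = \<nu> (b *\<^sub>R e k)" using nu_e[OF k] by (simp add: nu_scale)
  also have "\<dots> \<le> \<nu> (b *\<^sub>R e k + c) + \<nu> c" using nu_diff[of "b *\<^sub>R e k + c" c] by simp
  finally have "\<sigma> * \<bar>b\<bar> \<le> \<sigma> * (\<nu> (b *\<^sub>R e k + c) + \<nu> c)" using sig by simp
  also have "\<dots> \<le> 2 * \<nu> (a + b *\<^sub>R e k + c)"
    using bound_V[OF assms, of b] bound_e0[OF assms, of b] by (simp add: algebra_simps)
  finally show ?thesis .
qed

lemma decomp_unique:
  assumes k: "k \<in> K" and "a \<in> V (bar k)" "c \<in> V k" "a' \<in> V (bar k)" "c' \<in> V k"
    and eq: "a + b *\<^sub>R e k + c = a' + b' *\<^sub>R e k + c'"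
  shows "a = a'" "b = b'" "c = c'"
proof -
  have A: "a - a' \<in> V (bar k)" "c - c' \<in> V k"
    using assms subV[OF k] subV[of "bar k"] by (auto simp: subspace_diff)
  have z: "(a - a') + (b - b') *\<^sub>R e k + (c - c') = 0" using eq by (simp add: algebra_simps)
  show "a = a'" using bound_V_bar[OF k A, of "b - b'"] z sig nu_ge0[of "a - a'"] nu_eq0[of "a - a'"]
    by (simp add: mult_le_0_iff)
  show "c = c'" using bound_V[OF k A, of "b - b'"] z sig nu_ge0[of "c - c'"] nu_eq0[of "c - c'"]
    by (simp add: mult_le_0_iff)
  show "b = b'" using bound_e[OF k A, of "b - b'"] z sig by (simp add: mult_le_0_iff)
qed

text \<open>Coordinates of the splitting into \<open>V (bar k)\<close>, the line of
  \<open>e k\<close> and \<open>V k\<close>. The first component is \<open>pV (bar k)\<close>, since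
  exchanging the two ends of a frame only changes the sign of \<open>pb\<close>.\<close>

definition pV :: "nat \<times> bool \<Rightarrow> 'a \<Rightarrow> 'a" where
  "pV k x = (SOME c. c \<in> V k \<and> (\<exists>a b. a \<in> V (bar k) \<and> x = a + b *\<^sub>R e k + c))"
definition pb :: "nat \<times> bool \<Rightarrow> 'a \<Rightarrow> real" where
  "pb k x = (SOME b. \<exists>a\<in>V (bar k). \<exists>c\<in>V k. x = a + b *\<^sub>R e k + c)"

lemma coord_eqI:
  assumes k: "k \<in> K" and a: "a \<in> V (bar k)" and c: "c \<in> V k"
  shows "pV k (a + b *\<^sub>R e k + c) = c" "pV (bar k) (a + b *\<^sub>R e k + c) = a" "pb k (a + b *\<^sub>R e k + c) = b"
proof -
  have kb: "bar k \<in> K" using k by simp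
  note u = decomp_unique[OF k _ _ a c]
  show "pV k (a + b *\<^sub>R e k + c) = c"
    unfolding pV_def by (rule some_equality) (use a c in blast, use u in metis)
  have eq: "a + b *\<^sub>R e k + c = c + (- b) *\<^sub>R e (bar k) + a" using e_bar[OF k] by simp
  show "pV (bar k) (a + b *\<^sub>R e k + c) = a"
    unfolding pV_def eq
  proof (rule some_equality)
    show "a \<in> V (bar k) \<and> (\<exists>aa ba. aa \<in> V (bar (bar k)) \<and> c + - b *\<^sub>R e (bar k) + a = aa + ba *\<^sub>R e (bar k) + a)"
      using a c by (metis bar_bar)
    fix a' assume "a' \<in> V (bar k) \<and> (\<exists>aa ba. aa \<in> V (bar (bar k)) \<and> c + - b *\<^sub>R e (bar k) + a = aa + ba *\<^sub>R e (bar k) + a')"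
    then obtain aa ba where *: "a' \<in> V (bar k)" "aa \<in> V (bar (bar k))" "c + - b *\<^sub>R e (bar k) + a = aa + ba *\<^sub>R e (bar k) + a'" by blast
    show "a' = a" using decomp_unique(3)[OF kb _ a *(2) *(1) *(3)] c by simp
  qed
  show "pb k (a + b *\<^sub>R e k + c) = b"
    unfolding pb_def by (rule some_equality) (use a c in blast, use u in metis)
qed

lemma coord:
  assumes k: "k \<in> K"
  shows "pV k x \<in> V k" "x = pV (bar k) x + pb k x *\<^sub>R e k + pV k x"
proof -
  obtain a b c where *: "a \<in> V (bar k)" "c \<in> V k" "x = a + b *\<^sub>R e k + c" using decomp[OF k] by blast
  show "pV k x \<in> V k" "x = pV (bar k) x + pb k x *\<^sub>R e k + pV k x"
    using coord_eqI[OF k *(1,2), of b] * by simp_all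
qed

lemma coord_bar: "k \<in> K \<Longrightarrow> pV (bar k) x \<in> V (bar k)"
  by (rule coord) simp

lemma pb_bar: assumes k: "k \<in> K" shows "pb (bar k) x = - pb k x"
proof -
  have "x = pV k x + (- pb k x) *\<^sub>R e (bar k) + pV (bar k) x" using coord(2)[OF k, of x] e_bar[OF k] by (simp add: algebra_simps)
  then show ?thesis using coord_eqI(3)[of "bar k" "pV k x" "pV (bar k) x" "- pb k x"] coord(1)[OF k] coord_bar[OF k] k by simp
qed

lemma coord_lin:
  assumes k: "k \<in> K"
  shows "pV k (x + y) = pV k x + pV k y" "pb k (x + y) = pb k x + pb k y"
    "pV k (r *\<^sub>R x) = r *\<^sub>R pV k x" "pb k (r *\<^sub>R x) = r * pb k x"
proof -
  note S = subV[OF k] subV[of "bar k"]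
  have m: "pV (bar k) x + pV (bar k) y \<in> V (bar k)" "pV k x + pV k y \<in> V k"
    "r *\<^sub>R pV (bar k) x \<in> V (bar k)" "r *\<^sub>R pV k x \<in> V k"
    using coord(1)[OF k] coord_bar[OF k] S k by (auto simp: subspace_add subspace_scale)
  have 1: "x + y = (pV (bar k) x + pV (bar k) y) + (pb k x + pb k y) *\<^sub>R e k + (pV k x + pV k y)"
    by (subst (1) coord(2)[OF k, of x], subst (1) coord(2)[OF k, of y]) (simp add: algebra_simps)
  have 2: "r *\<^sub>R x = r *\<^sub>R pV (bar k) x + (r * pb k x) *\<^sub>R e k + r *\<^sub>R pV k x"
    using arg_cong[OF coord(2)[OF k, of x], of "\<lambda>x. r *\<^sub>R x"] by (simp add: algebra_simps)
  show "pV k (x + y) = pV k x + pV k y" "pb k (x + y) = pb k x + pb k y"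
    using coord_eqI[OF k m(1,2), of "pb k x + pb k y"] 1 by simp_all
  show "pV k (r *\<^sub>R x) = r *\<^sub>R pV k x" "pb k (r *\<^sub>R x) = r * pb k x"
    using coord_eqI[OF k m(3,4), of "r * pb k x"] 2 by simp_all
qed

lemma coord_diff:
  assumes k: "k \<in> K"
  shows "pV k (x - y) = pV k x - pV k y" and "pb k (x - y) = pb k x - pb k y"
  using coord_lin(1,2)[OF k, of x "- y"] coord_lin(3,4)[where x = y and r = "-1", OF k] by auto

lemma coord_e:
  assumes k: "k \<in> K"
  shows "pV k (e k) = 0" "pV (bar k) (e k) = 0" "pb k (e k) = 1"
  using coord_eqI[OF k, of 0 0 1] subV[OF k] subV[of "bar k"] k by (auto simp: subspace_0)

lemma coord_bounds:
  assumes k: "k \<in> K"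
  shows "\<sigma> * \<nu> (pV k x) \<le> \<nu> x" "\<sigma> * \<nu> (pV (bar k) x) \<le> \<nu> x" "\<sigma> * \<bar>pb k x\<bar> \<le> 2 * \<nu> x"
  using bound_V[OF k coord_bar[OF k] coord(1)[OF k], of x x "pb k x"]
    bound_V_bar[OF k coord_bar[OF k] coord(1)[OF k], of x "pb k x" x]
    bound_e[OF k coord_bar[OF k] coord(1)[OF k], of "pb k x" x x] coord(2)[OF k, of x] by simp_all

lemma coord_g:
  assumes k: "k \<in> K"
  shows "pV k (g k x) = g k (pV k x)" "pV (bar k) (g k x) = g k (pV (bar k) x)" "pb k (g k x) = pb k x"
proof -
  have "g k x = g k (pV (bar k) x + pb k x *\<^sub>R e k + pV k x)" using coord(2)[OF k, of x] by simp
  also have "\<dots> = g k (pV (bar k) x) + pb k x *\<^sub>R e k + g k (pV k x)"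
    using lin_g[OF k] g_e[OF k] by (simp add: linear_add linear_scale)
  finally have *: "g k x = g k (pV (bar k) x) + pb k x *\<^sub>R e k + g k (pV k x)" .
  show "pV k (g k x) = g k (pV k x)" "pV (bar k) (g k x) = g k (pV (bar k) x)" "pb k (g k x) = pb k x"
    using coord_eqI[OF k g_V_bar[OF k coord_bar[OF k]] g_V[OF k coord(1)[OF k]], of x "pb k x" x] * by simp_all
qed

lemma g_bar': "k \<in> K \<Longrightarrow> g (bar k) (g k x) = x"
  using g_bar[of "bar k" x] by simp

lemma expand: assumes k: "k \<in> K" "v \<in> V k" shows "\<nu> v \<le> s * \<nu> (g k v)"
proof -
  have "\<nu> (g (bar k) (g k v)) \<le> s * \<nu> (g k v)"
    by (rule contr) (use k g_V[OF k] in auto)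
  then show ?thesis using g_bar'[OF k(1)] by simp
qed

section \<open>Cones around the half-spaces\<close>

definition \<delta> :: real where "\<delta> = \<sigma>\<^sup>2 / 100"

text \<open>With \<open>100 * \<delta> = \<sigma>\<^sup>2\<close> the relative error
  \<open>3 * \<delta> / \<sigma>\<close> of \<open>F_near\<close> is at most
  \<open>3/100 * \<sigma>\<close>, a small part of the separation;
  \<open>s = \<delta>\<^sup>2\<close> is the contraction that \<open>F_g\<close> consumes.\<close>

lemma delta: "0 < \<delta>" "\<delta> \<le> 1/100" "100 * \<delta> = \<sigma>\<^sup>2" "s = \<delta>\<^sup>2" "\<delta> \<le> \<sigma> / 100"
proof -
  have "\<sigma>\<^sup>2 \<le> \<sigma> * 1" unfolding power2_eq_square using sig by (intro mult_left_mono) auto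
  then show "0 < \<delta>" "\<delta> \<le> 1/100" "100 * \<delta> = \<sigma>\<^sup>2" "s = \<delta>\<^sup>2" "\<delta> \<le> \<sigma> / 100"
    unfolding \<delta>_def s using sig by auto
qed

text \<open>The weights \<open>1 / \<delta>\<close> and \<open>\<delta>\<close> are exchanged by a contraction of strength \<open>\<delta>\<^sup>2\<close>, which is why \<open>F\<^sub>k \<circ> g\<^sub>k \<le> - F\<^bsub>bar k\<^esub>\<close>.\<close>

definition F :: "nat \<times> bool \<Rightarrow> 'a \<Rightarrow> real" where
  "F k x = \<nu> (pV (bar k) x) / \<delta> - \<delta> * \<nu> (pV k x) - pb k x"

lemma F_scale: "k \<in> K \<Longrightarrow> r \<ge> 0 \<Longrightarrow> F k (r *\<^sub>R x) = r * F k x"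
  unfolding F_def using coord_lin(3,4)[of k] coord_lin(3)[of "bar k"] by (simp add: nu_scale algebra_simps)

lemma F_0: "k \<in> K \<Longrightarrow> F k 0 = 0"
  using F_scale[of k 0 0] by simp

text \<open>Along its axis \<open>F k\<close> falls at unit speed, so translations by multiples of
  \<open>e k\<close> become gaps between level sets.\<close>

lemma F_shift: "k \<in> K \<Longrightarrow> F k (x + t *\<^sub>R e k) = F k x - t"
  unfolding F_def using coord_lin[of k] coord_lin[of "bar k"] coord_e[of k] by (simp add: algebra_simps)

lemma F_g: assumes k: "k \<in> K" shows "F k (g k x) \<le> - F (bar k) x"
proof -
  have 1: "\<nu> (g k (pV (bar k) x)) \<le> \<delta>\<^sup>2 * \<nu> (pV (bar k) x)"
    using contr[OF k coord_bar[OF k]] delta by simp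
  have 2: "\<nu> (pV k x) \<le> \<delta>\<^sup>2 * \<nu> (g k (pV k x))" using expand[OF k coord(1)[OF k]] delta by simp
  have a: "\<nu> (g k (pV (bar k) x)) / \<delta> \<le> \<delta> * \<nu> (pV (bar k) x)"
    using 1 delta(1) by (simp add: field_simps power2_eq_square)
  have b: "\<nu> (pV k x) / \<delta> \<le> \<delta> * \<nu> (g k (pV k x))"
    using 2 delta(1) by (simp add: field_simps power2_eq_square)
  show ?thesis
    unfolding F_def using a b coord_g[OF k, of x] pb_bar[OF k, of x] by simp
qed

definition Lip :: real where "Lip = 1 / (\<sigma> * \<delta>) + \<delta> / \<sigma> + 2 / \<sigma>"

lemma Lip_pos: "Lip > 0"
  unfolding Lip_def using sig delta by (simp add: add_pos_pos)

text \<open>The coordinates are bounded by \<nu> up to powers of \<open>1 / \<sigma>\<close>, so the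
  constant depends on \<sigma> alone. The drift argument measures the cost of a shift by it.\<close>

lemma F_lip: assumes k: "k \<in> K" shows "\<bar>F k x - F k y\<bar> \<le> Lip * \<nu> (x - y)"
proof -
  have 1: "\<bar>\<nu> u - \<nu> w\<bar> \<le> \<nu> (u - w)" for u w using nu_diff2[of u w] nu_diff2[of w u] nu_diff_comm[of u w] by linarith
  have a: "\<bar>\<nu> (pV (bar k) x) - \<nu> (pV (bar k) y)\<bar> \<le> \<nu> (x - y) / \<sigma>"
  proof -
    have "pV (bar k) x - pV (bar k) y = pV (bar k) (x - y)" using coord_diff(1)[of "bar k" x y] k by simp
    then show ?thesis
      using order_trans[OF mult_left_mono[OF 1[of "pV (bar k) x" "pV (bar k) y"], of \<sigma>]] coord_bounds(2)[OF k, of "x - y"] sig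
      by (simp add: pos_le_divide_eq mult.commute)
  qed
  have b: "\<bar>\<nu> (pV k x) - \<nu> (pV k y)\<bar> \<le> \<nu> (x - y) / \<sigma>"
  proof -
    have "pV k x - pV k y = pV k (x - y)" using coord_diff(1)[of k x y] k by simp
    then show ?thesis
      using order_trans[OF mult_left_mono[OF 1[of "pV k x" "pV k y"], of \<sigma>]] coord_bounds(1)[OF k, of "x - y"] sig
      by (simp add: pos_le_divide_eq mult.commute)
  qed
  have c: "\<bar>pb k x - pb k y\<bar> \<le> 2 * \<nu> (x - y) / \<sigma>"
    using coord_bounds(3)[OF k, of "x - y"] coord_diff(2)[OF k, of x y] sig
    by (simp add: pos_le_divide_eq mult.commute)
  have a': "\<bar>\<nu> (pV (bar k) x) / \<delta> - \<nu> (pV (bar k) y) / \<delta>\<bar> \<le> \<nu> (x - y) / (\<sigma> * \<delta>)"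
    using divide_right_mono[OF a, of \<delta>] delta(1) by (simp flip: diff_divide_distrib)
  have b': "\<bar>\<delta> * \<nu> (pV k x) - \<delta> * \<nu> (pV k y)\<bar> \<le> \<delta> * (\<nu> (x - y) / \<sigma>)"
    using mult_left_mono[OF b, of \<delta>] delta(1) by (simp add: abs_mult flip: right_diff_distrib)
  have "\<bar>F k x - F k y\<bar> \<le> \<nu> (x - y) / (\<sigma> * \<delta>) + \<delta> * (\<nu> (x - y) / \<sigma>) + 2 * \<nu> (x - y) / \<sigma>"
    unfolding F_def using a' b' c by linarith
  also have "\<dots> = Lip * \<nu> (x - y)" unfolding Lip_def by (simp add: algebra_simps)
  finally show ?thesis .
qed

lemma F_near:
  assumes k: "k \<in> K" and F: "F k x \<le> 0"
  obtains v b where "v \<in> V k" "b \<ge> 0" "\<nu> (x - (v + b *\<^sub>R e k)) \<le> (3 * \<delta> / \<sigma>) * \<nu> x"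
proof (cases "pb k x \<ge> 0")
  case True
  have "\<nu> (pV (bar k) x) / \<delta> \<le> \<delta> * \<nu> (pV k x) + pb k x" using F unfolding F_def by simp
  then have "\<nu> (pV (bar k) x) \<le> \<delta> * (\<delta> * \<nu> (pV k x) + pb k x)" using delta(1) by (simp add: field_simps)
  also have "\<dots> \<le> \<delta> * (1 * \<nu> (pV k x) + pb k x)"
    using delta(1,2) by (intro mult_left_mono add_right_mono mult_right_mono) auto
  also have "\<dots> \<le> \<delta> * (\<nu> x / \<sigma> + 2 * \<nu> x / \<sigma>)"
    using delta(1) coord_bounds[OF k, of x] sig True by (intro mult_left_mono add_mono) (auto simp: field_simps)
  finally have "\<nu> (pV (bar k) x) \<le> (3 * \<delta> / \<sigma>) * \<nu> x" by (simp add: algebra_simps)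
  moreover have "x - (pV k x + pb k x *\<^sub>R e k) = pV (bar k) x" using coord(2)[OF k, of x] by (simp add: algebra_simps)
  ultimately show ?thesis using that[of "pV k x" "pb k x"] coord(1)[OF k, of x] True by simp
next
  case False
  have 0: "\<nu> (pV (bar k) x) / \<delta> + \<bar>pb k x\<bar> \<le> \<delta> * \<nu> (pV k x)" using F False unfolding F_def by simp
  moreover have "\<nu> (pV (bar k) x) / \<delta> \<ge> \<nu> (pV (bar k) x)"
    using delta(1,2) by (simp add: field_simps mult_left_le_one_le)
  ultimately have "\<nu> (pV (bar k) x) + \<bar>pb k x\<bar> \<le> \<delta> * \<nu> (pV k x)" by linarith
  moreover have "\<delta> * \<nu> (pV k x) \<le> \<delta> * (\<nu> x / \<sigma>)"
    using coord_bounds(1)[OF k, of x] sig delta(1) by (intro mult_left_mono) (auto simp: field_simps)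
  moreover have E: "x - (pV k x + 0 *\<^sub>R e k) = pV (bar k) x + pb k x *\<^sub>R e k" using coord(2)[OF k, of x] by (simp add: algebra_simps)
  moreover have "\<nu> (pV (bar k) x + pb k x *\<^sub>R e k) \<le> \<nu> (pV (bar k) x) + \<bar>pb k x\<bar>"
    using nu_add[of "pV (bar k) x" "pb k x *\<^sub>R e k"] nu_e[OF k] by (simp add: nu_scale)
  moreover have "\<delta> * (\<nu> x / \<sigma>) \<le> (3 * \<delta> / \<sigma>) * \<nu> x" using delta(1) sig by (simp add: field_simps)
  ultimately have "\<nu> (x - (pV k x + 0 *\<^sub>R e k)) \<le> (3 * \<delta> / \<sigma>) * \<nu> x"
    unfolding E by linarith
  then show ?thesis using that[of "pV k x" 0] coord(1)[OF k, of x] by simp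
qed

text \<open>A nonzero common point \<open>x\<close> is within
  \<open>3/100 * \<sigma> * \<nu> x\<close> of both half-spaces. The approximating points differ by
  at most \<open>6/100 * \<sigma> * \<nu> x\<close>, so by \<open>sep\<close> the one at
  \<open>k\<close> has norm at most \<open>6/100 * \<nu> x\<close>, too short to be close to
  \<open>x\<close>.\<close>

lemma F_disjoint:
  assumes k: "k \<in> K" and l: "l \<in> K" and "k \<noteq> l" and Fk: "F k x \<le> 0" and Fl: "F l x \<le> 0"
  shows "x = 0"
proof (rule ccontr)
  assume "x \<noteq> 0"
  then have pos: "\<nu> x > 0" by (rule nu_pos)
  obtain v b where v: "v \<in> V k" "b \<ge> 0" "\<nu> (x - (v + b *\<^sub>R e k)) \<le> (3 * \<delta> / \<sigma>) * \<nu> x"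
    using F_near[OF k Fk] by blast
  obtain w c where w: "w \<in> V l" "c \<ge> 0" "\<nu> (x - (w + c *\<^sub>R e l)) \<le> (3 * \<delta> / \<sigma>) * \<nu> x"
    using F_near[OF l Fl] by blast
  have D: "\<sigma> * \<nu> (v + b *\<^sub>R e k) \<le> \<nu> ((v + b *\<^sub>R e k) - (w + c *\<^sub>R e l))"
    by (rule sep) (use v w assms in auto)
  have d3: "3 * \<delta> / \<sigma> \<le> 3/100 * \<sigma>" using delta(3) sig by (simp add: field_simps power2_eq_square)
  have "\<nu> ((v + b *\<^sub>R e k) - (w + c *\<^sub>R e l)) \<le> 2 * ((3 * \<delta> / \<sigma>) * \<nu> x)"
  proof -
    have E: "(v + b *\<^sub>R e k) - (w + c *\<^sub>R e l) = (x - (w + c *\<^sub>R e l)) - (x - (v + b *\<^sub>R e k))" by simp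
    show ?thesis unfolding E
      using nu_diff[of "x - (w + c *\<^sub>R e l)" "x - (v + b *\<^sub>R e k)"] v(3) w(3)
      by (simp only: mult_2)
  qed
  also have "\<dots> \<le> 2 * ((3/100 * \<sigma>) * \<nu> x)" using d3 pos by (intro mult_right_mono mult_left_mono) auto
  finally have "\<sigma> * \<nu> (v + b *\<^sub>R e k) \<le> \<sigma> * (6/100 * \<nu> x)" using D by linarith
  then have 1: "\<nu> (v + b *\<^sub>R e k) \<le> 6/100 * \<nu> x" using sig by simp
  have "\<nu> x \<le> \<nu> (x - (v + b *\<^sub>R e k)) + \<nu> (v + b *\<^sub>R e k)" using nu_add[of "x - (v + b *\<^sub>R e k)" "v + b *\<^sub>R e k"] by simp
  also have "\<dots> \<le> (3/100 * \<sigma>) * \<nu> x + 6/100 * \<nu> x"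
    using v(3) 1 d3 pos mult_right_mono[OF d3, of "\<nu> x"] by linarith
  also have "\<dots> \<le> (3/100 * 1) * \<nu> x + 6/100 * \<nu> x" using sig pos by (intro add_mono mult_right_mono) auto
  finally show False using pos by simp
qed

section \<open>Isotropic subspaces close to \<open>V k\<close>\<close>

definition near :: "nat \<times> bool \<Rightarrow> 'a set \<Rightarrow> bool" where
  "near k U \<longleftrightarrow> subspace U \<and> dim U = d \<and> (\<forall>v\<in>U. \<forall>w\<in>U. B v w = 0) \<and>
    (\<forall>x\<in>U. \<exists>v\<in>V k. \<nu> (x - v) \<le> \<sigma> / 10 * \<nu> x)"

lemma near_V: "k \<in> K \<Longrightarrow> near k (V k)"
  unfolding near_def using subV dimV isoV sig by (auto intro!: bexI[of _ x for x])

text \<open>As \<open>l \<noteq> bar k\<close>, a subspace close to \<open>V l\<close> stays away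
  from the span of \<open>V (bar k)\<close> and \<open>e k\<close>, so each of its vectors has a
  component in \<open>V k\<close> comparable to it. That component is stretched by at least
  \<open>1 / s\<close> while the others do not grow, and the image ends up almost inside
  \<open>V k\<close>.\<close>

lemma near_step:
  assumes k: "k \<in> K" and l: "l \<in> K" and kl: "l \<noteq> bar k" and N: "near l U"
  shows "near k (g k ` U)"
proof -
  have inj: "inj (g k)" using g_bar'[OF k] by (metis injI)
  have S: "subspace (g k ` U)" using N lin_g[OF k] by (simp add: near_def linear_subspace_image)
  have D: "dim (g k ` U) = d"
    using N dim_image_eq[OF lin_g[OF k], of U] inj by (simp add: near_def inj_on_subset)
  have I: "\<forall>v\<in>g k ` U. \<forall>w\<in>g k ` U. B v w = 0" using N g_B[OF k] by (auto simp: near_def)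
  have "\<exists>v\<in>V k. \<nu> (g k x - v) \<le> \<sigma> / 10 * \<nu> (g k x)" if x: "x \<in> U" for x
  proof -
    obtain v where v: "v \<in> V l" "\<nu> (x - v) \<le> \<sigma> / 10 * \<nu> x" using N x by (auto simp: near_def)
    define a b c where "a = pV (bar k) x" and "b = pb k x" and "c = pV k x"
    have abc: "a \<in> V (bar k)" "c \<in> V k" "x = a + b *\<^sub>R e k + c"
      using coord[OF k, of x] coord_bar[OF k, of x] by (auto simp: a_def b_def c_def)
    have kb: "bar k \<in> K" using k by simp
    \<comment> \<open>For either sign of \<open>b\<close>, the vector
      \<open>a + b *\<^sub>R e k\<close> or its negative lies in the half-space at
      \<open>bar k\<close>, so the separation of half-spaces controls the full span.\<close>
    have 1: "\<sigma> * \<nu> v \<le> \<nu> (v - (a + b *\<^sub>R e k))"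
    proof (cases "b \<le> 0")
      case True
      have "\<sigma> * \<nu> (v + 0 *\<^sub>R e l) \<le> \<nu> ((v + 0 *\<^sub>R e l) - (a + (- b) *\<^sub>R e (bar k)))"
        by (rule sep[OF l kb]) (use kl v abc True in auto)
      then show ?thesis using e_bar[OF k] by simp
    next
      case False
      have "\<sigma> * \<nu> (- v + 0 *\<^sub>R e l) \<le> \<nu> ((- v + 0 *\<^sub>R e l) - (- a + b *\<^sub>R e (bar k)))"
        by (rule sep[OF l kb]) (use kl v abc False subV[OF l] subV[OF kb] in \<open>auto simp: subspace_neg\<close>)
      moreover have "(- v + 0 *\<^sub>R e l) - (- a + b *\<^sub>R e (bar k)) = - (v - (a + b *\<^sub>R e k))"
        using e_bar[OF k] by simp
      ultimately show ?thesis by (metis nu_minus scale_zero_left add.right_neutral)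
    qed
    have "v - (a + b *\<^sub>R e k) = (v - x) + c" using abc(3) by simp
    then have 2: "\<nu> (v - (a + b *\<^sub>R e k)) \<le> \<nu> (x - v) + \<nu> c"
      apply (simp only:) using nu_add[of "v - x" c] nu_diff_comm[of x v] by simp
    have 3: "\<nu> x \<le> \<nu> (x - v) + \<nu> v" using nu_add[of "x - v" v] by simp
    have sx: "\<sigma> * \<nu> x \<le> \<nu> x" using sig by (simp add: mult_left_le_one_le)
    have "\<sigma> * \<nu> x \<le> \<sigma> * (\<nu> (x - v) + \<nu> v)" using 3 sig by (intro mult_left_mono) auto
    also have "\<dots> \<le> 1 * \<nu> (x - v) + \<sigma> * \<nu> v" unfolding distrib_left
      using sig by (intro add_right_mono mult_right_mono) auto
    also have "\<dots> \<le> 2 * (\<sigma> / 10 * \<nu> x) + \<nu> c" using 1 2 v(2) by linarith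
    finally have 4: "\<sigma> * \<nu> x \<le> 2 * \<nu> c" using nu_ge0[of c] by linarith
    have eq: "g k x - g k c = g k a + b *\<^sub>R e k"
      using lin_g[OF k] g_e[OF k] by (subst abc(3)) (simp add: linear_add linear_scale)
    have 5: "\<nu> (g k x - g k c) \<le> s * \<nu> a + \<bar>b\<bar>"
      unfolding eq using nu_add[of "g k a" "b *\<^sub>R e k"] contr[OF k abc(1)] nu_e[OF k] by (simp add: nu_scale)
    have s1: "0 < s" "s \<le> 1" using delta by (simp_all add: power_le_one)
    have 6: "\<sigma> * \<nu> a \<le> \<nu> x" "\<sigma> * \<bar>b\<bar> \<le> 2 * \<nu> x" using coord_bounds[OF k, of x] by (auto simp: a_def b_def)
    have "\<sigma> * (s * \<nu> a) \<le> \<sigma> * \<nu> a"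
      using s1 sig by (intro mult_left_mono mult_left_le_one_le) auto
    moreover have "\<sigma> * \<nu> (g k x - g k c) \<le> \<sigma> * (s * \<nu> a) + \<sigma> * \<bar>b\<bar>"
      using mult_left_mono[OF 5, of \<sigma>] sig by (simp add: distrib_left)
    ultimately have 7: "\<sigma> * \<nu> (g k x - g k c) \<le> 3 * \<nu> x" using 6 by linarith
    have 8: "\<nu> c \<le> s * \<nu> (g k c)" by (rule expand[OF k abc(2)])
    have 9: "\<sigma> * \<nu> (g k c) \<le> \<nu> (g k x)" using coord_bounds(1)[OF k, of "g k x"] coord_g(1)[OF k, of x] by (simp add: c_def)
    \<comment> \<open>Three factors \<open>1 / \<sigma>\<close> are lost: in the error bound, in
      bounding \<open>\<nu> x\<close> by \<open>\<nu> c\<close>, and in bounding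
      \<open>\<nu> (g k c)\<close> by \<open>\<nu> (g k x)\<close>. The fourth power of \<sigma> in
      \<open>s\<close> pays for them and leaves one factor over.\<close>
    have "\<sigma>\<^sup>2 * (\<sigma> * \<nu> (g k x - g k c)) \<le> \<sigma>\<^sup>2 * (3 * \<nu> x)" using 7 by (intro mult_left_mono) auto
    also have "\<dots> = 3 * \<sigma> * (\<sigma> * \<nu> x)" by (simp add: power2_eq_square)
    also have "\<dots> \<le> 3 * \<sigma> * (2 * \<nu> c)" using 4 sig by (intro mult_left_mono) auto
    also have "\<dots> \<le> 3 * \<sigma> * (2 * (s * \<nu> (g k c)))" using 8 sig by (intro mult_left_mono) auto
    also have "\<dots> = 6 * s * (\<sigma> * \<nu> (g k c))" by simp
    also have "\<dots> \<le> 6 * s * \<nu> (g k x)" using 9 s1 by (intro mult_left_mono) auto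
    also have "\<dots> = \<sigma> ^ 4 * (6 / 10000 * \<nu> (g k x))" unfolding s by (simp add: power_divide)
    also have "\<dots> = \<sigma>\<^sup>2 * (\<sigma> * (6 / 10000 * \<sigma> * \<nu> (g k x)))" by (simp add: power2_eq_square power4_eq_xxxx)
    also have "\<dots> \<le> \<sigma>\<^sup>2 * (\<sigma> * (\<sigma> / 10 * \<nu> (g k x)))"
      using sig by (intro mult_left_mono mult_right_mono) auto
    finally have "\<nu> (g k x - g k c) \<le> \<sigma> / 10 * \<nu> (g k x)" using sig by simp
    then show ?thesis using g_V[OF k abc(2)] by blast
  qed
  then show ?thesis using S D I by (auto simp: near_def)
qed

text \<open>Perturbing both subspaces by the relative amount \<open>\<sigma> / 10\<close> costs less
  than half of the separation.\<close>

lemma near_apart: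
  assumes k: "k \<in> K" and l: "l \<in> K" and "k \<noteq> l" and "near k U" "near l U'" and v: "v \<in> U" "v' \<in> U'"
  shows "\<sigma> * \<nu> v \<le> 2 * \<nu> (v - v')"
proof -
  obtain w where w: "w \<in> V k" "\<nu> (v - w) \<le> \<sigma> / 10 * \<nu> v" using assms(4) v(1) unfolding near_def by blast
  obtain w' where w': "w' \<in> V l" "\<nu> (v' - w') \<le> \<sigma> / 10 * \<nu> v'" using assms(5) v(2) unfolding near_def by blast
  have 1: "\<sigma> * \<nu> w \<le> \<nu> (w - w')" using sep[OF k l \<open>k \<noteq> l\<close> w(1) w'(1), of 0 0] by simp
  have 2: "\<nu> v' \<le> \<nu> v + \<nu> (v - v')" using nu_diff2[of v' v] nu_diff_comm[of v v'] by linarith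
  have 3: "\<nu> v \<le> \<nu> (v - w) + \<nu> w" using nu_add[of "v - w" w] by simp
  have E: "w - w' = ((v - v') - (v - w)) + (v' - w')" by simp
  have 4: "\<nu> (w - w') \<le> \<nu> (v - v') + \<nu> (v - w) + \<nu> (v' - w')"
    unfolding E using nu_add[of "(v - v') - (v - w)" "v' - w'"] nu_diff[of "v - v'" "v - w"] by linarith
  have "\<sigma> * \<nu> v \<le> \<sigma> * (\<nu> (v - w) + \<nu> w)" using 3 sig by (intro mult_left_mono) auto
  also have "\<dots> \<le> 1 * \<nu> (v - w) + \<sigma> * \<nu> w" unfolding distrib_left
    using sig by (intro add_right_mono mult_right_mono) auto
  also have "\<dots> \<le> 2 * (\<sigma> / 10 * \<nu> v) + \<nu> (v - v') + \<sigma> / 10 * \<nu> v'" using 1 4 w w' by linarith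
  also have "\<dots> \<le> 2 * (\<sigma> / 10 * \<nu> v) + \<nu> (v - v') + \<sigma> / 10 * (\<nu> v + \<nu> (v - v'))"
    using 2 sig by (intro add_left_mono mult_left_mono) auto
  also have "\<dots> \<le> 3 / 10 * (\<sigma> * \<nu> v) + \<nu> (v - v') + 1 / 10 * \<nu> (v - v')"
    using sig mult_right_mono[of \<sigma> 1 "\<nu> (v - v')"] by (simp add: distrib_left)
  finally show ?thesis using nu_ge0[of "v - v'"] by linarith
qed

text \<open>By \<open>proj\<close> both subspaces contain a point within 1 of \<open>p\<close>.
  These two points are within 2 of each other, which for separated subspaces only happens at norm at
  most \<open>4 / \<sigma>\<close>. The bound is independent of the words that produced
  \<open>U\<close> and \<open>U'\<close>.\<close>

lemma neutral_bound:
  assumes k: "k \<in> K" and l: "l \<in> K" and "k \<noteq> l" and N: "near k U" "near l U'"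
    and p: "B p p = 1" "\<And>v. v \<in> U \<Longrightarrow> B p v = 0" "\<And>v. v \<in> U' \<Longrightarrow> B p v = 0"
  shows "\<nu> p \<le> 1 + 4 / \<sigma>"
proof -
  obtain v where v: "v \<in> U" "(\<nu> (p - v))\<^sup>2 \<le> 1" using proj[of U p] N p by (auto simp: near_def)
  obtain v' where v': "v' \<in> U'" "(\<nu> (p - v'))\<^sup>2 \<le> 1" using proj[of U' p] N p by (auto simp: near_def)
  have 1: "\<nu> (p - v) \<le> 1" "\<nu> (p - v') \<le> 1" using v v' by (simp_all add: abs_square_le_1)
  have E: "v - v' = (p - v') - (p - v)" by simp
  have "\<nu> (v - v') \<le> 2" unfolding E using nu_diff[of "p - v'" "p - v"] 1 by linarith
  then have "\<sigma> * \<nu> v \<le> 4" using near_apart[OF k l \<open>k \<noteq> l\<close> N v(1) v'(1)] by linarith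
  then have "\<nu> v \<le> 4 / \<sigma>" using sig by (simp add: field_simps)
  then show ?thesis using nu_add[of "p - v" v] 1 by simp
qed

text \<open>The attracting subspace of the last letter moved by the product of the letters before
  it. By \<open>near_Vp\<close> it stays close to the subspace of the first letter, whatever the
  length.\<close>

fun Vp :: "(nat \<times> bool) list \<Rightarrow> 'a set" where
  "Vp [] = {}"
| "Vp [k] = V k"
| "Vp (k # l # ks) = g k ` Vp (l # ks)"

lemma near_Vp:
  "ks \<noteq> [] \<Longrightarrow> set ks \<subseteq> K \<Longrightarrow> successively (\<lambda>k l. l \<noteq> bar k) ks \<Longrightarrow> near (hd ks) (Vp ks)"
proof (induction ks rule: Vp.induct)
  case (3 k l ks)
  then show ?case using near_step[of k l "Vp (l # ks)"] by auto
qed (auto simp: near_V)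

text \<open>For \<open>B p p = 0\<close> the distance in \<open>proj\<close> is 0.\<close>

lemma perp_Vp:
  assumes "ks \<noteq> []" "set ks \<subseteq> K" "\<And>v. v \<in> Vp ks \<Longrightarrow> B p v = 0" "B p p = 0"
    "successively (\<lambda>k l. l \<noteq> bar k) ks"
  shows "p \<in> Vp ks"
proof -
  have N: "near (hd ks) (Vp ks)" using near_Vp assms by blast
  obtain v where v: "v \<in> Vp ks" "(\<nu> (p - v))\<^sup>2 \<le> 0" using proj[of "Vp ks" p] N assms by (auto simp: near_def)
  then have "p - v = 0" by (simp add: nu_eq0)
  then show ?thesis using v by simp
qed

end

section \<open>The drift argument\<close>

locale schottky_affine = schottky_data +
  fixes \<alpha> :: "nat \<times> bool \<Rightarrow> 'a \<Rightarrow> 'a" and P :: "nat \<times> bool \<Rightarrow> 'a \<Rightarrow> real"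
  assumes alpha_diff: "k \<in> {..<n} \<times> UNIV \<Longrightarrow> \<alpha> k x - \<alpha> k y = g k (x - y)"
    and alpha_bar: "k \<in> {..<n} \<times> UNIV \<Longrightarrow> \<alpha> k (\<alpha> (bar k) x) = x"
    and P_ge: "k \<in> {..<n} \<times> UNIV \<Longrightarrow> F k x + 1 \<le> P k x"
    and P_alpha: "k \<in> {..<n} \<times> UNIV \<Longrightarrow> P k (\<alpha> k x) = - P (bar k) x"
begin

text \<open>The shift granted per letter: along a vector of norm at most
  \<open>1 + 4 / \<sigma>\<close> it changes each \<open>F k\<close> by at most \<open>1/2\<close>,
  half of the gap between \<open>F k\<close> and \<open>P k\<close>.\<close>

definition \<eta> :: real where "\<eta> = 1 / (2 * Lip * (1 + 4 / \<sigma>))"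

lemma eta: "\<eta> > 0" "Lip * (\<eta> * (1 + 4 / \<sigma>)) = 1 / 2"
proof -
  have "Lip > 0" "1 + 4 / \<sigma> > 0" using Lip_pos sig by (simp_all add: add_pos_pos)
  then show "\<eta> > 0" "Lip * (\<eta> * (1 + 4 / \<sigma>)) = 1 / 2" unfolding \<eta>_def by simp_all
qed

text \<open>The induction replaces \<open>p\<close> by its image under the inverse of the first letter; by \<open>neutral_bound\<close> each letter
  allows a further shift by \<open>\<eta>\<close>.\<close>

lemma depth_step:
  assumes "ks \<noteq> []" "set ks \<subseteq> K" "successively (\<lambda>k l. l \<noteq> bar k) ks"
    and "k' \<in> K" "k' \<noteq> hd ks" "near k' U" "B p p = 1"
    and "\<And>v. v \<in> U \<Longrightarrow> B p v = 0" "\<And>v. v \<in> Vp ks \<Longrightarrow> B p v = 0"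
    and "nested P \<alpha> ks x" "0 \<le> \<theta>" "\<theta> \<le> (real (length ks) - 1) * \<eta>"
  shows "P (hd ks) (x - \<theta> *\<^sub>R p) \<le> 0"
  using assms
proof (induction ks arbitrary: k' U p x \<theta> rule: Vp.induct)
  case (2 k)
  then show ?case by simp
next
  case (3 k l ks)
  have k: "k \<in> K" and l: "l \<in> K" and kl: "l \<noteq> bar k" and kb: "bar k \<in> K" using 3 by auto
  define p' x' where "p' = g (bar k) p" and "x' = \<alpha> (bar k) x"
  have Bp': "B p' p' = 1" using g_B[OF kb] 3 by (simp add: p'_def)
  have N: "near (bar k) (g (bar k) ` U)" by (rule near_step[OF kb \<open>k' \<in> K\<close>]) (use 3 in auto)
  have pU: "B p' v = 0" if "v \<in> g (bar k) ` U" for v using that g_B[OF kb] 3 by (auto simp: p'_def)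
  have pV: "B p' v = 0" if v: "v \<in> Vp (l # ks)" for v
  proof -
    have "B p' (g (bar k) (g k v)) = B p (g k v)" using g_B[OF kb] by (simp add: p'_def)
    also have "\<dots> = 0" using 3(10) v by auto
    finally show ?thesis using g_bar'[OF k] by simp
  qed
  \<comment> \<open>The shorter word admits one \<eta> less. Truncation at 0 keeps the inductive
    shift nonnegative, and the remainder \<open>\<theta> - \<theta>1\<close> is at most
    \<eta>.\<close>
  define \<theta>1 where "\<theta>1 = max 0 (\<theta> - \<eta>)"
  have th: "0 \<le> \<theta>1" "\<theta>1 \<le> (real (length (l # ks)) - 1) * \<eta>" "0 \<le> \<theta> - \<theta>1" "\<theta> - \<theta>1 \<le> \<eta>"
    using 3(12,13) eta(1) by (auto simp: \<theta>1_def algebra_simps)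
  have "P (hd (l # ks)) (x' - \<theta>1 *\<^sub>R p') \<le> 0"
    by (rule 3(1)[OF _ _ _ kb _ N Bp' pU pV _ th(1,2)]) (use 3 kl in \<open>auto simp: x'_def\<close>)
  then have Fl: "F l (x' - \<theta>1 *\<^sub>R p') \<le> -1" using P_ge[OF l, of "x' - \<theta>1 *\<^sub>R p'"] by simp
  \<comment> \<open>The shifted point is strictly inside the cone of \<open>l\<close>, hence outside
    that of \<open>bar k\<close>. The remaining shift costs at most \<open>1/2\<close>, less than
    the gap 1 between \<open>F\<close> and \<open>P\<close>; so \<open>P (bar k)\<close> stays
    positive, which \<open>\<alpha> k\<close> turns into \<open>P k < 0\<close>.\<close>
  have Fk: "F (bar k) (x' - \<theta>1 *\<^sub>R p') > 0"
  proof (rule ccontr)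
    assume "\<not> ?thesis"
    then have "x' - \<theta>1 *\<^sub>R p' = 0" using F_disjoint[OF kb l kl[symmetric], of "x' - \<theta>1 *\<^sub>R p'"] Fl by linarith
    then show False using Fl F_0[OF l] by simp
  qed
  have "near (hd (l # ks)) (Vp (l # ks))" by (rule near_Vp) (use 3 in auto)
  then have "\<nu> p' \<le> 1 + 4 / \<sigma>" using neutral_bound[OF kb l _ N _ Bp' pU pV] kl by auto
  then have "Lip * ((\<theta> - \<theta>1) * \<nu> p') \<le> Lip * (\<eta> * (1 + 4 / \<sigma>))"
    using th Lip_pos eta(1) by (intro mult_left_mono mult_mono) auto
  moreover have "(x' - \<theta> *\<^sub>R p') - (x' - \<theta>1 *\<^sub>R p') = (- (\<theta> - \<theta>1)) *\<^sub>R p'" by (simp add: algebra_simps)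
  then have "\<nu> ((x' - \<theta> *\<^sub>R p') - (x' - \<theta>1 *\<^sub>R p')) = (\<theta> - \<theta>1) * \<nu> p'" using th(3) by (simp only: nu_scale) simp
  ultimately have "F (bar k) (x' - \<theta> *\<^sub>R p') \<ge> - 1 / 2"
    using F_lip[OF kb, of "x' - \<theta> *\<^sub>R p'" "x' - \<theta>1 *\<^sub>R p'"] Fk eta(2) by simp
  then have "P (bar k) (x' - \<theta> *\<^sub>R p') > 0" using P_ge[OF kb, of "x' - \<theta> *\<^sub>R p'"] by simp
  moreover have "x' - \<theta> *\<^sub>R p' = \<alpha> (bar k) (x - \<theta> *\<^sub>R p)"
  proof -
    have "x' - \<alpha> (bar k) (x - \<theta> *\<^sub>R p) = g (bar k) (\<theta> *\<^sub>R p)"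
      unfolding x'_def using alpha_diff[OF kb] by simp
    also have "\<dots> = \<theta> *\<^sub>R p'" unfolding p'_def using lin_g[OF kb] by (simp add: linear_scale)
    finally show ?thesis by (simp add: algebra_simps)
  qed
  ultimately have "P (bar (bar k)) (\<alpha> k (\<alpha> (bar k) (x - \<theta> *\<^sub>R p))) < 0"
    using P_alpha[OF k] by simp
  then show ?case using alpha_bar[OF k] by simp
qed simp

text \<open>The vector \<open>p\<close> exists by a dimension count: the span of \<open>e k\<close>
  and \<open>V (bar k)\<close> has dimension \<open>d + 1\<close>, \<open>Vp ks\<close> only
  \<open>d\<close>. Once \<open>\<theta> \<ge> Lip * R\<close>, shifting a point of norm at most
  \<open>R\<close> by \<open>- \<theta> *\<^sub>R p\<close> makes \<open>F k\<close> nonnegative,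
  whereas \<open>depth_step\<close> keeps it at most \<open>-1\<close>.\<close>

lemma depth_bound:
  assumes ks: "ks \<noteq> []" "set ks \<subseteq> K" "successively (\<lambda>k l. l \<noteq> bar k) ks"
    and x: "\<nu> x \<le> R" and J: "Lip * R \<le> (real (length ks) - 1) * \<eta>"
  shows "\<not> nested P \<alpha> ks x"
proof
  assume nest: "nested P \<alpha> ks x"
  define k where "k = hd ks"
  have k: "k \<in> K" and kb: "bar k \<in> K" using ks by (auto simp: k_def)
  have N: "near k (Vp ks)" unfolding k_def by (rule near_Vp[OF ks])
  have eV: "e k \<notin> span (V (bar k))"
  proof
    assume "e k \<in> span (V (bar k))"
    then have m: "e k \<in> V (bar k)" using subV[OF kb] span_eq_iff by blast
    have "pV (bar k) (e k) = e k" using coord_eqI(2)[OF k m, of 0 0] subV[OF k] by (simp add: subspace_0)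
    then show False using coord_e(2)[OF k] nu_e[OF k] by simp
  qed
  have "dim (Vp ks) < dim (span (insert (e k) (V (bar k))))"
    using N dimV[OF kb] eV by (simp add: near_def dim_insert)
  then obtain p0 where p0: "p0 \<in> span (insert (e k) (V (bar k)))" "p0 \<noteq> 0" "\<And>v. v \<in> Vp ks \<Longrightarrow> B p0 v = 0"
    using orthogonal_vector_exists[OF bil subspace_span, of "Vp ks" "insert (e k) (V (bar k))"] N by (auto simp: near_def)
  obtain b0 where "p0 - b0 *\<^sub>R e k \<in> V (bar k)"
    using p0(1) subV[OF kb] by (auto simp: span_insert span_eq_iff[THEN iffD2])
  then obtain a0 where a0: "a0 \<in> V (bar k)" "p0 = a0 + b0 *\<^sub>R e k" by (metis diff_add_cancel)
  have Bae: "B a0 (e k) = 0" using eV eV[THEN notE] schottky_data.eV[OF schottky_data_axioms kb a0(1)] e_bar[OF k]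
    by (simp add: bilinear_rneg[OF bil])
  have Bp0: "B p0 p0 = b0\<^sup>2 * B (e k) (e k)"
    unfolding a0(2) using isoV[OF kb a0(1) a0(1)] Bae Bsym[of "e k" a0]
    by (simp add: bilinear_ladd[OF bil] bilinear_radd[OF bil] bilinear_lmul[OF bil] bilinear_rmul[OF bil] power2_eq_square)
  \<comment> \<open>Without a neutral part \<open>p0\<close> would be isotropic and orthogonal to
    \<open>Vp ks\<close>, hence in it by maximality, and it would also lie in
    \<open>V (bar k)\<close>.\<close>
  have b0: "b0 \<noteq> 0"
  proof
    assume "b0 = 0"
    then have "p0 \<in> V (bar k)" "B p0 p0 = 0" using a0 Bp0 by auto
    moreover from this have "p0 \<in> Vp ks" using perp_Vp[OF ks(1,2) p0(3) _ ks(3)] by blast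
    ultimately show False
      using near_apart[OF kb k _ near_V[OF kb] N, of p0 p0] sig p0(2) nu_pos[of p0] by (simp add: mult_le_0_iff)
  qed
  define b where "b = 1 / sqrt (B (e k) (e k))"
  have Be: "0 < B (e k) (e k)" "B (e k) (e k) \<le> 1" using B_e[OF k] B_le[of "e k"] nu_e[OF k] by auto
  have b1: "b \<ge> 1" unfolding b_def using Be by simp
  \<comment> \<open>The factor gives \<open>B p p = 1\<close> and makes the coefficient of
    \<open>e k\<close> positive, so that \<open>- p\<close> points out of the cone;
    \<open>b \<ge> 1\<close> because \<open>B (e k) (e k) \<le> 1\<close>.\<close>
  define p where "p = (b / b0) *\<^sub>R p0"
  define a where "a = (b / b0) *\<^sub>R a0"
  have a: "a \<in> V (bar k)" unfolding a_def using a0 subV[OF kb] by (simp add: subspace_scale)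
  have p: "p = a + b *\<^sub>R e k" unfolding p_def a_def a0(2) using b0 by (simp add: algebra_simps)
  have Bpp: "B p p = 1"
    unfolding p_def using Bp0 b0 Be by (simp add: bilinear_lmul[OF bil] bilinear_rmul[OF bil] b_def power2_eq_square field_simps)
  have pVp: "B p v = 0" if "v \<in> Vp ks" for v
    unfolding p_def using p0(3)[OF that] by (simp add: bilinear_lmul[OF bil])
  have pV: "B p v = 0" if "v \<in> V (bar k)" for v
    unfolding p using isoV[OF kb a that] schottky_data.eV[OF schottky_data_axioms kb that] e_bar[OF k] Bsym[of "e k" v]
    by (simp add: bilinear_ladd[OF bil] bilinear_lmul[OF bil] bilinear_rneg[OF bil])
  define \<theta> where "\<theta> = (real (length ks) - 1) * \<eta>"
  have th: "\<theta> \<ge> 0" unfolding \<theta>_def using ks(1) eta(1) by (cases ks) auto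
  have "P (hd ks) (x - \<theta> *\<^sub>R p) \<le> 0"
    by (rule depth_step[OF ks kb _ near_V[OF kb] Bpp pV pVp nest th]) (auto simp: k_def \<theta>_def bar_neq)
  then have 1: "F k (x - \<theta> *\<^sub>R p) \<le> -1" using P_ge[OF k, of "x - \<theta> *\<^sub>R p"] by (simp add: k_def)
  have "- p = - a + (- b) *\<^sub>R e k + 0" unfolding p by simp
  moreover have "- a \<in> V (bar k)" "0 \<in> V k" using a subV[OF kb] subV[OF k] by (auto simp: subspace_neg subspace_0)
  ultimately have "F k (- p) = \<nu> a / \<delta> + b" using coord_eqI[OF k, of "- a" 0 "- b"] by (simp add: F_def)
  then have "F k (- p) \<ge> 1" using b1 delta(1) by (simp add: add_increasing)
  then have "F k (\<theta> *\<^sub>R (- p)) \<ge> \<theta>" using F_scale[OF k th, of "- p"] th mult_left_mono[of 1 "F k (- p)" \<theta>] by simp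
  moreover have "\<bar>F k (x - \<theta> *\<^sub>R p) - F k (\<theta> *\<^sub>R (- p))\<bar> \<le> Lip * \<nu> x" using F_lip[OF k, of "x - \<theta> *\<^sub>R p" "\<theta> *\<^sub>R (- p)"] by simp
  moreover have "Lip * \<nu> x \<le> Lip * R" using x Lip_pos by simp
  ultimately show False using 1 J unfolding \<theta>_def by linarith
qed

end

section \<open>Tessellations by free products\<close>

abbreviation reduced :: "(nat \<times> bool) list \<Rightarrow> bool" where
  "reduced \<equiv> successively (\<lambda>k l. l \<noteq> bar k)"

fun word_map :: "(nat \<times> bool \<Rightarrow> 'a \<Rightarrow> 'a) \<Rightarrow> (nat \<times> bool) list \<Rightarrow> 'a \<Rightarrow> 'a" where
  "word_map \<alpha> [] x = x"
| "word_map \<alpha> (k # w) x = \<alpha> k (word_map \<alpha> w x)"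

lemma word_map_append: "word_map \<alpha> (v @ w) x = word_map \<alpha> v (word_map \<alpha> w x)"
  by (induction v) auto

lemma word_map_inverse:
  assumes "\<And>k. k \<in> A \<Longrightarrow> bar k \<in> A" and "\<And>k x. k \<in> A \<Longrightarrow> \<alpha> k (\<alpha> (bar k) x) = x" and "set w \<subseteq> A"
  shows "word_map \<alpha> w (word_map \<alpha> (map bar (rev w)) x) = x"
    and "word_map \<alpha> (map bar (rev w)) (word_map \<alpha> w x) = x"
proof -
  have 1: "word_map \<alpha> w (word_map \<alpha> (map bar (rev w)) x) = x" if "set w \<subseteq> A" for w x
    using that
  proof (induction w arbitrary: x)
    case (Cons k w)
    then show ?case using assms(2)[of k] by (simp add: word_map_append)
  qed simp
  show "word_map \<alpha> w (word_map \<alpha> (map bar (rev w)) x) = x" by (rule 1[OF assms(3)])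
  have "map bar (rev (map bar (rev w))) = w" by (simp add: rev_map o_def)
  moreover have "set (map bar (rev w)) \<subseteq> A" using assms(1,3) by auto
  ultimately show "word_map \<alpha> (map bar (rev w)) (word_map \<alpha> w x) = x"
    using 1[of "map bar (rev w)" x] by simp
qed

lemma word_map_reduce:
  assumes "\<And>k x. k \<in> A \<Longrightarrow> \<alpha> k (\<alpha> (bar k) x) = x" and "set w \<subseteq> A"
  obtains w' where "reduced w'" "set w' \<subseteq> A" "word_map \<alpha> w' = word_map \<alpha> w"
proof -
  have "\<exists>w'. reduced w' \<and> set w' \<subseteq> A \<and> word_map \<alpha> w' = word_map \<alpha> w"
    using assms(2)
  proof (induction w)
    case (Cons k w)
    then obtain w' where w': "reduced w'" "set w' \<subseteq> A" "word_map \<alpha> w' = word_map \<alpha> w"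
      by auto
    have k: "k \<in> A" using Cons by auto
    show ?case
    proof (cases "w' \<noteq> [] \<and> hd w' = bar k")
      case True
      then obtain v where v: "w' = bar k # v" by (cases w') auto
      have "word_map \<alpha> v x = word_map \<alpha> (k # w) x" for x
        using w'(3)[symmetric] v assms(1)[OF k] by simp
      then show ?thesis using w' v by (intro exI[of _ v]) (auto simp: successively_Cons)
    next
      case False
      have "word_map \<alpha> (k # w') = word_map \<alpha> (k # w)" using w'(3) by (auto simp: fun_eq_iff)
      then show ?thesis using False w' k by (intro exI[of _ "k # w'"]) (auto simp: successively_Cons)
    qed
  qed (auto intro!: exI[of _ "[]"])
  then show ?thesis using that by blast
qed

text \<open>Stated with an inequality so that it covers the functions \<open>F\<close>, whose cones
  the linear maps do not pair exactly. A point outside the repelling cone of the last letter enters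
  the cone of each letter in turn.\<close>

lemma ping_pong_word:
  fixes P :: "nat \<times> bool \<Rightarrow> 'a \<Rightarrow> real"
  assumes step: "\<And>k x. k \<in> A \<Longrightarrow> P k (\<alpha> k x) \<le> - P (bar k) x"
    and disj: "\<And>k l x. k \<in> A \<Longrightarrow> l \<in> A \<Longrightarrow> k \<noteq> l \<Longrightarrow> P k x < 0 \<Longrightarrow> P l x > 0"
    and A: "\<And>k. k \<in> A \<Longrightarrow> bar k \<in> A"
  shows "w \<noteq> [] \<Longrightarrow> set w \<subseteq> A \<Longrightarrow> reduced w \<Longrightarrow> P (bar (last w)) x > 0 \<Longrightarrow> P (hd w) (word_map \<alpha> w x) < 0"
proof (induction w)
  case (Cons k w)
  show ?case
  proof (cases "w = []")
    case True
    then show ?thesis using Cons step[of k x] by simp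
  next
    case False
    then have "P (hd w) (word_map \<alpha> w x) < 0" using Cons by (auto simp: successively_Cons)
    moreover have "hd w \<in> A" using False Cons by auto
    ultimately have "P (bar k) (word_map \<alpha> w x) > 0"
      using disj[of "hd w" "bar k" "word_map \<alpha> w x"] A[of k] Cons False by (auto simp: successively_Cons)
    then show ?thesis using Cons step[of k "word_map \<alpha> w x"] by simp
  qed
qed simp

text \<open>Data as for a Poincare polyhedron theorem: disjoint closed sets
  \<open>{P k \<le> 0}\<close> paired exactly by the letters. \<open>depth\<close> takes the place
  of completeness: nested sequences leave every ball after a bounded number of steps.\<close>

locale tessellation =
  fixes A :: "(nat \<times> bool) set" and \<alpha> :: "nat \<times> bool \<Rightarrow> 'a::euclidean_space \<Rightarrow> 'a" and P :: "nat \<times> bool \<Rightarrow> 'a \<Rightarrow> real"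
  assumes fin_A: "finite A" and bar_A: "k \<in> A \<Longrightarrow> bar k \<in> A"
    and alpha_bar: "k \<in> A \<Longrightarrow> \<alpha> k (\<alpha> (bar k) x) = x"
    and P_alpha: "k \<in> A \<Longrightarrow> P k (\<alpha> k x) = - P (bar k) x"
    and disj: "k \<in> A \<Longrightarrow> l \<in> A \<Longrightarrow> k \<noteq> l \<Longrightarrow> P k x \<le> 0 \<Longrightarrow> P l x > 0"
    and cont_alpha: "k \<in> A \<Longrightarrow> continuous_on UNIV (\<alpha> k)"
    and cont_P: "k \<in> A \<Longrightarrow> continuous_on UNIV (P k)"
    and depth: "\<And>R. \<exists>J. \<forall>w x. length w = J \<and> reduced w \<and> set w \<subseteq> A \<and> norm x \<le> R \<longrightarrow> \<not> nested P \<alpha> w x"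
begin

definition D :: "'a set" where "D = {x. \<forall>k\<in>A. P k x \<ge> 0}"

definition \<Gamma> :: "('a \<Rightarrow> 'a) set" where "\<Gamma> = word_map \<alpha> ` {w. set w \<subseteq> A}"

lemmas wm_inv = word_map_inverse[where \<alpha> = \<alpha> and A = A, OF bar_A alpha_bar, simplified]
lemmas wm_reduce = word_map_reduce[where \<alpha> = \<alpha> and A = A, OF alpha_bar, simplified]

lemma set_inv_word: "set w \<subseteq> A \<Longrightarrow> set (map bar (rev w)) \<subseteq> A"
  using bar_A by auto

text \<open>The sets \<open>{P k \<le> 0}\<close> are disjoint including their boundaries, hence the
  strict inequality from two letters on. A reduced word carrying a point of \<open>D\<close> into
  \<open>D\<close> therefore has at most one letter.\<close>

lemma word_D:
  assumes "x \<in> D" "set w \<subseteq> A" "reduced w" "w \<noteq> []"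
  shows "P (hd w) (word_map \<alpha> w x) \<le> 0 \<and> (length w \<ge> 2 \<longrightarrow> P (hd w) (word_map \<alpha> w x) < 0)"
  using assms
proof (induction w)
  case (Cons k w)
  have k: "k \<in> A" "bar k \<in> A" using Cons bar_A by auto
  show ?case
  proof (cases "w = []")
    case True
    then show ?thesis using Cons P_alpha[OF k(1), of x] k by (auto simp: D_def)
  next
    case False
    then have "P (hd w) (word_map \<alpha> w x) \<le> 0" using Cons by (auto simp: successively_Cons)
    moreover have "hd w \<in> A" using False Cons by (cases w) auto
    ultimately have "P (bar k) (word_map \<alpha> w x) > 0"
      using disj[of "hd w" "bar k" "word_map \<alpha> w x"] k Cons False by (auto simp: successively_Cons)
    then show ?thesis using P_alpha[OF k(1), of "word_map \<alpha> w x"] by simp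
  qed
qed simp

lemma word_D_D:
  assumes "x \<in> D" "set w \<subseteq> A" "reduced w" "word_map \<alpha> w x \<in> D" "w \<noteq> []"
  obtains k where "k \<in> A" "w = [k]" "P (bar k) x = 0"
proof -
  have h: "hd w \<in> A" using assms by (cases w) auto
  have "P (hd w) (word_map \<alpha> w x) \<ge> 0" using assms(4) h by (auto simp: D_def)
  then have "\<not> length w \<ge> 2" using word_D[of x w] assms by auto
  then obtain k where k: "w = [k]" using assms(5) by (cases w; cases "tl w") auto
  then have "P k (\<alpha> k x) = 0" using word_D[of x w] assms h by (auto simp: D_def intro: antisym)
  then show ?thesis using that[of k] k h P_alpha[of k x] by simp
qed

text \<open>A point outside \<open>D\<close> is pulled back by the letter whose set contains it,
  until it reaches \<open>D\<close> or \<open>j\<close> steps are spent. The strict inequality at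
  the head is carried along because it excludes cancellation with the letter put in front.\<close>

lemma cover_step:
  "(\<exists>w. length w < j \<and> reduced w \<and> set w \<subseteq> A \<and> (\<exists>d\<in>D. x = word_map \<alpha> w d)) \<or>
   (\<exists>w. length w = j \<and> reduced w \<and> set w \<subseteq> A \<and> nested P \<alpha> w x \<and> (w \<noteq> [] \<longrightarrow> P (hd w) x < 0))"
proof (induction j arbitrary: x)
  case 0
  show ?case by (rule disjI2) (auto intro!: exI[of _ "[]"])
next
  case (Suc j)
  show ?case
  proof (cases "x \<in> D")
    case True
    then show ?thesis by (intro disjI1 exI[of _ "[]"]) auto
  next
    case False
    then obtain k where k: "k \<in> A" "P k x < 0" by (auto simp: D_def not_le)
    have kb: "bar k \<in> A" using k bar_A by simp
    define y where "y = \<alpha> (bar k) x"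
    have Py: "P (bar k) y > 0" using P_alpha[OF kb, of x] k by (simp add: y_def)
    have xy: "x = \<alpha> k y" using alpha_bar[OF k(1)] by (simp add: y_def)
    from Suc[of y] show ?thesis
    proof
      assume "\<exists>w. length w < j \<and> reduced w \<and> set w \<subseteq> A \<and> (\<exists>d\<in>D. y = word_map \<alpha> w d)"
      then obtain w d where w: "length w < j" "reduced w" "set w \<subseteq> A" "d \<in> D" "y = word_map \<alpha> w d" by blast
      have "w \<noteq> [] \<longrightarrow> hd w \<noteq> bar k" using word_D[OF w(4,3,2)] w(5) Py by auto
      then have "reduced (k # w)" using w by (auto simp: successively_Cons)
      then show ?thesis using w xy k by (intro disjI1 exI[of _ "k # w"]) (auto intro!: bexI[of _ d])
    next
      assume "\<exists>w. length w = j \<and> reduced w \<and> set w \<subseteq> A \<and> nested P \<alpha> w y \<and> (w \<noteq> [] \<longrightarrow> P (hd w) y < 0)"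
      then obtain w where w: "length w = j" "reduced w" "set w \<subseteq> A" "nested P \<alpha> w y" "w \<noteq> [] \<longrightarrow> P (hd w) y < 0" by blast
      have "reduced (k # w)" using w Py by (auto simp: successively_Cons)
      moreover have "nested P \<alpha> (k # w) x" using w k by (cases w) (auto simp: y_def)
      ultimately show ?thesis using w k by (intro disjI2 exI[of _ "k # w"]) auto
    qed
  qed
qed

text \<open>By \<open>depth\<close> the pull-back ends after a number of steps depending on
  \<open>R\<close> only. This local finiteness yields both proper discontinuity and continuity of
  the developing map.\<close>

lemma cover:
  obtains \<W> where "finite \<W>" "\<And>w. w \<in> \<W> \<Longrightarrow> set w \<subseteq> A"
    "\<And>x. norm x \<le> R \<Longrightarrow> \<exists>w\<in>\<W>. \<exists>d\<in>D. x = word_map \<alpha> w d"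
proof -
  obtain J where J: "\<And>w x. length w = J \<Longrightarrow> reduced w \<Longrightarrow> set w \<subseteq> A \<Longrightarrow> norm x \<le> R \<Longrightarrow> \<not> nested P \<alpha> w x"
    using depth[of R] by blast
  show ?thesis
  proof (rule that[of "{w. set w \<subseteq> A \<and> length w \<le> J}"])
    show "finite {w. set w \<subseteq> A \<and> length w \<le> J}" by (rule finite_lists_length_le[OF fin_A])
    fix x :: 'a assume x: "norm x \<le> R"
    show "\<exists>w\<in>{w. set w \<subseteq> A \<and> length w \<le> J}. \<exists>d\<in>D. x = word_map \<alpha> w d"
      using cover_step[of J x] J x by (metis (mono_tags, lifting) less_imp_le mem_Collect_eq)
  qed auto
qed

lemma cont_word: "set w \<subseteq> A \<Longrightarrow> continuous_on UNIV (word_map \<alpha> w)"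
proof (induction w)
  case (Cons k w)
  have "continuous_on UNIV (\<alpha> k \<circ> word_map \<alpha> w)"
    using Cons cont_alpha[of k] by (intro continuous_on_compose) (auto intro: continuous_on_subset)
  then show ?case by (simp add: o_def)
qed (simp add: continuous_on_id)

lemma closed_D: "closed D"
proof -
  have "D = (\<Inter>k\<in>A. {x. 0 \<le> P k x})" by (auto simp: D_def)
  moreover have "closed {x. 0 \<le> P k x}" if "k \<in> A" for k
    using cont_P[OF that] by (intro closed_Collect_le continuous_on_const)
  ultimately show ?thesis by (metis (no_types, lifting) closed_INT)
qed

text \<open>Points of \<open>D\<close> in one orbit are equal or lie on paired faces; the conclusion
  also determines the group element as a map, whatever word represents it.\<close>

lemma D_connect:
  assumes "d \<in> D" "d' \<in> D" "set w \<subseteq> A" "d' = word_map \<alpha> w d"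
  shows "d' = d \<and> word_map \<alpha> w = id \<or> (\<exists>k\<in>A. P (bar k) d = 0 \<and> d' = \<alpha> k d \<and> word_map \<alpha> w = \<alpha> k)"
proof -
  obtain w' where w': "reduced w'" "set w' \<subseteq> A" "word_map \<alpha> w' = word_map \<alpha> w"
    using wm_reduce[OF assms(3)] by blast
  show ?thesis
  proof (cases "w' = []")
    case True
    then have "word_map \<alpha> w = id" using w'(3) by (auto simp: fun_eq_iff)
    then show ?thesis using assms by simp
  next
    case False
    then obtain k where k: "k \<in> A" "w' = [k]" "P (bar k) d = 0"
      using word_D_D[OF assms(1) w'(2,1) _ False] w'(3) assms by auto
    have "word_map \<alpha> w = \<alpha> k" using w'(3)[symmetric] k(2) by (auto simp: fun_eq_iff)
    then show ?thesis using k assms(4) by auto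
  qed
qed

lemma properly_discontinuous: "acts_properly_discontinuously \<Gamma>"
  unfolding acts_properly_discontinuously_def
proof (intro allI impI)
  fix C :: "'a set" assume "compact C"
  then have "bounded C" by (rule compact_imp_bounded)
  then obtain R where R: "\<And>x. x \<in> C \<Longrightarrow> norm x \<le> R" unfolding bounded_iff by blast
  obtain \<W> where W: "finite \<W>" "\<And>w. w \<in> \<W> \<Longrightarrow> set w \<subseteq> A"
    "\<And>x. norm x \<le> R \<Longrightarrow> \<exists>w\<in>\<W>. \<exists>d\<in>D. x = word_map \<alpha> w d" using cover by blast
  \<comment> \<open>Once \<open>x\<close> and \<open>\<gamma> x\<close> are pulled back to
    \<open>D\<close> by words from the finite set, what remains of \<gamma> joins two points of
    \<open>D\<close>, so it is the identity or a letter.\<close>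
  define M where "M = (\<lambda>(u, h, v). word_map \<alpha> u \<circ> h \<circ> word_map \<alpha> (map bar (rev v))) ` (\<W> \<times> (insert id (\<alpha> ` A)) \<times> \<W>)"
  have "finite M" unfolding M_def using W(1) fin_A by (intro finite_imageI finite_cartesian_product) auto
  moreover have "{\<gamma>\<in>\<Gamma>. \<gamma> ` C \<inter> C \<noteq> {}} \<subseteq> M"
  proof
    fix \<gamma> assume "\<gamma> \<in> {\<gamma>\<in>\<Gamma>. \<gamma> ` C \<inter> C \<noteq> {}}"
    then obtain w x where w: "\<gamma> = word_map \<alpha> w" "set w \<subseteq> A" "x \<in> C" "\<gamma> x \<in> C" by (auto simp: \<Gamma>_def)
    obtain u d where u: "u \<in> \<W>" "d \<in> D" "x = word_map \<alpha> u d" using W(3) R w(3) by blast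
    obtain v d' where v: "v \<in> \<W>" "d' \<in> D" "\<gamma> x = word_map \<alpha> v d'" using W(3) R w(4) by blast
    define z where "z = map bar (rev v) @ w @ u"
    have z: "set z \<subseteq> A" using set_inv_word[OF W(2)[OF v(1)]] w(2) W(2)[OF u(1)] by (auto simp: z_def)
    have "d' = word_map \<alpha> (map bar (rev v)) (word_map \<alpha> v d')" using wm_inv(2)[OF W(2)[OF v(1)]] by simp
    also have "\<dots> = word_map \<alpha> z d" using u v w by (simp add: z_def word_map_append)
    finally have "word_map \<alpha> z \<in> insert id (\<alpha> ` A)" using D_connect[OF u(2) v(2) z] by auto
    moreover have "\<gamma> = word_map \<alpha> v \<circ> word_map \<alpha> z \<circ> word_map \<alpha> (map bar (rev u))"
      using wm_inv(1)[OF W(2)[OF v(1)]] wm_inv(1)[OF W(2)[OF u(1)]] w(1)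
      by (auto simp: fun_eq_iff z_def word_map_append)
    ultimately show "\<gamma> \<in> M" unfolding M_def using u v by (intro image_eqI[of _ _ "(v, word_map \<alpha> z, u)"]) auto
  qed
  ultimately show "finite {\<gamma>\<in>\<Gamma>. \<gamma> ` C \<inter> C \<noteq> {}}" by (rule finite_subset[rotated])
qed

lemma covered: "\<exists>w. set w \<subseteq> A \<and> (\<exists>d\<in>D. x = word_map \<alpha> w d)"
  using cover[of "norm x"] by (metis order_refl)

text \<open>Conjugated into \<open>D\<close>, a nontrivial stabiliser would be a letter
  \<open>k\<close> fixing a point of the face of \<open>bar k\<close>. That point would also lie on
  the face of \<open>k\<close>, but the two faces are disjoint.\<close>

lemma free_action:
  assumes w: "set w \<subseteq> A" and fx: "word_map \<alpha> w x = x"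
  shows "word_map \<alpha> w = id"
proof -
  obtain u d where u: "set u \<subseteq> A" "d \<in> D" "x = word_map \<alpha> u d" using covered by blast
  define z where "z = map bar (rev u) @ w @ u"
  have z: "set z \<subseteq> A" using set_inv_word[OF u(1)] w u(1) by (auto simp: z_def)
  have "word_map \<alpha> z d = word_map \<alpha> (map bar (rev u)) (word_map \<alpha> u d)" using fx u(3) by (simp add: z_def word_map_append)
  then have zd: "d = word_map \<alpha> z d" using wm_inv(2)[OF u(1)] by simp
  have "\<not> (\<exists>k\<in>A. P (bar k) d = 0 \<and> d = \<alpha> k d)"
  proof
    assume "\<exists>k\<in>A. P (bar k) d = 0 \<and> d = \<alpha> k d"
    then obtain k where k: "k \<in> A" "P (bar k) d = 0" "d = \<alpha> k d" by blast
    then have "P k d = 0" using P_alpha[OF k(1), of d] by simp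
    then show False using disj[of k "bar k" d] k bar_A by simp
  qed
  then have id: "word_map \<alpha> z = id" using D_connect[OF u(2,2) z zd] by blast
  have "word_map \<alpha> w y = word_map \<alpha> u (word_map \<alpha> z (word_map \<alpha> (map bar (rev u)) y))" for y
    using wm_inv(1)[OF u(1)] by (simp add: z_def word_map_append)
  then show ?thesis using id wm_inv(1)[OF u(1)] by (auto simp: fun_eq_iff)
qed

lemma orbit_eq: "orbit_of \<Gamma> x = orbit_of \<Gamma> y \<longleftrightarrow> (\<exists>w. set w \<subseteq> A \<and> y = word_map \<alpha> w x)"
proof
  have "word_map \<alpha> [] = (\<lambda>x. x)" by auto
  then have "(\<lambda>x. x) \<in> \<Gamma>" unfolding \<Gamma>_def by (intro image_eqI[of _ _ "[]"]) auto
  then have "y \<in> orbit_of \<Gamma> y" unfolding orbit_of_def by force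
  moreover assume "orbit_of \<Gamma> x = orbit_of \<Gamma> y"
  ultimately have "y \<in> orbit_of \<Gamma> x" by simp
  then show "\<exists>w. set w \<subseteq> A \<and> y = word_map \<alpha> w x" by (auto simp: orbit_of_def \<Gamma>_def)
next
  have *: "orbit_of \<Gamma> (word_map \<alpha> w x) \<subseteq> orbit_of \<Gamma> x" if "set w \<subseteq> A" for w x
  proof
    fix z assume "z \<in> orbit_of \<Gamma> (word_map \<alpha> w x)"
    then obtain v where v: "set v \<subseteq> A" "z = word_map \<alpha> v (word_map \<alpha> w x)" by (auto simp: orbit_of_def \<Gamma>_def)
    then have "z = word_map \<alpha> (v @ w) x" "set (v @ w) \<subseteq> A" using that by (auto simp: word_map_append)
    then show "z \<in> orbit_of \<Gamma> x" unfolding orbit_of_def \<Gamma>_def by blast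
  qed
  assume "\<exists>w. set w \<subseteq> A \<and> y = word_map \<alpha> w x"
  then obtain w where w: "set w \<subseteq> A" "y = word_map \<alpha> w x" by blast
  have "x = word_map \<alpha> (map bar (rev w)) y" using wm_inv(2)[OF w(1)] w(2) by simp
  then show "orbit_of \<Gamma> x = orbit_of \<Gamma> y" using *[OF w(1), of x] *[OF set_inv_word[OF w(1)], of y] w(2) by auto
qed

text \<open>The developing map is a continuous extension of \<open>\<Phi>\<close> which is locally injective, hence open by invariance of domain.\<close>

theorem orbit_space_homeomorphic:
  fixes \<Phi> :: "'a \<Rightarrow> 'a"
  assumes cont: "continuous_on D \<Phi>" and img: "\<Phi> ` D = X"
    and glue: "\<And>x y. x \<in> D \<Longrightarrow> y \<in> D \<Longrightarrow> \<Phi> x = \<Phi> y \<longleftrightarrow> x = y \<or> (\<exists>k\<in>A. P (bar k) x = 0 \<and> y = \<alpha> k x)"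
  shows "open X" "orbit_space \<Gamma> homeomorphic_space top_of_set X"
proof -
  \<comment> \<open>The chosen \<open>d\<close> does not matter: any two candidates are equal or
    paired by a letter, and \<Phi> agrees on them by \<open>glue\<close>.\<close>
  define \<Psi> where "\<Psi> x = \<Phi> (SOME d. d \<in> D \<and> (\<exists>w. set w \<subseteq> A \<and> x = word_map \<alpha> w d))" for x
  have Psi: "\<Psi> (word_map \<alpha> w d) = \<Phi> d" if "d \<in> D" "set w \<subseteq> A" for w d
  proof -
    have "\<exists>d'. d' \<in> D \<and> (\<exists>v. set v \<subseteq> A \<and> word_map \<alpha> w d = word_map \<alpha> v d')" using that by blast
    from someI_ex[OF this] obtain v d' where v: "\<Psi> (word_map \<alpha> w d) = \<Phi> d'" "d' \<in> D" "set v \<subseteq> A" "word_map \<alpha> w d = word_map \<alpha> v d'"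
      unfolding \<Psi>_def by blast
    have "d' = word_map \<alpha> (map bar (rev v) @ w) d" using v(4) wm_inv(2)[OF v(3)] by (simp add: word_map_append)
    moreover have "set (map bar (rev v) @ w) \<subseteq> A" using set_inv_word[OF v(3)] that(2) by simp
    ultimately have "d' = d \<or> (\<exists>k\<in>A. P (bar k) d = 0 \<and> d' = \<alpha> k d)" using D_connect[OF that(1) v(2)] by blast
    then have "\<Phi> d = \<Phi> d'" unfolding glue[OF that(1) v(2)] by metis
    then show ?thesis using v(1) by simp
  qed
  have Psi_eq: "\<Psi> x = \<Psi> y \<longleftrightarrow> (\<exists>w. set w \<subseteq> A \<and> y = word_map \<alpha> w x)" for x y
  proof -
    obtain u d where u: "set u \<subseteq> A" "d \<in> D" "x = word_map \<alpha> u d" using covered by blast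
    obtain v d' where v: "set v \<subseteq> A" "d' \<in> D" "y = word_map \<alpha> v d'" using covered by blast
    have P1: "\<Psi> x = \<Phi> d" "\<Psi> y = \<Phi> d'" using Psi u v by auto
    show ?thesis
    proof
      assume "\<Psi> x = \<Psi> y"
      then have "\<Phi> d = \<Phi> d'" using P1 by simp
      then have "d' = d \<or> (\<exists>k\<in>A. P (bar k) d = 0 \<and> d' = \<alpha> k d)" unfolding glue[OF u(2) v(2)] by metis
      then obtain z where z: "set z \<subseteq> A" "d' = word_map \<alpha> z d"
      proof
        assume "d' = d" then show ?thesis using that[of "[]"] by simp
      next
        assume "\<exists>k\<in>A. P (bar k) d = 0 \<and> d' = \<alpha> k d"
        then obtain k where "k \<in> A" "d' = \<alpha> k d" by blast
        then show ?thesis using that[of "[k]"] by simp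
      qed
      have "y = word_map \<alpha> (v @ z @ map bar (rev u)) x"
        using u v z wm_inv(2)[OF u(1)] by (simp add: word_map_append)
      then show "\<exists>w. set w \<subseteq> A \<and> y = word_map \<alpha> w x" using u v z set_inv_word[OF u(1)]
        by (intro exI[of _ "v @ z @ map bar (rev u)"]) auto
    next
      assume "\<exists>w. set w \<subseteq> A \<and> y = word_map \<alpha> w x"
      then obtain w where "set w \<subseteq> A" "y = word_map \<alpha> w x" by blast
      then have "y = word_map \<alpha> (w @ u) d" "set (w @ u) \<subseteq> A" using u by (auto simp: word_map_append)
      then show "\<Psi> x = \<Psi> y" using Psi[OF u(2)] P1 by simp
    qed
  qed
  have Psi_img: "range \<Psi> = X"
  proof
    show "range \<Psi> \<subseteq> X"
    proof
      fix p assume "p \<in> range \<Psi>"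
      then obtain x where "p = \<Psi> x" by blast
      moreover obtain w d where "set w \<subseteq> A" "d \<in> D" "x = word_map \<alpha> w d" using covered by blast
      ultimately show "p \<in> X" using Psi img by blast
    qed
    show "X \<subseteq> range \<Psi>"
    proof
      fix p assume "p \<in> X"
      then obtain d where "d \<in> D" "p = \<Phi> d" using img by blast
      then show "p \<in> range \<Psi>" using Psi[of d "[]"] by (intro image_eqI[of _ _ d]) auto
    qed
  qed
  \<comment> \<open>A ball meets only finitely many of the images of \<open>D\<close> needed to
    cover it, so \<Psi> is pasted from finitely many continuous pieces on closed sets.\<close>
  have cball: "continuous_on (cball 0 R) \<Psi>" for R
  proof -
    obtain \<W> where W: "finite \<W>" "\<And>w. w \<in> \<W> \<Longrightarrow> set w \<subseteq> A"
      "\<And>x. norm x \<le> R \<Longrightarrow> \<exists>w\<in>\<W>. \<exists>d\<in>D. x = word_map \<alpha> w d" using cover by blast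
    define A where "A w = cball 0 R \<inter> (word_map \<alpha> (map bar (rev w)) -` D)" for w
    have "continuous_on (\<Union>w\<in>\<W>. A w) \<Psi>"
    proof (rule continuous_on_closed_Union[OF W(1)])
      fix w assume w: "w \<in> \<W>"
      have c: "continuous_on UNIV (word_map \<alpha> (map bar (rev w)))" by (rule cont_word[OF set_inv_word[OF W(2)[OF w]]])
      show "closed (A w)" unfolding A_def
        by (intro closed_Int closed_cball continuous_closed_vimage closed_D) (use c in \<open>auto simp: continuous_on_eq_continuous_at\<close>)
      have "continuous_on (A w) (\<Phi> \<circ> word_map \<alpha> (map bar (rev w)))"
        by (intro continuous_on_compose continuous_on_subset[OF c] continuous_on_subset[OF cont]) (auto simp: A_def)
      moreover have "\<Psi> x = (\<Phi> \<circ> word_map \<alpha> (map bar (rev w))) x" if "x \<in> A w" for x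
        using that Psi[of "word_map \<alpha> (map bar (rev w)) x" w] W(2)[OF w] wm_inv(1)[OF W(2)[OF w]] by (simp add: A_def)
      ultimately show "continuous_on (A w) \<Psi>" by (simp cong: continuous_on_cong)
    qed
    moreover have "cball 0 R \<subseteq> (\<Union>w\<in>\<W>. A w)"
    proof
      fix x :: 'a assume x: "x \<in> cball 0 R"
      then obtain w d where w: "w \<in> \<W>" "d \<in> D" "x = word_map \<alpha> w d" using W(3)[of x] by auto
      then have "x \<in> A w" using x wm_inv(2)[OF W(2)[OF w(1)]] by (simp add: A_def)
      then show "x \<in> (\<Union>w\<in>\<W>. A w)" using w by blast
    qed
    ultimately show ?thesis by (rule continuous_on_subset)
  qed
  have contPsi: "continuous_on UNIV \<Psi>"
    unfolding continuous_on_eq_continuous_at[OF open_UNIV]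
  proof
    fix x :: 'a
    have "continuous_on (ball 0 (norm x + 1)) \<Psi>" using cball[of "norm x + 1"] by (rule continuous_on_subset) auto
    then show "isCont \<Psi> x" using continuous_on_eq_continuous_at[of "ball 0 (norm x + 1)" \<Psi>] by auto
  qed
  \<comment> \<open>Only finitely many elements bring the unit ball around \<open>x\<close> back to
    itself, and those other than the identity move \<open>x\<close>; each of them maps a small
    enough ball around \<open>x\<close> off that ball.\<close>
  have local_inj: "\<exists>r>0. inj_on \<Psi> (ball x r)" for x
  proof -
    have "finite {\<gamma>\<in>\<Gamma>. \<gamma> ` cball x 1 \<inter> cball x 1 \<noteq> {}}"
      using properly_discontinuous by (simp add: acts_properly_discontinuously_def)
    moreover define S where "S = {\<gamma>\<in>\<Gamma>. \<gamma> ` cball x 1 \<inter> cball x 1 \<noteq> {} \<and> \<gamma> \<noteq> id}"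
    ultimately have fin: "finite S" by (rule_tac finite_subset[rotated]) auto
    have "\<exists>r>0. \<forall>y\<in>ball x r. dist (\<gamma> y) x \<ge> r" if "\<gamma> \<in> S" for \<gamma>
    proof -
      obtain w where w: "set w \<subseteq> A" "\<gamma> = word_map \<alpha> w" using \<open>\<gamma> \<in> S\<close> by (auto simp: \<Gamma>_def S_def)
      have "\<gamma> x \<noteq> x" using free_action[OF w(1)] w(2) \<open>\<gamma> \<in> S\<close> by (auto simp: S_def)
      then have d: "dist (\<gamma> x) x > 0" by simp
      have "isCont \<gamma> x" using cont_word[OF w(1)] w(2) by (simp add: continuous_on_eq_continuous_at)
      then obtain r where r: "r > 0" "\<And>y. dist y x < r \<Longrightarrow> dist (\<gamma> y) (\<gamma> x) < dist (\<gamma> x) x / 2"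
        using d unfolding continuous_at_eps_delta by (metis half_gt_zero)
      have "dist (\<gamma> y) x \<ge> min r (dist (\<gamma> x) x / 2)" if "y \<in> ball x (min r (dist (\<gamma> x) x / 2))" for y
      proof -
        have "dist (\<gamma> y) (\<gamma> x) < dist (\<gamma> x) x / 2" using r(2)[of y] that by (simp add: dist_commute)
        then show ?thesis using dist_triangle2[of "\<gamma> x" x "\<gamma> y"] by (simp add: dist_commute min_def)
      qed
      then show ?thesis using r(1) d by (intro exI[of _ "min r (dist (\<gamma> x) x / 2)"]) auto
    qed
    then have "\<forall>\<gamma>\<in>S. \<exists>r. r > 0 \<and> (\<forall>y\<in>ball x r. dist (\<gamma> y) x \<ge> r)" by blast
    from bchoice[OF this] obtain \<rho> where "\<forall>\<gamma>\<in>S. \<rho> \<gamma> > 0 \<and> (\<forall>y\<in>ball x (\<rho> \<gamma>). dist (\<gamma> y) x \<ge> \<rho> \<gamma>)" ..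
    then have rho: "\<rho> \<gamma> > 0 \<and> (\<forall>y\<in>ball x (\<rho> \<gamma>). dist (\<gamma> y) x \<ge> \<rho> \<gamma>)" if "\<gamma> \<in> S" for \<gamma>
      using that by (rule bspec)
    define r where "r = Min (insert 1 (\<rho> ` S))"
    have r: "r > 0" "r \<le> 1" "\<And>\<gamma>. \<gamma> \<in> S \<Longrightarrow> r \<le> \<rho> \<gamma>"
    proof -
      have f: "finite (insert 1 (\<rho> ` S))" using fin by simp
      show "r > 0" unfolding r_def by (subst Min_gr_iff[OF f]) (auto simp: rho)
      show "r \<le> 1" unfolding r_def by (intro Min_le[OF f] insertI1)
      show "r \<le> \<rho> \<gamma>" if "\<gamma> \<in> S" for \<gamma> unfolding r_def using that by (intro Min_le[OF f] insertI2 imageI)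
    qed
    have "inj_on \<Psi> (ball x r)"
    proof (rule inj_onI)
      fix y z assume yz: "y \<in> ball x r" "z \<in> ball x r" "\<Psi> y = \<Psi> z"
      then obtain w where w: "set w \<subseteq> A" "z = word_map \<alpha> w y" using Psi_eq by blast
      show "y = z"
      proof (cases "word_map \<alpha> w = id")
        case False
        have "z \<in> word_map \<alpha> w ` cball x 1 \<inter> cball x 1" using w yz r by (auto intro!: image_eqI[of _ _ y])
        then have S: "word_map \<alpha> w \<in> S" using False w(1) unfolding S_def \<Gamma>_def by blast
        then have "dist z x \<ge> \<rho> (word_map \<alpha> w)" using rho[OF S] yz(1) r(3)[OF S] w(2) by auto
        then show ?thesis using r(3)[OF S] yz(2) by (simp add: dist_commute)
      qed (use w in simp)
    qed
    then show ?thesis using r by blast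
  qed
  have openmap: "open (\<Psi> ` U)" if "open U" for U
  proof (subst open_subopen, intro ballI)
    fix p assume "p \<in> \<Psi> ` U"
    then obtain x where x: "x \<in> U" "p = \<Psi> x" by blast
    obtain r where r: "r > 0" "inj_on \<Psi> (ball x r)" using local_inj by blast
    have "open (\<Psi> ` (ball x r \<inter> U))"
      by (rule invariance_of_domain) (use contPsi r that in \<open>auto intro: continuous_on_subset inj_on_subset\<close>)
    then show "\<exists>T. open T \<and> p \<in> T \<and> T \<subseteq> \<Psi> ` U" using x r by (intro exI[of _ "\<Psi> ` (ball x r \<inter> U)"]) auto
  qed
  show X: "open X" using openmap[of UNIV] Psi_img by simp
  have q2: "quotient_map euclidean (top_of_set X) \<Psi>"
  proof (rule continuous_open_imp_quotient_map)
    show "continuous_map euclidean (top_of_set X) \<Psi>"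
      using contPsi Psi_img by (auto simp: continuous_map_in_subtopology)
    show "open_map euclidean (top_of_set X) \<Psi>"
      unfolding open_map_def using openmap X Psi_img by (auto simp: openin_open_eq)
    show "\<Psi> ` topspace euclidean = topspace (top_of_set X)" using Psi_img by simp
  qed
  have q1: "quotient_map euclidean (orbit_space \<Gamma>) (orbit_of \<Gamma>)" by (rule quotient_map_orbit_space)
  \<comment> \<open>Two quotient maps from one space with the same fibres factor through each
    other.\<close>
  have same: "orbit_of \<Gamma> x = orbit_of \<Gamma> y \<longleftrightarrow> \<Psi> x = \<Psi> y" for x y using orbit_eq Psi_eq by simp
  obtain h where h: "continuous_map (orbit_space \<Gamma>) (top_of_set X) h" "\<And>x. h (orbit_of \<Gamma> x) = \<Psi> x"
    by (rule quotient_map_lift_exists[OF q1 quotient_imp_continuous_map[OF q2]]) (auto simp: same)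
  obtain k where k: "continuous_map (top_of_set X) (orbit_space \<Gamma>) k" "\<And>x. k (\<Psi> x) = orbit_of \<Gamma> x"
    by (rule quotient_map_lift_exists[OF q2 quotient_imp_continuous_map[OF q1]]) (auto simp: same)
  have "homeomorphic_maps (orbit_space \<Gamma>) (top_of_set X) h k"
    unfolding homeomorphic_maps_def
  proof (intro conjI ballI)
    fix o' assume "o' \<in> topspace (orbit_space \<Gamma>)"
    then obtain x where "o' = orbit_of \<Gamma> x" using quotient_imp_surjective_map[OF q1] by auto
    then show "k (h o') = o'" by (simp add: h k)
  next
    fix p assume "p \<in> topspace (top_of_set X)"
    then obtain x where "p = \<Psi> x" using Psi_img by auto
    then show "h (k p) = p" by (simp add: h k)
  qed (use h k in auto)
  then show "orbit_space \<Gamma> homeomorphic_space top_of_set X" by (auto simp: homeomorphic_space_def)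
qed

end

section \<open>Handles outside the ball\<close>

text \<open>For fixed \<open>w\<close> orthogonal to \<open>e\<close> this is the arc outside the unit ball, of a circle in the plane
  \<open>w + \<langle>e, \<omega>\<rangle>\<close>, from the point of the unit sphere above \<open>w\<close> to the point below. The distance \<open>c\<close> of the centres of the circles
  serves to make different tubes disjoint.\<close>

definition tube :: "'a::euclidean_space \<Rightarrow> 'a \<Rightarrow> real \<Rightarrow> real \<Rightarrow> 'a \<Rightarrow> 'a" where
  "tube e \<omega> c \<tau> w =
    (let q = c - w \<bullet> \<omega>; B = sqrt (1 - (norm w)\<^sup>2); \<rho> = sqrt (q\<^sup>2 + B\<^sup>2);
         \<psi> = (1 - 2 * \<tau>) * (pi - arctan (B / q))
     in w - (w \<bullet> \<omega>) *\<^sub>R \<omega> + (c + \<rho> * cos \<psi>) *\<^sub>R \<omega> + (\<rho> * sin \<psi>) *\<^sub>R e)"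

lemma sin_cos_inj:
  assumes "sin x = sin y" "cos x = cos y" "\<bar>x\<bar> < pi" "\<bar>y\<bar> < pi"
  shows "x = (y::real)"
proof -
  have "sin (x - y) = 0" "cos (x - y) = 1"
    using assms(1,2) by (auto simp: sin_diff cos_diff mult.commute simp flip: power2_eq_square)
  then obtain k :: int where "x - y = of_int k * (2 * pi)" unfolding cos_one_2pi_int by (auto simp: mult.assoc)
  moreover have "\<bar>x - y\<bar> < 2 * pi" using assms(3,4) by linarith
  ultimately have "\<bar>of_int k\<bar> * (2 * pi) < 1 * (2 * pi)" by (simp add: abs_mult)
  then have "\<bar>real_of_int k\<bar> < 1" using pi_gt_zero by (subst (asm) mult_less_cancel_right_pos) auto
  then have "k = 0" by linarith
  with \<open>x - y = _\<close> show ?thesis by simp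
qed

text \<open>With \<open>c \<ge> 1/2\<close> the centres of the circles lie beyond all base points in
  \<open>W\<close>, whose norm is below \<open>1/2\<close>; this is what makes \<open>q\<close>
  positive.\<close>

locale tube_data =
  fixes e \<omega> :: "'a::euclidean_space" and c :: real
  assumes unit: "norm e = 1" "norm \<omega> = 1" and orth: "e \<bullet> \<omega> = 0" and c: "c \<ge> 1/2"
begin

lemma ip: "e \<bullet> e = 1" "\<omega> \<bullet> \<omega> = 1" "\<omega> \<bullet> e = 0" "e \<bullet> \<omega> = 0"
  using unit orth by (auto simp: dot_square_norm inner_commute)

definition W :: "'a set" where "W = {w. w \<bullet> e = 0 \<and> norm w < 1/2}"

definition q where "q w = c - w \<bullet> \<omega>"
definition B where "B w = sqrt (1 - (norm (w::'a))\<^sup>2)"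
definition \<rho> where "\<rho> w = sqrt ((q w)\<^sup>2 + (B w)\<^sup>2)"
definition \<phi> where "\<phi> w = pi - arctan (B w / q w)"

lemma tube_eq: "tube e \<omega> c \<tau> w = w - (w \<bullet> \<omega>) *\<^sub>R \<omega> + (c + \<rho> w * cos ((1 - 2 * \<tau>) * \<phi> w)) *\<^sub>R \<omega>
    + (\<rho> w * sin ((1 - 2 * \<tau>) * \<phi> w)) *\<^sub>R e"
  by (simp add: tube_def q_def B_def \<rho>_def \<phi>_def Let_def)

text \<open>In the plane with axes \<omega> and \<open>e\<close>, relative to the centre, the end
  points are \<open>(- q w, B w)\<close> and \<open>(- q w, - B w)\<close>, at the angles
  \<open>\<phi> w\<close> and \<open>- \<phi> w\<close>. The arc between them passes through the
  angle 0, on the side away from the ball.\<close>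

lemma pos:
  assumes "w \<in> W"
  shows "q w > 0" "B w > 0" "\<rho> w > 0" "(B w)\<^sup>2 = 1 - (norm w)\<^sup>2" "(\<rho> w)\<^sup>2 = (q w)\<^sup>2 + (B w)\<^sup>2"
    "pi / 2 < \<phi> w" "\<phi> w < pi" "\<phi> w > 0" "\<rho> w * cos (\<phi> w) = - q w" "\<rho> w * sin (\<phi> w) = B w"
proof -
  have n: "norm w < 1/2" using assms by (auto simp: W_def)
  have "\<bar>w \<bullet> \<omega>\<bar> \<le> norm w" using Cauchy_Schwarz_ineq2[of w \<omega>] unit by simp
  then show q: "q w > 0" using c n by (auto simp: q_def)
  have "(norm w)\<^sup>2 < 1" using n by (simp add: power_less_one_iff abs_square_less_1)
  then show B: "B w > 0" "(B w)\<^sup>2 = 1 - (norm w)\<^sup>2" by (simp_all add: B_def)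
  show r: "\<rho> w > 0" "(\<rho> w)\<^sup>2 = (q w)\<^sup>2 + (B w)\<^sup>2" using q B(1) by (simp_all add: \<rho>_def add_pos_pos)
  show *: "pi / 2 < \<phi> w" "\<phi> w < pi" unfolding \<phi>_def using arctan_ubound[of "B w / q w"] q B
    by (auto simp: zero_less_arctan_iff)
  then show "\<phi> w > 0" using pi_gt_zero by linarith
  have s: "sqrt (1 + (B w / q w)\<^sup>2) = \<rho> w / q w"
  proof -
    have "1 + (B w / q w)\<^sup>2 = (\<rho> w / q w)\<^sup>2" using q r(2) by (simp add: power_divide field_simps)
    then show ?thesis using q r by simp
  qed
  show "\<rho> w * cos (\<phi> w) = - q w" unfolding \<phi>_def using q r s by (simp add: cos_arctan)
  show "\<rho> w * sin (\<phi> w) = B w" unfolding \<phi>_def using q r s by (simp add: sin_arctan)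
qed

lemma tube_0: "w \<in> W \<Longrightarrow> tube e \<omega> c 0 w = w + sqrt (1 - (norm w)\<^sup>2) *\<^sub>R e"
  unfolding tube_eq using pos[of w] by (simp add: q_def B_def scaleR_left_distrib scaleR_left_diff_distrib)

lemma tube_1: "w \<in> W \<Longrightarrow> tube e \<omega> c 1 w = w - sqrt (1 - (norm w)\<^sup>2) *\<^sub>R e"
  unfolding tube_eq using pos[of w] by (simp add: q_def B_def scaleR_left_distrib scaleR_left_diff_distrib)

lemma tube_coords:
  assumes "w \<in> W"
  shows "tube e \<omega> c \<tau> w \<bullet> \<omega> = c + \<rho> w * cos ((1 - 2 * \<tau>) * \<phi> w)"
    "tube e \<omega> c \<tau> w \<bullet> e = \<rho> w * sin ((1 - 2 * \<tau>) * \<phi> w)"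
    "tube e \<omega> c \<tau> w - (tube e \<omega> c \<tau> w \<bullet> \<omega>) *\<^sub>R \<omega> - (tube e \<omega> c \<tau> w \<bullet> e) *\<^sub>R e = w - (w \<bullet> \<omega>) *\<^sub>R \<omega>"
proof -
  have w: "w \<bullet> e = 0" using assms by (simp add: W_def)
  show 1: "tube e \<omega> c \<tau> w \<bullet> \<omega> = c + \<rho> w * cos ((1 - 2 * \<tau>) * \<phi> w)"
    "tube e \<omega> c \<tau> w \<bullet> e = \<rho> w * sin ((1 - 2 * \<tau>) * \<phi> w)"
    unfolding tube_eq by (simp_all add: inner_add_left inner_diff_left ip w)
  show "tube e \<omega> c \<tau> w - (tube e \<omega> c \<tau> w \<bullet> \<omega>) *\<^sub>R \<omega> - (tube e \<omega> c \<tau> w \<bullet> e) *\<^sub>R e = w - (w \<bullet> \<omega>) *\<^sub>R \<omega>"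
    unfolding 1 by (simp add: tube_eq)
qed

lemma norm_split: "(norm x)\<^sup>2 = (norm (x - (x \<bullet> \<omega>) *\<^sub>R \<omega> - (x \<bullet> e) *\<^sub>R e))\<^sup>2 + (x \<bullet> \<omega>)\<^sup>2 + (x \<bullet> e)\<^sup>2"
proof -
  have "(norm (x - (x \<bullet> \<omega>) *\<^sub>R \<omega> - (x \<bullet> e) *\<^sub>R e))\<^sup>2 = x \<bullet> x - (x \<bullet> \<omega>)\<^sup>2 - (x \<bullet> e)\<^sup>2"
    unfolding power2_norm_eq_inner
    by (simp add: inner_diff_left inner_diff_right ip inner_commute[of \<omega> x] inner_commute[of e x] power2_eq_square algebra_simps)
  then show ?thesis by (simp add: power2_norm_eq_inner)
qed

lemma rho_sq:
  assumes "w \<in> W"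
  shows "(\<rho> w)\<^sup>2 = c\<^sup>2 + 1 - 2 * c * (w \<bullet> \<omega>) - (norm (w - (w \<bullet> \<omega>) *\<^sub>R \<omega>))\<^sup>2"
proof -
  have w: "w \<bullet> e = 0" using assms by (simp add: W_def)
  have "(norm w)\<^sup>2 = (norm (w - (w \<bullet> \<omega>) *\<^sub>R \<omega>))\<^sup>2 + (w \<bullet> \<omega>)\<^sup>2" using norm_split[of w] w by simp
  then show ?thesis using pos[OF assms] by (simp add: q_def power2_eq_square algebra_simps)
qed

text \<open>By \<open>rho_sq\<close> the quadratic terms cancel and the squared norm becomes affine
  in the coordinate along \<omega>. Being outside the ball is then a comparison of cosines, and the
  second form compares different tubes in \<open>tubes_exist\<close>.\<close>

lemma norm_tube:
  assumes "w \<in> W"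
  shows "(norm (tube e \<omega> c \<tau> w))\<^sup>2 = 1 + 2 * c * (\<rho> w * cos ((1 - 2 * \<tau>) * \<phi> w) - \<rho> w * cos (\<phi> w))"
    and "(norm (tube e \<omega> c \<tau> w))\<^sup>2 = 1 + 2 * c * (tube e \<omega> c \<tau> w \<bullet> \<omega> - w \<bullet> \<omega>)"
proof -
  let ?C = "cos ((1 - 2 * \<tau>) * \<phi> w)" and ?S = "sin ((1 - 2 * \<tau>) * \<phi> w)"
  have "(norm (tube e \<omega> c \<tau> w))\<^sup>2 = (norm (w - (w \<bullet> \<omega>) *\<^sub>R \<omega>))\<^sup>2 + (c + \<rho> w * ?C)\<^sup>2 + (\<rho> w * ?S)\<^sup>2"
    unfolding norm_split[of "tube e \<omega> c \<tau> w"] tube_coords(3)[OF assms] by (simp add: tube_coords[OF assms])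
  also have "\<dots> = (norm (w - (w \<bullet> \<omega>) *\<^sub>R \<omega>))\<^sup>2 + c\<^sup>2 + 2 * c * (\<rho> w * ?C) + (\<rho> w)\<^sup>2 * (?S\<^sup>2 + ?C\<^sup>2)"
    by (simp only: power2_eq_square ring_distribs) (simp add: algebra_simps)
  also have "\<dots> = 1 + 2 * c * (c - w \<bullet> \<omega> + \<rho> w * ?C)"
    unfolding rho_sq[OF assms] sin_cos_squared_add by (simp add: power2_eq_square algebra_simps)
  finally have *: "(norm (tube e \<omega> c \<tau> w))\<^sup>2 = 1 + 2 * c * (c - w \<bullet> \<omega> + \<rho> w * ?C)" .
  show "(norm (tube e \<omega> c \<tau> w))\<^sup>2 = 1 + 2 * c * (\<rho> w * ?C - \<rho> w * cos (\<phi> w))"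
    using * pos(9)[OF assms] by (simp add: q_def)
  show "(norm (tube e \<omega> c \<tau> w))\<^sup>2 = 1 + 2 * c * (tube e \<omega> c \<tau> w \<bullet> \<omega> - w \<bullet> \<omega>)"
    using * tube_coords(1)[OF assms] by (simp add: algebra_simps)
qed

lemma tube_outside:
  assumes "w \<in> W" "0 < \<tau>" "\<tau> < 1"
  shows "norm (tube e \<omega> c \<tau> w) > 1"
proof -
  note p = pos[OF assms(1)]
  have "\<bar>1 - 2 * \<tau>\<bar> < 1" using assms by linarith
  then have "\<bar>(1 - 2 * \<tau>) * \<phi> w\<bar> < \<phi> w" using p(8) by (simp add: abs_mult)
  then have "cos (\<phi> w) < cos \<bar>(1 - 2 * \<tau>) * \<phi> w\<bar>" using p(7) by (intro cos_monotone_0_pi) auto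
  then have "\<rho> w * cos (\<phi> w) < \<rho> w * cos ((1 - 2 * \<tau>) * \<phi> w)" using p(3) by simp
  then have "(norm (tube e \<omega> c \<tau> w))\<^sup>2 > 1" unfolding norm_tube(1)[OF assms(1)] using c by simp
  then show ?thesis by (metis abs_norm_cancel abs_square_le_1 not_le)
qed

lemma norm_tube_ends:
  assumes "w \<in> W" shows "norm (tube e \<omega> c 0 w) = 1" "norm (tube e \<omega> c 1 w) = 1"
proof -
  have "(norm (tube e \<omega> c 0 w))\<^sup>2 = 1" "(norm (tube e \<omega> c 1 w))\<^sup>2 = 1"
    unfolding norm_tube(1)[OF assms] by simp_all
  then show "norm (tube e \<omega> c 0 w) = 1" "norm (tube e \<omega> c 1 w) = 1" by (metis abs_norm_cancel real_sqrt_abs real_sqrt_one)+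
qed

text \<open>The coordinates off the plane of the circle give the part of \<open>w\<close> orthogonal
  to \<omega>, the distance to the centre gives \<rho>, and \<open>rho_sq\<close> turns \<rho> into
  \<open>w \<bullet> \<omega>\<close> because \<open>c \<noteq> 0\<close>. The angle lies strictly
  between \<open>- pi\<close> and \<open>pi\<close>, so it is determined as well.\<close>

lemma tube_inj:
  assumes w: "w \<in> W" "w' \<in> W" and t: "\<tau> \<in> {0..1}" "\<tau>' \<in> {0..1}"
    and eq: "tube e \<omega> c \<tau> w = tube e \<omega> c \<tau>' w'"
  shows "\<tau> = \<tau>' \<and> w = w'"
proof -
  note p = pos[OF w(1)] and p' = pos[OF w(2)]
  define \<psi> \<psi>' where "\<psi> = (1 - 2 * \<tau>) * \<phi> w" and "\<psi>' = (1 - 2 * \<tau>') * \<phi> w'"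
  have F: "w - (w \<bullet> \<omega>) *\<^sub>R \<omega> = w' - (w' \<bullet> \<omega>) *\<^sub>R \<omega>"
    using tube_coords(3)[OF w(1), of \<tau>] tube_coords(3)[OF w(2), of \<tau>'] eq by simp
  have 1: "\<rho> w * cos \<psi> = \<rho> w' * cos \<psi>'" "\<rho> w * sin \<psi> = \<rho> w' * sin \<psi>'"
    using tube_coords(1,2)[OF w(1), of \<tau>] tube_coords(1,2)[OF w(2), of \<tau>'] eq by (simp_all add: \<psi>_def \<psi>'_def)
  have "(\<rho> w)\<^sup>2 = (\<rho> w * cos \<psi>)\<^sup>2 + (\<rho> w * sin \<psi>)\<^sup>2" by (simp add: power_mult_distrib flip: distrib_left)
  also have "\<dots> = (\<rho> w')\<^sup>2" unfolding 1 by (simp add: power_mult_distrib flip: distrib_left)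
  finally have r2: "(\<rho> w)\<^sup>2 = (\<rho> w')\<^sup>2" .
  then have r: "\<rho> w = \<rho> w'" using p(3) p'(3) by simp
  have "w \<bullet> \<omega> = w' \<bullet> \<omega>" using r2 rho_sq[OF w(1)] rho_sq[OF w(2)] F c by simp
  with F have ww: "w = w'" by simp
  have "\<bar>1 - 2 * \<tau>\<bar> \<le> 1" "\<bar>1 - 2 * \<tau>'\<bar> \<le> 1" using t by auto
  then have "\<bar>1 - 2 * \<tau>\<bar> * \<phi> w \<le> 1 * \<phi> w" "\<bar>1 - 2 * \<tau>'\<bar> * \<phi> w' \<le> 1 * \<phi> w'"
    using p(8) p'(8) by (auto intro!: mult_right_mono simp del: mult_1)
  moreover have "\<bar>\<psi>\<bar> = \<bar>1 - 2 * \<tau>\<bar> * \<phi> w" "\<bar>\<psi>'\<bar> = \<bar>1 - 2 * \<tau>'\<bar> * \<phi> w'"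
    using p(8) p'(8) by (simp_all add: \<psi>_def \<psi>'_def abs_mult)
  ultimately have b: "\<bar>\<psi>\<bar> < pi" "\<bar>\<psi>'\<bar> < pi" using p(7) p'(7) by linarith+
  have "\<psi> = \<psi>'" by (rule sin_cos_inj) (use 1 r p'(3) b in auto)
  then have "\<tau> = \<tau>'" using p(8) by (simp add: \<psi>_def \<psi>'_def ww)
  with ww show ?thesis by simp
qed

lemma tube_cont: "continuous_on ({0..1} \<times> W) (\<lambda>(\<tau>, w). tube e \<omega> c \<tau> w)"
proof -
  have "c - snd x \<bullet> \<omega> \<noteq> 0" if "x \<in> {0..1::real} \<times> W" for x using pos(1)[of "snd x"] that by (auto simp: q_def)
  then show ?thesis
    unfolding tube_def Let_def case_prod_unfold by (intro continuous_intros) auto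
qed

lemma zero_W: "0 \<in> W" by (simp add: W_def)

end

text \<open>Finitely many planes form a negligible set in dimension at least 3.\<close>

lemma generic_vector:
  fixes E :: "'a::euclidean_space set"
  assumes "finite E" "DIM('a) \<ge> 3"
  obtains \<omega> where "\<And>a b. a \<in> E \<Longrightarrow> b \<in> E \<Longrightarrow> \<omega> \<notin> span {a, b}"
proof -
  have "negligible (\<Union>(a, b)\<in>E \<times> E. span {a, b})"
  proof (rule negligible_Union)
    fix s assume "s \<in> (\<lambda>(a, b). span {a, b}) ` (E \<times> E)"
    then obtain a b where s: "s = span {a, b}" by auto
    have "dim {a, b} \<le> card {a, b}" by (rule dim_le_card') simp
    also have "\<dots> \<le> 2" by (simp add: card_insert_if)
    finally have "dim s < DIM('a)" using assms(2) unfolding s by (simp add: dim_span)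
    then show "negligible s" by (rule negligible_lowdim)
  qed (use assms(1) in auto)
  then have "(\<Union>(a, b)\<in>E \<times> E. span {a, b}) \<noteq> UNIV" using non_negligible_UNIV by metis
  then obtain \<omega> where "\<omega> \<notin> (\<Union>(a, b)\<in>E \<times> E. span {a, b})" by blast
  then show ?thesis using that by blast
qed

text \<open>All core circles are placed in the planes \<open>span {e i, v}\<close> for one generic
  \<open>v\<close>. Two such planes meet only in the line of \<open>v\<close>, where a point
  \<open>b *\<^sub>R v\<close> of the i-th circle has squared norm
  \<open>1 + b * (m * (i + 1))\<close>. Different indices force \<open>b = 0\<close>, which
  contradicts this norm. Compactness then thickens the disjoint cores.\<close>

lemma tubes_exist:
  fixes e :: "nat \<Rightarrow> 'a::euclidean_space"
  assumes unit: "\<And>i. i < n \<Longrightarrow> norm (e i) = 1" and dim: "DIM('a) \<ge> 3"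
    and dist: "\<And>i j. i < n \<Longrightarrow> j < n \<Longrightarrow> i \<noteq> j \<Longrightarrow> e i \<noteq> e j \<and> e i \<noteq> - e j"
  obtains \<omega> c r where "\<And>i. i < n \<Longrightarrow> tube_data (e i) (\<omega> i) (c i)" "0 < r" "r < 1/2"
    "\<And>i j \<tau> \<tau>' w w'. i < n \<Longrightarrow> j < n \<Longrightarrow> i \<noteq> j \<Longrightarrow> \<tau> \<in> {0..1} \<Longrightarrow> \<tau>' \<in> {0..1} \<Longrightarrow>
      w \<bullet> e i = 0 \<Longrightarrow> w' \<bullet> e j = 0 \<Longrightarrow> norm w \<le> r \<Longrightarrow> norm w' \<le> r \<Longrightarrow>
      tube (e i) (\<omega> i) (c i) \<tau> w \<noteq> tube (e j) (\<omega> j) (c j) \<tau>' w'"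
proof -
  obtain v :: 'a where v: "\<And>a b. a \<in> e ` {..<n} \<Longrightarrow> b \<in> e ` {..<n} \<Longrightarrow> v \<notin> span {a, b}"
    using generic_vector[of "e ` {..<n}"] dim by blast
  have vn: "v \<noteq> a *\<^sub>R e i + b *\<^sub>R e j" if "i < n" "j < n" for a b i j
    using v[of "e i" "e j"] that by (auto simp: span_insert span_singleton) (metis add_diff_cancel_left')
  define p where "p i = v - (v \<bullet> e i) *\<^sub>R e i" for i
  have p: "p i \<noteq> 0" if "i < n" for i using vn[of i i "v \<bullet> e i" 0] that by (auto simp: p_def)
  have pe: "p i \<bullet> e i = 0" if "i < n" for i using unit[OF that] by (simp add: p_def inner_diff_left dot_square_norm)
  define \<omega> where "\<omega> i = (1 / norm (p i)) *\<^sub>R p i" for i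
  define m where "m = (\<Sum>i<n. norm (p i)) + 1"
  have pm: "norm (p i) \<le> m" "m > 0" if "i < n" for i
    using member_le_sum[of i "{..<n}" "\<lambda>i. norm (p i)"] that by (auto simp: m_def intro!: add_nonneg_pos sum_nonneg)
  \<comment> \<open>Chosen so that \<open>2 * c i * (v \<bullet> \<omega> i) = m * (i + 1)\<close>,
    the slope that tells the circles apart; \<open>norm (p i) \<le> m\<close> keeps
    \<open>c i \<ge> 1/2\<close>.\<close>
  define c where "c i = m * (real i + 1) / (2 * norm (p i))" for i
  have cp: "2 * c i * (v \<bullet> \<omega> i) = m * (real i + 1)" if "i < n" for i
  proof -
    have "v \<bullet> p i = p i \<bullet> p i" using pe[OF that] by (simp add: p_def inner_diff_left inner_diff_right inner_commute)
    then show ?thesis using p[OF that] by (simp add: c_def \<omega>_def dot_square_norm power2_eq_square)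
  qed
  have td: "tube_data (e i) (\<omega> i) (c i)" if i: "i < n" for i
  proof
    show "norm (e i) = 1" using unit i by simp
    show "norm (\<omega> i) = 1" "e i \<bullet> \<omega> i = 0" using p[OF i] pe[OF i] by (auto simp: \<omega>_def inner_commute)
    have "norm (p i) * 1 \<le> m * (real i + 1)" using pm[OF i] by (intro mult_mono) auto
    then show "1/2 \<le> c i" unfolding c_def using p[OF i] by (simp add: field_simps)
  qed
  have core: "tube (e i) (\<omega> i) (c i) \<tau> 0 \<noteq> tube (e j) (\<omega> j) (c j) \<tau>' 0" if ij: "i < n" "j < n" "i \<noteq> j" for i j \<tau> \<tau>'
  proof
    assume eq: "tube (e i) (\<omega> i) (c i) \<tau> 0 = tube (e j) (\<omega> j) (c j) \<tau>' 0"
    define x where "x = tube (e i) (\<omega> i) (c i) \<tau> 0"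
    interpret i: tube_data "e i" "\<omega> i" "c i" by (rule td) fact
    interpret j: tube_data "e j" "\<omega> j" "c j" by (rule td) fact
    have xi: "x = (x \<bullet> \<omega> i) *\<^sub>R \<omega> i + (x \<bullet> e i) *\<^sub>R e i"
      using i.tube_coords(3)[OF i.zero_W, of \<tau>] by (simp add: x_def algebra_simps)
    have xj: "x = (x \<bullet> \<omega> j) *\<^sub>R \<omega> j + (x \<bullet> e j) *\<^sub>R e j"
      using j.tube_coords(3)[OF j.zero_W, of \<tau>'] eq by (simp add: x_def algebra_simps)
    have sp: "\<exists>a b. x = a *\<^sub>R e k + b *\<^sub>R v" if "x = (x \<bullet> \<omega> k) *\<^sub>R \<omega> k + (x \<bullet> e k) *\<^sub>R e k" for k
    proof -
      have w: "\<omega> k = (1 / norm (p k)) *\<^sub>R v - (1 / norm (p k) * (v \<bullet> e k)) *\<^sub>R e k"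
        unfolding \<omega>_def by (subst (2) p_def) (simp add: scaleR_diff_right)
      have "(x \<bullet> \<omega> k) *\<^sub>R \<omega> k + (x \<bullet> e k) *\<^sub>R e k = (x \<bullet> e k - (x \<bullet> \<omega> k) * (1 / norm (p k) * (v \<bullet> e k))) *\<^sub>R e k + ((x \<bullet> \<omega> k) * (1 / norm (p k))) *\<^sub>R v"
        by (subst (2) w) (simp add: algebra_simps)
      then show ?thesis using that by metis
    qed
    obtain a b where ab: "x = a *\<^sub>R e i + b *\<^sub>R v" using sp[OF xi] by blast
    obtain a' b' where ab': "x = a' *\<^sub>R e j + b' *\<^sub>R v" using sp[OF xj] by blast
    have bv: "(b' - b) *\<^sub>R v = a *\<^sub>R e i - a' *\<^sub>R e j" using ab ab' by (simp add: algebra_simps)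
    have veq: "v = (a / (b' - b)) *\<^sub>R e i + (- a' / (b' - b)) *\<^sub>R e j" if "b' \<noteq> b"
    proof -
      have "v = (1 / (b' - b)) *\<^sub>R ((b' - b) *\<^sub>R v)" using that by simp
      also have "\<dots> = (a / (b' - b)) *\<^sub>R e i + (- a' / (b' - b)) *\<^sub>R e j"
        by (subst bv) (simp add: algebra_simps)
      finally show ?thesis .
    qed
    have bb: "b' = b" by (rule ccontr) (use veq vn[OF ij(1,2)] in metis)
    then have aa: "a *\<^sub>R e i = a' *\<^sub>R e j" using ab ab' by simp
    have "norm (a *\<^sub>R e i) = norm (a' *\<^sub>R e j)" by (simp only: aa)
    then have "\<bar>a\<bar> = \<bar>a'\<bar>" using unit ij by simp
    then have "a' = a \<or> a' = - a" by linarith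
    then have "a *\<^sub>R (e i - e j) = 0 \<or> a *\<^sub>R (e i + e j) = 0" using aa by (auto simp: algebra_simps)
    then have "a = 0" using dist[OF ij] by (auto simp: add_eq_0_iff2)
    then have x: "x = b *\<^sub>R v" using ab by simp
    have "(norm x)\<^sup>2 = 1 + b * (m * (real i + 1))"
      using i.norm_tube(2)[OF i.zero_W, of \<tau>] cp[OF ij(1)] unfolding x_def[symmetric] by (simp add: x algebra_simps)
    moreover have "(norm x)\<^sup>2 = 1 + b * (m * (real j + 1))"
      using j.norm_tube(2)[OF j.zero_W, of \<tau>'] cp[OF ij(2)] unfolding eq[symmetric] x_def[symmetric] by (simp add: x algebra_simps)
    ultimately have "b = 0" using pm[OF ij(1)] ij(3) by auto
    with x \<open>(norm x)\<^sup>2 = 1 + b * (m * (real i + 1))\<close> show False by simp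
  qed
  have pair: "\<exists>r>0. \<forall>\<tau>\<in>{0..1}. \<forall>\<tau>'\<in>{0..1}. \<forall>w w'. w \<bullet> e i = 0 \<and> w' \<bullet> e j = 0 \<and> norm w \<le> r \<and> norm w' \<le> r \<longrightarrow>
      tube (e i) (\<omega> i) (c i) \<tau> w \<noteq> tube (e j) (\<omega> j) (c j) \<tau>' w'" if ij: "i < n" "j < n" "i \<noteq> j" for i j
  proof -
    define G where "G i x = tube (e i) (\<omega> i) (c i) (fst x) (snd x)" for i and x :: "real \<times> 'a"
    define M where "M i = {0..1::real} \<times> {w. w \<bullet> e i = 0 \<and> norm w \<le> 1/4}" for i
    have cM: "compact (M i)" for i
    proof -
      have "{w. w \<bullet> e i = 0 \<and> norm w \<le> 1/4} = cball 0 (1/4) \<inter> {w. e i \<bullet> w = 0}" by (auto simp: inner_commute)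
      then show ?thesis unfolding M_def by (simp add: compact_Times compact_Int_closed closed_hyperplane)
    qed
    have cG: "continuous_on (M i) (G i)" if "i < n" for i
    proof -
      interpret tube_data "e i" "\<omega> i" "c i" by (rule td) fact
      show ?thesis unfolding G_def
        by (rule continuous_on_subset[OF tube_cont[unfolded case_prod_unfold]]) (auto simp: M_def W_def)
    qed
    define Z where "Z i = G i ` ({0..1} \<times> {0})" for i
    have sub: "{0..1} \<times> {0} \<subseteq> M i" for i by (auto simp: M_def)
    have cZ: "compact (Z i)" if "i < n" for i
      unfolding Z_def by (intro compact_continuous_image continuous_on_subset[OF cG[OF that] sub] compact_Times) auto
    have "Z i \<inter> Z j = {}" using core[OF ij] by (auto simp: Z_def G_def)
    then obtain \<delta> where d: "\<delta> > 0" "\<And>x y. x \<in> Z i \<Longrightarrow> y \<in> Z j \<Longrightarrow> \<delta> \<le> dist x y"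
      using separate_compact_closed[OF cZ[OF ij(1)] compact_imp_closed[OF cZ[OF ij(2)]]] by blast
    have unif: "\<exists>r>0. \<forall>\<tau>\<in>{0..1}. \<forall>w. w \<bullet> e i = 0 \<and> norm w \<le> r \<longrightarrow> dist (G i (\<tau>, w)) (G i (\<tau>, 0)) < \<delta> / 2" if "i < n" for i
    proof -
      have "uniformly_continuous_on (M i) (G i)" by (rule compact_uniformly_continuous[OF cG[OF that] cM])
      then obtain r where r: "r > 0" "\<And>x y. x \<in> M i \<Longrightarrow> y \<in> M i \<Longrightarrow> dist x y < r \<Longrightarrow> dist (G i x) (G i y) < \<delta> / 2"
        unfolding uniformly_continuous_on_def using d(1) by (metis dist_commute half_gt_zero)
      show ?thesis
      proof (intro exI[of _ "min (r / 2) (1/4)"] conjI ballI allI impI)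
        fix \<tau> :: real and w assume "\<tau> \<in> {0..1}" "w \<bullet> e i = 0 \<and> norm w \<le> min (r / 2) (1/4)"
        then show "dist (G i (\<tau>, w)) (G i (\<tau>, 0)) < \<delta> / 2"
          using r(1) by (intro r(2)) (auto simp: M_def dist_Pair_Pair)
      qed (use r(1) in auto)
    qed
    obtain r where r: "r > 0" "\<And>\<tau> w. \<tau> \<in> {0..1} \<Longrightarrow> w \<bullet> e i = 0 \<Longrightarrow> norm w \<le> r \<Longrightarrow> dist (G i (\<tau>, w)) (G i (\<tau>, 0)) < \<delta> / 2"
      using unif[OF ij(1)] by blast
    obtain r' where r': "r' > 0" "\<And>\<tau> w. \<tau> \<in> {0..1} \<Longrightarrow> w \<bullet> e j = 0 \<Longrightarrow> norm w \<le> r' \<Longrightarrow> dist (G j (\<tau>, w)) (G j (\<tau>, 0)) < \<delta> / 2"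
      using unif[OF ij(2)] by blast
    show ?thesis
    proof (intro exI[of _ "min r r'"] conjI ballI allI impI notI)
      fix \<tau> \<tau>' :: real and w w' assume *: "\<tau> \<in> {0..1}" "\<tau>' \<in> {0..1}"
        "w \<bullet> e i = 0 \<and> w' \<bullet> e j = 0 \<and> norm w \<le> min r r' \<and> norm w' \<le> min r r'"
        "tube (e i) (\<omega> i) (c i) \<tau> w = tube (e j) (\<omega> j) (c j) \<tau>' w'"
      have "dist (G i (\<tau>, 0)) (G j (\<tau>', 0)) \<le> dist (G i (\<tau>, w)) (G i (\<tau>, 0)) + dist (G j (\<tau>', w')) (G j (\<tau>', 0))"
        using *(4) dist_triangle2[of "G i (\<tau>, 0)" "G j (\<tau>', 0)" "G i (\<tau>, w)"] by (simp add: G_def dist_commute)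
      also have "\<dots> < \<delta> / 2 + \<delta> / 2" using * by (intro add_strict_mono r(2) r'(2)) auto
      finally have "dist (G i (\<tau>, 0)) (G j (\<tau>', 0)) < \<delta>" by simp
      moreover have "\<delta> \<le> dist (G i (\<tau>, 0)) (G j (\<tau>', 0))" using * by (intro d(2)) (auto simp: Z_def)
      ultimately show False by simp
    qed (use r r' in auto)
  qed
  define I where "I = {(i, j). i < n \<and> j < n \<and> i \<noteq> j}"
  have "finite I" unfolding I_def by (rule finite_subset[of _ "{..<n} \<times> {..<n}"]) auto
  have "\<forall>x\<in>I. \<exists>r>0. \<forall>\<tau>\<in>{0..1}. \<forall>\<tau>'\<in>{0..1}. \<forall>w w'. w \<bullet> e (fst x) = 0 \<and> w' \<bullet> e (snd x) = 0 \<and> norm w \<le> r \<and> norm w' \<le> r \<longrightarrow>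
      tube (e (fst x)) (\<omega> (fst x)) (c (fst x)) \<tau> w \<noteq> tube (e (snd x)) (\<omega> (snd x)) (c (snd x)) \<tau>' w'"
  proof
    fix x assume "x \<in> I"
    then have "fst x < n" "snd x < n" "fst x \<noteq> snd x" by (auto simp: I_def)
    then show "\<exists>r>0. \<forall>\<tau>\<in>{0..1}. \<forall>\<tau>'\<in>{0..1}. \<forall>w w'. w \<bullet> e (fst x) = 0 \<and> w' \<bullet> e (snd x) = 0 \<and> norm w \<le> r \<and> norm w' \<le> r \<longrightarrow>
      tube (e (fst x)) (\<omega> (fst x)) (c (fst x)) \<tau> w \<noteq> tube (e (snd x)) (\<omega> (snd x)) (c (snd x)) \<tau>' w'" by (rule pair)
  qed
  from bchoice[OF this] obtain R where R: "\<forall>x\<in>I. R x > 0 \<and> (\<forall>\<tau>\<in>{0..1}. \<forall>\<tau>'\<in>{0..1}. \<forall>w w'. w \<bullet> e (fst x) = 0 \<and> w' \<bullet> e (snd x) = 0 \<and> norm w \<le> R x \<and> norm w' \<le> R x \<longrightarrow>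
      tube (e (fst x)) (\<omega> (fst x)) (c (fst x)) \<tau> w \<noteq> tube (e (snd x)) (\<omega> (snd x)) (c (snd x)) \<tau>' w')" ..
  define r where "r = Min (insert (1/4) (R ` I))"
  have f: "finite (insert (1/4) (R ` I))" using \<open>finite I\<close> by simp
  have r: "r > 0" unfolding r_def by (subst Min_gr_iff[OF f]) (use R in auto)
  have r4: "r \<le> 1/4" unfolding r_def by (intro Min_le[OF f] insertI1)
  have rR: "r \<le> R x" if "x \<in> I" for x unfolding r_def using that by (intro Min_le[OF f] insertI2 imageI)
  show ?thesis
  proof (rule that[of \<omega> c r])
    fix i j \<tau> \<tau>' w w' assume *: "i < n" "j < n" "i \<noteq> j" "\<tau> \<in> {0..1::real}" "\<tau>' \<in> {0..1::real}"
      "w \<bullet> e i = 0" "w' \<bullet> e j = 0" "norm w \<le> r" "norm w' \<le> r"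
    then have I: "(i, j) \<in> I" by (auto simp: I_def)
    show "tube (e i) (\<omega> i) (c i) \<tau> w \<noteq> tube (e j) (\<omega> j) (c j) \<tau>' w'"
      using bspec[OF R I] * rR[OF I] by (auto simp: order_trans)
  qed (use td r r4 in auto)
qed

section \<open>A model of the fundamental domain\<close>

definition letters :: "nat \<Rightarrow> (nat \<times> bool) set" where
  "letters n = {..<n} \<times> UNIV"

lemma letters_iff: "k \<in> letters n \<longleftrightarrow> fst k < n"
  by (cases k) (simp add: letters_def)

lemma finite_letters [simp]: "finite (letters n)"
  by (simp add: letters_def)

lemma bar_letters [simp]: "bar k \<in> letters n \<longleftrightarrow> k \<in> letters n"
  by (simp add: letters_iff)

definition axis_of :: "(nat \<Rightarrow> 'a::euclidean_space) \<Rightarrow> nat \<times> bool \<Rightarrow> 'a" where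
  "axis_of e k = (if snd k then - e (fst k) else e (fst k))"

definition proj_off :: "'a::euclidean_space \<Rightarrow> 'a \<Rightarrow> 'a" where
  "proj_off v x = x - (x \<bullet> v) *\<^sub>R v"

text \<open>Nonpositive exactly on the circular cone around \<open>v\<close> whose transverse part
  is at most \<open>1 / C\<close> times the axial one.\<close>

definition round_cone :: "real \<Rightarrow> 'a::euclidean_space \<Rightarrow> 'a \<Rightarrow> real" where
  "round_cone C v x = C * norm (proj_off v x) - x \<bullet> v"

lemma proj_off_scale: "proj_off v (r *\<^sub>R x) = r *\<^sub>R proj_off v x"
  by (simp add: proj_off_def scaleR_diff_right)

lemma proj_off_add: "proj_off v (x + y) = proj_off v x + proj_off v y"
  by (simp add: proj_off_def algebra_simps)

lemma proj_off_minus [simp]: "proj_off (- v) x = proj_off v x"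
  by (simp add: proj_off_def)

lemma proj_off_orth: "norm v = 1 \<Longrightarrow> proj_off v x \<bullet> v = 0"
  by (simp add: proj_off_def inner_diff_left dot_square_norm)

lemma proj_off_self [simp]: "norm v = 1 \<Longrightarrow> proj_off v v = 0"
  by (simp add: proj_off_def dot_square_norm)

lemma proj_off_id: "x \<bullet> v = 0 \<Longrightarrow> proj_off v x = x"
  by (simp add: proj_off_def)

lemma round_cone_scale: "r \<ge> 0 \<Longrightarrow> round_cone C v (r *\<^sub>R x) = r * round_cone C v x"
  by (simp add: round_cone_def proj_off_scale algebra_simps)

lemma continuous_proj_off: "continuous_on S (proj_off v)"
  unfolding proj_off_def by (intro continuous_intros)

lemma continuous_round_cone: "continuous_on S (round_cone C v)"
  unfolding round_cone_def by (intro continuous_intros continuous_proj_off)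

lemma round_cone_shift:
  assumes "norm v = 1" shows "round_cone C v (x + t *\<^sub>R v) = round_cone C v x - t"
  using assms by (simp add: round_cone_def proj_off_add proj_off_scale inner_add_left dot_square_norm)

lemma proj_off_decomp:
  "x = proj_off v x + (C * norm (proj_off v x) - round_cone C v x) *\<^sub>R v"
  by (simp add: round_cone_def proj_off_def)

lemma norm_proj_off:
  assumes "norm v = 1" shows "(norm x)\<^sup>2 = (norm (proj_off v x))\<^sup>2 + (x \<bullet> v)\<^sup>2"
proof -
  have "v \<bullet> v = 1" using assms by (simp add: dot_square_norm)
  then show ?thesis unfolding proj_off_def power2_norm_eq_inner
    by (simp add: inner_diff_left inner_diff_right inner_commute[of v x] power2_eq_square)
qed

text \<open>The horizontal part of the radial projection to the unit sphere of the boundary \<open>{round_cone C v = -1}\<close>.\<close>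

definition disc_map :: "real \<Rightarrow> 'a::euclidean_space \<Rightarrow> 'a" where
  "disc_map C y = (1 / sqrt ((norm y)\<^sup>2 + (C * norm y + 1)\<^sup>2)) *\<^sub>R y"

definition disc_inv :: "real \<Rightarrow> 'a::euclidean_space \<Rightarrow> 'a" where
  "disc_inv C w = (1 / (sqrt (1 - (norm w)\<^sup>2) - C * norm w)) *\<^sub>R w"

text \<open>Above \<open>y\<close> the level \<open>-1\<close> has height
  \<open>C * norm y + 1\<close>. The level surface is asymptotic to the cone, so radial projection
  fills the open cap cut out by the cone, of radius \<open>1 / sqrt (1 + C\<^sup>2)\<close>.\<close>

lemma disc_map_props:
  assumes C: "C > 0"
  shows "norm (disc_map C y) < 1 / sqrt (1 + C\<^sup>2)"
    and "sqrt (1 - (norm (disc_map C y))\<^sup>2) = (C * norm y + 1) / sqrt ((norm y)\<^sup>2 + (C * norm y + 1)\<^sup>2)"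
    and "disc_inv C (disc_map C y) = y"
proof -
  define s where "s = sqrt ((norm y)\<^sup>2 + (C * norm y + 1)\<^sup>2)"
  have p: "C * norm y + 1 > 0" using C by (simp add: add_nonneg_pos)
  have s: "s > 0" "s\<^sup>2 = (norm y)\<^sup>2 + (C * norm y + 1)\<^sup>2" unfolding s_def using p by (simp_all add: add_nonneg_pos)
  have n: "norm (disc_map C y) = norm y / s" using s by (simp add: disc_map_def s_def)
  have "1 - (norm (disc_map C y))\<^sup>2 = ((C * norm y + 1) / s)\<^sup>2"
    unfolding n using s by (simp add: power_divide field_simps)
  then show 2: "sqrt (1 - (norm (disc_map C y))\<^sup>2) = (C * norm y + 1) / sqrt ((norm y)\<^sup>2 + (C * norm y + 1)\<^sup>2)"
    using p s(1) by (simp add: s_def)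
  have "sqrt (1 - (norm (disc_map C y))\<^sup>2) - C * norm (disc_map C y) = 1 / s"
    unfolding 2 unfolding n s_def[symmetric] by (simp add: diff_divide_distrib add_divide_distrib)
  then show "disc_inv C (disc_map C y) = y"
    unfolding disc_inv_def using s(1) by (simp add: disc_map_def s_def)
  have "(norm y)\<^sup>2 * (1 + C\<^sup>2) < s\<^sup>2" unfolding s(2) using C by (simp add: power2_eq_square algebra_simps) (simp add: add_pos_nonneg)
  moreover have "(norm y * sqrt (1 + C\<^sup>2))\<^sup>2 = (norm y)\<^sup>2 * (1 + C\<^sup>2)" by (simp add: power_mult_distrib)
  ultimately have "(norm y * sqrt (1 + C\<^sup>2))\<^sup>2 < s\<^sup>2" by simp
  then have "norm y * sqrt (1 + C\<^sup>2) < s"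
    using s(1) by (intro power2_less_imp_less[of _ s]) auto
  then show "norm (disc_map C y) < 1 / sqrt (1 + C\<^sup>2)"
    unfolding n using s(1) by (simp add: field_simps add_pos_nonneg)
qed

lemma disc_inv_props:
  assumes C: "C > 0" and w: "norm w < 1 / sqrt (1 + C\<^sup>2)"
  shows "disc_map C (disc_inv C w) = w" "sqrt (1 - (norm w)\<^sup>2) - C * norm w > 0"
proof -
  have "norm w * sqrt (1 + C\<^sup>2) < 1" using w by (simp add: field_simps add_pos_nonneg)
  then have "(norm w * sqrt (1 + C\<^sup>2))\<^sup>2 < 1\<^sup>2" by (intro power_strict_mono) auto
  then have a: "(norm w)\<^sup>2 * (1 + C\<^sup>2) < 1" by (simp add: power_mult_distrib)
  then have b: "(norm w)\<^sup>2 < 1" by (simp add: distrib_left) (smt (verit) mult_nonneg_nonneg zero_le_power2)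
  have "(C * norm w)\<^sup>2 < 1 - (norm w)\<^sup>2" using a by (simp add: power_mult_distrib algebra_simps)
  then have "C * norm w < sqrt (1 - (norm w)\<^sup>2)" by (rule real_less_rsqrt)
  then show m: "sqrt (1 - (norm w)\<^sup>2) - C * norm w > 0" by simp
  define m where "m = sqrt (1 - (norm w)\<^sup>2) - C * norm w"
  have m0: "m > 0" using m by (simp add: m_def)
  have n: "norm (disc_inv C w) = norm w / m" using m0 by (simp add: disc_inv_def m_def)
  have "C * norm w + m = sqrt (1 - (norm w)\<^sup>2)" by (simp add: m_def)
  then have "(C * norm w + m)\<^sup>2 = 1 - (norm w)\<^sup>2" using b by simp
  moreover have "(norm w / m)\<^sup>2 + (C * (norm w / m) + 1)\<^sup>2 = ((norm w)\<^sup>2 + (C * norm w + m)\<^sup>2) / m\<^sup>2"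
    using m0 by (simp add: power_divide power2_eq_square field_simps)
  ultimately have "(norm w / m)\<^sup>2 + (C * (norm w / m) + 1)\<^sup>2 = (1 / m)\<^sup>2" by (simp add: power_divide)
  then have "sqrt ((norm (disc_inv C w))\<^sup>2 + (C * norm (disc_inv C w) + 1)\<^sup>2) = 1 / m" unfolding n using m0 by simp
  then show "disc_map C (disc_inv C w) = w" unfolding disc_map_def using m0 by (simp add: disc_inv_def m_def)
qed

lemma continuous_disc_map: "C > 0 \<Longrightarrow> continuous_on S (disc_map C)"
  unfolding disc_map_def
proof (intro continuous_intros ballI)
  fix y :: 'a assume "C > 0"
  then have "C * norm y + 1 > 0" by (simp add: add_nonneg_pos)
  then show "sqrt ((norm y)\<^sup>2 + (C * norm y + 1)\<^sup>2) \<noteq> 0"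
    by (metis add_nonneg_pos less_irrefl real_sqrt_eq_zero_cancel_iff zero_le_power2 zero_less_power)
qed

text \<open>The tubes are disjoint up to twice the radius \<open>1 / sqrt (1 + C\<^sup>2)\<close> of
  the handles; the outer half is the room in which lateral points of a handle are seen not to be
  interior. \<open>\<Lambda> i\<close> is the isotopy of the normal space of \<open>e i\<close> that
  the collar undergoes.\<close>

locale handle_model =
  fixes n :: nat and e \<omega> :: "nat \<Rightarrow> 'a::euclidean_space" and c :: "nat \<Rightarrow> real" and C :: real
    and \<Lambda> :: "nat \<Rightarrow> real \<Rightarrow> 'a \<Rightarrow> 'a"
  assumes td: "i < n \<Longrightarrow> tube_data (e i) (\<omega> i) (c i)"
    and C: "C > 0" and small: "4 / sqrt (1 + C\<^sup>2) < 1"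
    and tubes_disj: "i < n \<Longrightarrow> j < n \<Longrightarrow> i \<noteq> j \<Longrightarrow> \<tau> \<in> {0..1} \<Longrightarrow> \<tau>' \<in> {0..1} \<Longrightarrow>
      w \<bullet> e i = 0 \<Longrightarrow> w' \<bullet> e j = 0 \<Longrightarrow> norm w \<le> 2 / sqrt (1 + C\<^sup>2) \<Longrightarrow> norm w' \<le> 2 / sqrt (1 + C\<^sup>2) \<Longrightarrow>
      tube (e i) (\<omega> i) (c i) \<tau> w \<noteq> tube (e j) (\<omega> j) (c j) \<tau>' w'"
    and cones: "k \<in> letters n \<Longrightarrow> l \<in> letters n \<Longrightarrow> k \<noteq> l \<Longrightarrow> round_cone C (axis_of e k) x \<le> 0 \<Longrightarrow>
      round_cone C (axis_of e l) x \<le> 0 \<Longrightarrow> x = 0"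
    and cont_Lam: "i < n \<Longrightarrow> continuous_on ({0..1} \<times> {y. y \<bullet> e i = 0}) (\<lambda>(\<tau>, y). \<Lambda> i \<tau> y)"
    and bij_Lam: "i < n \<Longrightarrow> \<tau> \<in> {0..1} \<Longrightarrow> bij_betw (\<Lambda> i \<tau>) {y. y \<bullet> e i = 0} {y. y \<bullet> e i = 0}"
    and Lam_0: "i < n \<Longrightarrow> y \<bullet> e i = 0 \<Longrightarrow> \<Lambda> i 0 y = y"
begin

abbreviation K where "K \<equiv> letters n"
abbreviation ev where "ev \<equiv> axis_of e"
abbreviation N where "N k \<equiv> round_cone C (axis_of e k)"
abbreviation pr where "pr i \<equiv> proj_off (e i)"
abbreviation tb where "tb i \<equiv> tube (e i) (\<omega> i) (c i)"

definition \<eta> :: real where "\<eta> = 1 / sqrt (1 + C\<^sup>2)"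

lemma eta: "0 < \<eta>" "\<eta> < 1/4" "2 * \<eta> < 1/2"
  using small by (auto simp: \<eta>_def add_pos_nonneg)

lemma unit: "i < n \<Longrightarrow> norm (e i) = 1"
  using td[of i] by (simp add: tube_data_def)

lemma unit_ev: "k \<in> K \<Longrightarrow> norm (ev k) = 1"
  using unit[of "fst k"] by (simp add: axis_of_def letters_iff)

lemma pr_ev: "proj_off (ev k) x = pr (fst k) x"
  by (simp add: axis_of_def)

lemma N_shift: "k \<in> K \<Longrightarrow> N k (x + t *\<^sub>R ev k) = N k x - t"
  using round_cone_shift[OF unit_ev] by simp

lemma decomp: "x = pr (fst k) x + (C * norm (pr (fst k) x) - N k x) *\<^sub>R ev k"
  using proj_off_decomp[of x "ev k" C] by (simp add: pr_ev)

lemma pr_orth: "k \<in> K \<Longrightarrow> pr (fst k) x \<bullet> e (fst k) = 0"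
  using proj_off_orth[OF unit] by (simp add: letters_iff)

lemma N_point:
  assumes "k \<in> K" "y \<bullet> e (fst k) = 0"
  shows "N k (y + (C * norm y - t) *\<^sub>R ev k) = t" "pr (fst k) (y + s *\<^sub>R ev k) = y"
proof -
  have y: "proj_off (ev k) y = y" "y \<bullet> ev k = 0" using assms(2) by (auto simp: axis_of_def proj_off_id)
  show "N k (y + (C * norm y - t) *\<^sub>R ev k) = t"
    using assms(1) y by (simp add: N_shift) (simp add: round_cone_def)
  have "proj_off (ev k) (y + s *\<^sub>R ev k) = y" using y unit_ev[OF assms(1)] by (simp add: proj_off_add proj_off_scale)
  then show "pr (fst k) (y + s *\<^sub>R ev k) = y" by (simp add: pr_ev)
qed

section \<open>The central part of the domain and its image, a ball with caps\<close>

lemma N_unique: "k \<in> K \<Longrightarrow> l \<in> K \<Longrightarrow> N k x < 0 \<Longrightarrow> N l x \<le> 0 \<Longrightarrow> k = l"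
  using cones[of k l x] by (metis less_irrefl less_le round_cone_scale[of 0 C _ 0, simplified])

text \<open>The depth in the cones. At most one summand is nonzero, so the sum is a manifestly
  continuous form of the case distinction \<open>u_eq\<close>.\<close>

definition u :: "'a \<Rightarrow> real" where "u x = (\<Sum>k\<in>K. max 0 (- N k x))"

lemma u_eq: assumes "k \<in> K" "N k x \<le> 0" shows "u x = - N k x"
proof (cases "N k x = 0")
  case False
  then have "N k x < 0" using assms by simp
  then have "max 0 (- N l x) = (if l = k then - N k x else 0)" if "l \<in> K" for l
    using N_unique[OF assms(1) that] by (auto simp: max_def)
  then show ?thesis unfolding u_def using assms(1) by (simp add: sum.delta cong: sum.cong)
next
  case True
  have "max 0 (- N l x) = 0" if l: "l \<in> K" for l
  proof (cases "N l x < 0")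
    case neg: True
    then have "l = k" using N_unique[OF l assms(1) neg] assms(2) by simp
    then show ?thesis using neg True by simp
  qed simp
  then have "u x = 0" unfolding u_def by (intro sum.neutral ballI)
  then show ?thesis using True by simp
qed

lemma u_nonneg: "u x \<ge> 0" unfolding u_def by (intro sum_nonneg) auto

lemma u_pos: "u x > 0 \<Longrightarrow> \<exists>k\<in>K. u x = - N k x"
proof -
  assume "u x > 0"
  then have "(\<Sum>k\<in>K. max 0 (- N k x)) \<noteq> 0" unfolding u_def by simp
  then obtain k where k: "k \<in> K" "max 0 (- N k x) \<noteq> 0" by (rule sum.not_neutral_contains_not_neutral)
  then have "N k x \<le> 0" by (cases "N k x \<le> 0") auto
  then show ?thesis using u_eq[OF k(1)] k(1) by blast
qed

lemma u_scale: "r \<ge> 0 \<Longrightarrow> u (r *\<^sub>R x) = r * u x"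
  unfolding u_def by (simp add: round_cone_scale sum_distrib_left max_mult_distrib_left)

lemma u_0 [simp]: "u 0 = 0"
  using u_scale[of 0 0] by simp

text \<open>Along a ray in a cone \<open>u\<close> is linear, and the boundary \<open>u = 1\<close> is sent to the unit sphere.\<close>

definition ballmap :: "'a \<Rightarrow> 'a" where
  "ballmap x = ((norm x + u x) / (norm x * (1 + norm x))) *\<^sub>R x"

definition Bs :: "'a set" where "Bs = {x. \<forall>k\<in>K. N k x \<ge> -1}"
definition cap :: "nat \<times> bool \<Rightarrow> 'a set" where "cap k = {z. norm z = 1 \<and> N k z < 0}"

lemma Bs_u: "x \<in> Bs \<longleftrightarrow> u x \<le> 1"
proof
  assume "x \<in> Bs"
  then have "u x > 0 \<Longrightarrow> u x \<le> 1" using u_pos[of x] unfolding Bs_def by force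
  then show "u x \<le> 1" by linarith
next
  assume *: "u x \<le> 1"
  show "x \<in> Bs" unfolding Bs_def
  proof safe
    fix k assume "k \<in> K" then show "-1 \<le> N k x" using u_eq[of k x] * by linarith
  qed
qed

lemma norm_ballmap: "norm (ballmap x) = (norm x + u x) / (1 + norm x)"
proof (cases "x = 0")
  case False
  have "norm (ballmap x) = (norm x + u x) / (norm x * (1 + norm x)) * norm x"
    unfolding ballmap_def norm_scaleR using u_nonneg[of x]
    by (subst abs_of_nonneg) (auto intro!: divide_nonneg_nonneg mult_nonneg_nonneg add_nonneg_nonneg)
  then show ?thesis using False by simp
qed (simp add: ballmap_def)

lemma ballmap_pos: "x \<noteq> 0 \<Longrightarrow> (norm x + u x) / (norm x * (1 + norm x)) > 0"
  using u_nonneg[of x] by (intro divide_pos_pos mult_pos_pos add_pos_nonneg) auto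

lemma ballmap_norm_le: "x \<in> Bs \<Longrightarrow> norm (ballmap x) \<le> 1"
  unfolding norm_ballmap Bs_u by (simp add: divide_le_eq_1 add_pos_nonneg)

lemma one_norm [simp]: "1 + norm x \<noteq> 0" "norm x \<noteq> - 1" for x :: 'a
  using norm_ge_zero[of x] by linarith+

lemma ballmap_u1: "u x = 1 \<Longrightarrow> ballmap x = (1 / norm x) *\<^sub>R x"
  using norm_ge_zero[of x] by (cases "x = 0") (auto simp: ballmap_def add.commute[of "norm x" 1])

text \<open>Rays from 0 are preserved, and by homogeneity of \<open>u\<close> the image norm at
  distance \<open>t\<close> in a unit direction \<open>z\<close> is
  \<open>t * (1 + u z) / (1 + t)\<close>, increasing in \<open>t\<close>.\<close>

lemma ballmap_inj: "inj_on ballmap Bs"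
proof (rule inj_onI)
  fix x y assume eq: "ballmap x = ballmap y"
  show "x = y"
  proof (cases "x = 0 \<or> y = 0")
    case True
    have "ballmap z = 0 \<longleftrightarrow> z = 0" for z
      using ballmap_pos[of z] by (cases "z = 0") (simp_all add: ballmap_def del: divide_eq_0_iff)
    then show ?thesis using True eq by (metis (no_types))
  next
    case False
    define a b where "a = (norm x + u x) / (norm x * (1 + norm x))" and "b = (norm y + u y) / (norm y * (1 + norm y))"
    have ab: "a > 0" "b > 0" "a *\<^sub>R x = b *\<^sub>R y" using False eq ballmap_pos by (auto simp: a_def b_def ballmap_def)
    define r where "r = a / b"
    have r: "r > 0" "y = r *\<^sub>R x"
    proof -
      have "y = (1 / b) *\<^sub>R (b *\<^sub>R y)" using ab by simp
      also have "\<dots> = r *\<^sub>R x" unfolding ab(3)[symmetric] by (simp add: r_def)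
      finally show "y = r *\<^sub>R x" .
    qed (use ab in \<open>simp add: r_def\<close>)
    define t where "t = norm x"
    have t: "t > 0" using False by (simp add: t_def)
    have ny: "norm y = r * t" "u y = r * u x" using r u_scale[of r x] by (simp_all add: t_def)
    have "(t + u x) / (1 + t) = (r * t + r * u x) / (1 + r * t)"
      using norm_ballmap[of x] norm_ballmap[of y] eq ny by (simp add: t_def)
    moreover have "1 + t > 0" "1 + r * t > 0" using t r by (simp_all add: add_pos_pos)
    ultimately have "(t + u x) * (1 + r * t) = (r * t + r * u x) * (1 + t)" by (simp add: frac_eq_eq)
    also have "\<dots> = (t + u x) * (r + r * t)" by (simp add: algebra_simps)
    finally have "1 + r * t = r + r * t" using t u_nonneg[of x] by (auto simp: add_pos_nonneg)
    then show ?thesis using r by simp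
  qed
qed

lemma ballmap_image: "ballmap ` Bs = ball 0 1 \<union> (\<Union>k\<in>K. cap k)"
proof
  show "ballmap ` Bs \<subseteq> ball 0 1 \<union> (\<Union>k\<in>K. cap k)"
  proof safe
    fix x assume x: "x \<in> Bs" and nc: "ballmap x \<notin> (\<Union>k\<in>K. cap k)"
    show "ballmap x \<in> ball 0 1"
    proof (rule ccontr)
      assume "ballmap x \<notin> ball 0 1"
      then have "norm (ballmap x) = 1" using ballmap_norm_le[OF x] by simp
      then have u1: "u x = 1" unfolding norm_ballmap by (simp add: divide_eq_1_iff add_pos_nonneg)
      then obtain k where k: "k \<in> K" "N k x = -1" using u_pos[of x] by fastforce
      have "N k (ballmap x) = (1 / norm x) * N k x" unfolding ballmap_u1[OF u1] by (rule round_cone_scale) simp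
      moreover have "x \<noteq> 0" using u1 by auto
      ultimately have "ballmap x \<in> cap k" using k \<open>norm (ballmap x) = 1\<close> by (simp add: cap_def)
      then show False using nc k by blast
    qed
  qed
next
  show "ball 0 1 \<union> (\<Union>k\<in>K. cap k) \<subseteq> ballmap ` Bs"
  proof
    fix z assume z: "z \<in> ball 0 1 \<union> (\<Union>k\<in>K. cap k)"
    show "z \<in> ballmap ` Bs"
    proof (cases "z = 0")
      case True
      have "0 \<in> Bs" by (simp add: Bs_u)
      moreover have "ballmap 0 = 0" by (simp add: ballmap_def)
      ultimately show ?thesis using True by (metis imageI)
    next
      case False
      define \<upsilon> where "\<upsilon> = u z / norm z"
      \<comment> \<open>Solving \<open>ballmap x = z\<close> on the ray of \<open>z\<close> gives
        \<open>x = (1 / m) *\<^sub>R z\<close>. On the unit sphere \<open>m\<close> reduces to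
        \<open>\<upsilon>\<close>, which is positive exactly on the caps.\<close>
      define m where "m = 1 + \<upsilon> - norm z"
      have up: "\<upsilon> \<ge> 0" using u_nonneg[of z] by (simp add: \<upsilon>_def)
      have zn: "norm z \<le> 1" using z by (auto simp: cap_def)
      have m: "m > 0"
      proof (cases "norm z < 1")
        case True then show ?thesis using up by (simp add: m_def)
      next
        case f: False
        then obtain k where "k \<in> K" "N k z < 0" using z by (auto simp: cap_def)
        then have "u z > 0" using u_eq[of k z] by simp
        then have "\<upsilon> > 0" using False by (simp add: \<upsilon>_def)
        then show ?thesis using zn by (simp add: m_def)
      qed
      define x where "x = (1 / m) *\<^sub>R z"
      have nx: "norm x = norm z / m" using m by (simp add: x_def)
      have ux: "u x = norm z * \<upsilon> / m" using u_scale[of "1 / m" z] m False by (simp add: x_def \<upsilon>_def)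
      have "norm z * (1 + \<upsilon>) \<le> 1 + \<upsilon>" using zn up by (simp add: mult_left_le_one_le)
      then have "x \<in> Bs" unfolding Bs_u ux using m by (simp add: divide_le_eq_1 m_def algebra_simps)
      moreover have "ballmap x = z"
      proof -
        have "norm x + u x = norm z * (1 + \<upsilon>) / m" unfolding nx ux by (simp add: algebra_simps add_divide_distrib)
        moreover have "1 + norm x = (1 + \<upsilon>) / m" unfolding nx using m by (simp add: field_simps m_def)
        moreover have "q / m \<noteq> 0 \<Longrightarrow> (r * q / m) / (r / m * (q / m)) = m" if "r \<noteq> 0" for q r :: real
          using that m by (auto simp: field_simps)
        moreover have "(1 + \<upsilon>) / m \<noteq> 0" "norm z \<noteq> 0" using m up False by auto
        ultimately have "(norm x + u x) / (norm x * (1 + norm x)) = m"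
          using nx by metis
        then show ?thesis unfolding ballmap_def using m by (simp add: x_def)
      qed
      ultimately show ?thesis by (metis imageI)
    qed
  qed
qed

lemma cont_u: "continuous_on S u"
  unfolding u_def by (intro continuous_intros continuous_on_max continuous_round_cone)

lemma cont_ballmap: "continuous_on UNIV ballmap"
  unfolding continuous_on_eq_continuous_at[OF open_UNIV]
proof
  fix x :: 'a
  show "isCont ballmap x"
  proof (cases "x = 0")
    case False
    have "continuous_on (- {0}) ballmap"
      unfolding ballmap_def by (intro continuous_intros cont_u) (auto simp: add_eq_0_iff)
    then show ?thesis using False continuous_on_eq_continuous_at[of "- {0}" ballmap] by auto
  next
    case True
    have cu: "isCont u 0" using cont_u[of UNIV] by (simp add: continuous_on_eq_continuous_at)
    have "isCont (\<lambda>x. (norm x + u x) / (1 + norm x)) 0" by (intro continuous_intros cu) simp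
    then have "isCont (\<lambda>x. norm (ballmap x)) 0" unfolding norm_ballmap .
    moreover have "ballmap 0 = 0" by (simp add: ballmap_def)
    ultimately show ?thesis unfolding True isCont_def by (simp add: tendsto_norm_zero_iff)
  qed
qed

text \<open>The collar of \<open>(i, False)\<close> fills the first half of the tube while undergoing the isotopy \<open>\<Lambda> i\<close>, the collar of
  \<open>(i, True)\<close> fills the second half.\<close>

definition collar :: "nat \<times> bool \<Rightarrow> 'a \<Rightarrow> 'a" where
  "collar k x = (let i = fst k; \<sigma> = -1 - N k x in
     if snd k then tb i (1 - \<sigma> / 2) (disc_map C (pr i x))
     else tb i (\<sigma> / 2) (disc_map C (\<Lambda> i \<sigma> (pr i x))))"

section \<open>Assembling the ball and the collars\<close>

definition Dh :: "'a set" where "Dh = {x. \<forall>k\<in>K. N k x \<ge> -2}"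

definition model :: "'a \<Rightarrow> 'a" where
  "model x = (if \<exists>k\<in>K. N k x < -1 then collar (SOME k. k \<in> K \<and> N k x < -1) x else ballmap x)"

text \<open>Open in radius, but with both ends \<tau> = 0 and \<tau> = 1 included: they lie on the
  unit sphere and contain the caps, where handle and open ball are joined.\<close>

definition Tset :: "nat \<Rightarrow> 'a set" where
  "Tset i = {tb i \<tau> w | \<tau> w. \<tau> \<in> {0..1} \<and> w \<bullet> e i = 0 \<and> norm w < \<eta>}"

lemma disc_W:
  assumes "i < n" "y \<bullet> e i = 0"
  shows "disc_map C y \<in> tube_data.W (e i)" "disc_map C y \<bullet> e i = 0" "norm (disc_map C y) < \<eta>"
proof -
  interpret tube_data "e i" "\<omega> i" "c i" by (rule td) fact
  show 1: "disc_map C y \<bullet> e i = 0" using assms by (simp add: disc_map_def)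
  show 2: "norm (disc_map C y) < \<eta>" using disc_map_props(1)[OF C, of y] by (simp add: \<eta>_def)
  show "disc_map C y \<in> W" using 1 2 eta by (simp add: W_def)
qed

lemma Lam_orth: "i < n \<Longrightarrow> \<tau> \<in> {0..1} \<Longrightarrow> y \<bullet> e i = 0 \<Longrightarrow> \<Lambda> i \<tau> y \<bullet> e i = 0"
  using bij_Lam[of i \<tau>] by (auto simp: bij_betw_def)

text \<open>The collar begins where the ball map ends: \<open>disc_map\<close> is the horizontal
  part of the radial projection, the tube starts on the sphere over its base point, and the isotopy
  starts at the identity.\<close>

lemma collar_start:
  assumes k: "k \<in> K" and N: "N k x = -1"
  shows "collar k x = ballmap x"
proof -
  define i y where "i = fst k" and "y = pr i x"
  have i: "i < n" using k by (simp add: i_def letters_iff)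
  interpret tube_data "e i" "\<omega> i" "c i" by (rule td) fact
  have y: "y \<bullet> e i = 0" using pr_orth[OF k] by (simp add: y_def i_def)
  have x: "x = y + (C * norm y + 1) *\<^sub>R ev k" using decomp[of x k] N by (simp add: y_def i_def)
  have "(norm x)\<^sup>2 = (norm y)\<^sup>2 + (C * norm y + 1)\<^sup>2"
  proof -
    have "x \<bullet> ev k = C * norm y + 1" using N by (simp add: round_cone_def pr_ev y_def i_def)
    then show ?thesis using norm_proj_off[OF unit_ev[OF k], of x] by (simp add: pr_ev y_def i_def)
  qed
  then have nx: "norm x = sqrt ((norm y)\<^sup>2 + (C * norm y + 1)\<^sup>2)" by (metis norm_ge_zero real_sqrt_abs abs_of_nonneg)
  have "u x = 1" using u_eq[OF k, of x] N by simp
  then have "ballmap x = (1 / norm x) *\<^sub>R x" by (rule ballmap_u1)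
  also have "\<dots> = disc_map C y + sqrt (1 - (norm (disc_map C y))\<^sup>2) *\<^sub>R ev k"
    unfolding disc_map_props(2)[OF C] nx[symmetric] by (subst (2) x) (simp add: disc_map_def nx[symmetric] scaleR_add_right)
  finally have b: "ballmap x = disc_map C y + sqrt (1 - (norm (disc_map C y))\<^sup>2) *\<^sub>R ev k" .
  show ?thesis
    unfolding b using N tube_0[OF disc_W(1)[OF i y]] tube_1[OF disc_W(1)[OF i y]] Lam_0[OF i y]
    by (auto simp: collar_def Let_def i_def[symmetric] y_def[symmetric] axis_of_def)
qed

lemma model_ball: "x \<in> Bs \<Longrightarrow> model x = ballmap x"
  by (auto simp: model_def Bs_def not_less)

lemma model_collar: assumes k: "k \<in> K" "N k x \<le> -1" shows "model x = collar k x"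
proof (cases "N k x = -1")
  case True
  have "x \<in> Bs" using u_eq[OF k(1)] True by (simp add: Bs_u)
  then show ?thesis using model_ball collar_start[OF k(1) True] by simp
next
  case False
  then have ex: "k \<in> K \<and> N k x < -1" using k by simp
  have "(SOME l. l \<in> K \<and> N l x < -1) = k"
  proof (rule some_equality)
    show "k \<in> K \<and> N k x < -1" by (rule ex)
    fix l assume "l \<in> K \<and> N l x < -1"
    then show "l = k" using N_unique[of l k x] k by simp
  qed
  then show ?thesis unfolding model_def using ex by auto
qed

lemma collar_form:
  assumes k: "k \<in> K" and N: "N k x \<le> -1" "N k x \<ge> -2"
  obtains \<tau> y where "collar k x = tb (fst k) \<tau> (disc_map C y)" "y \<bullet> e (fst k) = 0"
    "\<tau> = (if snd k then 1 - (-1 - N k x) / 2 else (-1 - N k x) / 2)"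
    "y = (if snd k then pr (fst k) x else \<Lambda> (fst k) (-1 - N k x) (pr (fst k) x))"
    "\<tau> \<in> {0..1}" "N k x < -1 \<Longrightarrow> 0 < \<tau> \<and> \<tau> < 1"
proof -
  define \<tau> where "\<tau> = (if snd k then 1 - (-1 - N k x) / 2 else (-1 - N k x) / 2)"
  define y where "y = (if snd k then pr (fst k) x else \<Lambda> (fst k) (-1 - N k x) (pr (fst k) x))"
  show ?thesis
  proof (rule that[of \<tau> y])
    show "collar k x = tb (fst k) \<tau> (disc_map C y)" by (simp add: collar_def \<tau>_def y_def Let_def)
    show "y \<bullet> e (fst k) = 0" using pr_orth[OF k] Lam_orth[of "fst k" "-1 - N k x"] k N by (simp add: y_def letters_iff)
  qed (use N in \<open>auto simp: \<tau>_def y_def field_simps\<close>)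
qed

lemma collar_norm:
  assumes k: "k \<in> K" and N: "N k x < -1" "N k x \<ge> -2"
  shows "norm (collar k x) > 1"
proof -
  interpret tube_data "e (fst k)" "\<omega> (fst k)" "c (fst k)" by (rule td) (use k in \<open>simp add: letters_iff\<close>)
  show ?thesis using collar_form[OF k _ N(2)] N(1) tube_outside disc_W(1)[of "fst k"] k
    by (metis less_imp_le letters_iff)
qed

lemma cont_collar: assumes k: "k \<in> K" shows "continuous_on {x. N k x \<le> -1 \<and> N k x \<ge> -2} (collar k)"
proof -
  define i where "i = fst k"
  have i: "i < n" using k by (simp add: i_def letters_iff)
  interpret tube_data "e i" "\<omega> i" "c i" by (rule td) fact
  define S where "S = {x. N k x \<le> -1 \<and> N k x \<ge> -2}"
  define \<tau> y where "\<tau> x = (if snd k then 1 - (-1 - N k x) / 2 else (-1 - N k x) / 2)"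
    and "y x = (if snd k then pr i x else \<Lambda> i (-1 - N k x) (pr i x))" for x
  have cN: "continuous_on S (N k)" by (rule continuous_round_cone)
  have cp: "continuous_on S (pr i)" by (rule continuous_proj_off)
  have ct: "continuous_on S \<tau>" unfolding \<tau>_def by (cases "snd k") (auto intro!: continuous_intros cN)
  have cy: "continuous_on S y"
  proof (cases "snd k")
    case False
    have "continuous_on S (\<lambda>x. (-1 - N k x, pr i x))" by (intro continuous_intros cN cp)
    then have "continuous_on S ((\<lambda>(\<tau>, y). \<Lambda> i \<tau> y) \<circ> (\<lambda>x. (-1 - N k x, pr i x)))"
      by (rule continuous_on_compose[OF _ continuous_on_subset[OF cont_Lam[OF i]]])
        (use pr_orth[OF k] in \<open>auto simp: S_def i_def\<close>)
    then show ?thesis using False by (simp add: y_def[abs_def] o_def)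
  qed (use cp in \<open>simp add: y_def[abs_def]\<close>)
  have ty: "\<tau> x \<in> {0..1}" "y x \<bullet> e i = 0" if "x \<in> S" for x
    using that pr_orth[OF k] Lam_orth[OF i, of "-1 - N k x"] by (auto simp: \<tau>_def y_def S_def i_def field_simps)
  have "continuous_on S (\<lambda>x. (\<tau> x, disc_map C (y x)))"
    by (intro continuous_intros ct continuous_on_compose2[OF continuous_disc_map[OF C, of UNIV] cy]) auto
  then have "continuous_on S ((\<lambda>(\<tau>, w). tb i \<tau> w) \<circ> (\<lambda>x. (\<tau> x, disc_map C (y x))))"
    by (rule continuous_on_compose[OF _ continuous_on_subset[OF tube_cont]]) (use ty disc_W(1)[OF i] in auto)
  then have "continuous_on S (\<lambda>x. tb i (\<tau> x) (disc_map C (y x)))" by (simp add: o_def)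
  moreover have "collar k = (\<lambda>x. tb i (\<tau> x) (disc_map C (y x)))"
    by (auto simp: fun_eq_iff collar_def \<tau>_def y_def Let_def i_def)
  ultimately show ?thesis by (simp add: S_def)
qed

lemma cont_model: "continuous_on Dh model"
proof -
  define U where "U k = {x. N k x \<le> -1 \<and> N k x \<ge> -2}" for k
  have cl: "closed (U k)" for k
    unfolding U_def by (intro closed_Collect_conj closed_Collect_le continuous_intros continuous_round_cone)
  have "continuous_on (U k) model" if "k \<in> K" for k
    using cont_collar[OF that] model_collar[OF that] by (subst continuous_on_cong[of _ "U k" _ "collar k"]) (auto simp: U_def)
  then have 1: "continuous_on (\<Union>k\<in>K. U k) model" using cl by (intro continuous_on_closed_Union) auto
  have clB: "closed Bs"
  proof -
    have "Bs = u -` {..1}" by (auto simp: Bs_u)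
    then show ?thesis using cont_u[of UNIV] by (simp add: continuous_closed_vimage continuous_on_eq_continuous_at)
  qed
  have 2: "continuous_on Bs model"
    using continuous_on_subset[OF cont_ballmap] model_ball by (subst continuous_on_cong[of _ Bs _ ballmap]) auto
  have "continuous_on (Bs \<union> (\<Union>k\<in>K. U k)) model"
    by (rule continuous_on_closed_Un[OF clB _ 2 1]) (use cl in \<open>auto intro: closed_UN\<close>)
  then show ?thesis
    by (rule continuous_on_subset) (auto simp: Dh_def Bs_def U_def not_le intro: less_imp_le)
qed

lemma cap_Tset: assumes k: "k \<in> K" shows "cap k \<subseteq> Tset (fst k)"
proof
  fix z assume z: "z \<in> cap k"
  define i w where "i = fst k" and "w = pr i z"
  have i: "i < n" using k by (simp add: i_def letters_iff)
  interpret tube_data "e i" "\<omega> i" "c i" by (rule td) fact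
  have w: "w \<bullet> e i = 0" using pr_orth[OF k] by (simp add: w_def i_def)
  define b where "b = z \<bullet> ev k"
  have b: "C * norm w < b" using z by (simp add: cap_def round_cone_def pr_ev w_def i_def b_def)
  have n: "(norm w)\<^sup>2 + b\<^sup>2 = 1" using norm_proj_off[OF unit_ev[OF k], of z] z by (simp add: cap_def pr_ev w_def i_def b_def)
  have "(C * norm w)\<^sup>2 < b\<^sup>2" using b C by (intro power_strict_mono) auto
  then have "(norm w * sqrt (1 + C\<^sup>2))\<^sup>2 < 1\<^sup>2" using n by (simp add: power_mult_distrib algebra_simps)
  then have "norm w * sqrt (1 + C\<^sup>2) < 1" by (rule power_less_imp_less_base) simp
  then have wn: "norm w < \<eta>" unfolding \<eta>_def by (simp add: field_simps add_pos_nonneg)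
  then have W: "w \<in> W" using w eta by (simp add: W_def)
  have "b = sqrt (1 - (norm w)\<^sup>2)" using n b C by (smt (verit) mult_nonneg_nonneg norm_ge_zero real_sqrt_abs)
  then have "z = w + sqrt (1 - (norm w)\<^sup>2) *\<^sub>R ev k"
    using b_def by (simp add: w_def i_def flip: pr_ev) (simp add: proj_off_def)
  then have "z = tb i 0 w \<or> z = tb i 1 w" using tube_0[OF W] tube_1[OF W] by (auto simp: axis_of_def i_def)
  then show "z \<in> Tset (fst k)" unfolding Tset_def i_def[symmetric] using w wn by force
qed

lemma model_image: "model ` Dh = ball 0 1 \<union> (\<Union>i<n. Tset i)"
proof
  show "model ` Dh \<subseteq> ball 0 1 \<union> (\<Union>i<n. Tset i)"
  proof
    fix z assume "z \<in> model ` Dh"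
    then obtain x where x: "x \<in> Dh" "z = model x" by blast
    show "z \<in> ball 0 1 \<union> (\<Union>i<n. Tset i)"
    proof (cases "x \<in> Bs")
      case True
      then have "z \<in> ball 0 1 \<union> (\<Union>k\<in>K. cap k)" using x model_ball ballmap_image by auto
      then show ?thesis
      proof
        assume "z \<in> (\<Union>k\<in>K. cap k)"
        then obtain k where k: "k \<in> K" "z \<in> cap k" by blast
        then have "z \<in> Tset (fst k)" "fst k < n" using cap_Tset[OF k(1)] by (auto simp: letters_iff)
        then show ?thesis by blast
      qed simp
    next
      case False
      then obtain k where k: "k \<in> K" "N k x \<le> -1" "N k x \<ge> -2" using x by (auto simp: Bs_def Dh_def)
      obtain \<tau> y where ty: "collar k x = tb (fst k) \<tau> (disc_map C y)" "y \<bullet> e (fst k) = 0" "\<tau> \<in> {0..1}"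
        using collar_form[OF k] by metis
      have kn: "fst k < n" using k(1) by (simp add: letters_iff)
      have "z = tb (fst k) \<tau> (disc_map C y)" using ty(1) model_collar[OF k(1,2)] x(2) by simp
      then have "z \<in> Tset (fst k)" unfolding Tset_def using ty(3) disc_W(2,3)[OF kn ty(2)] by blast
      then show ?thesis using kn by blast
    qed
  qed
next
  have B: "Bs \<subseteq> Dh" by (auto simp: Bs_def Dh_def intro: order_trans[rotated])
  show "ball 0 1 \<union> (\<Union>i<n. Tset i) \<subseteq> model ` Dh"
  proof safe
    fix z :: 'a assume "z \<in> ball 0 1"
    then obtain x where "x \<in> Bs" "z = ballmap x" using ballmap_image by blast
    then show "z \<in> model ` Dh" using B model_ball by (intro image_eqI[of _ _ x]) auto
  next
    fix i z assume i: "i < n" and "z \<in> Tset i"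
    then obtain \<tau> w where z: "z = tb i \<tau> w" "\<tau> \<in> {0..1}" "w \<bullet> e i = 0" "norm w < \<eta>" by (auto simp: Tset_def)
    define y where "y = disc_inv C w"
    have y: "y \<bullet> e i = 0" "disc_map C y = w" using z disc_inv_props[OF C, of w] by (auto simp: y_def disc_inv_def \<eta>_def)
    \<comment> \<open>The first half of the tube, midpoint included, is assigned to
      \<open>(i, False)\<close>. Below, \<open>s\<close> is the depth under the level
      \<open>-1\<close> at which the preimage lies.\<close>
    define k where "k = (i, \<tau> > 1/2)"
    have k: "k \<in> K" "fst k = i" using i by (auto simp: k_def letters_iff)
    define s where "s = (if \<tau> > 1/2 then 2 * (1 - \<tau>) else 2 * \<tau>)"
    have s: "s \<in> {0..1}" using z by (auto simp: s_def)
    obtain y' where y': "y' \<bullet> e i = 0" "(if \<tau> > 1/2 then y' else \<Lambda> i s y') = y"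
    proof (cases "\<tau> > 1/2")
      case True then show ?thesis using that y(1) by auto
    next
      case False
      have "y \<in> \<Lambda> i s ` {y. y \<bullet> e i = 0}" using bij_Lam[OF i s] y(1) by (simp add: bij_betw_def)
      then show ?thesis using that False by auto
    qed
    define x where "x = y' + (C * norm y' - (-1 - s)) *\<^sub>R ev k"
    have Nx: "N k x = -1 - s" "pr i x = y'"
      using N_point[OF k(1), of y' "-1 - s"] N_point(2)[OF k(1), of y'] y' k(2) by (auto simp: x_def)
    have "collar k x = z" using Nx y' y z k(2) by (auto simp: collar_def Let_def k_def s_def diff_divide_distrib split: if_splits)
    moreover have "x \<in> Dh" unfolding Dh_def
    proof safe
      fix l assume l: "l \<in> K"
      show "-2 \<le> N l x" using N_unique[OF l k(1), of x] Nx s by (cases "N l x < 0") auto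
    qed
    ultimately show "z \<in> model ` Dh" using model_collar[OF k(1), of x] Nx s by (intro image_eqI[of _ _ x]) auto
  qed
qed

text \<open>The identification of the outer faces. A point on a level of \<open>N\<close> is known
  from its normal part, so \<open>\<Lambda> i 1\<close> describes the whole side pairing.\<close>

definition matched :: "nat \<Rightarrow> 'a \<Rightarrow> 'a \<Rightarrow> bool" where
  "matched i x x' \<longleftrightarrow> N (i, False) x = -2 \<and> N (i, True) x' = -2 \<and> pr i x' = \<Lambda> i 1 (pr i x)"

lemma disc_map_inj: "disc_map C y = disc_map C y' \<Longrightarrow> y = y'"
  using disc_map_props(3)[OF C] by metis

lemma point_eq: "k \<in> K \<Longrightarrow> N k x = N k x' \<Longrightarrow> pr (fst k) x = pr (fst k) x' \<Longrightarrow> x = x'"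
  using decomp[of x k] decomp[of x' k] by simp

lemma matched_model: assumes i: "i < n" and m: "matched i x x'" shows "model x = model x'"
proof -
  have "model x = collar (i, False) x" "model x' = collar (i, True) x'"
    using m i by (auto intro!: model_collar simp: matched_def letters_iff)
  then show ?thesis using m by (simp add: collar_def matched_def)
qed

text \<open>The norm separates the ball from the collars, disjointness of the tubes reduces to one
  handle, and injectivity of the tube to one arc parameter. The two halves of a handle meet only
  where \<open>N k x + N l x' = -4\<close>, that is, at level \<open>-2\<close> on both
  sides.\<close>

lemma model_eq_imp:
  assumes x: "x \<in> Dh" "x' \<in> Dh" and eq: "model x = model x'"
  shows "x = x' \<or> (\<exists>i<n. matched i x x' \<or> matched i x' x)"
proof -
  consider "x \<in> Bs" "x' \<in> Bs" | "x \<in> Bs" "x' \<notin> Bs" | "x \<notin> Bs" "x' \<in> Bs" | "x \<notin> Bs" "x' \<notin> Bs" by blast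
  then show ?thesis
  proof cases
    case 1
    then show ?thesis using eq model_ball ballmap_inj by (auto dest: inj_onD)
  next
    case 2
    then obtain k where k: "k \<in> K" "N k x' < -1" "N k x' \<ge> -2" using x by (auto simp: Bs_def Dh_def not_le)
    then show ?thesis using collar_norm[OF k] model_collar[OF k(1), of x'] model_ball[OF 2(1)] ballmap_norm_le[OF 2(1)] eq by simp
  next
    case 3
    then obtain k where k: "k \<in> K" "N k x < -1" "N k x \<ge> -2" using x by (auto simp: Bs_def Dh_def not_le)
    then show ?thesis using collar_norm[OF k] model_collar[OF k(1), of x] model_ball[OF 3(2)] ballmap_norm_le[OF 3(2)] eq by simp
  next
    case 4
    obtain k where k: "k \<in> K" "N k x < -1" "N k x \<ge> -2" using 4 x by (auto simp: Bs_def Dh_def not_le)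
    obtain l where l: "l \<in> K" "N l x' < -1" "N l x' \<ge> -2" using 4 x by (auto simp: Bs_def Dh_def not_le)
    obtain \<tau> y where t: "collar k x = tb (fst k) \<tau> (disc_map C y)" "y \<bullet> e (fst k) = 0"
      "\<tau> = (if snd k then 1 - (-1 - N k x) / 2 else (-1 - N k x) / 2)"
      "y = (if snd k then pr (fst k) x else \<Lambda> (fst k) (-1 - N k x) (pr (fst k) x))" "\<tau> \<in> {0..1}"
      using collar_form[OF k(1) _ k(3)] k(2) by (metis less_imp_le)
    obtain \<tau>' y' where t': "collar l x' = tb (fst l) \<tau>' (disc_map C y')" "y' \<bullet> e (fst l) = 0"
      "\<tau>' = (if snd l then 1 - (-1 - N l x') / 2 else (-1 - N l x') / 2)"
      "y' = (if snd l then pr (fst l) x' else \<Lambda> (fst l) (-1 - N l x') (pr (fst l) x'))" "\<tau>' \<in> {0..1}"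
      using collar_form[OF l(1) _ l(3)] l(2) by (metis less_imp_le)
    have kn: "fst k < n" "fst l < n" using k l by (auto simp: letters_iff)
    have te: "tb (fst k) \<tau> (disc_map C y) = tb (fst l) \<tau>' (disc_map C y')"
      using eq model_collar[OF k(1), of x] model_collar[OF l(1), of x'] k l t t' by simp
    have same: "fst k = fst l"
    proof (rule ccontr)
      assume "fst k \<noteq> fst l"
      moreover have "2 / sqrt (1 + C\<^sup>2) = 2 * \<eta>" by (simp add: \<eta>_def)
      then have "norm (disc_map C y) \<le> 2 / sqrt (1 + C\<^sup>2)" "norm (disc_map C y') \<le> 2 / sqrt (1 + C\<^sup>2)"
        using disc_W(3)[OF kn(1) t(2)] disc_W(3)[OF kn(2) t'(2)] eta(1) by linarith+
      ultimately show False
        using te tubes_disj[OF kn _ t(5) t'(5) disc_W(2)[OF kn(1) t(2)] disc_W(2)[OF kn(2) t'(2)]] by blast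
    qed
    define i where "i = fst k"
    have i: "i < n" "fst k = i" "fst l = i" using kn same by (auto simp: i_def)
    interpret tube_data "e i" "\<omega> i" "c i" by (rule td) fact
    have "\<tau> = \<tau>' \<and> disc_map C y = disc_map C y'"
      by (rule tube_inj) (use te t t' i disc_W(1)[OF i(1)] in auto)
    then have ty: "\<tau> = \<tau>'" "y = y'" using disc_map_inj by auto
    show ?thesis
    proof (cases "snd k = snd l")
      case True
      then have kl: "k = l" using same by (simp add: prod_eq_iff)
      have N: "N k x = N k x'" using ty(1) t(3) t'(3) kl by (auto split: if_splits)
      have "pr i x = pr i x'"
      proof (cases "snd k")
        case False
        have s: "-1 - N k x \<in> {0..1}" using k by auto
        have "\<Lambda> i (-1 - N k x) (pr i x) = \<Lambda> i (-1 - N k x) (pr i x')" using ty(2) t(4) t'(4) False kl N i by simp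
        then show ?thesis using bij_Lam[OF i(1) s] pr_orth[OF k(1)] i(2) by (auto simp: bij_betw_def dest: inj_onD)
      qed (use ty(2) t(4) t'(4) kl i in simp)
      then show ?thesis using point_eq[OF k(1) N] i by simp
    next
      case False
      show ?thesis
      proof (cases "snd k")
        case True
        then have *: "snd l = False" "k = (i, True)" "l = (i, False)" using False i by (auto simp: prod_eq_iff)
        have "1 - (-1 - N k x) / 2 = (-1 - N l x') / 2" using ty(1) unfolding t(3) t'(3) by (simp only: True *(1) if_True if_False)
        then have "N k x + N l x' = -4" by (simp add: field_simps)
        then have "N k x = -2" "N l x' = -2" using k(3) l(3) by linarith+
        then have "matched i x' x" using ty(2) t(4) t'(4) True * by (auto simp: matched_def)
        then show ?thesis using i by blast
      next
        case f: False
        then have *: "snd l = True" "k = (i, False)" "l = (i, True)" using False i by (auto simp: prod_eq_iff)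
        have "(-1 - N k x) / 2 = 1 - (-1 - N l x') / 2" using ty(1) unfolding t(3) t'(3) by (simp only: f *(1) if_True if_False)
        then have "N k x + N l x' = -4" by (simp add: field_simps)
        then have "N k x = -2" "N l x' = -2" using k(3) l(3) by linarith+
        then have "matched i x x'" using ty(2) t(4) t'(4) f * by (auto simp: matched_def)
        then show ?thesis using i by blast
      qed
    qed
  qed
qed

section \<open>The closed handlebody and its interior\<close>

definition handles :: "'a set" where
  "handles = (\<Union>i<n. (\<lambda>(\<tau>, w). tb i \<tau> w) ` ({0..1} \<times> {w. w \<bullet> e i = 0 \<and> norm w \<le> \<eta>}))"

lemma handle_W:
  assumes "i < n" "w \<bullet> e i = 0" "norm w \<le> 2 * \<eta>" shows "w \<in> tube_data.W (e i)"
proof -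
  interpret tube_data "e i" "\<omega> i" "c i" by (rule td) fact
  show ?thesis using assms eta by (simp add: W_def)
qed

lemma compact_handles: "compact handles"
  unfolding handles_def
proof (intro compact_UN finite_lessThan)
  fix i assume "i \<in> {..<n}"
  then have i: "i < n" by simp
  interpret tube_data "e i" "\<omega> i" "c i" by (rule td[OF i])
  have "{w. w \<bullet> e i = 0 \<and> norm w \<le> \<eta>} = cball 0 \<eta> \<inter> {w. e i \<bullet> w = 0}" by (auto simp: inner_commute)
  then have "compact ({0..1::real} \<times> {w. w \<bullet> e i = 0 \<and> norm w \<le> \<eta>})"
    by (simp add: compact_Times compact_Int_closed closed_hyperplane)
  moreover have "{0..1} \<times> {w. w \<bullet> e i = 0 \<and> norm w \<le> \<eta>} \<subseteq> {0..1} \<times> W"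
    using handle_W[OF i] eta by auto
  ultimately show "compact ((\<lambda>(\<tau>, w). tb i \<tau> w) ` ({0..1} \<times> {w. w \<bullet> e i = 0 \<and> norm w \<le> \<eta>}))"
    by (intro compact_continuous_image continuous_on_subset[OF tube_cont])
qed

text \<open>Openness of the model enters as a hypothesis and is supplied later by the quotient. For
  the other inclusion, each remaining point is a limit of points outside the handlebody: a lateral
  point of a handle through slightly wider tubes, a point of the sphere off the handles
  radially.\<close>

lemma interior_handlebody:
  assumes "open (ball 0 1 \<union> (\<Union>i<n. Tset i))"
  shows "interior (cball 0 1 \<union> handles) = ball 0 1 \<union> (\<Union>i<n. Tset i)"
proof
  have "ball 0 1 \<union> (\<Union>i<n. Tset i) \<subseteq> cball 0 1 \<union> handles"
  proof (intro Un_mono ball_subset_cball)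
    show "(\<Union>i<n. Tset i) \<subseteq> handles"
    proof
      fix x assume "x \<in> (\<Union>i<n. Tset i)"
      then obtain i \<tau> w where "i < n" "x = tb i \<tau> w" "\<tau> \<in> {0..1}" "w \<bullet> e i = 0" "norm w < \<eta>"
        by (auto simp: Tset_def)
      then show "x \<in> handles" unfolding handles_def by (intro UN_I[of i] image_eqI[of _ _ "(\<tau>, w)"]) auto
    qed
  qed
  then show "ball 0 1 \<union> (\<Union>i<n. Tset i) \<subseteq> interior (cball 0 1 \<union> handles)" using assms by (rule interior_maximal)
next
  show "interior (cball 0 1 \<union> handles) \<subseteq> ball 0 1 \<union> (\<Union>i<n. Tset i)"
  proof (rule subsetI, rule ccontr)
    fix x assume x: "x \<in> interior (cball 0 1 \<union> handles)" and nx: "x \<notin> ball 0 1 \<union> (\<Union>i<n. Tset i)"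
    obtain r where r: "r > 0" "ball x r \<subseteq> cball 0 1 \<union> handles" using x by (auto simp: mem_interior)
    show False
    proof (cases "x \<in> handles")
      case True
      then obtain i \<tau> w where x': "i < n" "x = tb i \<tau> w" "\<tau> \<in> {0..1}" "w \<bullet> e i = 0" "norm w \<le> \<eta>"
        by (auto simp: handles_def)
      have "x \<notin> Tset i" using nx x'(1) by blast
      then have wn: "norm w = \<eta>" unfolding Tset_def using x' by force
      interpret tube_data "e i" "\<omega> i" "c i" by (rule td) fact
      \<comment> \<open>Widening by \<open>1 + \<delta>\<close> stays within the double radius,
        where the tubes are injective and disjoint. Pulling \<tau> towards \<open>1/2\<close> keeps
        the point outside the ball even if \<tau> is 0 or 1.\<close>
      define G where "G \<delta> = tb i ((1 - \<delta>) * \<tau> + \<delta> / 2) ((1 + \<delta>) *\<^sub>R w)" for \<delta>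
      have GW: "(1 + \<delta>) *\<^sub>R w \<in> W" "norm ((1 + \<delta>) *\<^sub>R w) \<le> 2 * \<eta>" "(1 - \<delta>) * \<tau> + \<delta> / 2 \<in> {0..1}" if "\<delta> \<in> {0..1}" for \<delta>
      proof -
        have "\<delta> * \<eta> \<le> 1 * \<eta>" using that eta by (intro mult_right_mono) auto
        then show 1: "norm ((1 + \<delta>) *\<^sub>R w) \<le> 2 * \<eta>" using that wn by (simp add: distrib_right)
        show "(1 + \<delta>) *\<^sub>R w \<in> W" using handle_W[OF x'(1) _ 1] x'(4) by simp
        have "(1 - \<delta>) * \<tau> \<le> (1 - \<delta>) * 1" using that x'(3) by (intro mult_left_mono) auto
        moreover have "0 \<le> (1 - \<delta>) * \<tau>" using that x'(3) by simp
        ultimately show "(1 - \<delta>) * \<tau> + \<delta> / 2 \<in> {0..1}" using that by auto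
      qed
      have "continuous_on {0..1} ((\<lambda>(\<tau>, w). tb i \<tau> w) \<circ> (\<lambda>\<delta>. ((1 - \<delta>) * \<tau> + \<delta> / 2, (1 + \<delta>) *\<^sub>R w)))"
        by (intro continuous_on_compose continuous_on_subset[OF tube_cont] continuous_intros) (use GW in auto)
      then have cG: "continuous_on {0..1} G" by (simp add: o_def G_def[abs_def])
      have G0: "G 0 = x" using x' by (simp add: G_def)
      have "\<forall>e>0. \<exists>d>0. \<forall>\<delta>\<in>{0..1}. dist \<delta> 0 < d \<longrightarrow> dist (G \<delta>) (G 0) < e"
        using cG[unfolded continuous_on_iff, rule_format, of 0] by auto
      then obtain d where d: "d > 0" "\<And>\<delta>. \<delta> \<in> {0..1} \<Longrightarrow> dist \<delta> 0 < d \<Longrightarrow> dist (G \<delta>) x < r"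
        using r(1) G0 by auto
      define \<delta> where "\<delta> = min (d / 2) (1 / 2)"
      have dl: "\<delta> \<in> {0..1}" "\<delta> > 0" "\<delta> < 1" "dist \<delta> 0 < d" using d(1) by (auto simp: \<delta>_def)
      have "G \<delta> \<in> cball 0 1 \<union> handles" using d(2)[OF dl(1,4)] r(2) by (auto simp: dist_commute)
      moreover have "norm (G \<delta>) > 1"
      proof -
        have "0 \<le> (1 - \<delta>) * \<tau>" using dl x'(3) by simp
        then have "0 < (1 - \<delta>) * \<tau> + \<delta> / 2" using dl(2) by linarith
        moreover have "(1 - \<delta>) * \<tau> \<le> (1 - \<delta>) * 1" using dl(3) x'(3) by (intro mult_left_mono) auto
        moreover have "X + \<delta> / 2 < 1" if "X \<le> (1 - \<delta>) * 1" for X using that dl(2) by simp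
        ultimately have "(1 - \<delta>) * \<tau> + \<delta> / 2 < 1" "0 < (1 - \<delta>) * \<tau> + \<delta> / 2" by blast+
        then show ?thesis unfolding G_def using GW(1)[OF dl(1)] by (intro tube_outside)
      qed
      ultimately have "G \<delta> \<in> handles" by auto
      then obtain j \<tau>' w' where j: "j < n" "G \<delta> = tb j \<tau>' w'" "\<tau>' \<in> {0..1}" "w' \<bullet> e j = 0" "norm w' \<le> \<eta>"
        by (auto simp: handles_def)
      have e2: "2 / sqrt (1 + C\<^sup>2) = 2 * \<eta>" by (simp add: \<eta>_def)
      have ji: "j = i"
      proof (rule ccontr)
        assume "j \<noteq> i"
        then show False
          using tubes_disj[OF x'(1) j(1) _ GW(3)[OF dl(1)] j(3), of "(1 + \<delta>) *\<^sub>R w" w'] GW(2)[OF dl(1)] j x'(4) eta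
          unfolding e2 by (auto simp: G_def)
      qed
      have "w' \<in> W" using handle_W[OF x'(1), of w'] j ji eta by simp
      then have "(1 + \<delta>) *\<^sub>R w = w'"
        using tube_inj[OF GW(1)[OF dl(1)] _ GW(3)[OF dl(1)] j(3)] j(2) ji by (auto simp: G_def)
      then have "norm w' = (1 + \<delta>) * \<eta>" using wn dl by auto
      then show False using j(5) dl eta by (simp add: distrib_right) (metis add_le_same_cancel1 mult_pos_pos not_le)
    next
      case False
      then have "norm x = 1" using nx x interior_subset by (force simp: not_less)
      have "open (- handles)" using compact_handles compact_imp_closed by blast
      then obtain r' where r': "r' > 0" "ball x r' \<subseteq> - handles" using False by (metis Compl_iff openE)
      define \<delta> where "\<delta> = min r r' / 2"
      have dl: "\<delta> > 0" "\<delta> < r" "\<delta> < r'" using r(1) r'(1) by (auto simp: \<delta>_def)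
      define z where "z = (1 + \<delta>) *\<^sub>R x"
      have "z - x = \<delta> *\<^sub>R x" by (simp add: z_def algebra_simps)
      then have "dist x z = \<delta>" using \<open>norm x = 1\<close> dl by (metis dist_commute dist_norm norm_scaleR abs_of_pos mult.right_neutral)
      moreover have "norm z > 1" using \<open>norm x = 1\<close> dl by (simp add: z_def)
      ultimately have "z \<in> ball x r" "z \<in> ball x r'" "z \<notin> cball 0 1" using dl by auto
      then show False using r(2) r'(2) by blast
    qed
  qed
qed

end

section \<open>Connectedness of the linear maps of positive determinant\<close>

text \<open>The identity outside the block \<open>I\<close>, so that the induction on blocks takes
  place among matrices of one size.\<close>

definition supported_on :: "'n set \<Rightarrow> real ^ 'n ^ 'n \<Rightarrow> bool" where
  "supported_on I A \<longleftrightarrow> (\<forall>i j. i \<notin> I \<or> j \<notin> I \<longrightarrow> A $ i $ j = (if i = j then 1 else 0))"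

definition GL_path :: "'n set \<Rightarrow> real ^ 'n ^ 'n \<Rightarrow> bool" where
  "GL_path I A \<longleftrightarrow> (\<exists>\<phi> :: real \<Rightarrow> real ^ 'n ^ 'n. continuous_on {0..1} \<phi> \<and> \<phi> 0 = mat 1 \<and> \<phi> 1 = A \<and>
    (\<forall>t\<in>{0..1}. supported_on I (\<phi> t) \<and> det (\<phi> t) \<noteq> 0))"

lemma GL_pathE:
  assumes "GL_path I A"
  obtains \<phi> where "continuous_on {0..1::real} \<phi>" "\<phi> 0 = mat 1" "\<phi> 1 = A"
    "\<forall>t\<in>{0..1}. supported_on I (\<phi> t) \<and> det (\<phi> t) \<noteq> 0"
  using assms unfolding GL_path_def by blast

lemma supported_mult:
  assumes "supported_on I A" "supported_on I (B :: real ^ 'n::finite ^ 'n)"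
  shows "supported_on I (A ** B)"
  unfolding supported_on_def
proof (intro allI impI)
  fix i j assume ij: "i \<notin> I \<or> j \<notin> I"
  show "(A ** B) $ i $ j = (if i = j then 1 else 0)"
  proof (cases "i \<in> I")
    case False
    then have "A $ i $ l * B $ l $ j = (if l = i then B $ i $ j else 0)" for l
      using assms(1) by (auto simp: supported_on_def)
    then have "(A ** B) $ i $ j = B $ i $ j" by (simp add: matrix_matrix_mult_def)
    then show ?thesis using assms(2) False by (simp add: supported_on_def)
  next
    case True
    then have j: "j \<notin> I" using ij by simp
    then have "A $ i $ l * B $ l $ j = (if l = j then A $ i $ j else 0)" for l
      using assms(2) by (auto simp: supported_on_def)
    then have "(A ** B) $ i $ j = A $ i $ j" by (simp add: matrix_matrix_mult_def)
    then show ?thesis using assms(1) j by (simp add: supported_on_def)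
  qed
qed

lemma continuous_matrix_mult:
  fixes f g :: "'a::topological_space \<Rightarrow> real ^ 'n::finite ^ 'n"
  assumes "continuous_on S f" "continuous_on S g"
  shows "continuous_on S (\<lambda>x. f x ** g x)"
  unfolding matrix_matrix_mult_def
  by (intro continuous_on_vec_lambda continuous_intros assms)

lemma continuous_det:
  fixes f :: "'a::topological_space \<Rightarrow> real ^ 'n::finite ^ 'n"
  assumes "continuous_on S f"
  shows "continuous_on S (\<lambda>x. det (f x))"
  unfolding det_def by (intro continuous_intros assms)

lemma matrix_mult_linear:
  fixes A B C :: "real ^ 'n::finite ^ 'n"
  shows "(A + B) ** C = A ** C + B ** C" "(A - B) ** C = A ** C - B ** C" "A ** (B - C) = A ** B - A ** C"
    "(- A) ** C = - (A ** C)" "A ** (- C) = - (A ** C)"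
    "(t *\<^sub>R A) ** C = t *\<^sub>R (A ** C)" "A ** (t *\<^sub>R C) = t *\<^sub>R (A ** C)"
  by (simp_all add: matrix_matrix_mult_def vec_eq_iff algebra_simps sum.distrib sum_subtractf sum_negf sum_distrib_left)

lemma GL_path_mult:
  assumes "GL_path I A" "GL_path I B" shows "GL_path I (A ** B)"
proof -
  obtain \<phi> where f: "continuous_on {0..1::real} \<phi>" "\<phi> 0 = mat 1" "\<phi> 1 = A"
    "\<forall>t\<in>{0..1}. supported_on I (\<phi> t) \<and> det (\<phi> t) \<noteq> 0"
    by (rule GL_pathE[OF assms(1)])
  obtain \<psi> where g: "continuous_on {0..1::real} \<psi>" "\<psi> 0 = mat 1" "\<psi> 1 = B"
    "\<forall>t\<in>{0..1}. supported_on I (\<psi> t) \<and> det (\<psi> t) \<noteq> 0"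
    by (rule GL_pathE[OF assms(2)])
  show ?thesis unfolding GL_path_def
  proof (rule exI[of _ "\<lambda>t. \<phi> t ** \<psi> t"], intro conjI ballI)
    show "continuous_on {0..1} (\<lambda>t. \<phi> t ** \<psi> t)" by (rule continuous_matrix_mult[OF f(1) g(1)])
    fix t :: real assume t: "t \<in> {0..1}"
    show "supported_on I (\<phi> t ** \<psi> t)" "det (\<phi> t ** \<psi> t) \<noteq> 0"
      using bspec[OF f(4) t] bspec[OF g(4) t] by (auto simp: supported_mult det_mul)
  qed (use f g in auto)
qed

lemma GL_path_det_pos:
  assumes "GL_path I A" shows "det A > 0"
proof (rule ccontr)
  assume "\<not> ?thesis"
  obtain \<phi> where f: "continuous_on {0..1::real} \<phi>" "\<phi> 0 = mat 1" "\<phi> 1 = A"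
    "\<forall>t\<in>{0..1}. supported_on I (\<phi> t) \<and> det (\<phi> t) \<noteq> 0"
    by (rule GL_pathE[OF assms])
  have "\<exists>x\<ge>0. x \<le> 1 \<and> det (\<phi> x) = 0"
    by (rule IVT2'[of "\<lambda>t. det (\<phi> t)"]) (use f \<open>\<not> _\<close> continuous_det[OF f(1)] in auto)
  then show False using f(4) by auto
qed

text \<open>For \<open>Z ** Z = 0\<close> the matrices \<open>mat 1 + t *\<^sub>R Z\<close> and
  \<open>mat 1 - t *\<^sub>R Z\<close> are inverse to each other, so the whole segment stays
  invertible.\<close>

lemma GL_path_shear:
  assumes "\<And>i j. i \<notin> I \<or> j \<notin> I \<Longrightarrow> Z $ i $ j = 0" and "Z ** Z = 0"
  shows "GL_path I (mat 1 + Z)" "(mat 1 + Z) ** (mat 1 - Z) = mat 1" "(mat 1 - Z) ** (mat 1 + Z) = mat 1"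
proof -
  have 1: "(mat 1 + t *\<^sub>R Z) ** (mat 1 - t *\<^sub>R Z) = mat 1" for t
    using assms(2)
    by (simp add: matrix_add_ldistrib matrix_mult_linear)
  show "(mat 1 + Z) ** (mat 1 - Z) = mat 1" using 1[of 1] by simp
  show "(mat 1 - Z) ** (mat 1 + Z) = mat 1" using 1[of "-1"] by simp
  have "det (mat 1 + t *\<^sub>R Z) * det (mat 1 - t *\<^sub>R Z) = 1" for t using arg_cong[OF 1[of t], of det] by (simp add: det_mul)
  then have "det (mat 1 + t *\<^sub>R Z) \<noteq> 0" for t by (metis mult_zero_left zero_neq_one)
  then show "GL_path I (mat 1 + Z)"
    unfolding GL_path_def
    by (intro exI[of _ "\<lambda>t. mat 1 + t *\<^sub>R Z"])
      (auto intro!: continuous_intros simp: supported_on_def mat_def assms(1))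
qed

lemma GL_path_mono: "GL_path I A \<Longrightarrow> I \<subseteq> J \<Longrightarrow> GL_path J A"
  unfolding GL_path_def supported_on_def by (metis (no_types, lifting) subsetD)

text \<open>One elimination step: the inverse of a transvection is again joined to the identity, so
  a path to the transformed matrix yields one to \<open>A\<close>.\<close>

lemma GL_path_left_shear:
  assumes Z: "\<And>i j. i \<notin> I \<or> j \<notin> I \<Longrightarrow> Z $ i $ j = 0" "Z ** Z = 0"
    and "supported_on I A" "det A > 0"
    and "supported_on I ((mat 1 + Z) ** A) \<Longrightarrow> det ((mat 1 + Z) ** A) > 0 \<Longrightarrow> GL_path I ((mat 1 + Z) ** A)"
  shows "GL_path I A"
proof -
  have p: "GL_path I (mat 1 + Z)" by (rule GL_path_shear(1)[OF Z])
  then have s: "supported_on I (mat 1 + Z)" unfolding GL_path_def by (metis atLeastAtMost_iff order_refl zero_le_one)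
  have "GL_path I ((mat 1 + Z) ** A)"
    by (rule assms(5)) (use supported_mult[OF s assms(3)] GL_path_det_pos[OF p] assms(4) in \<open>auto simp: det_mul\<close>)
  moreover have "GL_path I (mat 1 + (- Z))"
    by (rule GL_path_shear(1)) (use Z in \<open>auto simp: matrix_mult_linear\<close>)
  ultimately have "GL_path I ((mat 1 - Z) ** ((mat 1 + Z) ** A))" using GL_path_mult by force
  moreover have E: "(mat 1 - Z) ** (mat 1 + Z) = mat 1"
    by (rule GL_path_shear(3)[where I = I]) (use Z in auto)
  have "(mat 1 - Z) ** ((mat 1 + Z) ** A) = A" by (simp only: matrix_mul_assoc E matrix_mul_lid)
  ultimately show ?thesis by simp
qed

lemma GL_path_right_shear:
  assumes Z: "\<And>i j. i \<notin> I \<or> j \<notin> I \<Longrightarrow> Z $ i $ j = 0" "Z ** Z = 0"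
    and "supported_on I A" "det A > 0"
    and "supported_on I (A ** (mat 1 + Z)) \<Longrightarrow> det (A ** (mat 1 + Z)) > 0 \<Longrightarrow> GL_path I (A ** (mat 1 + Z))"
  shows "GL_path I A"
proof -
  have p: "GL_path I (mat 1 + Z)" by (rule GL_path_shear(1)[OF Z])
  then have s: "supported_on I (mat 1 + Z)" unfolding GL_path_def by (metis atLeastAtMost_iff order_refl zero_le_one)
  have "GL_path I (A ** (mat 1 + Z))"
    by (rule assms(5)) (use supported_mult[OF assms(3) s] GL_path_det_pos[OF p] assms(4) in \<open>auto simp: det_mul\<close>)
  moreover have "GL_path I (mat 1 + (- Z))"
    by (rule GL_path_shear(1)) (use Z in \<open>auto simp: matrix_mult_linear\<close>)
  ultimately have "GL_path I ((A ** (mat 1 + Z)) ** (mat 1 - Z))" using GL_path_mult by force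
  moreover have E: "(mat 1 + Z) ** (mat 1 - Z) = mat 1"
    by (rule GL_path_shear(2)[where I = I]) (use Z in auto)
  have "(A ** (mat 1 + Z)) ** (mat 1 - Z) = A" by (simp only: matrix_mul_assoc[symmetric] E matrix_mul_rid)
  ultimately show ?thesis by simp
qed

definition mat_unit :: "'n \<Rightarrow> 'n \<Rightarrow> real \<Rightarrow> real ^ 'n::finite ^ 'n" where
  "mat_unit i j c = (\<chi> k l. if k = i \<and> l = j then c else 0)"

lemma mat_unit_mult: "(mat_unit i j c ** A) $ k $ l = (if k = i then c * A $ j $ l else 0)"
proof -
  have "mat_unit i j c $ k $ m * A $ m $ l = (if m = j then (if k = i then c * A $ j $ l else 0) else 0)" for m
    by (auto simp: mat_unit_def)
  then show ?thesis by (simp add: matrix_matrix_mult_def)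
qed

text \<open>Gaussian elimination by transvections, which are joined to the identity by segments.\<close>

lemma GL_path_connected:
  fixes A :: "real ^ 'n::finite ^ 'n"
  assumes "I \<noteq> {}" "supported_on I A" "det A > 0"
  shows "GL_path I A"
proof -
  have "finite I" by simp
  then show ?thesis using assms
  proof (induction I arbitrary: A rule: finite_ne_induct)
    case (singleton i)
    have off: "A $ k $ l = 0" if "k \<noteq> l" for k l
      using singleton(1) that by (auto simp: supported_on_def) (metis)
    have "det A = (\<Prod>k\<in>UNIV. A $ k $ k)" by (rule det_diagonal) (simp add: off)
    also have "\<dots> = (\<Prod>k\<in>UNIV. if k = i then A $ i $ i else 1)"
      using singleton(1) by (intro prod.cong) (auto simp: supported_on_def)
    finally have a: "A $ i $ i > 0" using singleton(2) by simp
    define \<phi> where "\<phi> t = mat 1 + t *\<^sub>R (A - mat 1)" for t :: real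
    have s: "supported_on {i} (\<phi> t)" for t
      using singleton(1) by (auto simp: \<phi>_def supported_on_def mat_def)
    have "det (\<phi> t) \<noteq> 0" if t: "t \<in> {0..1}" for t
    proof -
      have "det (\<phi> t) = (\<Prod>k\<in>UNIV. \<phi> t $ k $ k)"
        by (rule det_diagonal) (simp add: \<phi>_def mat_def off)
      also have "\<dots> = (\<Prod>k\<in>UNIV. if k = i then \<phi> t $ i $ i else 1)"
        using s[of t] by (intro prod.cong) (auto simp: supported_on_def)
      also have "\<dots> = (1 - t) + t * A $ i $ i" by (simp add: \<phi>_def mat_def algebra_simps)
      also have "\<dots> > 0"
        using t a by (cases "t = 1") (auto intro!: add_pos_nonneg)
      finally show ?thesis by simp
    qed
    then show ?case unfolding GL_path_def
      using s by (intro exI[of _ \<phi>]) (auto simp: \<phi>_def intro!: continuous_intros)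
  next
    case (insert i J)
    let ?I = "insert i J"
    \<comment> \<open>With column \<open>i\<close> already cleared, clearing row \<open>i\<close>
      leaves a matrix supported on \<open>J\<close>, to which the induction hypothesis
      applies.\<close>
    have clear_row: "GL_path ?I A" if "supported_on ?I A" "det A > 0" "A $ i $ i = 1" "\<And>j. j \<in> J \<Longrightarrow> A $ j $ i = 0" for A
    proof -
      define Z :: "real ^ 'n ^ 'n" where "Z = (\<chi> k l. if k = i \<and> l \<in> J then - A $ i $ l else 0)"
      have m: "(M ** Z) $ k $ l = (if l \<in> J then - (M $ k $ i * A $ i $ l) else 0)" for M :: "real ^ 'n ^ 'n" and k l
      proof -
        have "M $ k $ m * Z $ m $ l = (if m = i then (if l \<in> J then - (M $ k $ i * A $ i $ l) else 0) else 0)" for m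
          by (auto simp: Z_def)
        then show ?thesis by (simp add: matrix_matrix_mult_def)
      qed
      show ?thesis
      proof (rule GL_path_right_shear[of ?I Z])
        show "Z $ a $ b = 0" if "a \<notin> ?I \<or> b \<notin> ?I" for a b using that by (auto simp: Z_def)
        show "Z ** Z = 0" using insert(3) by (simp add: vec_eq_iff m) (simp add: Z_def)
        assume s: "supported_on ?I (A ** (mat 1 + Z))" and d: "det (A ** (mat 1 + Z)) > 0"
        have e: "(A ** (mat 1 + Z)) $ k $ l = A $ k $ l + (if l \<in> J then - (A $ k $ i * A $ i $ l) else 0)" for k l
          by (simp add: matrix_add_ldistrib m)
        have "supported_on J (A ** (mat 1 + Z))"
          unfolding supported_on_def
        proof (intro allI impI)
          fix k l assume kl: "k \<notin> J \<or> l \<notin> J"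
          show "(A ** (mat 1 + Z)) $ k $ l = (if k = l then 1 else 0)"
          proof (cases "k = i \<or> l = i")
            case True
            have "A $ k $ i = 0" if "k \<noteq> i" using that(1) \<open>supported_on ?I A\<close> \<open>\<And>j. j \<in> J \<Longrightarrow> A $ j $ i = 0\<close>
              by (cases "k \<in> J") (auto simp: supported_on_def)
            moreover have "A $ i $ l = 0" if "l \<noteq> i" "l \<notin> J" using that \<open>supported_on ?I A\<close>
              by (auto simp: supported_on_def)
            ultimately show ?thesis unfolding e using True insert(3) \<open>A $ i $ i = 1\<close> by auto
          next
            case False
            then have "k \<notin> ?I \<or> l \<notin> ?I" using kl by auto
            then show ?thesis using s unfolding supported_on_def by blast
          qed
        qed
        then show "GL_path ?I (A ** (mat 1 + Z))" using insert(4) d GL_path_mono by blast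
      qed (use that in auto)
    qed
    have clear_col: "GL_path ?I A" if "supported_on ?I A" "det A > 0" "A $ i $ i = 1" for A
    proof -
      define Z :: "real ^ 'n ^ 'n" where "Z = (\<chi> k l. if l = i \<and> k \<in> J then - A $ k $ i else 0)"
      have m: "(Z ** M) $ k $ l = (if k \<in> J then - (A $ k $ i * M $ i $ l) else 0)" for M :: "real ^ 'n ^ 'n" and k l
      proof -
        have "Z $ k $ m * M $ m $ l = (if m = i then (if k \<in> J then - (A $ k $ i * M $ i $ l) else 0) else 0)" for m
          by (auto simp: Z_def)
        then show ?thesis by (simp add: matrix_matrix_mult_def)
      qed
      show ?thesis
      proof (rule GL_path_left_shear[of ?I Z])
        show "Z $ a $ b = 0" if "a \<notin> ?I \<or> b \<notin> ?I" for a b using that by (auto simp: Z_def)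
        show "Z ** Z = 0" using insert(3) by (simp add: vec_eq_iff m) (simp add: Z_def)
        assume s: "supported_on ?I ((mat 1 + Z) ** A)" and d: "det ((mat 1 + Z) ** A) > 0"
        have e: "((mat 1 + Z) ** A) $ k $ l = A $ k $ l + (if k \<in> J then - (A $ k $ i * A $ i $ l) else 0)" for k l
          by (simp add: matrix_mult_linear m)
        show "GL_path ?I ((mat 1 + Z) ** A)"
          by (rule clear_row[OF s d]) (use e insert(3) that(3) in auto)
      qed (use that in auto)
    qed
    \<comment> \<open>Transvections cannot rescale a row, so the pivot is made 1 by adding a
      multiple of row \<open>j\<close>.\<close>
    have fix_entry: "GL_path ?I A" if A: "supported_on ?I A" "det A > 0" "j \<in> J" "A $ j $ i \<noteq> 0" for A j
    proof (rule GL_path_left_shear[of ?I "mat_unit i j ((1 - A $ i $ i) / A $ j $ i)"])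
      have ij: "i \<noteq> j" using A insert(3) by auto
      show "mat_unit i j ((1 - A $ i $ i) / A $ j $ i) $ a $ b = 0" if "a \<notin> ?I \<or> b \<notin> ?I" for a b
        using that A by (auto simp: mat_unit_def)
      show "mat_unit i j ((1 - A $ i $ i) / A $ j $ i) ** mat_unit i j ((1 - A $ i $ i) / A $ j $ i) = 0"
        using ij by (simp add: vec_eq_iff mat_unit_mult) (simp add: mat_unit_def)
      assume *: "supported_on ?I ((mat 1 + mat_unit i j ((1 - A $ i $ i) / A $ j $ i)) ** A)"
        "det ((mat 1 + mat_unit i j ((1 - A $ i $ i) / A $ j $ i)) ** A) > 0"
      show "GL_path ?I ((mat 1 + mat_unit i j ((1 - A $ i $ i) / A $ j $ i)) ** A)"
        by (rule clear_col[OF *]) (use A in \<open>simp add: matrix_mult_linear mat_unit_mult\<close>)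
    qed (use A in auto)
    show ?case
    proof (cases "\<exists>j\<in>J. A $ j $ i \<noteq> 0")
      case True
      then show ?thesis using fix_entry insert.prems by blast
    next
      case False
      have ii: "A $ i $ i \<noteq> 0"
      proof
        assume 0: "A $ i $ i = 0"
        have "A $ k $ i = 0" for k
        proof (cases "k \<in> ?I")
          case True then show ?thesis using False 0 by auto
        next
          case F: False
          then have "A $ k $ i = (if k = i then 1 else 0)" using insert.prems(1) unfolding supported_on_def by blast
          then show ?thesis using F by auto
        qed
        then have "column i A = 0" by (simp add: column_def vec_eq_iff)
        then show False using det_zero_column(2)[of i A] insert.prems(2) by simp
      qed
      \<comment> \<open>If the rest of the column vanishes, row \<open>i\<close> is first copied
        onto another row. This uses \<open>J\<close> nonempty, which is why blocks of size one form
        the base case.\<close>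
      obtain j where j: "j \<in> J" using insert(2) by blast
      then have ij: "i \<noteq> j" using insert(3) by auto
      show ?thesis
      proof (rule GL_path_left_shear[of ?I "mat_unit j i 1"])
        show "mat_unit j i 1 $ a $ b = 0" if "a \<notin> ?I \<or> b \<notin> ?I" for a b using that j by (auto simp: mat_unit_def)
        show "mat_unit j i 1 ** mat_unit j i 1 = 0" using ij by (simp add: vec_eq_iff mat_unit_mult) (simp add: mat_unit_def)
        assume *: "supported_on ?I ((mat 1 + mat_unit j i 1) ** A)" "det ((mat 1 + mat_unit j i 1) ** A) > 0"
        show "GL_path ?I ((mat 1 + mat_unit j i 1) ** A)"
          by (rule fix_entry[OF * j]) (use False j ii in \<open>simp add: matrix_mult_linear mat_unit_mult\<close>)
      qed (use insert.prems in auto)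
    qed
  qed
qed

text \<open>\<open>g\<close> fixes \<open>e\<close> but need not preserve its orthogonal complement,
  so the map joined to the identity is \<open>L\<close>, the normal part of \<open>g\<close>
  completed by the identity on the axis. Rotating \<open>e\<close> to a coordinate axis makes
  \<open>L\<close> supported on the other indices.\<close>

lemma linear_isotopy:
  fixes g :: "real ^ 'n \<Rightarrow> real ^ 'n"
  assumes e: "norm e = 1" and g: "linear g" "g e = e" "det (matrix g) > 0" and dim: "CARD('n) \<ge> 2"
  obtains \<Lambda> where "continuous_on ({0..1::real} \<times> UNIV) (\<lambda>(\<tau>, y). \<Lambda> \<tau> y)"
    "\<And>\<tau>. \<tau> \<in> {0..1} \<Longrightarrow> linear (\<Lambda> \<tau>) \<and> bij_betw (\<Lambda> \<tau>) {y. y \<bullet> e = 0} {y. y \<bullet> e = 0}"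
    "\<And>y. \<Lambda> 0 y = y" "\<And>y. y \<bullet> e = 0 \<Longrightarrow> \<Lambda> 1 y = proj_off e (g y)"
proof -
  obtain k :: 'n where "True" by blast
  obtain R :: "real ^ 'n \<Rightarrow> real ^ 'n" where R: "orthogonal_transformation R" "R (axis k 1) = e"
  proof -
    have "norm (axis k 1 :: real ^ 'n) = norm e" using e by simp
    then show ?thesis using orthogonal_transformation_exists that by blast
  qed
  have linR: "linear R" using R(1) by (rule orthogonal_transformation_linear)
  obtain S where S: "linear S" "\<And>x. S (R x) = x" "\<And>x. R (S x) = x"
  proof -
    have "bij R" using R(1) by (rule orthogonal_transformation_bij)
    moreover have "linear (inv_into UNIV R)" using R(1) by (metis orthogonal_transformation_inv orthogonal_transformation_linear)
    ultimately show ?thesis using that[of "inv_into UNIV R"] by (simp add: bij_is_inj bij_is_surj surj_f_inv_f)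
  qed
  have ip: "R x \<bullet> R y = x \<bullet> y" for x y using R(1) by (simp add: orthogonal_transformation_def)
  have Re: "R x \<bullet> e = x $ k" for x using ip[of x "axis k 1"] R(2) by (simp add: inner_axis)
  have Se: "S y $ k = y \<bullet> e" for y using Re[of "S y"] S(3) by simp
  have ee: "e \<bullet> e = 1" using e by (simp add: dot_square_norm)
  define L where "L x = proj_off e (g x) + (x \<bullet> e) *\<^sub>R e" for x
  define h where "h x = x - (g x \<bullet> e - x \<bullet> e) *\<^sub>R e" for x
  have linL: "linear L" unfolding L_def proj_off_def
    by (intro linearI) (simp_all add: linear_add[OF g(1)] linear_scale[OF g(1)] algebra_simps)
  have linh: "linear h" unfolding h_def
    by (intro linearI) (simp_all add: linear_add[OF g(1)] linear_scale[OF g(1)] algebra_simps)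
  have Lgh: "L = g \<circ> h"
    unfolding fun_eq_iff o_apply L_def h_def proj_off_def linear_diff[OF g(1)] linear_scale[OF g(1)] g(2)
    by (simp add: scaleR_left_diff_distrib)
  define N where "N = matrix (S \<circ> L \<circ> R)"
  have Nv: "N *v x = S (L (R x))" for x
    unfolding N_def using linear_compose[OF linear_compose[OF linR linL] S(1)] by (simp add: matrix_works linear_matrix_vector_mul_eq o_assoc)
  have supp: "supported_on (- {k}) N"
  proof -
    have ent: "N $ i $ j = S (L (R (axis j 1))) $ i" for i j
      by (simp add: N_def matrix_def)
    show ?thesis unfolding supported_on_def
    proof (intro allI impI)
      fix i j assume "i \<notin> - {k} \<or> j \<notin> - {k}"
      then consider "j = k" | "i = k" by auto
      then show "N $ i $ j = (if i = j then 1 else 0)"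
      proof cases
        case 1
        have "L e = e" using e by (simp add: L_def g(2) ee)
        then have "S (L (R (axis j 1))) = axis k 1" using 1 R(2) S(2)[of "axis k 1"] by simp
        then show ?thesis unfolding ent using 1 by (simp add: axis_def)
      next
        case 2
        have "L x \<bullet> e = x \<bullet> e" for x using proj_off_orth[OF e] by (simp add: L_def inner_add_left ee)
        then have "S (L (R (axis j 1))) $ k = axis j 1 $ k" using Se Re by metis
        then show ?thesis unfolding ent using 2 by (auto simp: axis_def)
      qed
    qed
  qed
  \<comment> \<open>\<open>h\<close> is a shear along \<open>e\<close>: the functional \<phi>
    vanishes at \<open>e\<close>, so \<open>H (- t)\<close> inverts \<open>H t\<close> and the
    determinant keeps its sign from \<open>H 0\<close>, the identity, to \<open>H 1 = h\<close>.
    Hence \<open>L\<close> inherits a positive determinant from \<open>g\<close>.\<close>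
  have hom: "\<exists>B. B ** matrix h = mat 1 \<and> det B > 0 \<and> det (matrix h) > 0"
  proof -
    define \<phi> where "\<phi> x = g x \<bullet> e - x \<bullet> e" for x
    have lin\<phi>: "linear \<phi>" unfolding \<phi>_def by (intro linearI) (simp_all add: linear_add[OF g(1)] linear_scale[OF g(1)] algebra_simps)
    have \<phi>e: "\<phi> e = 0" by (simp add: \<phi>_def g(2))
    define H where "H t x = x - t *\<^sub>R (\<phi> x *\<^sub>R e)" for t x
    have linH: "linear (H t)" for t unfolding H_def
      by (intro linearI) (simp_all add: linear_add[OF lin\<phi>] linear_scale[OF lin\<phi>] algebra_simps)
    have inv: "H (- t) (H t x) = x" for t x
      unfolding H_def by (simp add: linear_diff[OF lin\<phi>] linear_scale[OF lin\<phi>] \<phi>e)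
    have m: "matrix (H t) = mat 1 - t *\<^sub>R matrix (\<lambda>x. \<phi> x *\<^sub>R e)" for t
      by (simp add: H_def matrix_def vec_eq_iff mat_def axis_def)
    have dn: "det (matrix (H t)) \<noteq> 0" for t
    proof -
      have "matrix (H (- t)) ** matrix (H t) = matrix (H (- t) \<circ> H t)" using matrix_compose[OF linH linH] by simp
      also have "H (- t) \<circ> H t = id" using inv by (auto simp: fun_eq_iff)
      finally have "det (matrix (H (- t))) * det (matrix (H t)) = 1" by (simp add: det_mul[symmetric] matrix_id_mat_1[unfolded id_def])
      then show ?thesis by auto
    qed
    have "det (matrix (H 1)) > 0"
    proof (rule ccontr)
      assume n: "\<not> ?thesis"
      have c: "continuous_on {0..1} (\<lambda>t. det (matrix (H t)))" unfolding m by (intro continuous_det continuous_intros)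
      have "det (matrix (H 0)) = 1" by (simp add: m)
      then have "\<exists>x\<ge>0. x \<le> 1 \<and> det (matrix (H x)) = 0" using n c by (intro IVT2') auto
      then show False using dn by auto
    qed
    moreover have "H 1 = h" by (auto simp: fun_eq_iff H_def h_def \<phi>_def)
    ultimately have dh: "det (matrix h) > 0" by simp
    have "matrix (H (-1)) ** matrix h = mat 1"
      using matrix_compose[OF linh linH, of "-1"] inv[of 1] \<open>H 1 = h\<close> by (simp add: o_def matrix_id_mat_1[unfolded id_def])
    moreover from this have "det (matrix (H (-1))) * det (matrix h) = 1" by (metis det_I det_mul)
    then have "det (matrix (H (-1))) > 0" using dh by (metis zero_less_mult_pos2 zero_less_one)
    ultimately show ?thesis using dh by blast
  qed
  have "det (matrix L) > 0"
  proof -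
    have "matrix L = matrix g ** matrix h" unfolding Lgh using matrix_compose[OF linh g(1)] .
    then show ?thesis using hom g(3) by (auto simp: det_mul)
  qed
  moreover have "det N = det (matrix L)"
  proof -
    have "N = matrix S ** (matrix L ** matrix R)"
      unfolding N_def using matrix_compose[OF linear_compose[OF linR linL] S(1)] matrix_compose[OF linR linL] by (simp add: o_assoc)
    moreover have "matrix S ** matrix R = mat 1"
      using matrix_compose[OF linR S(1)] S(2) by (simp add: o_def matrix_id_mat_1[unfolded id_def])
    then have "det (matrix S) * det (matrix R) = 1" by (metis det_I det_mul)
    ultimately show ?thesis by (simp add: det_mul)
  qed
  ultimately have detN: "det N > 0" by simp
  have "- {k} \<noteq> {}"
  proof
    assume "- {k} = {}"
    then have "(UNIV :: 'n set) = {k}" by auto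
    then have "CARD('n) = 1" by (metis card_1_singleton_iff One_nat_def)
    then show False using dim by simp
  qed
  then have "GL_path (- {k}) N" by (intro GL_path_connected supp detN)
  then obtain \<phi> where f: "continuous_on {0..1::real} \<phi>" "\<phi> 0 = mat 1" "\<phi> 1 = N"
    "\<forall>t\<in>{0..1}. supported_on (- {k}) (\<phi> t) \<and> det (\<phi> t) \<noteq> 0"
    by (rule GL_pathE)
  define \<Lambda> where "\<Lambda> \<tau> y = R (\<phi> \<tau> *v S y)" for \<tau> y
  show ?thesis
  proof (rule that[of \<Lambda>])
    have "continuous_on ({0..1::real} \<times> UNIV) (\<lambda>p. R (\<phi> (fst p) *v S (snd p)))"
    proof (rule linear_continuous_on_compose[OF _ linR])
      have c1: "continuous_on ({0..1::real} \<times> UNIV) (\<lambda>p. \<phi> (fst p))"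
        by (rule continuous_on_compose2[OF f(1) continuous_on_fst[OF continuous_on_id]]) auto
      have c2: "continuous_on ({0..1::real} \<times> UNIV) (\<lambda>p. S (snd p))"
        by (rule linear_continuous_on_compose[OF _ S(1)]) (rule continuous_on_snd[OF continuous_on_id])
      show "continuous_on ({0..1::real} \<times> UNIV) (\<lambda>p. \<phi> (fst p) *v S (snd p))"
        unfolding matrix_vector_mult_def by (intro continuous_on_vec_lambda continuous_intros c1 c2)
    qed
    then show "continuous_on ({0..1::real} \<times> UNIV) (\<lambda>(\<tau>, y). \<Lambda> \<tau> y)" by (simp add: \<Lambda>_def case_prod_unfold)
    show "\<Lambda> 0 y = y" for y using S(3) by (simp add: \<Lambda>_def f(2))
    show "\<Lambda> 1 y = proj_off e (g y)" if "y \<bullet> e = 0" for y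
      unfolding \<Lambda>_def f(3) Nv using that S(3) by (simp add: L_def)
    fix \<tau> :: real assume t: "\<tau> \<in> {0..1}"
    have lin: "linear (\<Lambda> \<tau>)"
      unfolding \<Lambda>_def using linear_compose[OF linear_compose[OF S(1) matrix_vector_mul_linear] linR] by (simp add: o_def)
    have inj: "inj (\<Lambda> \<tau>)"
    proof (rule injI)
      fix x y assume "\<Lambda> \<tau> x = \<Lambda> \<tau> y"
      then have "\<phi> \<tau> *v S x = \<phi> \<tau> *v S y" using S(2) unfolding \<Lambda>_def by metis
      moreover have "inj ((*v) (\<phi> \<tau>))" using bspec[OF f(4) t] by (simp add: inj_matrix_vector_mult invertible_det_nz)
      ultimately have "S x = S y" by (simp add: injD)
      then show "x = y" using S(3) by metis
    qed
    have pres: "\<Lambda> \<tau> y \<bullet> e = y \<bullet> e" for y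
    proof -
      have "(\<phi> \<tau> *v S y) $ k = (\<Sum>j\<in>UNIV. \<phi> \<tau> $ k $ j * S y $ j)" by (simp add: matrix_vector_mult_def)
      also have "\<dots> = (\<Sum>j\<in>UNIV. if j = k then S y $ k else 0)"
        using bspec[OF f(4) t] by (intro sum.cong) (auto simp: supported_on_def)
      finally show ?thesis unfolding \<Lambda>_def Re using Se by simp
    qed
    have surj: "surj (\<Lambda> \<tau>)" by (rule linear_inj_imp_surj[OF lin inj])
    have "bij_betw (\<Lambda> \<tau>) {y. y \<bullet> e = 0} {y. y \<bullet> e = 0}"
      unfolding bij_betw_def
    proof
      show "inj_on (\<Lambda> \<tau>) {y. y \<bullet> e = 0}" using inj by (rule inj_on_subset) simp
      show "\<Lambda> \<tau> ` {y. y \<bullet> e = 0} = {y. y \<bullet> e = 0}"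
      proof
        show "\<Lambda> \<tau> ` {y. y \<bullet> e = 0} \<subseteq> {y. y \<bullet> e = 0}" using pres by auto
        show "{y. y \<bullet> e = 0} \<subseteq> \<Lambda> \<tau> ` {y. y \<bullet> e = 0}"
        proof
          fix y assume "y \<in> {y. y \<bullet> e = 0}"
          moreover obtain z where "y = \<Lambda> \<tau> z" using surj by (rule surjE)
          ultimately show "y \<in> \<Lambda> \<tau> ` {y. y \<bullet> e = 0}" using pres by auto
        qed
      qed
    qed
    with lin show "linear (\<Lambda> \<tau>) \<and> bij_betw (\<Lambda> \<tau>) {y. y \<bullet> e = 0} {y. y \<bullet> e = 0}" by blast
  qed
qed

text \<open>Rotations taking one coordinate axis to each \<open>e i\<close> identify the standard
  disc, up to the factor \<eta>, with the bases of the tubes.\<close>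

lemma handlebody_of_model:
  fixes e :: "nat \<Rightarrow> real ^ 'n"
  assumes "handle_model n e \<omega> c C \<Lambda>"
  shows "is_handlebody n (cball 0 1 \<union> handle_model.handles n e \<omega> c C)"
proof -
  interpret handle_model n e \<omega> c C \<Lambda> by fact
  obtain k :: 'n where "True" by blast
  have "\<exists>R :: real ^ 'n \<Rightarrow> real ^ 'n. orthogonal_transformation R \<and> R (axis k 1) = e i" if "i < n" for i
  proof -
    have "norm (axis k 1 :: real ^ 'n) = norm (e i)" using unit[OF that] by simp
    then obtain R :: "real ^ 'n \<Rightarrow> real ^ 'n" where "orthogonal_transformation R" "R (axis k 1) = e i" by (rule orthogonal_transformation_exists)
    then show ?thesis by (intro exI[of _ R] conjI)
  qed
  then have "\<forall>i\<in>{..<n}. \<exists>R :: real ^ 'n \<Rightarrow> real ^ 'n. orthogonal_transformation R \<and> R (axis k 1) = e i" by simp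
  from bchoice[OF this] obtain R :: "nat \<Rightarrow> real ^ 'n \<Rightarrow> real ^ 'n" where "\<forall>i\<in>{..<n}. orthogonal_transformation (R i) \<and> R i (axis k 1) = e i" ..
  then have R: "orthogonal_transformation (R i) \<and> R i (axis k 1) = e i" if "i < n" for i using that by simp
  define D where "D = {y :: real ^ 'n. norm y \<le> 1 \<and> y $ k = 0}"
  define h where "h i = (\<lambda>(t, y). tb i ((1 + t) / 2) (\<eta> *\<^sub>R R i y))" for i
  have RW: "\<eta> *\<^sub>R R i y \<bullet> e i = 0" "norm (\<eta> *\<^sub>R R i y) \<le> \<eta>" if "i < n" "y \<in> D" for i y
  proof -
    have "R i y \<bullet> e i = y \<bullet> axis k 1" using R[OF that(1)] by (metis orthogonal_transformation_def)
    also have "\<dots> = 0" using that(2) by (simp add: D_def inner_axis)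
    finally show "\<eta> *\<^sub>R R i y \<bullet> e i = 0" by simp
    have "norm (R i y) = norm y" using R[OF that(1)] by (simp add: orthogonal_transformation_norm)
    then have "norm (\<eta> *\<^sub>R R i y) \<le> \<eta> * 1" using that(2) eta(1) by (auto simp: D_def intro!: mult_left_mono simp del: mult_1_right)
    then show "norm (\<eta> *\<^sub>R R i y) \<le> \<eta>" by simp
  qed
  have Rimg: "(\<lambda>y. \<eta> *\<^sub>R R i y) ` D = {w. w \<bullet> e i = 0 \<and> norm w \<le> \<eta>}" if i: "i < n" for i
  proof
    show "(\<lambda>y. \<eta> *\<^sub>R R i y) ` D \<subseteq> {w. w \<bullet> e i = 0 \<and> norm w \<le> \<eta>}" using RW[OF i] by auto
    show "{w. w \<bullet> e i = 0 \<and> norm w \<le> \<eta>} \<subseteq> (\<lambda>y. \<eta> *\<^sub>R R i y) ` D"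
    proof safe
      fix w assume w: "w \<bullet> e i = 0" "norm w \<le> \<eta>"
      obtain y where y: "R i y = (1 / \<eta>) *\<^sub>R w" using orthogonal_transformation_surj R[OF i] by (metis surjD)
      have "y \<bullet> axis k 1 = R i y \<bullet> e i" using R[OF i] by (metis orthogonal_transformation_def)
      then have "y $ k = 0" using w y by (simp add: inner_axis)
      moreover have "norm y = norm (R i y)" using R[OF i] by (simp add: orthogonal_transformation_norm)
      then have "\<eta> * norm y \<le> \<eta> * 1" using w y eta(1) by (simp add: field_simps)
      then have "norm y \<le> 1" using eta(1) by (simp only: mult_le_cancel_left_pos)
      ultimately show "w \<in> (\<lambda>y. \<eta> *\<^sub>R R i y) ` D" using y eta(1) by (intro image_eqI[of _ _ y]) (auto simp: D_def)
    qed
  qed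
  have timg: "(\<lambda>t::real. (1 + t) / 2) ` {-1..1} = {0..1}"
    by (auto simp: image_iff intro!: bexI[of _ "2 * x - 1" for x])
  have himg: "h i ` ({-1..1} \<times> D) = (\<lambda>(\<tau>, w). tb i \<tau> w) ` ({0..1} \<times> {w. w \<bullet> e i = 0 \<and> norm w \<le> \<eta>})" if "i < n" for i
  proof -
    have "h i = (\<lambda>(\<tau>, w). tb i \<tau> w) \<circ> map_prod (\<lambda>t. (1 + t) / 2) (\<lambda>y. \<eta> *\<^sub>R R i y)" by (auto simp: h_def fun_eq_iff)
    then have "h i ` ({-1..1} \<times> D) = (\<lambda>(\<tau>, w). tb i \<tau> w) ` (map_prod (\<lambda>t. (1 + t) / 2) (\<lambda>y. \<eta> *\<^sub>R R i y) ` ({-1..1} \<times> D))"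
      by (simp only: image_comp)
    then show ?thesis by (simp only: map_prod_surj_on[OF timg Rimg[OF that]])
  qed
  have td': "tube_data (e i) (\<omega> i) (c i)" if "i < n" for i by (rule td[OF that])
  have hW: "\<eta> *\<^sub>R R i y \<in> tube_data.W (e i)" if "i < n" "y \<in> D" for i y
    using handle_W[OF that(1)] RW[OF that] eta by simp
  have A: "continuous_on ({-1..1} \<times> D) (h i) \<and> inj_on (h i) ({-1..1} \<times> D) \<and>
        h i ` ({-1, 1} \<times> D) \<subseteq> sphere 0 1 \<and> h i ` ({-1<..<1} \<times> D) \<inter> cball 0 1 = {}" if i: "i < n" for i
  proof (intro conjI)
    interpret tube_data "e i" "\<omega> i" "c i" by (rule td[OF i])
    have lin: "linear (R i)" using R[OF i] by (simp add: orthogonal_transformation_linear)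
    have "continuous_on ({-1..1} \<times> D) ((\<lambda>(\<tau>, w). tb i \<tau> w) \<circ> (\<lambda>p. ((1 + fst p) / 2, \<eta> *\<^sub>R R i (snd p))))"
      by (intro continuous_on_compose continuous_on_subset[OF tube_cont] continuous_intros
          linear_continuous_on_compose[OF _ lin])
        (use hW[OF i] in \<open>auto simp: case_prod_unfold\<close>)
    then show "continuous_on ({-1..1} \<times> D) (h i)" by (simp add: h_def o_def case_prod_unfold)
    show "inj_on (h i) ({-1..1} \<times> D)"
    proof (rule inj_onI, clarify)
      fix t y t' y' assume *: "t \<in> {-1..1::real}" "y \<in> D" "t' \<in> {-1..1::real}" "y' \<in> D" "h i (t, y) = h i (t', y')"
      have "(1 + t) / 2 = (1 + t') / 2 \<and> \<eta> *\<^sub>R R i y = \<eta> *\<^sub>R R i y'"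
        by (rule tube_inj) (use * hW[OF i] in \<open>auto simp: h_def\<close>)
      then show "t = t' \<and> y = y'" using eta(1) R[OF i] orthogonal_transformation_inj by (auto dest: injD)
    qed
    show "h i ` ({-1, 1} \<times> D) \<subseteq> sphere 0 1" using norm_tube_ends hW[OF i] by (auto simp: h_def)
    show "h i ` ({-1<..<1} \<times> D) \<inter> cball 0 1 = {}"
    proof -
      have "norm (h i (t, y)) > 1" if "t \<in> {-1<..<1}" "y \<in> D" for t y
        unfolding h_def using tube_outside[OF hW[OF i that(2)], of "(1 + t) / 2"] that(1) by auto
      then show ?thesis by fastforce
    qed
  qed
  have B: "h i ` ({-1..1} \<times> D) \<inter> h j ` ({-1..1} \<times> D) = {}" if ij: "i < n" "j < n" "i \<noteq> j" for i j
  proof -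
    have "norm w \<le> \<eta> \<Longrightarrow> norm w \<le> 2 / sqrt (1 + C\<^sup>2)" for w :: "real ^ 'n"
    proof -
      have "2 / sqrt (1 + C\<^sup>2) = 2 * \<eta>" by (simp add: \<eta>_def)
      then show "norm w \<le> \<eta> \<Longrightarrow> norm w \<le> 2 / sqrt (1 + C\<^sup>2)" using eta(1) by linarith
    qed
    then show ?thesis unfolding himg[OF ij(1)] himg[OF ij(2)] using tubes_disj[OF ij] by fastforce
  qed
  have U: "cball 0 1 \<union> handles = cball 0 1 \<union> (\<Union>i<n. h i ` ({-1..1} \<times> D))"
    unfolding handles_def using himg by simp
  show ?thesis unfolding is_handlebody_def Let_def
  proof (rule exI[of _ k], rule exI[of _ h], fold D_def, intro conjI)
    show "\<forall>i<n. \<forall>j<n. i \<noteq> j \<longrightarrow> h i ` ({-1..1} \<times> D) \<inter> h j ` ({-1..1} \<times> D) = {}"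
      by (intro allI impI B)
  qed (use A in blast, rule U)
qed

section \<open>The quotient of the fundamental domain\<close>

text \<open>\<open>F k\<close> is homogeneous, \<open>P k\<close> exceeds it by at least
  \<open>\<kappa> k\<close>, and both fall at unit speed along the axis; so each side
  \<open>P k = 0\<close> is a graph over the normal space of its axis.\<close>

locale handle_domain =
  fixes n :: nat and e :: "nat \<Rightarrow> real ^ 'n" and F P :: "nat \<times> bool \<Rightarrow> real ^ 'n \<Rightarrow> real"
    and \<kappa> :: "nat \<times> bool \<Rightarrow> real" and g :: "nat \<Rightarrow> real ^ 'n \<Rightarrow> real ^ 'n" and t :: "nat \<Rightarrow> real ^ 'n"
  assumes dim: "CARD('n) \<ge> 3"
    and unit_e: "i < n \<Longrightarrow> norm (e i) = 1"
    and cont_F: "k \<in> letters n \<Longrightarrow> continuous_on UNIV (F k)"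
    and F_scale: "k \<in> letters n \<Longrightarrow> r \<ge> 0 \<Longrightarrow> F k (r *\<^sub>R x) = r * F k x"
    and F_shift: "k \<in> letters n \<Longrightarrow> F k (x + s *\<^sub>R axis_of e k) = F k x - s"
    and F_disj: "k \<in> letters n \<Longrightarrow> l \<in> letters n \<Longrightarrow> k \<noteq> l \<Longrightarrow> F k x \<le> 0 \<Longrightarrow> F l x \<le> 0 \<Longrightarrow> x = 0"
    and cont_P: "k \<in> letters n \<Longrightarrow> continuous_on UNIV (P k)"
    and P_shift: "k \<in> letters n \<Longrightarrow> P k (x + s *\<^sub>R axis_of e k) = P k x - s"
    and kappa: "k \<in> letters n \<Longrightarrow> \<kappa> k > 0"
    and P_ge: "k \<in> letters n \<Longrightarrow> F k x + \<kappa> k \<le> P k x"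
    and lin_g: "i < n \<Longrightarrow> linear (g i)"
    and g_e: "i < n \<Longrightarrow> g i (e i) = e i"
    and det_g: "i < n \<Longrightarrow> det (matrix (g i)) > 0"
    and P_g: "i < n \<Longrightarrow> P (i, True) (g i x + t i) = - P (i, False) x"
begin

abbreviation K where "K \<equiv> letters n"
abbreviation ev where "ev \<equiv> axis_of e"

lemma unit_ev: "k \<in> K \<Longrightarrow> norm (ev k) = 1"
  using unit_e[of "fst k"] by (simp add: axis_of_def letters_iff)

lemma F_0: "k \<in> K \<Longrightarrow> F k 0 = 0" using F_scale[of k 0 0] by simp

lemma F_neg: "k \<in> K \<Longrightarrow> l \<in> K \<Longrightarrow> k \<noteq> l \<Longrightarrow> F k x \<le> 0 \<Longrightarrow> F l x \<ge> 0"
  using F_disj[of k l x] F_0[of l] by (cases "F l x \<le> 0") auto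

lemma F_neg': assumes "k \<in> K" "l \<in> K" "F k x < 0" "F l x \<le> 0" shows "k = l"
proof (rule ccontr)
  assume "k \<noteq> l"
  then have "x = 0" using F_disj assms by simp
  then show False using assms F_0 by simp
qed

lemma e_distinct: assumes "i < n" "j < n" "i \<noteq> j" shows "e i \<noteq> e j \<and> e i \<noteq> - e j"
proof -
  have F1: "F (i, False) (e i) = -1"
    using F_shift[of "(i, False)" 0 1] F_0[of "(i, False)"] assms by (simp add: letters_iff axis_of_def)
  have F2: "F (j, b) (axis_of e (j, b)) = -1" for b
    using F_shift[of "(j, b)" 0 1] F_0[of "(j, b)"] assms by (simp add: letters_iff)
  show ?thesis
    using F_neg'[of "(i, False)" "(j, False)" "e i"] F_neg'[of "(i, False)" "(j, True)" "e i"]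
      F1 F2[of False] F2[of True] assms by (auto simp: letters_iff axis_of_def)
qed

text \<open>On the normal space \<open>F k\<close> is at most \<open>C\<close> times the norm, by
  compactness of the sphere, and both functions fall at the same speed along the axis. So a narrow
  enough round cone lies inside the cone of \<open>F k\<close>; the lower bound \<open>C0\<close>
  lets it be as narrow as desired.\<close>

lemma cone_bound: "\<exists>C>0. C \<ge> C0 \<and> (\<forall>k\<in>K. \<forall>x. F k x \<le> round_cone C (ev k) x)"
proof -
  have "\<exists>C. \<forall>x\<in>sphere 0 1. F k x \<le> C" if k: "k \<in> K" for k
  proof -
    have "compact (F k ` sphere 0 1)"
      by (intro compact_continuous_image continuous_on_subset[OF cont_F[OF k]]) auto
    then have "bounded (F k ` sphere 0 1)" by (rule compact_imp_bounded)
    then show ?thesis unfolding bounded_real by (metis abs_le_D1 imageI)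
  qed
  then have "\<forall>k\<in>K. \<exists>C. \<forall>x\<in>sphere 0 1. F k x \<le> C" by blast
  from bchoice[OF this] obtain c where c: "\<forall>k\<in>K. \<forall>x\<in>sphere 0 1. F k x \<le> c k" ..
  define C where "C = Max (insert 1 (insert C0 (c ` K)))"
  have f: "finite (insert 1 (insert C0 (c ` K)))" by simp
  have C1: "C \<ge> 1" unfolding C_def by (intro Max_ge[OF f]) auto
  have C0: "C \<ge> C0" unfolding C_def by (intro Max_ge[OF f]) auto
  have Ck: "C \<ge> c k" if "k \<in> K" for k unfolding C_def using that by (intro Max_ge[OF f]) auto
  have "F k x \<le> round_cone C (ev k) x" if k: "k \<in> K" for k x
  proof -
    define y where "y = proj_off (ev k) x"
    have "F k y \<le> C * norm y"
    proof (cases "y = 0")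
      case False
      then have "F k y = norm y * F k ((1 / norm y) *\<^sub>R y)" using F_scale[OF k, of "norm y" "(1 / norm y) *\<^sub>R y"] by simp
      also have "F k ((1 / norm y) *\<^sub>R y) \<le> C"
      proof -
        have "(1 / norm y) *\<^sub>R y \<in> sphere 0 1" using False by simp
        then have "F k ((1 / norm y) *\<^sub>R y) \<le> c k" using c k by blast
        then show ?thesis using Ck[OF k] by simp
      qed
      then have "norm y * F k ((1 / norm y) *\<^sub>R y) \<le> norm y * C" by (intro mult_left_mono) auto
      finally show ?thesis by (simp add: mult.commute)
    qed (use F_0[OF k] in simp)
    moreover have "x = y + (x \<bullet> ev k) *\<^sub>R ev k" by (simp add: y_def proj_off_def)
    then have "F k x = F k y - x \<bullet> ev k" using F_shift[OF k, of y "x \<bullet> ev k"] by simp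
    ultimately show ?thesis by (simp add: round_cone_def y_def)
  qed
  then show ?thesis using C1 C0 by (intro exI[of _ C]) auto
qed

definition D where "D = {x. \<forall>k\<in>K. P k x \<ge> 0}"

text \<open>\<open>\<theta>\<close> moves points along the axes so as to carry each set \<open>P k \<ge> 0\<close> to the set \<open>round_cone C (ev k) \<ge> -2\<close>.\<close>

theorem handlebody_quotient:
  obtains H :: "(real ^ 'n) set" and \<Phi> where "is_handlebody n H" "continuous_on D \<Phi>" "open (\<Phi> ` D) \<Longrightarrow> \<Phi> ` D = interior H"
    "\<And>x y. x \<in> D \<Longrightarrow> y \<in> D \<Longrightarrow> \<Phi> x = \<Phi> y \<longleftrightarrow> x = y \<or>
      (\<exists>i<n. P (i, False) x = 0 \<and> y = g i x + t i \<or> P (i, False) y = 0 \<and> x = g i y + t i)"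
proof -
  obtain \<omega> c r where tubes: "\<And>i. i < n \<Longrightarrow> tube_data (e i) (\<omega> i) (c i)" "0 < r" "r < 1/2"
    "\<And>i j \<tau> \<tau>' w w'. i < n \<Longrightarrow> j < n \<Longrightarrow> i \<noteq> j \<Longrightarrow> \<tau> \<in> {0..1} \<Longrightarrow> \<tau>' \<in> {0..1} \<Longrightarrow>
      w \<bullet> e i = 0 \<Longrightarrow> w' \<bullet> e j = 0 \<Longrightarrow> norm w \<le> r \<Longrightarrow> norm w' \<le> r \<Longrightarrow>
      tube (e i) (\<omega> i) (c i) \<tau> w \<noteq> tube (e j) (\<omega> j) (c j) \<tau>' w'"
    by (rule tubes_exist[of n e]) (use unit_e dim e_distinct in auto)
  \<comment> \<open>\<open>C \<ge> 4 / r\<close> makes the doubled handle radius at most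
    \<open>r\<close>, and with \<open>r < 1/2\<close> it also gives the smallness required by
    \<open>handle_model\<close>.\<close>
  obtain C where C: "C > 0" "C \<ge> 4 / r" "\<And>k x. k \<in> K \<Longrightarrow> F k x \<le> round_cone C (ev k) x"
    using cone_bound by blast
  have sq: "C < sqrt (1 + C\<^sup>2)" using C(1) by (intro real_less_rsqrt) simp
  have "4 / r > 8" using tubes(2,3) by (simp add: field_simps)
  then have C8: "C > 8" using C(2) by linarith
  have small: "4 / sqrt (1 + C\<^sup>2) < 1"
  proof -
    have "sqrt (1 + C\<^sup>2) > 4" using sq C8 by linarith
    moreover have "4 / q < 1" if "q > 4" for q :: real using that by simp
    ultimately show ?thesis by blast
  qed
  have small2: "2 / sqrt (1 + C\<^sup>2) \<le> r"
  proof -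
    have "2 / sqrt (1 + C\<^sup>2) \<le> 4 / C" using sq C(1) by (intro frac_le) auto
    also have "\<dots> \<le> r" using C(1,2) tubes(2) by (simp add: field_simps)
    finally show ?thesis .
  qed
  have "\<exists>\<Lambda> :: real \<Rightarrow> real ^ 'n \<Rightarrow> real ^ 'n. continuous_on ({0..1::real} \<times> UNIV) (\<lambda>(\<tau>, y). \<Lambda> \<tau> y) \<and>
      (\<forall>\<tau>\<in>{0..1}. linear (\<Lambda> \<tau>) \<and> bij_betw (\<Lambda> \<tau>) {y. y \<bullet> e i = 0} {y. y \<bullet> e i = 0}) \<and>
      (\<forall>y. \<Lambda> 0 y = y) \<and> (\<forall>y. y \<bullet> e i = 0 \<longrightarrow> \<Lambda> 1 y = proj_off (e i) (g i y))" if i: "i < n" for i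
  proof -
    have "CARD('n) \<ge> 2" using dim by simp
    then obtain \<Lambda> :: "real \<Rightarrow> real ^ 'n \<Rightarrow> real ^ 'n" where "continuous_on ({0..1::real} \<times> UNIV) (\<lambda>(\<tau>, y). \<Lambda> \<tau> y)"
      "\<And>\<tau>. \<tau> \<in> {0..1} \<Longrightarrow> linear (\<Lambda> \<tau>) \<and> bij_betw (\<Lambda> \<tau>) {y. y \<bullet> e i = 0} {y. y \<bullet> e i = 0}"
      "\<And>y. \<Lambda> 0 y = y" "\<And>y. y \<bullet> e i = 0 \<Longrightarrow> \<Lambda> 1 y = proj_off (e i) (g i y)"
      by (rule linear_isotopy[OF unit_e[OF i] lin_g[OF i] g_e[OF i] det_g[OF i]]) blast
    then show ?thesis by (intro exI[of _ \<Lambda>]) simp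
  qed
  then have "\<forall>i\<in>{..<n}. \<exists>\<Lambda> :: real \<Rightarrow> real ^ 'n \<Rightarrow> real ^ 'n. continuous_on ({0..1::real} \<times> UNIV) (\<lambda>(\<tau>, y). \<Lambda> \<tau> y) \<and>
      (\<forall>\<tau>\<in>{0..1}. linear (\<Lambda> \<tau>) \<and> bij_betw (\<Lambda> \<tau>) {y. y \<bullet> e i = 0} {y. y \<bullet> e i = 0}) \<and>
      (\<forall>y. \<Lambda> 0 y = y) \<and> (\<forall>y. y \<bullet> e i = 0 \<longrightarrow> \<Lambda> 1 y = proj_off (e i) (g i y))" by blast
  from bchoice[OF this] obtain \<Lambda> :: "nat \<Rightarrow> real \<Rightarrow> real ^ 'n \<Rightarrow> real ^ 'n" where
    L: "\<forall>i\<in>{..<n}. continuous_on ({0..1::real} \<times> UNIV) (\<lambda>(\<tau>, y). \<Lambda> i \<tau> y) \<and>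
      (\<forall>\<tau>\<in>{0..1}. linear (\<Lambda> i \<tau>) \<and> bij_betw (\<Lambda> i \<tau>) {y. y \<bullet> e i = 0} {y. y \<bullet> e i = 0}) \<and>
      (\<forall>y. \<Lambda> i 0 y = y) \<and> (\<forall>y. y \<bullet> e i = 0 \<longrightarrow> \<Lambda> i 1 y = proj_off (e i) (g i y))" ..
  \<comment> \<open>The linear isotopy plus a translation growing linearly: at \<tau> = 1 it is the
    map induced by \<open>g i x + t i\<close> on normal parts.\<close>
  define M where "M i \<tau> y = \<Lambda> i \<tau> y + \<tau> *\<^sub>R proj_off (e i) (t i)" for i \<tau> y
  interpret hm: handle_model n e \<omega> c C M
  proof (rule handle_model.intro)
    fix i j assume i: "i < n"
    show "tube_data (e i) (\<omega> i) (c i)" by (rule tubes(1)[OF i])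
    have Li: "continuous_on ({0..1::real} \<times> UNIV) (\<lambda>(\<tau>, y). \<Lambda> i \<tau> y)"
      "\<And>\<tau>. \<tau> \<in> {0..1} \<Longrightarrow> bij_betw (\<Lambda> i \<tau>) {y. y \<bullet> e i = 0} {y. y \<bullet> e i = 0}" "\<And>y. \<Lambda> i 0 y = y"
      using bspec[OF L, of i] i by auto
    show "continuous_on ({0..1} \<times> {y. y \<bullet> e i = 0}) (\<lambda>(\<tau>, y). M i \<tau> y)"
      unfolding M_def using continuous_on_subset[OF Li(1), of "{0..1} \<times> {y. y \<bullet> e i = 0}"]
      by (auto simp: case_prod_unfold intro!: continuous_intros)
    show "M i 0 y = y" for y using Li(3) by (simp add: M_def)
    have po: "proj_off (e i) (t i) \<bullet> e i = 0" by (rule proj_off_orth[OF unit_e[OF i]])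
    fix \<tau> :: real assume tau: "\<tau> \<in> {0..1}"
    have "bij_betw (\<lambda>y. y + \<tau> *\<^sub>R proj_off (e i) (t i)) {y. y \<bullet> e i = 0} {y. y \<bullet> e i = 0}"
      by (rule bij_betw_byWitness[where f' = "\<lambda>y. y - \<tau> *\<^sub>R proj_off (e i) (t i)"])
        (auto simp: inner_add_left inner_diff_left po)
    from bij_betw_trans[OF Li(2)[OF tau] this] show "bij_betw (M i \<tau>) {y. y \<bullet> e i = 0} {y. y \<bullet> e i = 0}"
      by (simp add: o_def M_def[abs_def])
  next
    fix k l x assume kl: "k \<in> K" "l \<in> K" "k \<noteq> l" "round_cone C (ev k) x \<le> 0" "round_cone C (ev l) x \<le> 0"
    then show "x = 0" using F_disj[OF kl(1-3)] C(3)[OF kl(1), of x] C(3)[OF kl(2), of x] by simp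
  next
    fix i j \<tau> \<tau>' w w' assume *: "i < n" "j < n" "i \<noteq> j" "\<tau> \<in> {0..1::real}" "\<tau>' \<in> {0..1::real}"
      "w \<bullet> e i = 0" "w' \<bullet> e j = 0" "norm w \<le> 2 / sqrt (1 + C\<^sup>2)" "norm w' \<le> 2 / sqrt (1 + C\<^sup>2)"
    show "tube (e i) (\<omega> i) (c i) \<tau> w \<noteq> tube (e j) (\<omega> j) (c j) \<tau>' w'"
      by (rule tubes(4)[OF *(1-7)]) (use *(8,9) small2 in linarith)+
  qed (use C small in auto)
  let ?N = "\<lambda>k. round_cone C (ev k)"
  have N_ge: "F k x \<le> ?N k x" if "k \<in> K" for k x by (rule C(3)[OF that])
  \<comment> \<open>On a line parallel to the axis \<open>?N k - F k\<close> and
    \<open>P k - F k\<close> are constant, and \<theta> multiplies \<open>F k\<close> by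
    \<open>(?N k - F k + 2) / (P k - F k)\<close> where \<open>F k \<le> 0\<close>. This fixes
    \<open>F k = 0\<close> and sends \<open>P k = 0\<close> to \<open>?N k = -2\<close>. At most one
    summand is nonzero.\<close>
  define \<theta> where "\<theta> x = x + (\<Sum>k\<in>K. (max 0 (- F k x) * ((?N k x - F k x + 2) / (P k x - F k x) - 1)) *\<^sub>R ev k)" for x
  have PF: "P k x - F k x > 0" if "k \<in> K" for k x using P_ge[OF that, of x] kappa[OF that] by simp
  have th_k: "\<theta> x = x + ((- F k x) * ((?N k x - F k x + 2) / (P k x - F k x) - 1)) *\<^sub>R ev k"
    if k: "k \<in> K" "F k x \<le> 0" for k x
  proof -
    have "(max 0 (- F l x) * ((?N l x - F l x + 2) / (P l x - F l x) - 1)) *\<^sub>R ev l =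
        (if l = k then ((- F k x) * ((?N k x - F k x + 2) / (P k x - F k x) - 1)) *\<^sub>R ev k else 0)" if "l \<in> K" for l
      using F_neg[OF k(1) that _ k(2)] k(2) by (cases "l = k") auto
    then show ?thesis unfolding \<theta>_def using k(1) by (simp add: sum.delta cong: sum.cong)
  qed
  have th_0: "\<theta> x = x" if "\<And>k. k \<in> K \<Longrightarrow> F k x \<ge> 0" for x
    unfolding \<theta>_def using that by (simp cong: sum.cong)
  have Fth: "F k (\<theta> x) = F k x * ((?N k x - F k x + 2) / (P k x - F k x))" if k: "k \<in> K" "F k x \<le> 0" for k x
  proof -
    have "a - (- a) * (q - 1) = a * q" for a q :: real by (simp add: algebra_simps)
    then show ?thesis unfolding th_k[OF k] F_shift[OF k(1)] by blast
  qed
  have m_pos: "(?N k x - F k x + 2) / (P k x - F k x) > 0" if k: "k \<in> K" for k x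
    using PF[OF k, of x] N_ge[OF k, of x] by simp
  have line: "?N k (x + s *\<^sub>R ev k) - F k (x + s *\<^sub>R ev k) = ?N k x - F k x"
    "P k (x + s *\<^sub>R ev k) - F k (x + s *\<^sub>R ev k) = P k x - F k x" if k: "k \<in> K" for k x s
    using round_cone_shift[OF unit_ev[OF k]] F_shift[OF k] P_shift[OF k] by simp_all
  have inv_th: "?N k (\<theta> x) - F k (\<theta> x) = ?N k x - F k x" "P k (\<theta> x) - F k (\<theta> x) = P k x - F k x"
    "proj_off (ev k) (\<theta> x) = proj_off (ev k) x" if k: "k \<in> K" "F k x \<le> 0" for k x
  proof -
    have "proj_off (ev k) (x + s *\<^sub>R ev k) = proj_off (ev k) x" for s
      using unit_ev[OF k(1)] by (simp add: proj_off_add proj_off_scale)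
    then show "?N k (\<theta> x) - F k (\<theta> x) = ?N k x - F k x" "P k (\<theta> x) - F k (\<theta> x) = P k x - F k x"
      "proj_off (ev k) (\<theta> x) = proj_off (ev k) x"
      unfolding th_k[OF k] using line[OF k(1)] by blast+
  qed
  have Nth: "?N k (\<theta> x) + 2 = P k x * ((?N k x - F k x + 2) / (P k x - F k x))" if k: "k \<in> K" "F k x \<le> 0" for k x
  proof -
    have "?N k (\<theta> x) + 2 = F k (\<theta> x) + (?N k x - F k x + 2)" using inv_th(1)[OF k] by simp
    also have "?N k x - F k x + 2 = (P k x - F k x) * ((?N k x - F k x + 2) / (P k x - F k x))" using PF[OF k(1), of x] by simp
    finally show ?thesis unfolding Fth[OF k] by (simp only: flip: distrib_right) simp
  qed
  have Fth_sign: "F k (\<theta> x) < 0 \<longleftrightarrow> F k x < 0" if k: "k \<in> K" for k x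
  proof (cases "F k x \<le> 0")
    case True
    have "a * q < 0 \<longleftrightarrow> a < 0" if "q > 0" for a q :: real using that by (auto simp: mult_less_0_iff)
    from this[OF m_pos[OF k, of x]] show ?thesis unfolding Fth[OF k True] .
  next
    case False
    show ?thesis
    proof (cases "\<exists>l\<in>K. F l x \<le> 0")
      case True
      then obtain l where l: "l \<in> K" "F l x \<le> 0" by blast
      have "F l (\<theta> x) \<le> 0" unfolding Fth[OF l] using l(2) m_pos[OF l(1), of x] by (intro mult_nonpos_nonneg) simp_all
      moreover have "l \<noteq> k" using l False by metis
      ultimately have "F k (\<theta> x) \<ge> 0" using F_neg[OF l(1) k, of "\<theta> x"] by simp
      then show ?thesis using False by simp
    next
      case F2: False
      then have "\<theta> x = x" by (intro th_0) (meson linear)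
      then show ?thesis by simp
    qed
  qed
  have D_img: "\<theta> x \<in> hm.Dh \<longleftrightarrow> x \<in> D" for x
  proof -
    have "(?N k (\<theta> x) \<ge> -2) \<longleftrightarrow> (P k x \<ge> 0)" if k: "k \<in> K" for k
    proof (cases "F k x < 0")
      case True
      then have "?N k (\<theta> x) + 2 = P k x * ((?N k x - F k x + 2) / (P k x - F k x))" by (intro Nth k) simp
      moreover have "a * q \<ge> 0 \<longleftrightarrow> a \<ge> 0" if "q > 0" for a q :: real using that by (auto simp: zero_le_mult_iff)
      note this[OF m_pos[OF k, of x], of "P k x"]
      ultimately show ?thesis by linarith
    next
      case False
      then have "F k (\<theta> x) \<ge> 0" using Fth_sign[OF k, of x] by simp
      then have "?N k (\<theta> x) \<ge> 0" using N_ge[OF k, of "\<theta> x"] by simp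
      moreover have "P k x \<ge> 0" using False P_ge[OF k, of x] kappa[OF k] by simp
      ultimately show ?thesis by simp
    qed
    then show ?thesis by (auto simp: hm.Dh_def D_def)
  qed
  have th_inj: "x = y" if eq: "\<theta> x = \<theta> y" for x y
  proof (cases "\<exists>k\<in>K. F k x < 0")
    case True
    then obtain k where k: "k \<in> K" "F k x < 0" by blast
    then have ky: "F k y < 0" using Fth_sign[OF k(1), of x] Fth_sign[OF k(1), of y] eq by simp
    have kx': "F k x \<le> 0" and ky': "F k y \<le> 0" using k ky by auto
    have mm: "?N k x - F k x = ?N k y - F k y" "P k x - F k x = P k y - F k y"
      using inv_th(1,2)[OF k(1) kx'] inv_th(1,2)[OF k(1) ky'] eq by simp_all
    have "a = b" if "a * q = b * q" "q > 0" for a b q :: real using that by simp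
    moreover have "F k x * ((?N k y - F k y + 2) / (P k y - F k y)) = F k y * ((?N k y - F k y + 2) / (P k y - F k y))"
      using Fth[OF k(1) kx'] Fth[OF k(1) ky'] unfolding eq mm by linarith
    ultimately have FF: "F k x = F k y" using m_pos[OF k(1), of y] by blast
    define v where "v = (- F k y * ((?N k y - F k y + 2) / (P k y - F k y) - 1)) *\<^sub>R ev k"
    have "\<theta> x = x + v" using th_k[OF k(1) kx'] unfolding FF mm[unfolded FF] v_def .
    moreover have "\<theta> y = y + v" using th_k[OF k(1) ky'] unfolding v_def .
    ultimately have "x + v = y + v" using eq by metis
    then show ?thesis by (rule add_right_imp_eq)
  next
    case False
    then have Fx: "\<not> F k x < 0" if "k \<in> K" for k using that by blast
    then have "\<theta> x = x" by (intro th_0) (simp add: not_less)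
    moreover have "F k y \<ge> 0" if "k \<in> K" for k
      using Fx[OF that] Fth_sign[OF that, of x] Fth_sign[OF that, of y] eq by (simp add: not_less)
    then have "\<theta> y = y" by (rule th_0)
    ultimately show ?thesis using eq by metis
  qed
  have th_surj: "\<exists>x. \<theta> x = z" for z
  proof (cases "\<exists>k\<in>K. F k z < 0")
    case True
    then obtain k where k: "k \<in> K" "F k z < 0" by blast
    define m p where "m = ?N k z - F k z + 2" and "p = P k z - F k z"
    have mp: "m > 0" "p > 0" using N_ge[OF k(1), of z] PF[OF k(1), of z] by (auto simp: m_def p_def)
    define x where "x = z + (F k z - F k z * p / m) *\<^sub>R ev k"
    have Fx: "F k x = F k z * p / m" unfolding x_def F_shift[OF k(1)] by simp
    have mx: "?N k x - F k x + 2 = m" "P k x - F k x = p" using line[OF k(1)] by (simp_all add: x_def m_def p_def)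
    have "F k x \<le> 0" unfolding Fx using k mp by (simp add: divide_nonpos_pos mult_nonpos_nonneg)
    from th_k[OF k(1) this] have "\<theta> x = x + (- (F k z * p / m) * (m / p - 1)) *\<^sub>R ev k" unfolding mx unfolding Fx by simp
    also have "- (F k z * p / m) * (m / p - 1) = F k z * p / m - F k z" using mp by (simp add: field_simps)
    also have "x + (F k z * p / m - F k z) *\<^sub>R ev k = z" unfolding x_def by (simp add: algebra_simps)
    finally show ?thesis by blast
  next
    case False
    then have "\<theta> z = z" by (intro th_0) (meson not_le)
    then show ?thesis by blast
  qed
  have img: "\<theta> ` D = hm.Dh"
  proof
    show "\<theta> ` D \<subseteq> hm.Dh" using D_img by auto
    show "hm.Dh \<subseteq> \<theta> ` D"
    proof
      fix z assume z: "z \<in> hm.Dh"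
      obtain x where "\<theta> x = z" using th_surj by blast
      then show "z \<in> \<theta> ` D" using D_img[of x] z by blast
    qed
  qed
  have cont_th: "continuous_on UNIV \<theta>"
  proof -
    have "P k x - F k x \<noteq> 0" if "k \<in> K" for k x using PF[OF that, of x] by simp
    then show ?thesis unfolding \<theta>_def
      by (intro continuous_intros continuous_on_sum continuous_on_max continuous_round_cone cont_F cont_P) auto
  qed
  define \<Phi> where "\<Phi> = hm.model \<circ> \<theta>"
  have Phi_img: "\<Phi> ` D = ball 0 1 \<union> (\<Union>i<n. hm.Tset i)" unfolding \<Phi>_def image_comp[symmetric] img by (rule hm.model_image)
  have match: "hm.matched i (\<theta> x) (\<theta> y) \<longleftrightarrow> P (i, False) x = 0 \<and> y = g i x + t i"
    if i: "i < n" and xy: "x \<in> D" "y \<in> D" for i x y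
  proof -
    have k: "(i, b) \<in> K" for b using i by (simp add: letters_iff)
    have Nz: "?N (i, b) (\<theta> x) = -2 \<longleftrightarrow> P (i, b) x = 0" for b x
    proof (cases "F (i, b) x < 0")
      case True
      then have "?N (i, b) (\<theta> x) + 2 = P (i, b) x * ((?N (i, b) x - F (i, b) x + 2) / (P (i, b) x - F (i, b) x))" by (intro Nth k) simp
      moreover have "a * q = 0 \<longleftrightarrow> a = 0" if "q > 0" for a q :: real using that by auto
      note this[OF m_pos[OF k, of b x], of "P (i, b) x"]
      ultimately have "?N (i, b) (\<theta> x) + 2 = 0 \<longleftrightarrow> P (i, b) x = 0" by simp
      then show ?thesis by linarith
    next
      case False
      then have "F (i, b) (\<theta> x) \<ge> 0" using Fth_sign[OF k, of b x] by simp
      then have "?N (i, b) (\<theta> x) \<ge> 0" using N_ge[OF k, of b "\<theta> x"] by simp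
      moreover have "P (i, b) x > 0" using False P_ge[OF k, of b x] kappa[OF k, of b] by simp
      ultimately show ?thesis by simp
    qed
    have pr_th: "proj_off (e i) (\<theta> x) = proj_off (e i) x" if "P (i, b) x = 0" for b x
    proof -
      have "F (i, b) x \<le> 0" using that P_ge[OF k, of b x] kappa[OF k, of b] by simp
      then have "proj_off (axis_of e (i, b)) (\<theta> x) = proj_off (axis_of e (i, b)) x" by (intro inv_th k)
      then show ?thesis by (cases b) (simp_all add: axis_of_def)
    qed
    have L1: "M i 1 (proj_off (e i) x) = proj_off (e i) (g i x + t i)" for x
    proof -
      have "proj_off (e i) x \<bullet> e i = 0" by (rule proj_off_orth[OF unit_e[OF i]])
      then have "\<Lambda> i 1 (proj_off (e i) x) = proj_off (e i) (g i (proj_off (e i) x))" using bspec[OF L, of i] i by auto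
      also have "g i (proj_off (e i) x) = g i x - (x \<bullet> e i) *\<^sub>R e i"
        unfolding proj_off_def using lin_g[OF i] g_e[OF i] by (simp add: linear_diff linear_scale)
      also have "proj_off (e i) (g i x - (x \<bullet> e i) *\<^sub>R e i) = proj_off (e i) (g i x)"
        using proj_off_add[of "e i" "g i x" "- ((x \<bullet> e i) *\<^sub>R e i)"] proj_off_scale[of "e i" "- (x \<bullet> e i)" "e i"] unit_e[OF i] by simp
      finally show ?thesis by (simp add: M_def proj_off_add)
    qed
    \<comment> \<open>The face \<open>P (i, True) = 0\<close> is a graph over the normal space, so
      equal normal parts mean equal points.\<close>
    have uniq: "y = y'" if "P (i, True) y = 0" "P (i, True) y' = 0" "proj_off (e i) y = proj_off (e i) y'" for y y'
    proof -
      have d: "y = proj_off (e i) y + (- (y \<bullet> e i)) *\<^sub>R axis_of e (i, True)" for y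
        by (simp add: proj_off_def axis_of_def)
      have "P (i, True) y = P (i, True) (proj_off (e i) y) + y \<bullet> e i" for y
        using P_shift[OF k, of True "proj_off (e i) y" "- (y \<bullet> e i)"] d[of y] by simp
      then have "y \<bullet> e i = y' \<bullet> e i" using that by (metis add_left_cancel)
      then show ?thesis using d[of y] d[of y'] that(3) by simp
    qed
    have "hm.matched i (\<theta> x) (\<theta> y) \<longleftrightarrow> P (i, False) x = 0 \<and> P (i, True) y = 0 \<and> proj_off (e i) y = proj_off (e i) (g i x + t i)"
    proof -
      have "proj_off (e i) (\<theta> y) = M i 1 (proj_off (e i) (\<theta> x)) \<longleftrightarrow> proj_off (e i) y = proj_off (e i) (g i x + t i)"
        if "P (i, False) x = 0" "P (i, True) y = 0"
        using pr_th[OF that(1)] pr_th[OF that(2)] L1 by simp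
      then show ?thesis unfolding hm.matched_def Nz by blast
    qed
    also have "\<dots> \<longleftrightarrow> P (i, False) x = 0 \<and> y = g i x + t i"
      using P_g[OF i, of x] uniq[of y "g i x + t i"] by auto
    finally show ?thesis .
  qed
  show ?thesis
  proof (rule that[of "cball 0 1 \<union> hm.handles" \<Phi>])
    show "is_handlebody n (cball 0 1 \<union> hm.handles)" by (rule handlebody_of_model) (rule hm.handle_model_axioms)
    show "continuous_on D \<Phi>" unfolding \<Phi>_def
      by (intro continuous_on_compose continuous_on_subset[OF cont_th]) (use img hm.cont_model in auto)
    show "\<Phi> ` D = interior (cball 0 1 \<union> hm.handles)" if "open (\<Phi> ` D)"
      using hm.interior_handlebody that unfolding Phi_img by simp
    fix x y assume xy: "x \<in> D" "y \<in> D"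
    have h: "\<theta> x \<in> hm.Dh" "\<theta> y \<in> hm.Dh" using D_img xy by auto
    have "\<Phi> x = \<Phi> y \<longleftrightarrow> \<theta> x = \<theta> y \<or> (\<exists>i<n. hm.matched i (\<theta> x) (\<theta> y) \<or> hm.matched i (\<theta> y) (\<theta> x))"
      unfolding \<Phi>_def o_apply using hm.model_eq_imp[OF h] hm.matched_model by metis
    also have "\<theta> x = \<theta> y \<longleftrightarrow> x = y" using th_inj by blast
    finally show "\<Phi> x = \<Phi> y \<longleftrightarrow> x = y \<or>
      (\<exists>i<n. P (i, False) x = 0 \<and> y = g i x + t i \<or> P (i, False) y = 0 \<and> x = g i y + t i)"
      using match xy by (metis (no_types, lifting))
  qed
qed

end

section \<open>The splitting by moduli of eigenvalues\<close>

text \<open>The polynomial \<open>p\<close> in the operator \<open>g\<close>, applied to a vector,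
  by Horner's scheme. Real coefficients keep the kernels in the real space; complex roots enter only
  through \<open>cpoly\<close>.\<close>

definition papp :: "('a::real_vector \<Rightarrow> 'a) \<Rightarrow> real poly \<Rightarrow> 'a \<Rightarrow> 'a" where
  "papp g p = fold_coeffs (\<lambda>a f x. a *\<^sub>R x + g (f x)) p (\<lambda>x. 0)"

abbreviation cpoly :: "real poly \<Rightarrow> complex poly" where
  "cpoly \<equiv> map_poly complex_of_real"

lemma cpoly_pCons: "cpoly (pCons a p) = pCons (of_real a) (cpoly p)"
  by (simp add: map_poly_pCons)

lemma cpoly_mult: "cpoly (p * q) = cpoly p * cpoly q"
  by (intro poly_eqI) (simp add: coeff_map_poly coeff_mult)

lemma cpoly_degree: "degree (cpoly p) = degree p"
  by (simp add: degree_map_poly)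

lemma cpoly_root_exists:
  assumes "degree p > 0" obtains z where "poly (cpoly p) z = 0"
proof -
  have "\<not> constant (poly (cpoly p))" using assms by (simp add: constant_degree cpoly_degree)
  then show ?thesis using fundamental_theorem_of_algebra that by blast
qed

text \<open>The real irreducible factor of a root is linear or has a conjugate pair of roots. Either
  way its roots share one modulus, so factors can be grouped by modulus.\<close>

lemma cpoly_root_factor:
  assumes root: "poly (cpoly p) z = 0"
  obtains q r where "p = q * r" "Im z = 0 \<and> q = [:- Re z, 1:] \<or> Im z \<noteq> 0 \<and> q = [:(cmod z)\<^sup>2, - 2 * Re z, 1:]"
proof (cases "Im z = 0")
  case True
  then have "z = of_real (Re z)" by (simp add: complex_eq_iff)
  moreover have "poly (cpoly p) (of_real r) = of_real (poly p r)" for r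
    by (induction p rule: pCons_induct) (simp_all add: cpoly_pCons)
  ultimately have "of_real (poly p (Re z)) = (0 :: complex)" using root by metis
  then have "poly p (Re z) = 0" by simp
  then have "[:- Re z, 1:] dvd p" by (simp add: poly_eq_0_iff_dvd)
  then show ?thesis using that True by (auto simp: dvd_def)
next
  case False
  define q where "q = [:(cmod z)\<^sup>2, - 2 * Re z, 1:]"
  have q0: "q \<noteq> 0" and dq: "degree q = 2" by (simp_all add: q_def)
  have qz: "poly (cpoly q) z = 0"
    by (simp add: q_def cpoly_pCons complex_eq_iff cmod_power2) (simp add: power2_eq_square algebra_simps)
  define r where "r = p mod q"
  have p: "p = q * (p div q) + r" by (simp add: r_def)
  have cadd: "cpoly (a + b) = cpoly a + cpoly b" for a b by (intro poly_eqI) (simp add: coeff_map_poly)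
  have rz: "poly (cpoly r) z = 0" using root qz by (subst (asm) p) (simp add: cadd cpoly_mult)
  have dr: "degree r < 2" using degree_mod_less[OF q0, of p] dq by (auto simp: r_def)
  then obtain a b where r: "r = [:a, b:]"
    by (cases r rule: pCons_cases) (metis degree_pCons_eq_if less_2_cases_iff degree_0_id degree_eq_zeroE One_nat_def Suc_inject pCons_0_0)
  have "b * Im z = 0 \<and> a + b * Re z = 0" using rz by (simp add: r cpoly_pCons complex_eq_iff mult.commute)
  then have "r = 0" using False r by auto
  then show ?thesis using that[of q "p div q"] p False by (auto simp: q_def)
qed

lemma quadratic_roots:
  "poly (cpoly [:(cmod z)\<^sup>2, - 2 * Re z, 1:]) w = 0 \<Longrightarrow> cmod w = cmod z"
proof -
  assume "poly (cpoly [:(cmod z)\<^sup>2, - 2 * Re z, 1:]) w = 0"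
  moreover have "poly (cpoly [:(cmod z)\<^sup>2, - 2 * Re z, 1:]) w = (w - z) * (w - cnj z)"
    by (simp add: cpoly_pCons complex_eq_iff cmod_power2) (simp add: power2_eq_square algebra_simps)
  ultimately have "w = z \<or> w = cnj z" by simp
  then show ?thesis by auto
qed

lemma factor_by_class:
  fixes p :: "real poly"
  assumes "p \<noteq> 0"
  shows "\<exists>p1 p2 p3. p = p1 * p2 * p3 \<and> (\<forall>z. poly (cpoly p1) z = 0 \<longrightarrow> cmod z < 1) \<and>
    (\<forall>z. poly (cpoly p2) z = 0 \<longrightarrow> cmod z = 1) \<and> (\<forall>z. poly (cpoly p3) z = 0 \<longrightarrow> cmod z > 1)"
  using assms
proof (induction "degree p" arbitrary: p rule: less_induct)
  case less
  show ?case
  proof (cases "degree p = 0")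
    case True
    then obtain c where c: "p = [:c:]" "c \<noteq> 0" using less.prems by (metis degree_eq_zeroE pCons_0_0)
    then show ?thesis by (intro exI[of _ "[:c:]"] exI[of _ 1]) (auto simp: cpoly_pCons map_poly_1)
  next
    case False
    then obtain z where z: "poly (cpoly p) z = 0" using cpoly_root_exists by blast
    obtain q r where qr: "p = q * r" "Im z = 0 \<and> q = [:- Re z, 1:] \<or> Im z \<noteq> 0 \<and> q = [:(cmod z)\<^sup>2, - 2 * Re z, 1:]"
      using cpoly_root_factor[OF z] by metis
    have q: "cmod w = cmod z" if "poly (cpoly q) w = 0" for w
      using qr(2)
    proof
      assume "Im z = 0 \<and> q = [:- Re z, 1:]"
      then have "w = z" using that by (simp add: cpoly_pCons complex_eq_iff)
      then show ?thesis by simp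
    next
      assume "Im z \<noteq> 0 \<and> q = [:(cmod z)\<^sup>2, - 2 * Re z, 1:]"
      then show ?thesis using that quadratic_roots by blast
    qed
    have "r \<noteq> 0" "q \<noteq> 0" using less.prems qr(1) by auto
    moreover have "degree q > 0" using qr(2) by auto
    ultimately have "degree r < degree p" using qr(1) by (simp add: degree_mult_eq)
    then obtain p1 p2 p3 where IH: "r = p1 * p2 * p3" "\<forall>z. poly (cpoly p1) z = 0 \<longrightarrow> cmod z < 1"
      "\<forall>z. poly (cpoly p2) z = 0 \<longrightarrow> cmod z = 1" "\<forall>z. poly (cpoly p3) z = 0 \<longrightarrow> cmod z > 1"
      using less.hyps[OF _ \<open>r \<noteq> 0\<close>] by blast
    consider "cmod z < 1" | "cmod z = 1" | "cmod z > 1" by linarith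
    then show ?thesis
    proof cases
      case 1
      show ?thesis by (rule exI[of _ "q * p1"], rule exI[of _ p2], rule exI[of _ p3])
        (use IH q 1 qr(1) in \<open>auto simp: cpoly_mult algebra_simps\<close>)
    next
      case 2
      show ?thesis by (rule exI[of _ p1], rule exI[of _ "q * p2"], rule exI[of _ p3])
        (use IH q 2 qr(1) in \<open>auto simp: cpoly_mult algebra_simps\<close>)
    next
      case 3
      show ?thesis by (rule exI[of _ p1], rule exI[of _ p2], rule exI[of _ "q * p3"])
        (use IH q 3 qr(1) in \<open>auto simp: cpoly_mult algebra_simps\<close>)
    qed
  qed
qed

text \<open>A nonzero combination of least degree divides both polynomials; its roots would be
  common, so it is constant.\<close>

lemma bezout_no_common_root:
  fixes p q :: "real poly"
  assumes "\<And>z. poly (cpoly p) z = 0 \<Longrightarrow> poly (cpoly q) z \<noteq> 0"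
  obtains a b where "a * p + b * q = 1"
proof -
  define I where "I r \<longleftrightarrow> r \<noteq> 0 \<and> (\<exists>a b. r = a * p + b * q)" for r
  have "p \<noteq> 0 \<or> q \<noteq> 0" using assms[of 0] by auto
  moreover have "p = 1 * p + 0 * q" "q = 0 * p + 1 * q" by simp_all
  ultimately have "\<exists>r. I r" unfolding I_def by metis
  then obtain r where r: "I r" "\<And>s. I s \<Longrightarrow> degree r \<le> degree s" by (metis ex_has_least_nat)
  obtain a b where ab: "r = a * p + b * q" and r0: "r \<noteq> 0" using r(1) by (auto simp: I_def)
  have rem: "r dvd f" if f: "f = c * p + d * q" for f c d
  proof (rule ccontr)
    assume "\<not> r dvd f"
    then have m: "f mod r \<noteq> 0" by (simp add: dvd_eq_mod_eq_0)
    have "f mod r = f - f div r * r" by (simp add: minus_div_mult_eq_mod)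
    also have "\<dots> = (c - f div r * a) * p + (d - f div r * b) * q" by (subst (2) ab, subst (1) f) (simp add: algebra_simps)
    finally have "I (f mod r)" unfolding I_def using m by blast
    then have "degree r \<le> degree (f mod r)" by (rule r(2))
    moreover have "degree (f mod r) < degree r" using degree_mod_less'[OF r0 m] .
    ultimately show False by simp
  qed
  have "r dvd p" "r dvd q" using rem[of p 1 0] rem[of q 0 1] by simp_all
  have "degree r = 0"
  proof (rule ccontr)
    assume "degree r \<noteq> 0"
    then obtain z where "poly (cpoly r) z = 0" using cpoly_root_exists by blast
    then have "poly (cpoly p) z = 0" "poly (cpoly q) z = 0" using \<open>r dvd p\<close> \<open>r dvd q\<close> by (auto simp: dvd_def cpoly_mult)
    then show False using assms by blast
  qed
  then obtain k where k: "r = [:k:]" "k \<noteq> 0" using r0 by (metis degree_eq_zeroE pCons_0_0)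
  have "smult (1 / k) a * p + smult (1 / k) b * q = smult (1 / k) r" by (simp add: ab smult_add_right)
  also have "\<dots> = 1" using k by (simp add: one_pCons)
  finally show ?thesis using that by blast
qed

section \<open>Polynomials in a linear map\<close>

locale poly_map =
  fixes g :: "real ^ 'n \<Rightarrow> real ^ 'n"
  assumes lin: "linear g"
begin

lemma papp_0 [simp]: "papp g 0 x = 0" by (simp add: papp_def)

lemma papp_pCons [simp]: "papp g (pCons a p) x = a *\<^sub>R x + g (papp g p x)"
proof (cases "a = 0 \<and> p = 0")
  case True
  then show ?thesis using lin by (simp add: papp_def linear_0)
next
  case False
  then show ?thesis unfolding papp_def by (cases "a = 0") auto
qed

lemma papp_add: "papp g (p + q) x = papp g p x + papp g q x"
proof (induction p arbitrary: q rule: pCons_induct)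
  case (pCons a p)
  show ?case by (cases q rule: pCons_cases) (simp add: pCons.IH linear_add[OF lin] scaleR_left_distrib)
qed simp

lemma papp_smult: "papp g (smult c p) x = c *\<^sub>R papp g p x"
  by (induction p rule: pCons_induct) (simp_all add: linear_scale[OF lin] scaleR_add_right)

lemma linear_papp: "linear (papp g p)"
proof (induction p rule: pCons_induct)
  case 0
  show ?case by (rule linearI) simp_all
next
  case (pCons a p)
  then show ?case
    by (intro linearI) (simp_all add: linear_add[OF pCons(2)] linear_add[OF lin] linear_scale[OF pCons(2)] linear_scale[OF lin] algebra_simps)
qed

lemma papp_g: "papp g p (g x) = g (papp g p x)"
  by (induction p rule: pCons_induct) (simp_all add: linear_0[OF lin] linear_add[OF lin] linear_scale[OF lin])

lemma papp_mult: "papp g (p * q) x = papp g p (papp g q x)"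
  by (induction p rule: pCons_induct) (simp_all add: papp_add papp_smult)

lemma papp_1 [simp]: "papp g 1 x = x"
  by (simp add: one_pCons linear_0[OF lin])

lemma papp_monom: "papp g (monom c i) x = c *\<^sub>R (g ^^ i) x"
  by (induction i) (simp_all add: monom_0 monom_Suc linear_0[OF lin] linear_scale[OF lin])

lemma papp_in: "subspace U \<Longrightarrow> (\<And>x. x \<in> U \<Longrightarrow> g x \<in> U) \<Longrightarrow> x \<in> U \<Longrightarrow> papp g p x \<in> U"
  by (induction p rule: pCons_induct) (auto simp: subspace_0 subspace_add subspace_scale)

lemma papp_sum: "papp g (sum f I) x = (\<Sum>i\<in>I. papp g (f i) x)"
  by (induction I rule: infinite_finite_induct) (auto simp: papp_add)

text \<open>Among the iterates \<open>(g ^^ i) x\<close> with \<open>i\<close> up to the dimension,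
  two coincide or there is a linear relation; either is a polynomial killing
  \<open>x\<close>.\<close>

lemma vector_annihilator: "\<exists>p. p \<noteq> 0 \<and> papp g p x = 0"
proof (cases "inj_on (\<lambda>i. (g ^^ i) x) {..DIM(real ^ 'n)}")
  case False
  then obtain i j where ij: "i \<noteq> j" "(g ^^ i) x = (g ^^ j) x" by (auto simp: inj_on_def)
  define p :: "real poly" where "p = monom 1 i + monom (-1) j"
  have "coeff p i = 1" using ij by (simp add: p_def)
  then have "p \<noteq> 0" by auto
  moreover have "papp g p x = 0" using ij by (simp add: p_def papp_add papp_monom)
  ultimately show ?thesis by blast
next
  case True
  define f where "f i = (g ^^ i) x" for i
  define A where "A = f ` {..DIM(real ^ 'n)}"
  have inj: "inj_on f {..DIM(real ^ 'n)}" using True by (simp add: f_def[abs_def])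
  have "finite A" "card A = DIM(real ^ 'n) + 1" using card_image[OF inj] by (auto simp: A_def)
  then have "dependent A" using dependent_biggerset[of A] by simp
  then obtain u v where u: "(\<Sum>a\<in>A. u a *\<^sub>R a) = 0" "v \<in> A" "u v \<noteq> 0"
    using dependent_finite[OF \<open>finite A\<close>] by blast
  define p :: "real poly" where "p = (\<Sum>i\<le>DIM(real ^ 'n). monom (u (f i)) i)"
  obtain j where j: "j \<le> DIM(real ^ 'n)" "v = f j" using u(2) by (auto simp: A_def)
  have "coeff p j = u (f j)" using j by (simp add: p_def coeff_sum sum.delta)
  then have "p \<noteq> 0" using u(3) j by auto
  have "papp g p x = (\<Sum>i\<le>DIM(real ^ 'n). u (f i) *\<^sub>R f i)" by (simp add: p_def papp_sum papp_monom f_def)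
  also have "\<dots> = (\<Sum>a\<in>A. u a *\<^sub>R a)" unfolding A_def sum.reindex[OF inj] by simp
  finally show ?thesis using u(1) \<open>p \<noteq> 0\<close> by auto
qed

lemma annihilator: "\<exists>p. p \<noteq> 0 \<and> (\<forall>x. papp g p x = 0)"
proof -
  have "\<forall>x. \<exists>p. p \<noteq> 0 \<and> papp g p x = 0" using vector_annihilator by blast
  from choice[OF this] obtain q where q: "\<forall>x. q x \<noteq> 0 \<and> papp g (q x) x = 0" ..
  define p where "p = (\<Prod>b\<in>Basis. q b)"
  have z: "papp g p b = 0" if "b \<in> Basis" for b
  proof -
    have "p = (\<Prod>b\<in>Basis - {b}. q b) * q b" unfolding p_def using that by (subst prod.remove[OF finite_Basis that]) (simp add: mult.commute)
    then show ?thesis using q linear_0[OF linear_papp] by (simp add: papp_mult)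
  qed
  have "papp g p x = 0" for x
  proof -
    have "papp g p (\<Sum>b\<in>Basis. (x \<bullet> b) *\<^sub>R b) = (\<Sum>b\<in>Basis. (x \<bullet> b) *\<^sub>R papp g p b)"
      by (simp add: linear_sum[OF linear_papp] linear_scale[OF linear_papp])
    also have "\<dots> = 0" using z by simp
    finally show ?thesis by (simp add: euclidean_representation)
  qed
  moreover have "p \<noteq> 0" unfolding p_def using q by simp
  ultimately show ?thesis by blast
qed

text \<open>On \<open>u + \<i> v\<close> the complexified map is multiplication by \<open>z\<close>,
  so \<open>papp g p\<close> is multiplication by the value of \<open>p\<close> at
  \<open>z\<close>.\<close>

lemma eigen_papp:
  assumes "g u = Re z *\<^sub>R u - Im z *\<^sub>R v" "g v = Im z *\<^sub>R u + Re z *\<^sub>R v"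
  shows "papp g p u = Re (poly (cpoly p) z) *\<^sub>R u - Im (poly (cpoly p) z) *\<^sub>R v \<and>
    papp g p v = Im (poly (cpoly p) z) *\<^sub>R u + Re (poly (cpoly p) z) *\<^sub>R v"
proof (induction p rule: pCons_induct)
  case (pCons a p)
  let ?w = "poly (cpoly p) z"
  have "g (papp g p u) = Re ?w *\<^sub>R g u - Im ?w *\<^sub>R g v" "g (papp g p v) = Im ?w *\<^sub>R g u + Re ?w *\<^sub>R g v"
    using pCons.IH by (simp_all add: linear_diff[OF lin] linear_add[OF lin] linear_scale[OF lin])
  then show ?case unfolding papp_pCons assms cpoly_pCons
    by (simp add: algebra_simps)
qed simp

lemma eigenvalue_root:
  assumes "eigenvalue_on g U z" "\<And>x. x \<in> U \<Longrightarrow> papp g p x = 0"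
  shows "poly (cpoly p) z = 0"
proof -
  obtain u v where uv: "u \<in> U" "v \<in> U" "u \<noteq> 0 \<or> v \<noteq> 0" "g u = Re z *\<^sub>R u - Im z *\<^sub>R v" "g v = Im z *\<^sub>R u + Re z *\<^sub>R v"
    using assms(1) by (auto simp: eigenvalue_on_def)
  define \<alpha> \<beta> where "\<alpha> = Re (poly (cpoly p) z)" and "\<beta> = Im (poly (cpoly p) z)"
  have 1: "\<alpha> *\<^sub>R u - \<beta> *\<^sub>R v = 0" "\<beta> *\<^sub>R u + \<alpha> *\<^sub>R v = 0"
    using eigen_papp[OF uv(4,5), of p] assms(2) uv(1,2) by (auto simp: \<alpha>_def \<beta>_def)
  have "(\<alpha>\<^sup>2 + \<beta>\<^sup>2) *\<^sub>R u = \<alpha> *\<^sub>R (\<alpha> *\<^sub>R u - \<beta> *\<^sub>R v) + \<beta> *\<^sub>R (\<beta> *\<^sub>R u + \<alpha> *\<^sub>R v)"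
    "(\<alpha>\<^sup>2 + \<beta>\<^sup>2) *\<^sub>R v = \<alpha> *\<^sub>R (\<beta> *\<^sub>R u + \<alpha> *\<^sub>R v) - \<beta> *\<^sub>R (\<alpha> *\<^sub>R u - \<beta> *\<^sub>R v)"
    by (simp_all add: algebra_simps power2_eq_square)
  then have "(\<alpha>\<^sup>2 + \<beta>\<^sup>2) *\<^sub>R u = 0" "(\<alpha>\<^sup>2 + \<beta>\<^sup>2) *\<^sub>R v = 0" unfolding 1 by simp_all
  then have "\<alpha>\<^sup>2 + \<beta>\<^sup>2 = 0" using uv(3) by (metis scaleR_eq_0_iff)
  then show ?thesis by (simp add: complex_eq_iff \<alpha>_def \<beta>_def sum_power2_eq_zero_iff)
qed

text \<open>Descent on the degree of \<open>r = q * t\<close> with \<open>q\<close> the irreducible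
  factor of a root: either \<open>t\<close> already kills \<open>U\<close>, or some
  \<open>papp g t x\<close> is a nonzero vector killed by \<open>q\<close> and gives an eigenvector
  for that root.\<close>

lemma eigenvalue_exists:
  assumes U: "subspace U" "\<And>x. x \<in> U \<Longrightarrow> g x \<in> U"
    and r: "r \<noteq> 0" and "\<And>x. x \<in> U \<Longrightarrow> papp g r x = 0" and "U \<noteq> {0}"
  shows "\<exists>z. eigenvalue_on g U z \<and> poly (cpoly r) z = 0"
  using r assms(4)
proof (induction "degree r" arbitrary: r rule: less_induct)
  case less
  obtain x0 where x0: "x0 \<in> U" "x0 \<noteq> 0" using assms(5) subspace_0[OF U(1)] by blast
  have "degree r > 0"
  proof (rule ccontr)
    assume "\<not> ?thesis"
    then obtain c where "r = [:c:]" "c \<noteq> 0" using less.prems(1) by (metis degree_eq_zeroE pCons_0_0 neq0_conv)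
    then show False using less.prems(2)[OF x0(1)] x0(2) by (simp add: linear_0[OF lin])
  qed
  then obtain z where z: "poly (cpoly r) z = 0" using cpoly_root_exists by blast
  obtain q t where qt: "r = q * t" "Im z = 0 \<and> q = [:- Re z, 1:] \<or> Im z \<noteq> 0 \<and> q = [:(cmod z)\<^sup>2, - 2 * Re z, 1:]"
    using cpoly_root_factor[OF z] by metis
  have t0: "t \<noteq> 0" "q \<noteq> 0" "degree q > 0" using less.prems(1) qt by auto
  then have dt: "degree t < degree r" using qt(1) by (simp add: degree_mult_eq)
  show ?case
  proof (cases "\<forall>x\<in>U. papp g t x = 0")
    case True
    then obtain w where "eigenvalue_on g U w" "poly (cpoly t) w = 0" using less.hyps[OF dt t0(1)] by blast
    then show ?thesis using qt(1) by (auto simp: cpoly_mult)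
  next
    case False
    then obtain x where x: "x \<in> U" "papp g t x \<noteq> 0" by blast
    define u where "u = papp g t x"
    have u: "u \<in> U" "u \<noteq> 0" "papp g q u = 0"
      using x papp_in[OF U] less.prems(2)[OF x(1)] qt(1) by (auto simp: u_def papp_mult)
    have "eigenvalue_on g U z" using qt(2)
    proof
      assume q: "Im z = 0 \<and> q = [:- Re z, 1:]"
      then have "g u = Re z *\<^sub>R u" using u(3) by (simp add: linear_0[OF lin] algebra_simps)
      then show ?thesis unfolding eigenvalue_on_def using q u subspace_0[OF U(1)]
        by (intro bexI[of _ u] bexI[of _ 0]) (auto simp: linear_0[OF lin])
    next
      assume q: "Im z \<noteq> 0 \<and> q = [:(cmod z)\<^sup>2, - 2 * Re z, 1:]"
      \<comment> \<open>Solves the first eigenvector equation; the second one is then the quadratic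
        relation satisfied by \<open>u\<close>.\<close>
      define v where "v = (1 / Im z) *\<^sub>R (Re z *\<^sub>R u - g u)"
      have gg: "g (g u) = Re z *\<^sub>R g u + (Re z *\<^sub>R g u - ((Re z)\<^sup>2 + (Im z)\<^sup>2) *\<^sub>R u)"
      proof -
        have "((Re z)\<^sup>2 + (Im z)\<^sup>2) *\<^sub>R u + g ((- (2 * Re z)) *\<^sub>R u + g u) = 0"
          using u(3) q by (simp add: linear_0[OF lin] cmod_power2)
        then have "((Re z)\<^sup>2 + (Im z)\<^sup>2) *\<^sub>R u + ((- (2 * Re z)) *\<^sub>R g u + g (g u)) = 0"
          by (simp only: linear_add[OF lin] linear_scale[OF lin])
        moreover have "G2 = r *\<^sub>R G + (r *\<^sub>R G - k *\<^sub>R u)" if eq: "k *\<^sub>R u + ((- (2 * r)) *\<^sub>R G + G2) = 0"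
          for G G2 :: "real ^ 'n" and r k
        proof (subst vec_eq_iff, rule allI)
          fix i
          have "k * u $ i + ((- (2 * r)) * G $ i + G2 $ i) = 0" using arg_cong[OF eq, of "\<lambda>v. v $ i"] by simp
          then show "G2 $ i = (r *\<^sub>R G + (r *\<^sub>R G - k *\<^sub>R u)) $ i" by (simp add: algebra_simps)
        qed
        from this[OF calculation] show ?thesis .
      qed
      have "Im z *\<^sub>R v = Re z *\<^sub>R u - g u" using q by (simp add: v_def)
      then have 1: "g u = Re z *\<^sub>R u - Im z *\<^sub>R v" by simp
      have "Im z *\<^sub>R g v = Re z *\<^sub>R g u - g (g u)"
        using q by (simp add: v_def linear_scale[OF lin] linear_diff[OF lin])
      also have "\<dots> = Im z *\<^sub>R (Im z *\<^sub>R u + Re z *\<^sub>R v)"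
        unfolding gg unfolding 1 by (simp add: algebra_simps power2_eq_square)
      finally have 2: "g v = Im z *\<^sub>R u + Re z *\<^sub>R v" using q by simp
      have "v \<in> U" unfolding v_def using u(1) U by (auto intro!: subspace_scale subspace_diff)
      then show ?thesis unfolding eigenvalue_on_def using u 1 2 by blast
    qed
    then show ?thesis using z by blast
  qed
qed

end

lemma in_split_parts:
  assumes "modulus_splitting g U1 U2 U3"
  shows "subspace U1" "subspace U2" "subspace U3" "\<And>x. x \<in> U1 \<Longrightarrow> g x \<in> U1" "\<And>x. x \<in> U2 \<Longrightarrow> g x \<in> U2"
    "\<And>x. x \<in> U3 \<Longrightarrow> g x \<in> U3"
    "\<And>z. eigenvalue_on g U1 z \<Longrightarrow> cmod z < 1" "\<And>z. eigenvalue_on g U2 z \<Longrightarrow> cmod z = 1"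
    "\<And>z. eigenvalue_on g U3 z \<Longrightarrow> cmod z > 1"
    "\<And>x. \<exists>a b c. a \<in> U1 \<and> b \<in> U2 \<and> c \<in> U3 \<and> x = a + b + c"
    "\<And>a b c a' b' c'. a \<in> U1 \<Longrightarrow> b \<in> U2 \<Longrightarrow> c \<in> U3 \<Longrightarrow> a' \<in> U1 \<Longrightarrow> b' \<in> U2 \<Longrightarrow> c' \<in> U3 \<Longrightarrow>
      a + b + c = a' + b' + c' \<Longrightarrow> a = a' \<and> b = b' \<and> c = c'"
proof -
  have ex: "\<exists>!t. case t of (a, b, c) \<Rightarrow> a \<in> U1 \<and> b \<in> U2 \<and> c \<in> U3 \<and> x = a + b + c" for x
    using assms unfolding modulus_splitting_def by (elim conjE) (erule spec)
  show "\<exists>a b c. a \<in> U1 \<and> b \<in> U2 \<and> c \<in> U3 \<and> x = a + b + c" for x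
    using ex1_implies_ex[OF ex[of x]] by auto
  show "a = a' \<and> b = b' \<and> c = c'" if *: "a \<in> U1" "b \<in> U2" "c \<in> U3" "a' \<in> U1" "b' \<in> U2" "c' \<in> U3"
      "a + b + c = a' + b' + c'" for a b c a' b' c'
  proof -
    obtain t0 where "\<And>t. (case t of (a', b', c') \<Rightarrow> a' \<in> U1 \<and> b' \<in> U2 \<and> c' \<in> U3 \<and> a + b + c = a' + b' + c') \<Longrightarrow> t = t0"
      using ex[of "a + b + c"] by (elim ex1E) blast
    from this[of "(a, b, c)"] this[of "(a', b', c')"] show ?thesis using * by auto
  qed
qed (use assms in \<open>auto simp: modulus_splitting_def invariant_subspace_def\<close>)

text \<open>This makes the descriptions \<open>V_lt\<close>, \<open>V_eq\<close> and
  \<open>V_gt\<close> meaningful. Existence is the kernel decomposition of an annihilating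
  polynomial with factors grouped by modulus. For uniqueness, the product of the other two factors
  acts injectively, hence bijectively, on a part of any splitting, so this part lies in the
  corresponding kernel; nested direct decompositions coincide.\<close>

theorem modulus_splitting_unique_exists:
  fixes g :: "real ^ 'n \<Rightarrow> real ^ 'n"
  assumes lin: "linear g"
  shows "modulus_splitting g (V_lt g) (V_eq g) (V_gt g)"
proof -
  interpret poly_map g by (rule poly_map.intro[OF lin])
  obtain p where p: "p \<noteq> 0" "\<And>x. papp g p x = 0" using annihilator by blast
  obtain p1 p2 p3 where f: "p = p1 * p2 * p3" and c1: "\<And>z. poly (cpoly p1) z = 0 \<Longrightarrow> cmod z < 1"
    and c2: "\<And>z. poly (cpoly p2) z = 0 \<Longrightarrow> cmod z = 1" and c3: "\<And>z. poly (cpoly p3) z = 0 \<Longrightarrow> cmod z > 1"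
  proof -
    obtain p1 p2 p3 where "p = p1 * p2 * p3" "\<forall>z. poly (cpoly p1) z = 0 \<longrightarrow> cmod z < 1"
      "\<forall>z. poly (cpoly p2) z = 0 \<longrightarrow> cmod z = 1" "\<forall>z. poly (cpoly p3) z = 0 \<longrightarrow> cmod z > 1"
      using factor_by_class[OF p(1)] by (elim exE conjE)
    then show ?thesis using that[of p1 p2 p3] by simp
  qed
  define E where "E q = {x. papp g q x = 0}" for q
  have subE: "subspace (E q)" for q
    using linear_papp[of q] by (auto simp: E_def subspace_def linear_0 linear_add linear_scale)
  have invE: "g x \<in> E q" if "x \<in> E q" for q x using that by (simp add: E_def papp_g linear_0[OF lin])
  have E_mult: "papp g q x \<in> E r" if "r * q = p * s" for r q s x
  proof -
    have "papp g r (papp g q x) = papp g (p * s) x" unfolding papp_mult[symmetric] that ..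
    also have "\<dots> = 0" by (simp add: papp_mult p(2))
    finally show ?thesis by (simp add: E_def)
  qed
  obtain a b where ab: "a * p1 + b * (p2 * p3) = 1"
    by (rule bezout_no_common_root[of p1 "p2 * p3"]) (use c1 c2 c3 in \<open>force simp: cpoly_mult\<close>, blast)
  obtain c d where cd: "c * p2 + d * p3 = 1"
    by (rule bezout_no_common_root[of p2 p3]) (use c2 c3 in force, blast)
  have split: "\<exists>x1 x2 x3. x1 \<in> E p1 \<and> x2 \<in> E p2 \<and> x3 \<in> E p3 \<and> x = x1 + x2 + x3" for x
  proof -
    have "x = papp g (a * p1) x + papp g (b * (p2 * p3)) x" unfolding papp_add[symmetric] ab by simp
    moreover define y where "y = papp g (a * p1) x"
    moreover have "y = papp g (c * p2) y + papp g (d * p3) y" unfolding papp_add[symmetric] cd by simp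
    moreover have "papp g (b * (p2 * p3)) x \<in> E p1" by (rule E_mult[of _ _ b]) (simp add: f algebra_simps)
    moreover have "papp g (c * p2) y \<in> E p3" unfolding y_def papp_mult[symmetric]
      by (rule E_mult[of _ _ "a * c"]) (simp add: f algebra_simps)
    moreover have "papp g (d * p3) y \<in> E p2" unfolding y_def papp_mult[symmetric]
      by (rule E_mult[of _ _ "a * d"]) (simp add: f algebra_simps)
    ultimately show ?thesis
      by (intro exI[of _ "papp g (b * (p2 * p3)) x"] exI[of _ "papp g (d * p3) y"] exI[of _ "papp g (c * p2) y"])
        (simp add: algebra_simps)
  qed
  have zero: "x1 = 0 \<and> x2 = 0 \<and> x3 = 0" if *: "x1 \<in> E p1" "x2 \<in> E p2" "x3 \<in> E p3" "x1 + x2 + x3 = 0" for x1 x2 x3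
  proof -
    have z: "papp g q 0 = 0" for q using linear_papp by (rule linear_0)
    have e: "papp g p1 x1 = 0" "papp g p2 x2 = 0" "papp g p3 x3 = 0" using * by (auto simp: E_def)
    have x1: "x1 = - x2 - x3" using *(4) by (simp add: algebra_simps eq_neg_iff_add_eq_0)
    have "papp g (p2 * p3) x2 = 0" unfolding mult.commute[of p2] papp_mult e(2) z ..
    moreover have "papp g (p2 * p3) x3 = 0" unfolding papp_mult e(3) z ..
    ultimately have "papp g (p2 * p3) x1 = 0" unfolding x1 by (simp add: linear_diff[OF linear_papp] linear_neg[OF linear_papp])
    then have "papp g (a * p1 + b * (p2 * p3)) x1 = 0" by (simp add: papp_add papp_mult e z)
    then have x10: "x1 = 0" unfolding ab by simp
    then have x2: "x2 = - x3" using *(4) by (simp add: eq_neg_iff_add_eq_0)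
    have "papp g p3 x2 = 0" unfolding x2 by (simp add: linear_neg[OF linear_papp] e)
    then have "papp g (c * p2 + d * p3) x2 = 0" by (simp add: papp_add papp_mult e z)
    then have "x2 = 0" unfolding cd by simp
    then show ?thesis using x10 x2 by simp
  qed
  have eigE: "poly (cpoly q) z = 0" if "eigenvalue_on g (E q) z" for q z
    by (rule eigenvalue_root[OF that]) (simp add: E_def)
  have M: "modulus_splitting g (E p1) (E p2) (E p3)"
    unfolding modulus_splitting_def invariant_subspace_def
  proof (intro conjI allI impI subE)
    fix x
    obtain x1 x2 x3 where x: "x1 \<in> E p1" "x2 \<in> E p2" "x3 \<in> E p3" "x = x1 + x2 + x3" using split by blast
    show "\<exists>!(a, b, c). a \<in> E p1 \<and> b \<in> E p2 \<and> c \<in> E p3 \<and> x = a + b + c"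
    proof (rule ex1I[of _ "(x1, x2, x3)"])
      show "case (x1, x2, x3) of (a, b, c) \<Rightarrow> a \<in> E p1 \<and> b \<in> E p2 \<and> c \<in> E p3 \<and> x = a + b + c" using x by simp
      fix t assume t: "case t of (a, b, c) \<Rightarrow> a \<in> E p1 \<and> b \<in> E p2 \<and> c \<in> E p3 \<and> x = a + b + c"
      obtain y1 y2 y3 where ty: "t = (y1, y2, y3)" by (cases t) auto
      have "(x1 - y1) + (x2 - y2) + (x3 - y3) = 0" using t ty x(4) by (simp add: algebra_simps)
      moreover have "x1 - y1 \<in> E p1" "x2 - y2 \<in> E p2" "x3 - y3 \<in> E p3" using t ty x subE by (auto simp: subspace_diff)
      ultimately have "x1 - y1 = 0 \<and> x2 - y2 = 0 \<and> x3 - y3 = 0" using zero by blast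
      then show "t = (x1, x2, x3)" using ty by simp
    qed
  qed (use invE eigE c1 c2 c3 in auto)
  have uniq: "U1 = E p1 \<and> U2 = E p2 \<and> U3 = E p3" if S: "modulus_splitting g U1 U2 U3" for U1 U2 U3
  proof -
    note s = in_split_parts[OF S] and m = in_split_parts[OF M]
    have sub: "U \<subseteq> E q" if U: "subspace U" "\<And>x. x \<in> U \<Longrightarrow> g x \<in> U" and qr: "q * r = p"
      and no: "\<And>z. eigenvalue_on g U z \<Longrightarrow> poly (cpoly r) z \<noteq> 0" for U q r
    proof -
      define N where "N = {x \<in> U. papp g r x = 0}"
      have "N = U \<inter> E r" by (auto simp: N_def E_def)
      then have sN: "subspace N" using subspace_inter[OF U(1) subE] by metis
      have r0: "r \<noteq> 0" using qr p(1) by auto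
      have "N = {0}"
      proof (rule ccontr)
        assume n: "N \<noteq> {0}"
        have "\<exists>z. eigenvalue_on g N z \<and> poly (cpoly r) z = 0"
          by (rule eigenvalue_exists[OF sN _ r0 _ n]) (use U(2) in \<open>auto simp: N_def papp_g linear_0[OF lin]\<close>)
        then obtain z where "eigenvalue_on g N z" "poly (cpoly r) z = 0" by blast
        moreover from this(1) have "eigenvalue_on g U z" unfolding eigenvalue_on_def N_def by blast
        ultimately show False using no by blast
      qed
      then have inj: "inj_on (papp g r) U"
        using linear_inj_on_iff_eq_0[OF linear_papp U(1)] by (auto simp: N_def)
      have im: "papp g r ` U \<subseteq> U" using papp_in[OF U] by auto
      have "dim (papp g r ` U) = dim U" using dim_image_eq[OF linear_papp, of r U] inj U(1) by (simp add: span_eq_iff[THEN iffD2])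
      then have eq: "papp g r ` U = U"
        using subspace_dim_equal[OF linear_subspace_image[OF linear_papp U(1)] U(1) im] by simp
      show ?thesis
      proof
        fix x assume "x \<in> U"
        then obtain y where "x = papp g r y" using eq by blast
        then show "x \<in> E q" using p(2)[of y] qr by (simp add: E_def papp_mult[symmetric])
      qed
    qed
    have 1: "U1 \<subseteq> E p1"
      by (rule sub[OF s(1,4), of _ "p2 * p3"]) (use c2 c3 s(7) in \<open>force simp: f cpoly_mult algebra_simps\<close>)+
    have 2: "U2 \<subseteq> E p2"
      by (rule sub[OF s(2,5), of _ "p1 * p3"]) (use c1 c3 s(8) in \<open>force simp: f cpoly_mult algebra_simps\<close>)+
    have 3: "U3 \<subseteq> E p3"
      by (rule sub[OF s(3,6), of _ "p1 * p2"]) (use c1 c2 s(9) in \<open>force simp: f cpoly_mult algebra_simps\<close>)+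
    have 0: "0 \<in> E q" for q using subE by (rule subspace_0)
    have "E p1 \<subseteq> U1"
    proof
      fix x assume x: "x \<in> E p1"
      obtain a b c where abc: "a \<in> U1" "b \<in> U2" "c \<in> U3" "x = a + b + c" using s(10) by blast
      have "x = a \<and> 0 = b \<and> 0 = c" by (rule m(11)) (use x abc 1 2 3 0 in auto)
      then show "x \<in> U1" using abc by simp
    qed
    moreover have "E p2 \<subseteq> U2"
    proof
      fix x assume x: "x \<in> E p2"
      obtain a b c where abc: "a \<in> U1" "b \<in> U2" "c \<in> U3" "x = a + b + c" using s(10) by blast
      have "0 = a \<and> x = b \<and> 0 = c" by (rule m(11)) (use x abc 1 2 3 0 in auto)
      then show "x \<in> U2" using abc by simp
    qed
    moreover have "E p3 \<subseteq> U3"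
    proof
      fix x assume x: "x \<in> E p3"
      obtain a b c where abc: "a \<in> U1" "b \<in> U2" "c \<in> U3" "x = a + b + c" using s(10) by blast
      have "0 = a \<and> 0 = b \<and> x = c" by (rule m(11)) (use x abc 1 2 3 0 in auto)
      then show "x \<in> U3" using abc by simp
    qed
    ultimately show ?thesis using 1 2 3 by blast
  qed
  have "V_lt g = E p1" unfolding V_lt_def by (rule the_equality) (use M uniq in blast)+
  moreover have "V_eq g = E p2" unfolding V_eq_def by (rule the_equality) (use M uniq in blast)+
  moreover have "V_gt g = E p3" unfolding V_gt_def by (rule the_equality) (use M uniq in blast)+
  ultimately show ?thesis using M by simp
qed

section \<open>Linear algebra of the quadratic form\<close>

locale signature_form =
  fixes Q :: "real ^ 'n \<Rightarrow> real" and S :: "(real ^ 'n) set" and d :: nat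
  assumes sig: "has_signature Q (d + 1) d" and maxS: "maximal_positive_definite Q S"
    and dim_UNIV: "CARD('n) = 2 * d + 1"
begin

abbreviation B where "B \<equiv> polar Q"

lemma normal_form:
  obtains I :: "'n set" and f h where "card I = d + 1" "linear f" "linear h" "\<And>x. h (f x) = x" "\<And>x. f (h x) = x"
    "\<And>x. Q x = (\<Sum>i\<in>UNIV. (if i \<in> I then 1 else -1) * (h x $ i)\<^sup>2)"
proof -
  obtain I :: "'n set" and f where f: "card I = d + 1" "linear f" "bij f"
    "\<And>x. Q (f x) = (\<Sum>i\<in>I. (x $ i)\<^sup>2) - (\<Sum>i\<in>- I. (x $ i)\<^sup>2)"
    using sig unfolding has_signature_def by blast
  obtain h where h: "linear h" "h \<circ> f = id" using linear_injective_left_inverse[OF f(2) bij_is_inj[OF f(3)]] by blast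
  have hf: "h (f x) = x" for x using h(2) by (metis comp_apply id_apply)
  have fh: "f (h x) = x" for x using bij_is_surj[OF f(3)] hf by (metis surjD)
  have "Q x = (\<Sum>i\<in>UNIV. (if i \<in> I then 1 else -1) * (h x $ i)\<^sup>2)" for x
  proof -
    have "(\<Sum>i\<in>UNIV. (if i \<in> I then 1 else -1) * (h x $ i)\<^sup>2) =
        (\<Sum>i\<in>I. (if i \<in> I then 1 else -1) * (h x $ i)\<^sup>2) + (\<Sum>i\<in>- I. (if i \<in> I then 1 else -1) * (h x $ i)\<^sup>2)"
      by (subst sum.union_disjoint[symmetric]) (auto simp: Compl_partition)
    also have "\<dots> = (\<Sum>i\<in>I. (h x $ i)\<^sup>2) - (\<Sum>i\<in>- I. (h x $ i)\<^sup>2)" by (simp add: sum_negf)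
    finally show ?thesis using f(4)[of "h x"] fh by simp
  qed
  then show ?thesis using that f h(1) hf fh by blast
qed

lemma form_props:
  shows bilinear_B: "bilinear B" and B_sym: "B x y = B y x" and B_self: "B x x = Q x"
    and nondegenerate: "(\<And>y. B x y = 0) \<Longrightarrow> x = 0"
proof -
  obtain I :: "'n set" and f h where f: "card I = d + 1" "linear f" "linear h" "\<And>x. h (f x) = x" "\<And>x. f (h x) = x"
    "\<And>x. Q x = (\<Sum>i\<in>UNIV. (if i \<in> I then 1 else -1) * (h x $ i)\<^sup>2)" using normal_form by blast
  define s :: "'n \<Rightarrow> real" where "s i = (if i \<in> I then 1 else -1)" for i
  have Bf: "B x y = (\<Sum>i\<in>UNIV. s i * (h x $ i * h y $ i))" for x y
  proof -
    have "Q (x + y) - Q x - Q y = (\<Sum>i\<in>UNIV. s i * (h x $ i + h y $ i)\<^sup>2 - s i * (h x $ i)\<^sup>2 - s i * (h y $ i)\<^sup>2)"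
      unfolding f(6) s_def[symmetric] by (simp add: linear_add[OF f(3)] sum_subtractf)
    also have "\<dots> = (\<Sum>i\<in>UNIV. 2 * (s i * (h x $ i * h y $ i)))"
      by (intro sum.cong) (simp_all add: power2_eq_square algebra_simps)
    finally show ?thesis by (simp add: polar_def sum_distrib_left[symmetric])
  qed
  show "bilinear B" unfolding bilinear_def
    by (auto intro!: linearI simp: Bf linear_add[OF f(3)] linear_scale[OF f(3)] algebra_simps sum.distrib sum_distrib_left)
  show "B x y = B y x" unfolding Bf by (simp add: mult.commute)
  show "B x x = Q x" unfolding Bf f(6) s_def by (simp add: power2_eq_square)
  show "x = 0" if z: "\<And>y. B x y = 0"
  proof -
    have "h x $ i = 0" for i
    proof -
      have "B x (f (axis i 1)) = (\<Sum>j\<in>UNIV. if j = i then s i * h x $ i else 0)"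
        unfolding Bf f(4) by (intro sum.cong) (auto simp: axis_def)
      then show ?thesis using z by (simp add: s_def split: if_splits)
    qed
    then have "h x = 0" by (simp add: vec_eq_iff)
    then show ?thesis using f(5)[of x] linear_0[OF f(2)] by simp
  qed
qed

lemmas B_lin = bilinear_ladd[OF bilinear_B] bilinear_radd[OF bilinear_B] bilinear_lmul[OF bilinear_B]
  bilinear_rmul[OF bilinear_B] bilinear_lneg[OF bilinear_B] bilinear_rneg[OF bilinear_B]
  bilinear_lsub[OF bilinear_B] bilinear_rsub[OF bilinear_B] bilinear_lzero[OF bilinear_B] bilinear_rzero[OF bilinear_B]

lemma Q_0: "Q 0 = 0" using B_self[of 0] by (simp add: B_lin)

lemma subS: "subspace S" and posS: "x \<in> S \<Longrightarrow> x \<noteq> 0 \<Longrightarrow> Q x > 0"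
  using maxS by (auto simp: maximal_positive_definite_def positive_definite_subspace_def)

definition T where "T = perp Q S"

lemma T_iff: "y \<in> T \<longleftrightarrow> (\<forall>x\<in>S. B x y = 0)"
  by (simp add: T_def perp_def)

lemma subT: "subspace T"
  by (auto simp: subspace_def T_iff B_lin)

lemma S_T: "x \<in> S \<Longrightarrow> x \<in> T \<Longrightarrow> x = 0"
  using posS[of x] B_self[of x] by (force simp: T_iff)

text \<open>For \<open>x\<close> outside \<open>S\<close> a dimension count gives a nonzero vector
  in the span of \<open>S\<close> and \<open>x\<close> that is orthogonal to \<open>S\<close>;
  positivity on \<open>S\<close> forces it to involve \<open>x\<close>.\<close>

lemma S_plus_T: "\<exists>u\<in>S. x - u \<in> T"
proof (cases "x \<in> S")
  case True
  then show ?thesis using subspace_0[OF subT] by (intro bexI[of _ x]) auto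
next
  case False
  then have "x \<notin> span S" using subS span_eq_iff by blast
  then have "dim S < dim (span (insert x S))" by (simp add: dim_insert)
  then obtain p where p: "p \<in> span (insert x S)" "p \<noteq> 0" "\<And>v. v \<in> S \<Longrightarrow> B p v = 0"
    using orthogonal_vector_exists[OF bilinear_B subspace_span subS] by blast
  obtain c where c: "p - c *\<^sub>R x \<in> S" using p(1) subS by (auto simp: span_insert span_eq_iff[THEN iffD2])
  have pT: "p \<in> T" using p(3) B_sym by (simp add: T_iff)
  have c0: "c \<noteq> 0"
  proof
    assume "c = 0" then have "p \<in> S" using c by simp
    then show False using S_T pT p(2) by blast
  qed
  define u where "u = (- 1 / c) *\<^sub>R (p - c *\<^sub>R x)"
  have "u \<in> S" unfolding u_def by (rule subspace_scale[OF subS c])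
  moreover have "x - u = (1 / c) *\<^sub>R p" unfolding u_def using c0 by (simp add: algebra_simps)
  then have "x - u \<in> T" using subspace_scale[OF subT pT] by simp
  ultimately show ?thesis by blast
qed

text \<open>A vector of \<open>T\<close> with positive value could be added to \<open>S\<close>,
  against maximality.\<close>

lemma T_nonpos: assumes t: "t \<in> T" shows "Q t \<le> 0"
proof (rule ccontr)
  assume "\<not> Q t \<le> 0"
  then have Qt: "Q t > 0" by simp
  have "positive_definite_subspace Q (span (insert t S))"
    unfolding positive_definite_subspace_def
  proof (intro conjI ballI impI subspace_span)
    fix x assume x: "x \<in> span (insert t S)" "x \<noteq> 0"
    obtain c where c: "x - c *\<^sub>R t \<in> S" using x(1) subS by (auto simp: span_insert span_eq_iff[THEN iffD2])
    define w where "w = x - c *\<^sub>R t"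
    have x_eq: "x = w + c *\<^sub>R t" by (simp add: w_def)
    have "B w t = 0" using t c by (simp add: T_iff w_def)
    then have "B x x = B w w + c\<^sup>2 * B t t"
      unfolding x_eq by (simp add: B_lin B_sym[of t w] power2_eq_square)
    then have Qx: "Q x = Q w + c\<^sup>2 * Q t" by (simp only: B_self)
    show "0 < Q x"
    proof (cases "w = 0")
      case True
      then have "c \<noteq> 0" using x x_eq by auto
      then show ?thesis using Qx True Qt Q_0 by simp
    next
      case False
      then have "Q w > 0" using posS c by (simp add: w_def)
      then show ?thesis unfolding Qx using Qt by (simp add: add_pos_nonneg)
    qed
  qed
  moreover have "S \<subseteq> span (insert t S)" by (meson insert_subset span_superset subset_trans subset_insertI)
  ultimately have "span (insert t S) = S" using maxS by (auto simp: maximal_positive_definite_def)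
  then have "t \<in> S" by (metis insertI1 span_base)
  then have "t = 0" using S_T t by blast
  then show False using Qt Q_0 by simp
qed

text \<open>A null vector \<open>t\<close> of \<open>T\<close> is orthogonal to \<open>T\<close>,
  since otherwise some \<open>t' + c *\<^sub>R t\<close> would have value 1. It is orthogonal to
  \<open>S\<close> too, and nondegeneracy gives \<open>t = 0\<close>.\<close>

lemma T_neg: assumes t: "t \<in> T" "t \<noteq> 0" shows "Q t < 0"
proof (rule ccontr)
  assume "\<not> Q t < 0"
  then have Qt: "Q t = 0" using T_nonpos[OF t(1)] by simp
  have B0: "B t t' = 0" if t': "t' \<in> T" for t'
  proof (rule ccontr)
    assume n: "B t t' \<noteq> 0"
    define c where "c = (1 - Q t') / (2 * B t t')"
    have "B (t' + c *\<^sub>R t) (t' + c *\<^sub>R t) = B t' t' + 2 * c * B t t'"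
      using Qt B_self[of t] by (simp add: B_lin B_sym[of t' t] algebra_simps)
    then have "Q (t' + c *\<^sub>R t) = Q t' + 2 * c * B t t'" by (simp only: B_self)
    also have "\<dots> = 1"
    proof -
      have "2 * c * B t t' = 1 - Q t'" using n by (simp add: c_def)
      then show ?thesis by simp
    qed
    finally have "Q (t' + c *\<^sub>R t) > 0" by simp
    moreover have "t' + c *\<^sub>R t \<in> T" using t t' subT by (simp add: subspace_add subspace_scale)
    ultimately show False using T_nonpos by fastforce
  qed
  have "B t y = 0" for y
  proof -
    obtain u where u: "u \<in> S" "y - u \<in> T" using S_plus_T by blast
    have "B t u = 0" using t u B_sym[of t u] by (simp add: T_iff)
    then show ?thesis using B0[OF u(2)] by (simp add: B_lin)
  qed
  then show False using nondegenerate t by blast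
qed

definition pS where "pS x = orth_proj Q S x"

lemma pS: "pS x \<in> S" "x - pS x \<in> T" and pS_eq: "u \<in> S \<Longrightarrow> x - u \<in> T \<Longrightarrow> pS x = u"
proof -
  have uniq: "u = v" if "u \<in> S" "x - u \<in> T" "v \<in> S" "x - v \<in> T" for u v
  proof -
    have "u - v \<in> S" using that subS by (simp add: subspace_diff)
    moreover have "(x - v) - (x - u) \<in> T" by (rule subspace_diff[OF subT that(4,2)])
    ultimately show ?thesis using S_T[of "u - v"] by simp
  qed
  obtain u where u: "u \<in> S" "x - u \<in> T" using S_plus_T by blast
  have "pS x = u" unfolding pS_def orth_proj_def T_def[symmetric] by (rule the_equality) (use u uniq in blast)+
  then show "pS x \<in> S" "x - pS x \<in> T" using u by auto
  show "pS x = u" if "u \<in> S" "x - u \<in> T" for u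
    unfolding pS_def orth_proj_def T_def[symmetric] by (rule the_equality) (use that uniq in blast)+
qed

lemma pT_eq: "orth_proj Q T x = x - pS x"
  unfolding orth_proj_def
proof (rule the_equality)
  have S_perp: "u \<in> perp Q T" if "u \<in> S" for u using that B_sym by (auto simp: perp_def T_iff)
  show "x - pS x \<in> T \<and> x - (x - pS x) \<in> perp Q T" using pS S_perp by simp
  fix u assume u: "u \<in> T \<and> x - u \<in> perp Q T"
  have "(x - pS x) - u \<in> T" using pS u subT by (simp add: subspace_diff)
  moreover have "(x - pS x) - u \<in> perp Q T"
  proof -
    have "(x - u) - pS x \<in> perp Q T" using u S_perp[OF pS(1)[of x]] by (auto simp: perp_def B_lin)
    then show ?thesis by (simp add: algebra_simps)
  qed
  ultimately have "Q ((x - pS x) - u) = 0" using B_self by (auto simp: perp_def)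
  then have "(x - pS x) - u = 0" using T_neg \<open>(x - pS x) - u \<in> T\<close> by force
  then show "u = x - pS x" by simp
qed

lemma pS_lin: "linear pS"
proof (rule linearI)
  show "pS (x + y) = pS x + pS y" for x y
  proof (rule pS_eq)
    have "(x - pS x) + (y - pS y) \<in> T" by (rule subspace_add[OF subT pS(2) pS(2)])
    then show "x + y - (pS x + pS y) \<in> T" by (simp add: algebra_simps)
  qed (rule subspace_add[OF subS pS(1) pS(1)])
  show "pS (c *\<^sub>R x) = c *\<^sub>R pS x" for c x
  proof (rule pS_eq)
    have "c *\<^sub>R (x - pS x) \<in> T" by (rule subspace_scale[OF subT pS(2)])
    then show "c *\<^sub>R x - c *\<^sub>R pS x \<in> T" by (simp add: algebra_simps)
  qed (rule subspace_scale[OF subS pS(1)])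
qed

section \<open>The Euclidean structure of \<open>N0\<close>\<close>

definition ip where "ip x y = B (pS x) (pS y) - B (x - pS x) (y - pS y)"

lemma ip_bilinear: "bilinear ip"
  unfolding bilinear_def ip_def
  by (auto intro!: linearI simp: B_lin linear_add[OF pS_lin] linear_scale[OF pS_lin] algebra_simps)

lemmas ip_lin = bilinear_ladd[OF ip_bilinear] bilinear_radd[OF ip_bilinear] bilinear_lmul[OF ip_bilinear]
  bilinear_rmul[OF ip_bilinear] bilinear_lneg[OF ip_bilinear] bilinear_rneg[OF ip_bilinear]
  bilinear_lsub[OF ip_bilinear] bilinear_rsub[OF ip_bilinear] bilinear_lzero[OF ip_bilinear] bilinear_rzero[OF ip_bilinear]

lemma ip_sym: "ip x y = ip y x"
  unfolding ip_def using B_sym by simp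

lemma N0_eq: "N0 Q S x = ip x x"
  unfolding N0_def T_def[symmetric] pT_eq pS_def[symmetric] ip_def B_self ..

lemma ip_pos: "x \<noteq> 0 \<Longrightarrow> ip x x > 0"
proof -
  assume x: "x \<noteq> 0"
  have "Q (pS x) \<ge> 0" using posS[OF pS(1)[of x]] Q_0 by (cases "pS x = 0") auto
  moreover have "Q (x - pS x) \<le> 0" by (rule T_nonpos[OF pS(2)])
  moreover have "Q (pS x) > 0 \<or> Q (x - pS x) < 0"
  proof (cases "pS x = 0")
    case True
    then show ?thesis using T_neg[OF pS(2)[of x]] x by simp
  next
    case False
    then show ?thesis using posS[OF pS(1)[of x]] by simp
  qed
  ultimately show ?thesis unfolding ip_def B_self by linarith
qed

lemma ip_nonneg: "ip x x \<ge> 0"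
  using ip_pos[of x] by (cases "x = 0") (auto simp: ip_lin)

lemma polar_N0: "polar (N0 Q S) x y = ip x y"
  unfolding polar_def N0_eq using ip_sym[of y x] by (simp add: ip_lin)

definition \<nu> where "\<nu> x = form_norm (N0 Q S) x"

lemma nu_sq: "(\<nu> x)\<^sup>2 = ip x x" and nu_nonneg: "\<nu> x \<ge> 0"
  using ip_nonneg by (simp_all add: \<nu>_def form_norm_def N0_eq)

lemma nu_pos: "x \<noteq> 0 \<Longrightarrow> \<nu> x > 0"
  using ip_pos by (simp add: \<nu>_def form_norm_def N0_eq)

lemma nu_scale: "\<nu> (c *\<^sub>R x) = \<bar>c\<bar> * \<nu> x"
proof -
  have "ip (c *\<^sub>R x) (c *\<^sub>R x) = c\<^sup>2 * ip x x" by (simp add: ip_lin power2_eq_square)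
  then show ?thesis by (simp add: \<nu>_def form_norm_def N0_eq real_sqrt_mult)
qed

lemma ip_CS: "\<bar>ip x y\<bar> \<le> \<nu> x * \<nu> y"
proof (cases "y = 0")
  case True
  then show ?thesis by (simp add: ip_lin nu_nonneg)
next
  case False
  have p: "ip y y > 0" by (rule ip_pos[OF False])
  define c where "c = ip x y / ip y y"
  have "0 \<le> ip (x - c *\<^sub>R y) (x - c *\<^sub>R y)" by (rule ip_nonneg)
  also have "\<dots> = ip x x - 2 * c * ip x y + c\<^sup>2 * ip y y"
    using ip_sym[of y x] by (simp add: ip_lin power2_eq_square algebra_simps)
  also have "\<dots> = ip x x - (ip x y)\<^sup>2 / ip y y" using p by (simp add: c_def power2_eq_square field_simps)
  finally have "(ip x y)\<^sup>2 \<le> ip x x * ip y y" using p by (simp add: field_simps)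
  then have "(ip x y)\<^sup>2 \<le> (\<nu> x * \<nu> y)\<^sup>2" by (simp add: power_mult_distrib nu_sq)
  then show ?thesis using nu_nonneg by (simp add: abs_le_square_iff[symmetric] abs_mult)
qed

lemma nu_add: "\<nu> (x + y) \<le> \<nu> x + \<nu> y"
proof -
  have "(\<nu> (x + y))\<^sup>2 = (\<nu> x)\<^sup>2 + 2 * ip x y + (\<nu> y)\<^sup>2"
    unfolding nu_sq using ip_sym[of y x] by (simp add: ip_lin)
  also have "\<dots> \<le> (\<nu> x)\<^sup>2 + 2 * (\<nu> x * \<nu> y) + (\<nu> y)\<^sup>2" using ip_CS[of x y] by linarith
  also have "\<dots> = (\<nu> x + \<nu> y)\<^sup>2" by (simp add: power2_eq_square algebra_simps)
  finally show ?thesis by (rule power2_le_imp_le) (simp add: nu_nonneg)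
qed

lemma B_le_nu: "B x x \<le> (\<nu> x)\<^sup>2"
proof -
  have o: "B (pS x) (x - pS x) = 0" using pS[of x] by (simp add: T_iff)
  have "B x x = B (pS x + (x - pS x)) (pS x + (x - pS x))" by simp
  also have "\<dots> = B (pS x) (pS x) + B (x - pS x) (x - pS x)"
    by (simp only: bilinear_ladd[OF bilinear_B] bilinear_radd[OF bilinear_B] o B_sym[of "x - pS x" "pS x"] add_0_left add_0_right)
  also have "\<dots> \<le> ip x x" unfolding ip_def using T_nonpos[OF pS(2)[of x]] by (simp add: B_self)
  finally show ?thesis by (simp add: nu_sq)
qed

section \<open>Dimension counts, projections, operator norms and angles\<close>

lemma subspace_meet:
  fixes U W :: "(real ^ 'n) set"
  assumes "subspace U" "subspace W" "U \<inter> W \<subseteq> {0}"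
  shows "dim U + dim W \<le> 2 * d + 1"
proof -
  have "U \<inter> W = {0}" using assms subspace_0 by auto
  then have "dim {x + y |x y. x \<in> U \<and> y \<in> W} = dim U + dim W" using dim_sums_Int[OF assms(1,2)] by simp
  moreover have "dim {x + y |x y. x \<in> U \<and> y \<in> W} \<le> CARD('n)" using dim_subset_UNIV[of "{x + y |x y. x \<in> U \<and> y \<in> W}"] by simp
  ultimately show ?thesis using dim_UNIV by simp
qed

text \<open>The positive coordinate space of the normal form has dimension \<open>d + 1\<close> and
  meets \<open>T\<close> only in 0.\<close>

lemma dim_T_le: "dim T \<le> d"
proof -
  obtain I :: "'n set" and f h where f: "card I = d + 1" "linear f" "linear h" "\<And>x. h (f x) = x" "\<And>x. f (h x) = x"
    "\<And>x. Q x = (\<Sum>i\<in>UNIV. (if i \<in> I then 1 else -1) * (h x $ i)\<^sup>2)" using normal_form by blast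
  define P where "P = span ((\<lambda>i. axis i 1 :: real ^ 'n) ` I)"
  have inj: "inj_on (\<lambda>i. axis i 1 :: real ^ 'n) I" by (simp add: inj_on_def axis_eq_axis)
  have ind: "independent ((\<lambda>i. axis i 1 :: real ^ 'n) ` I)"
    by (rule independent_mono[OF independent_Basis]) (auto simp: Basis_vec_def)
  have dP: "dim P = d + 1" unfolding P_def by (simp add: dim_span dim_eq_card_independent[OF ind] card_image[OF inj] f(1))
  have Pz: "x $ i = 0" if "x \<in> P" "i \<notin> I" for x i
    using that(1) unfolding P_def
    by (induction rule: span_induct_alt) (use that(2) in \<open>auto simp: axis_def split: if_splits\<close>)
  have pos: "Q (f x) \<ge> 0" if "x \<in> P" for x
    unfolding f(6) f(4) using Pz[OF that] by (intro sum_nonneg) auto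
  have subfP: "subspace (f ` P)" unfolding P_def by (intro linear_subspace_image f(2) subspace_span)
  have "f ` P \<inter> T \<subseteq> {0}" using pos T_neg by force
  moreover have "inj f" using f(4) by (metis injI)
  then have "dim (f ` P) = d + 1" using dim_image_eq[OF f(2)] dP by (metis inj_on_subset subset_UNIV)
  ultimately show ?thesis using subspace_meet[OF subfP subT] by simp
qed

definition isotropic where "isotropic V \<longleftrightarrow> subspace V \<and> (\<forall>x\<in>V. \<forall>y\<in>V. B x y = 0)"

text \<open>Projection along \<open>S\<close> is injective on an isotropic subspace, so in dimension
  \<open>dim T\<close> it is onto \<open>T\<close>. The \<open>v\<close> with the same
  \<open>T\<close>-part as \<open>x\<close> puts \<open>x - v\<close> into \<open>S\<close>, where
  the square of \<nu> equals \<open>Q\<close>, and by orthogonality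
  \<open>Q (x - v) = Q x\<close>.\<close>

lemma isotropic_proj:
  assumes V: "isotropic V" and d: "dim V = dim T" and x: "\<And>v. v \<in> V \<Longrightarrow> B x v = 0"
  shows "\<exists>v\<in>V. (\<nu> (x - v))\<^sup>2 \<le> B x x"
proof -
  have subV: "subspace V" using V by (simp add: isotropic_def)
  define p where "p v = v - pS v" for v
  have linp: "linear p" unfolding p_def by (intro linear_compose_sub linear_ident pS_lin)
  have inj: "inj_on p V"
    unfolding linear_inj_on_iff_eq_0[OF linp subV]
  proof (intro ballI impI)
    fix v assume v: "v \<in> V" "p v = 0"
    then have "v \<in> S" using pS(1)[of v] by (simp add: p_def)
    moreover have "Q v = 0" using V v by (metis B_self isotropic_def)
    ultimately show "v = 0" using posS by force
  qed
  have sub: "p ` V \<subseteq> T" using pS(2) by (auto simp: p_def)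
  have "span V = V" using subV span_eq_iff by blast
  then have "dim (p ` V) = dim V" using dim_image_eq[OF linp, of V] inj by (simp only:)
  then have "p ` V = T" using subspace_dim_equal[OF linear_subspace_image[OF linp subV] subT sub] d by simp
  then obtain v where v: "v \<in> V" "p v = p x" using pS(2)[of x] by (metis imageE p_def)
  have "p (x - v) = 0" using v(2) by (simp add: linear_diff[OF linp])
  then have m: "pS (x - v) = x - v" by (simp add: p_def)
  have "(\<nu> (x - v))\<^sup>2 = Q (x - v)" unfolding nu_sq ip_def m by (simp add: B_self B_lin Q_0)
  also have "\<dots> = B (x - v) (x - v)" by (simp only: B_self)
  also have "\<dots> = B x x" using x[OF v(1)] V v(1) B_sym[of v x]
    by (simp add: B_lin isotropic_def)
  finally show ?thesis using v(1) by (metis order_refl)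
qed

lemma O_grp_B: assumes "g \<in> O_grp Q" shows "B (g x) (g y) = B x y"
  using assms unfolding O_grp_def polar_def by (simp flip: linear_add)

lemma nu_bounded: "\<exists>C>0. \<forall>x. \<nu> x \<le> C * norm x"
proof -
  define C where "C = (\<Sum>i\<in>UNIV. \<nu> (axis i 1)) + 1"
  have z: "\<nu> 0 = 0" using nu_scale[of 0 0] by simp
  have sum: "\<nu> (sum f A) \<le> (\<Sum>i\<in>A. \<nu> (f i))" if "finite A" for f :: "'n \<Rightarrow> real ^ 'n" and A
    using that by (induction A) (auto simp: z intro: order_trans[OF nu_add])
  have "\<nu> x \<le> C * norm x" for x
  proof -
    have "x = (\<Sum>i\<in>UNIV. x $ i *\<^sub>R axis i 1)" using basis_expansion[of x] by (simp add: scalar_mult_eq_scaleR)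
    then have "\<nu> x \<le> (\<Sum>i\<in>UNIV. \<nu> (x $ i *\<^sub>R axis i 1))" using sum[of UNIV "\<lambda>i. x $ i *\<^sub>R axis i 1"] by simp
    also have "\<dots> \<le> (\<Sum>i\<in>UNIV. norm x * \<nu> (axis i 1))"
      unfolding nu_scale by (intro sum_mono mult_right_mono component_le_norm_cart nu_nonneg)
    also have "\<dots> \<le> C * norm x" by (simp add: C_def sum_distrib_left[symmetric] algebra_simps)
    finally show ?thesis .
  qed
  moreover have "C > 0" unfolding C_def by (intro add_nonneg_pos sum_nonneg nu_nonneg) simp
  ultimately show ?thesis by blast
qed

text \<open>The supremum in \<open>form_opnorm\<close> bounds the quotients only if they are bounded
  above, which follows from the equivalence of \<nu> with the Euclidean norm. The linear
  \<open>h\<close> stands beside \<open>f\<close> because an inverse taken by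
  \<open>inv_into\<close> on a subspace agrees with a linear map only there.\<close>

lemma opnorm_bound:
  assumes U: "subspace U" and f: "\<And>x. x \<in> U \<Longrightarrow> f x = h x" "linear h"
    and le: "form_opnorm (N0 Q S) U f \<le> s" and x: "x \<in> U"
  shows "\<nu> (f x) \<le> s * \<nu> x"
proof (cases "x = 0")
  case True
  then show ?thesis using f(1)[OF x] linear_0[OF f(2)] nu_scale[of 0 0] by simp
next
  case False
  have "\<exists>M. \<forall>x. x \<noteq> 0 \<longrightarrow> \<nu> (h x) / \<nu> x \<le> M"
  proof -
    obtain C where C: "C > 0" "\<And>x. \<nu> x \<le> C * norm x" using nu_bounded by blast
    have cont: "continuous_on (sphere 0 1) \<nu>"
    proof -
      have "dist (\<nu> x) (\<nu> y) \<le> C * dist x y" for x y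
        using nu_add[of "x - y" y] nu_add[of "y - x" x] C(2)[of "x - y"] C(2)[of "y - x"]
        by (simp add: dist_norm norm_minus_commute abs_le_iff)
      then have "C-lipschitz_on (sphere 0 1) \<nu>" using C(1) by (intro lipschitz_onI) auto
      then show ?thesis by (rule lipschitz_on_continuous_on)
    qed
    have ne: "sphere (0 :: real ^ 'n) 1 \<noteq> {}" by simp
    obtain m where m: "m \<in> sphere 0 1" "\<And>y. y \<in> sphere 0 1 \<Longrightarrow> \<nu> m \<le> \<nu> y"
      using continuous_attains_inf[OF compact_sphere ne cont] by blast
    have mp: "\<nu> m > 0" using m(1) by (intro nu_pos) auto
    have low: "\<nu> m * norm y \<le> \<nu> y" for y
    proof (cases "y = 0")
      case False
      have "\<nu> m \<le> \<nu> ((1 / norm y) *\<^sub>R y)" by (rule m(2)) (use False in simp)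
      then show ?thesis using False by (simp add: nu_scale field_simps)
    qed (simp add: nu_nonneg)
    obtain L where L: "\<And>x. norm (h x) \<le> L * norm x" using linear_bounded[OF f(2)] by blast
    have "\<nu> (h y) / \<nu> y \<le> C * \<bar>L\<bar> / \<nu> m" if "y \<noteq> 0" for y
    proof -
      have "\<nu> (h y) \<le> C * norm (h y)" by (rule C)
      also have "\<dots> \<le> C * (\<bar>L\<bar> * norm y)"
        using C(1) L[of y] by (intro mult_left_mono order_trans[OF L] mult_right_mono) auto
      finally have "\<nu> (h y) * \<nu> m \<le> C * \<bar>L\<bar> * (\<nu> m * norm y)" using mp mult_right_mono[of "\<nu> (h y)" _ "\<nu> m"] by (simp add: ac_simps)
      also have "\<dots> \<le> C * \<bar>L\<bar> * \<nu> y" using C(1) low by (intro mult_left_mono) auto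
      finally show ?thesis using mp nu_pos[OF that] by (simp add: field_simps)
    qed
    then show ?thesis by blast
  qed
  then obtain M where M: "\<And>x. x \<noteq> 0 \<Longrightarrow> \<nu> (h x) / \<nu> x \<le> M" by blast
  have "\<nu> (f x) / \<nu> x \<le> form_opnorm (N0 Q S) U f"
    unfolding form_opnorm_def \<nu>_def[symmetric]
  proof (rule cSup_upper)
    show "\<nu> (f x) / \<nu> x \<in> {\<nu> (f x) / \<nu> x |x. x \<in> U \<and> x \<noteq> 0}" using x False by blast
    show "bdd_above {\<nu> (f x) / \<nu> x |x. x \<in> U \<and> x \<noteq> 0}"
      unfolding bdd_above_def using M f(1) by (intro exI[of _ M]) auto
  qed
  then have "\<nu> (f x) / \<nu> x \<le> s" using le by (rule order_trans)
  then show ?thesis using nu_pos[OF False] by (simp only: pos_divide_le_eq)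
qed

text \<open>From \<open>ip x y \<le> c * (\<nu> x * \<nu> y)\<close>, with \<open>c\<close> the
  cosine, and the inequality of means, \<open>(\<nu> (x - y))\<^sup>2\<close> is at least
  \<open>(1 - c) * ((\<nu> x)\<^sup>2 + (\<nu> y)\<^sup>2)\<close>. Capping the angle at
  \<open>pi / 2\<close> keeps \<open>c \<ge> 0\<close>, so that the means may be multiplied by
  it.\<close>

lemma angle_separation:
  assumes eps: "\<epsilon> > 0" and sep: "set_angle (N0 Q S) X Y \<ge> \<epsilon>" and xy: "x \<in> X" "y \<in> Y"
    and \<sigma>: "\<sigma> = sqrt (1 - cos (min \<epsilon> (pi / 2)))"
  shows "\<sigma> * \<nu> x \<le> \<nu> (x - y)"
proof -
  define c where "c = cos (min \<epsilon> (pi / 2))"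
  have th: "0 < min \<epsilon> (pi / 2)" "min \<epsilon> (pi / 2) \<le> pi / 2" using eps by auto
  have c: "0 \<le> c" "c < 1"
    using th cos_ge_zero[of "min \<epsilon> (pi / 2)"] cos_monotone_0_pi[of 0 "min \<epsilon> (pi / 2)"] pi_gt_zero by (auto simp: c_def simp del: min_less_iff_conj)
  have s2: "\<sigma>\<^sup>2 = 1 - c" "\<sigma> \<ge> 0" "\<sigma> \<le> 1" using c by (auto simp: \<sigma> c_def[symmetric])
  show ?thesis
  proof (cases "x = 0 \<or> y = 0")
    case True
    then show ?thesis using s2 nu_nonneg[of x] nu_nonneg[of "x - y"] nu_scale[of 0 0] by (auto simp: mult_left_le_one_le)
  next
    case False
    then have p: "\<nu> x > 0" "\<nu> y > 0" using nu_pos by auto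
    define t where "t = ip x y / (\<nu> x * \<nu> y)"
    have ang: "form_angle (N0 Q S) a b = arccos (ip a b / (\<nu> a * \<nu> b))" for a b
      by (simp add: form_angle_def polar_N0 \<nu>_def)
    have bd: "\<bar>ip a b / (\<nu> a * \<nu> b)\<bar> \<le> 1" for a b
    proof (cases "\<nu> a * \<nu> b = 0")
      case False
      then have "\<nu> a * \<nu> b > 0" using nu_nonneg[of a] nu_nonneg[of b] by (simp add: less_le)
      then show ?thesis using ip_CS[of a b] by (simp only: abs_divide abs_of_pos pos_divide_le_eq mult_1)
    qed auto
    have "set_angle (N0 Q S) X Y \<le> form_angle (N0 Q S) x y"
      unfolding set_angle_def
    proof (rule cInf_lower)
      show "form_angle (N0 Q S) x y \<in> {form_angle (N0 Q S) x y |x y. x \<in> X \<and> x \<noteq> 0 \<and> y \<in> Y \<and> y \<noteq> 0}"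
        using xy False by blast
      show "bdd_below {form_angle (N0 Q S) x y |x y. x \<in> X \<and> x \<noteq> 0 \<and> y \<in> Y \<and> y \<noteq> 0}"
        unfolding bdd_below_def
      proof (intro exI[of _ 0] ballI)
        fix a assume "a \<in> {form_angle (N0 Q S) x y |x y. x \<in> X \<and> x \<noteq> 0 \<and> y \<in> Y \<and> y \<noteq> 0}"
        then obtain x y where a: "a = arccos (ip x y / (\<nu> x * \<nu> y))" unfolding ang by blast
        show "0 \<le> a" unfolding a using bd[of x y] by (intro arccos_lbound; linarith)
      qed
    qed
    then have "\<epsilon> \<le> arccos t" using sep by (simp add: ang t_def)
    have t1: "-1 \<le> t" "t \<le> 1" using bd[of x y] unfolding t_def[symmetric] by linarith+
    have "t \<le> c"
    proof -
      have "cos (arccos t) \<le> cos (min \<epsilon> (pi / 2))"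
        using th \<open>\<epsilon> \<le> arccos t\<close> arccos_ubound[OF t1] by (intro cos_monotone_0_pi_le) auto
      then show ?thesis using cos_arccos[OF t1] by (simp add: c_def)
    qed
    then have ipc: "ip x y \<le> c * (\<nu> x * \<nu> y)" using p by (simp add: t_def divide_le_eq)
    have "2 * (\<nu> x * \<nu> y) \<le> (\<nu> x)\<^sup>2 + (\<nu> y)\<^sup>2" using sum_squares_bound[of "\<nu> x" "\<nu> y"] by simp
    then have am: "c * (2 * (\<nu> x * \<nu> y)) \<le> c * ((\<nu> x)\<^sup>2 + (\<nu> y)\<^sup>2)" using c by (intro mult_left_mono) auto
    have "(\<nu> (x - y))\<^sup>2 = (\<nu> x)\<^sup>2 + (\<nu> y)\<^sup>2 - 2 * ip x y"
      unfolding nu_sq using ip_sym[of y x] by (simp add: ip_lin)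
    also have "\<dots> \<ge> (\<nu> x)\<^sup>2 + (\<nu> y)\<^sup>2 - c * ((\<nu> x)\<^sup>2 + (\<nu> y)\<^sup>2)" using ipc am by linarith
    also have "(\<nu> x)\<^sup>2 + (\<nu> y)\<^sup>2 - c * ((\<nu> x)\<^sup>2 + (\<nu> y)\<^sup>2) = \<sigma>\<^sup>2 * (\<nu> x)\<^sup>2 + (1 - c) * (\<nu> y)\<^sup>2"
      unfolding s2 by (simp add: algebra_simps)
    finally have "\<sigma>\<^sup>2 * (\<nu> x)\<^sup>2 + (1 - c) * (\<nu> y)\<^sup>2 \<le> (\<nu> (x - y))\<^sup>2" .
    moreover have "0 \<le> (1 - c) * (\<nu> y)\<^sup>2" using c by (intro mult_nonneg_nonneg) auto
    ultimately have "\<sigma>\<^sup>2 * (\<nu> x)\<^sup>2 \<le> (\<nu> (x - y))\<^sup>2" by linarith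
    then have "(\<sigma> * \<nu> x)\<^sup>2 \<le> (\<nu> (x - y))\<^sup>2" by (simp add: power_mult_distrib)
    then show ?thesis by (rule power2_le_imp_le) (rule nu_nonneg)
  qed
qed

end

context signature_form
begin

lemma dim_S_T: "2 * d + 1 \<le> dim S + dim T"
proof -
  have "{x + y |x y. x \<in> S \<and> y \<in> T} = UNIV"
  proof safe
    fix x show "\<exists>u v. x = u + v \<and> u \<in> S \<and> v \<in> T"
      using pS[of x] by (intro exI[of _ "pS x"] exI[of _ "x - pS x"]) simp
  qed simp
  then show ?thesis using dim_sums_Int[OF subS subT] dim_UNIV by simp
qed

lemma dim_le_dim_T:
  assumes U: "subspace U" "\<And>x. x \<in> U \<Longrightarrow> Q x \<le> 0"
  shows "dim U \<le> dim T"
proof -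
  have "U \<inter> S \<subseteq> {0}" using U(2) posS by force
  then show ?thesis using subspace_meet[OF U(1) subS] dim_S_T by simp
qed

text \<open>\<open>b\<close> is the Gram map of the form. It conjugates \<open>k\<close> to the
  Euclidean adjoint of \<open>f\<close> and is invertible by nondegeneracy.\<close>

lemma det_adjoint_pair:
  assumes f: "linear f" and k: "linear k" and fk: "\<And>x y. B (f x) y = B x (k y)"
  shows "det (matrix f) = det (matrix k)"
proof -
  define b where "b y = (\<Sum>i\<in>UNIV. B (axis i 1) y *\<^sub>R (axis i 1 :: real ^ 'n))" for y
  have lb: "linear b"
    unfolding b_def by (intro linearI) (simp_all add: B_lin sum.distrib algebra_simps scaleR_sum_right)
  have xb: "x \<bullet> b y = B x y" for x y
  proof -
    have x: "x = (\<Sum>i\<in>UNIV. x $ i *\<^sub>R axis i 1)" using basis_expansion[of x] by (simp add: scalar_mult_eq_scaleR)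
    have "x \<bullet> b y = (\<Sum>i\<in>UNIV. B (axis i 1) y * x $ i)" by (simp add: b_def inner_sum_right inner_axis)
    also have "\<dots> = B (\<Sum>i\<in>UNIV. x $ i *\<^sub>R axis i 1) y"
      using bilinear_B by (subst linear_sum[of "\<lambda>x. B x y"]) (auto simp: bilinear_def B_lin mult.commute)
    finally show ?thesis using x by simp
  qed
  have adj: "adjoint f (b y) = b (k y)" for y
  proof -
    have "x \<bullet> adjoint f (b y) = x \<bullet> b (k y)" for x by (simp add: adjoint_works[OF f] xb fk)
    then show ?thesis using vector_eq_ldot[of "adjoint f (b y)" "b (k y)"] by blast
  qed
  have inj: "inj b"
    unfolding linear_injective_0[OF lb]
  proof (intro allI impI)
    fix y assume "b y = 0"
    then have "B y x = 0" for x using xb[of x y] B_sym by simp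
    then show "y = 0" by (rule nondegenerate)
  qed
  have nz: "det (matrix b) \<noteq> 0" using inj lb det_nz_iff_inj by blast
  have "adjoint f \<circ> b = b \<circ> k" using adj by auto
  then have "matrix (adjoint f) ** matrix b = matrix b ** matrix k"
    using matrix_compose lb k adjoint_linear[OF f] by metis
  then have "det (matrix (adjoint f)) * det (matrix b) = det (matrix b) * det (matrix k)"
    by (metis det_mul)
  then show ?thesis using nz matrix_adjoint[OF f] det_transpose[of "matrix f"] by simp
qed

end

section \<open>Pseudohyperbolic maps\<close>

locale ph_map = signature_form Q S d for Q :: "real ^ 'n \<Rightarrow> real" and S d +
  fixes g :: "real ^ 'n \<Rightarrow> real ^ 'n" and s :: real
  assumes ph: "pseudohyperbolic Q g" and frame: "is_frame Q (frame_of g)"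
    and cs: "contraction_strength Q S g \<le> s" and s: "0 < s" "s < 1"
begin

lemma g_O: "g \<in> O_grp Q" and lin: "linear g" and bij_g: "bij g"
  using ph by (auto simp: pseudohyperbolic_def O_grp_def)

definition h where "h = inv_into UNIV g"

lemma h: "g (h x) = x" "h (g x) = x"
  using bij_g by (simp_all add: h_def bij_inv_eq_iff surj_f_inv_f bij_is_surj inv_f_f bij_is_inj)

lemma lin_h: "linear h"
  by (rule linearI) (metis h linear_add[OF lin], metis h linear_scale[OF lin])

abbreviation L where "L \<equiv> V_lt g"
abbreviation E where "E \<equiv> V_eq g"
abbreviation G where "G \<equiv> V_gt g"

lemmas parts = in_split_parts[OF modulus_splitting_unique_exists[OF lin]]

lemma isoL: "isotropic L" and isoG: "isotropic G"
  using frame by (auto simp: is_frame_def frame_of_def MTIS_def totally_isotropic_def isotropic_def)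

lemma linear_onto:
  fixes f :: "real ^ 'n \<Rightarrow> real ^ 'n"
  assumes f: "linear f" and U: "subspace U" "\<And>x. x \<in> U \<Longrightarrow> f x \<in> U" "\<And>x. x \<in> U \<Longrightarrow> f x = 0 \<Longrightarrow> x = 0" and y: "y \<in> U"
  obtains x where "x \<in> U" "y = f x"
proof -
  have inj: "inj_on f U" unfolding linear_inj_on_iff_eq_0[OF f U(1)] using U(3) by blast
  have "span U = U" using U(1) span_eq_iff by blast
  then have "dim (f ` U) = dim U" using dim_image_eq[OF f, of U] inj by (simp only:)
  moreover have "f ` U \<subseteq> U" using U(2) by blast
  ultimately have "f ` U = U" using subspace_dim_equal[OF linear_subspace_image[OF f U(1)] U(1)] by simp
  then show ?thesis using that y by blast
qed

lemma h_in: assumes "subspace U" "\<And>x. x \<in> U \<Longrightarrow> g x \<in> U" "y \<in> U" shows "h y \<in> U"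
proof -
  obtain x where "x \<in> U" "y = g x"
  proof (rule linear_onto[OF lin assms(1) _ _ assms(3)])
    show "x = 0" if "g x = 0" for x using that h(2)[of x] linear_0[OF lin_h] by simp
  qed (use assms(2) in auto)
  then show ?thesis by (simp add: h)
qed

lemma h_L: "x \<in> L \<Longrightarrow> h x \<in> L" and h_G: "x \<in> G \<Longrightarrow> h x \<in> G"
  using h_in[OF parts(1)] h_in[OF parts(3)] parts(4,6) by blast+

lemma contr_L: "x \<in> L \<Longrightarrow> \<nu> (g x) \<le> s * \<nu> x"
  by (rule opnorm_bound[OF parts(1) refl lin]) (use cs in \<open>auto simp: contraction_strength_def\<close>)

lemma contr_G: assumes "x \<in> G" shows "\<nu> (h x) \<le> s * \<nu> x"
proof -
  have eq: "inv_into G g x = h x" if "x \<in> G" for x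
  proof (rule inv_into_f_eq)
    show "inj_on g G" using bij_is_inj[OF bij_g] by (rule inj_on_subset) simp
  qed (use h_G[OF that] h in auto)
  have "\<nu> (inv_into G g x) \<le> s * \<nu> x"
  proof (rule opnorm_bound[OF parts(3) _ lin_h _ assms])
    show "form_opnorm (N0 Q S) G (inv_into G g) \<le> s" using cs by (simp add: contraction_strength_def)
  qed (rule eq)
  then show ?thesis using eq[OF assms] by simp
qed

text \<open>A unit vector of the neutral line for \<nu>. Its sign is arbitrary here and is fixed
  later by the wings.\<close>

definition e0 where "e0 = (SOME e. E = span {e} \<and> \<nu> e = 1)"

lemma e0: "E = span {e0}" "\<nu> e0 = 1"
proof -
  have d1: "dim E = 1" using ph by (simp add: pseudohyperbolic_def)
  have "\<not> E \<subseteq> {0}"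
  proof
    assume "E \<subseteq> {0}"
    then have "dim E = 0" by (simp add: dim_eq_0)
    then show False using d1 by simp
  qed
  then obtain u where u: "u \<in> E" "u \<noteq> 0" by blast
  define e where "e = (1 / \<nu> u) *\<^sub>R u"
  have e: "\<nu> e = 1" "e \<in> E" using nu_pos[OF u(2)] u(1) by (simp_all add: e_def nu_scale subspace_scale[OF parts(2)])
  have "e \<noteq> 0" using e(1) nu_scale[of 0 0] by auto
  then have "dim (span {e}) = 1" by (simp add: dim_insert)
  moreover have "span {e} \<subseteq> E" using e(2) parts(2) by (simp add: span_minimal)
  ultimately have "span {e} = E" using subspace_dim_equal[OF subspace_span parts(2)] d1 by simp
  then have "\<exists>e. E = span {e} \<and> \<nu> e = 1" using e(1) by blast
  from someI_ex[OF this] show "E = span {e0}" "\<nu> e0 = 1" unfolding e0_def by blast+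
qed

lemma e0_nz: "e0 \<noteq> 0" using e0(2) nu_scale[of 0 0] by auto

lemma g_e0: "g e0 = e0"
  using ph e0(1) by (auto simp: pseudohyperbolic_def span_base)

lemma decomp: "\<exists>a b c. a \<in> L \<and> c \<in> G \<and> x = a + b *\<^sub>R e0 + c"
  using parts(10)[of x] unfolding e0(1) span_singleton by blast

lemma decomp_unique:
  assumes "a \<in> L" "c \<in> G" "a' \<in> L" "c' \<in> G" "a + b *\<^sub>R e0 + c = a' + b' *\<^sub>R e0 + c'"
  shows "a = a' \<and> b = b' \<and> c = c'"
proof -
  have "a = a' \<and> b *\<^sub>R e0 = b' *\<^sub>R e0 \<and> c = c'"
    by (rule parts(11)) (use assms in \<open>auto simp: e0(1) span_singleton\<close>)
  then show ?thesis using e0_nz by simp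
qed

text \<open>Since 1 is not an eigenvalue on \<open>U\<close>, \<open>v = g w - w\<close> for some
  \<open>w\<close> in \<open>U\<close>, and invariance of the form together with
  \<open>g e0 = e0\<close> gives \<open>B (g w) e0 = B w e0\<close>.\<close>

lemma B_e0_aux:
  assumes U: "subspace U" "\<And>x. x \<in> U \<Longrightarrow> g x \<in> U" "\<And>x. x \<in> U \<Longrightarrow> g x = x \<Longrightarrow> x = 0" and v: "v \<in> U"
  shows "B v e0 = 0"
proof -
  obtain w where w: "w \<in> U" "v = g w - w"
  proof (rule linear_onto[of "\<lambda>x. g x - x" U v])
    show "linear (\<lambda>x. g x - x)" by (intro linear_compose_sub linear_ident lin)
  qed (use U v subspace_diff[OF U(1)] in auto)
  have "B (g w) e0 = B w e0" using O_grp_B[OF g_O, of w e0] g_e0 by simp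
  then show ?thesis using w by (simp add: B_lin)
qed

lemma fixed_0: assumes "\<nu> x \<le> s * \<nu> x" shows "x = 0"
proof (rule ccontr)
  assume "x \<noteq> 0"
  then have "s * \<nu> x < 1 * \<nu> x" using nu_pos s by (intro mult_strict_right_mono) auto
  then show False using assms by simp
qed

lemma B_e0_L: "v \<in> L \<Longrightarrow> B v e0 = 0"
proof (rule B_e0_aux[OF parts(1)])
  fix x assume "x \<in> L" "g x = x"
  then have "\<nu> x \<le> s * \<nu> x" using contr_L[of x] by simp
  then show "x = 0" by (rule fixed_0)
qed (use parts(4) in auto)

lemma B_e0_G: "v \<in> G \<Longrightarrow> B v e0 = 0"
proof (rule B_e0_aux[OF parts(3)])
  fix x assume "x \<in> G" "g x = x"
  then have "\<nu> x \<le> s * \<nu> x" using contr_G[of x] h(2)[of x] by simp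
  then show "x = 0" by (rule fixed_0)
qed (use parts(6) in auto)

lemma isotropic_nonpos: "isotropic U \<Longrightarrow> x \<in> U \<Longrightarrow> Q x \<le> 0"
  using B_self[of x] by (auto simp: isotropic_def)

text \<open>The isotropic parts have dimension at most \<open>dim T \<le> d\<close>, the neutral one
  has dimension 1, and together they fill \<open>2 * d + 1\<close>; equality holds
  throughout.\<close>

lemma dims: "dim L = d" "dim G = d" "dim T = d"
proof -
  have "{x + y |x y. x \<in> L \<and> y \<in> {x + y |x y. x \<in> E \<and> y \<in> G}} = UNIV"
  proof safe
    fix x obtain a b c where "a \<in> L" "b \<in> E" "c \<in> G" "x = a + b + c" using parts(10)[of x] by blast
    then show "\<exists>u v. x = u + v \<and> u \<in> L \<and> v \<in> {x + y |x y. x \<in> E \<and> y \<in> G}"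
      by (intro exI[of _ a] exI[of _ "b + c"]) (auto simp: add.assoc)
  qed simp
  moreover have "subspace {x + y |x y. x \<in> E \<and> y \<in> G}" using parts(2,3) by (rule subspace_sums)
  ultimately have "2 * d + 1 \<le> dim L + dim {x + y |x y. x \<in> E \<and> y \<in> G}"
    using dim_sums_Int[OF parts(1), of "{x + y |x y. x \<in> E \<and> y \<in> G}"] dim_UNIV by simp
  moreover have "dim {x + y |x y. x \<in> E \<and> y \<in> G} \<le> dim E + dim G" using dim_sums_Int[OF parts(2,3)] by simp
  moreover have "dim E = 1" using ph by (simp add: pseudohyperbolic_def)
  moreover have "dim L \<le> dim T" "dim G \<le> dim T"
    using dim_le_dim_T[OF parts(1)] dim_le_dim_T[OF parts(3)] isotropic_nonpos isoL isoG by blast+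
  ultimately show "dim L = d" "dim G = d" "dim T = d" using dim_T_le by linarith+
qed

text \<open>Otherwise the form would be nonpositive on the span of \<open>L\<close> and
  \<open>e0\<close>, whose dimension exceeds \<open>dim T\<close>.\<close>

lemma Q_e0: "Q e0 > 0"
proof (rule ccontr)
  assume n: "\<not> Q e0 > 0"
  define W where "W = span (insert e0 L)"
  have "Q x \<le> 0" if xW: "x \<in> W" for x
  proof -
    have sp: "span L = L" using parts(1) span_eq_iff by blast
    obtain b where b: "x - b *\<^sub>R e0 \<in> L" using xW unfolding W_def span_insert sp by blast
    define v where "v = x - b *\<^sub>R e0"
    have v: "B v v = 0" "B v e0 = 0" using b isoL B_e0_L by (auto simp: v_def isotropic_def)
    have "x = v + b *\<^sub>R e0" by (simp add: v_def)
    then have "B x x = b * b * B e0 e0" using v B_sym[of e0 v] by (simp add: B_lin)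
    then have "Q x = (b * b) * Q e0" by (simp only: B_self)
    moreover have "(b * b) * Q e0 \<le> 0" using n by (intro mult_nonneg_nonpos) auto
    ultimately show ?thesis by simp
  qed
  then have "dim W \<le> dim T" unfolding W_def by (intro dim_le_dim_T subspace_span) auto
  moreover have "e0 \<notin> span L"
  proof
    assume "e0 \<in> span L"
    then have "e0 \<in> L" using parts(1) span_eq_iff by blast
    then have "e0 = 0 \<and> (0::real) = 1 \<and> (0::real^'n) = 0"
      using decomp_unique[of e0 0 0 0 0 1] subspace_0[OF parts(1)] subspace_0[OF parts(3)] by simp
    then show False by simp
  qed
  then have "dim W = dim L + 1" by (simp add: W_def dim_insert)
  ultimately show False using dims by simp
qed

text \<open>The \<open>V\<close>-component of a vector orthogonal to \<open>U\<close> is orthogonal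
  to \<open>U\<close>, to \<open>e0\<close> and to \<open>V\<close>, hence zero.\<close>

lemma perp_aux:
  assumes UV: "isotropic U" "isotropic V" "\<And>v. v \<in> U \<Longrightarrow> B v e0 = 0" "\<And>v. v \<in> V \<Longrightarrow> B v e0 = 0"
    and dec: "\<And>x. \<exists>a b c. a \<in> U \<and> c \<in> V \<and> x = a + b *\<^sub>R e0 + c"
  shows "perp Q U = {v + b *\<^sub>R e0 |v b. v \<in> U}"
proof
  show "{v + b *\<^sub>R e0 |v b. v \<in> U} \<subseteq> perp Q U"
    using UV by (auto simp: perp_def isotropic_def B_lin)
  show "perp Q U \<subseteq> {v + b *\<^sub>R e0 |v b. v \<in> U}"
  proof
    fix y assume y: "y \<in> perp Q U"
    obtain a b c where y_eq: "a \<in> U" "c \<in> V" "y = a + b *\<^sub>R e0 + c" using dec[of y] by blast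
    have "B c x = 0" for x
    proof -
      obtain a' b' c' where x: "a' \<in> U" "c' \<in> V" "x = a' + b' *\<^sub>R e0 + c'" using dec[of x] by blast
      have "B a' y = 0" using y x(1) by (simp add: perp_def)
      then have "B a' c = 0" using UV y_eq x by (simp add: B_lin isotropic_def)
      then show ?thesis using UV y_eq x B_sym[of c a'] by (simp add: B_lin isotropic_def)
    qed
    then have "c = 0" by (rule nondegenerate)
    then show "y \<in> {v + b *\<^sub>R e0 |v b. v \<in> U}" using y_eq by auto
  qed
qed

lemma decomp_swap: "\<exists>a b c. a \<in> G \<and> c \<in> L \<and> x = a + b *\<^sub>R e0 + c"
proof -
  obtain a b c where "a \<in> L" "c \<in> G" "x = a + b *\<^sub>R e0 + c" using decomp by blast
  then show ?thesis by (intro exI[of _ c] exI[of _ b] exI[of _ a]) (simp add: ac_simps)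
qed

lemma perp_L: "perp Q L = {v + b *\<^sub>R e0 |v b. v \<in> L}"
  using perp_aux[OF isoL isoG] B_e0_L B_e0_G decomp by blast

lemma perp_G: "perp Q G = {v + b *\<^sub>R e0 |v b. v \<in> G}"
  using perp_aux[OF isoG isoL] B_e0_L B_e0_G decomp_swap by blast

text \<open>\<open>g = g1 \<circ> g2\<close>, where \<open>g1\<close> acts only on the contracted and \<open>g2\<close> only on the expanded part; the adjoint of \<open>g1\<close> is the inverse
  of \<open>g2\<close>.\<close>

lemma det_g: "det (matrix g) = 1"
proof -
  have "\<forall>x. \<exists>t. fst t \<in> L \<and> snd (snd t) \<in> G \<and> x = fst t + fst (snd t) *\<^sub>R e0 + snd (snd t)" using decomp by force
  from choice[OF this] obtain p where p: "\<And>x. fst (p x) \<in> L \<and> snd (snd (p x)) \<in> G \<and> x = fst (p x) + fst (snd (p x)) *\<^sub>R e0 + snd (snd (p x))"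
    by blast
  define a b c where "a x = fst (p x)" and "b x = fst (snd (p x))" and "c x = snd (snd (p x))" for x
  have abc: "a x \<in> L" "c x \<in> G" "x = a x + b x *\<^sub>R e0 + c x" for x using p[of x] by (auto simp: a_def b_def c_def)
  have abcI: "a x = u \<and> b x = v \<and> c x = w" if "u \<in> L" "w \<in> G" "x = u + v *\<^sub>R e0 + w" for x u v w
    by (rule decomp_unique[OF abc(1,2) that(1,2)]) (use abc(3)[of x] that(3) in metis)
  have add: "a (x + y) = a x + a y \<and> b (x + y) = b x + b y \<and> c (x + y) = c x + c y" for x y
  proof (rule abcI)
    show "x + y = a x + a y + (b x + b y) *\<^sub>R e0 + (c x + c y)"
    proof -
      have "a x + a y + (b x + b y) *\<^sub>R e0 + (c x + c y) = (a x + b x *\<^sub>R e0 + c x) + (a y + b y *\<^sub>R e0 + c y)"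
        by (simp add: algebra_simps)
      then show ?thesis by (simp only: abc(3)[symmetric])
    qed
  qed (auto intro: subspace_add parts abc)
  have scl: "a (r *\<^sub>R x) = r *\<^sub>R a x \<and> b (r *\<^sub>R x) = r * b x \<and> c (r *\<^sub>R x) = r *\<^sub>R c x" for r x
  proof (rule abcI)
    show "r *\<^sub>R x = r *\<^sub>R a x + (r * b x) *\<^sub>R e0 + r *\<^sub>R c x"
    proof -
      have "r *\<^sub>R a x + (r * b x) *\<^sub>R e0 + r *\<^sub>R c x = r *\<^sub>R (a x + b x *\<^sub>R e0 + c x)"
        by (simp add: algebra_simps)
      then show ?thesis by (simp only: abc(3)[symmetric])
    qed
  qed (auto intro: subspace_scale parts abc)
  define g1 g2 k2 where "g1 x = g (a x) + b x *\<^sub>R e0 + c x" and "g2 x = a x + b x *\<^sub>R e0 + g (c x)"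
    and "k2 x = a x + b x *\<^sub>R e0 + h (c x)" for x
  have l: "linear g1" "linear g2" "linear k2"
    unfolding g1_def g2_def k2_def
    by (auto intro!: linearI simp: add scl linear_add[OF lin] linear_scale[OF lin] linear_add[OF lin_h]
        linear_scale[OF lin_h] algebra_simps)
  have ab2: "a (g2 x) = a x \<and> b (g2 x) = b x \<and> c (g2 x) = g (c x)" for x
    by (rule abcI) (auto simp: g2_def abc(1) intro: parts(6) abc(2))
  have "g1 \<circ> g2 = g"
  proof
    fix x
    have "g x = g (a x) + b x *\<^sub>R e0 + g (c x)"
      by (subst abc(3)[of x]) (simp add: linear_add[OF lin] linear_scale[OF lin] g_e0)
    then show "(g1 \<circ> g2) x = g x" by (simp add: g1_def ab2)
  qed
  then have 1: "det (matrix g) = det (matrix g1) * det (matrix g2)" using matrix_compose[OF l(2,1)] det_mul by metis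
  have "k2 \<circ> g2 = id"
  proof
    fix x show "(k2 \<circ> g2) x = id x" using abc(3)[of x] by (simp add: k2_def ab2 h)
  qed
  then have 2: "det (matrix k2) * det (matrix g2) = 1"
    using matrix_compose[OF l(2,3)] by (metis det_mul det_I matrix_id)
  have "det (matrix g1) = det (matrix k2)"
  proof (rule det_adjoint_pair[OF l(1,3)])
    fix x y
    have z: "B (g (a x)) (a y) = 0" "B (a x) (a y) = 0" "B (c x) (c y) = 0" "B (c x) (h (c y)) = 0"
      using isoL isoG abc parts(4) h_G by (auto simp: isotropic_def)
    have z2: "B (g (a x)) e0 = 0" "B (a x) e0 = 0" "B (c x) e0 = 0" "B e0 (a y) = 0" "B e0 (c y) = 0" "B e0 (h (c y)) = 0"
      using B_e0_L B_e0_G abc parts(4) h_G by (auto simp: B_sym[of e0])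
    have m: "B (g (a x)) (c y) = B (a x) (h (c y))" using O_grp_B[OF g_O, of "a x" "h (c y)"] by (simp add: h)
    have y: "B u y = B u (a y) + b y * B u e0 + B u (c y)" for u by (subst abc(3)[of y]) (simp add: B_lin)
    have x: "B x u = B (a x) u + b x * B e0 u + B (c x) u" for u by (subst abc(3)[of x]) (simp add: B_lin)
    show "B (g1 x) y = B x (k2 y)" unfolding y x g1_def k2_def by (simp add: B_lin z z2 m)
  qed
  then show ?thesis using 1 2 by simp
qed

end

section \<open>Orientations and wings\<close>

definition leibniz :: "nat \<Rightarrow> (nat \<Rightarrow> nat \<Rightarrow> real) \<Rightarrow> real" where
  "leibniz k A = (\<Sum>p | p permutes {..<k}. of_int (sign p) * (\<Prod>i<k. A i (p i)))"

lemma leibniz_cong: "(\<And>i j. i < k \<Longrightarrow> j < k \<Longrightarrow> A i j = A' i j) \<Longrightarrow> leibniz k A = leibniz k A'"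
  unfolding leibniz_def
  by (intro sum.cong refl arg_cong2[of _ _ _ _ "(*)"] prod.cong) (auto dest: permutes_in_image)

lemma leibniz_permute_rows:
  assumes q: "q permutes {..<k}"
  shows "leibniz k (\<lambda>i. A (q i)) = of_int (sign q) * leibniz k A"
proof -
  have "leibniz k (\<lambda>i. A (q i)) =
      (\<Sum>p | p permutes {..<k}. of_int (sign (p \<circ> q)) * (\<Prod>i<k. A (q i) ((p \<circ> q) i)))"
    unfolding leibniz_def by (rule sum_permutations_compose_right[OF q])
  also have "\<dots> = (\<Sum>p | p permutes {..<k}. of_int (sign q) * (of_int (sign p) * (\<Prod>i<k. A i (p i))))"
  proof (rule sum.cong[OF refl])
    fix p assume "p \<in> {p. p permutes {..<k}}"
    then have p: "p permutes {..<k}" by simp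
    have perm: "permutation p" "permutation q" using p q permutation_permutes by blast+
    have "(\<Prod>i<k. A i (p i)) = (\<Prod>i<k. A (q i) ((p \<circ> q) i))"
      using prod.permute[OF q, of "\<lambda>i. A i (p i)"] by (simp add: o_def)
    then show "of_int (sign (p \<circ> q)) * (\<Prod>i<k. A (q i) ((p \<circ> q) i)) = of_int (sign q) * (of_int (sign p) * (\<Prod>i<k. A i (p i)))"
      by (simp add: sign_compose[OF perm])
  qed
  finally show ?thesis by (simp add: leibniz_def sum_distrib_left)
qed

lemma leibniz_identical_rows:
  assumes "i < k" "j < k" "i \<noteq> j" "A i = A j"
  shows "leibniz k A = 0"
proof -
  define q where "q = Transposition.transpose i j"
  have q: "q permutes {..<k}" unfolding q_def using assms by (intro permutes_swap_id) auto
  have "(\<lambda>l. A (q l)) = A" using assms(4) by (auto simp: q_def Transposition.transpose_def)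
  then have "leibniz k A = of_int (sign q) * leibniz k A" using leibniz_permute_rows[OF q, of A] by simp
  moreover have "sign q = -1" using assms(3) by (simp add: q_def sign_swap_id)
  ultimately show ?thesis by simp
qed

text \<open>Expanding the product gives a sum over all functions on the indices; the non-injective
  ones contribute a determinant with two equal rows. Permutations are restricted to
  \<open>{..<k}\<close> because the expansion runs over \<open>PiE\<close>, whose members are fixed
  outside it.\<close>

lemma leibniz_mult: "leibniz k (\<lambda>i j. \<Sum>l<k. A i l * B l j) = leibniz k A * leibniz k B"
proof -
  define Fn where "Fn = PiE {..<k} (\<lambda>_. {..<k})"
  define Pm where "Pm = {p. p permutes {..<k}}"
  define tm where "tm f = (\<Prod>i<k. A i (f i)) * leibniz k (\<lambda>i. B (f i))" for f
  define res where "res q = restrict q {..<k}" for q :: "nat \<Rightarrow> nat"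
  have "leibniz k (\<lambda>i j. \<Sum>l<k. A i l * B l j) =
      (\<Sum>p\<in>Pm. of_int (sign p) * (\<Sum>f\<in>Fn. \<Prod>i<k. A i (f i) * B (f i) (p i)))"
    unfolding leibniz_def Fn_def Pm_def by (simp add: prod_sum_PiE)
  also have "\<dots> = (\<Sum>f\<in>Fn. tm f)"
    unfolding sum_distrib_left tm_def leibniz_def Pm_def
    by (subst sum.swap) (simp add: prod.distrib mult.left_commute)
  also have "\<dots> = (\<Sum>f\<in>res ` Pm. tm f)"
  proof (rule sum.mono_neutral_right)
    show "finite Fn" by (simp add: Fn_def finite_PiE)
    show "res ` Pm \<subseteq> Fn"
    proof (rule image_subsetI)
      fix q assume "q \<in> Pm"
      then have "q permutes {..<k}" by (simp add: Pm_def)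
      then have "q i < k" if "i < k" for i using permutes_in_image[of q "{..<k}" i] that by simp
      then show "res q \<in> Fn" by (simp add: res_def Fn_def)
    qed
    show "\<forall>f\<in>Fn - res ` Pm. tm f = 0"
    proof
      fix f assume f: "f \<in> Fn - res ` Pm"
      have "\<not> inj_on f {..<k}"
      proof
        assume inj: "inj_on f {..<k}"
        have "f ` {..<k} \<subseteq> {..<k}" using f by (auto simp: Fn_def)
        then have bij: "bij_betw f {..<k} {..<k}" using inj endo_inj_surj[of "{..<k}" f] by (auto simp: bij_betw_def)
        define q where "q i = (if i < k then f i else i)" for i
        have "bij_betw q {..<k} {..<k}" using bij by (subst bij_betw_cong[of _ _ f]) (auto simp: q_def)
        then have "q permutes {..<k}" by (rule bij_imp_permutes) (simp add: q_def)
        moreover have "f = res q" using f by (auto simp: res_def q_def Fn_def fun_eq_iff PiE_def extensional_def)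
        ultimately show False using f by (auto simp: Pm_def)
      qed
      then obtain i j where "i < k" "j < k" "i \<noteq> j" "f i = f j" by (auto simp: inj_on_def)
      then have "leibniz k (\<lambda>i. B (f i)) = 0" by (intro leibniz_identical_rows[of i k j]) auto
      then show "tm f = 0" by (simp add: tm_def)
    qed
  qed
  also have "\<dots> = (\<Sum>q\<in>Pm. tm (res q))"
  proof (rule sum.reindex_cong[OF _ refl refl])
    show "inj_on res Pm"
    proof (rule inj_onI)
      fix p q assume pq: "p \<in> Pm" "q \<in> Pm" "res p = res q"
      show "p = q"
      proof
        fix i show "p i = q i"
          using fun_cong[OF pq(3), of i] pq(1,2) by (cases "i < k") (auto simp: res_def Pm_def permutes_not_in)
      qed
    qed
  qed
  also have "\<dots> = (\<Sum>q\<in>Pm. of_int (sign q) * (\<Prod>i<k. A i (q i)) * leibniz k B)"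
  proof (rule sum.cong[OF refl])
    fix q assume "q \<in> Pm"
    then have q: "q permutes {..<k}" by (simp add: Pm_def)
    have "leibniz k (\<lambda>i. B (res q i)) = leibniz k (\<lambda>i. B (q i))" by (rule leibniz_cong) (simp add: res_def)
    moreover have "(\<Prod>i<k. A i (res q i)) = (\<Prod>i<k. A i (q i))" by (simp add: res_def)
    ultimately show "tm (res q) = of_int (sign q) * (\<Prod>i<k. A i (q i)) * leibniz k B"
      by (simp add: tm_def leibniz_permute_rows[OF q])
  qed
  finally show ?thesis by (simp add: leibniz_def Pm_def sum_distrib_right)
qed

lemma leibniz_one: "leibniz k (\<lambda>i j. if i = j then 1 else 0) = 1"
proof -
  have "leibniz k (\<lambda>i j. if i = j then 1 else 0) = (\<Sum>p\<in>{id}. of_int (sign p) * (\<Prod>i<k. if i = p i then 1 else 0))"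
    unfolding leibniz_def
  proof (rule sum.mono_neutral_right)
    show "\<forall>p\<in>{p. p permutes {..<k}} - {id}. of_int (sign p) * (\<Prod>i<k. if i = p i then 1 else (0::real)) = 0"
    proof
      fix p assume p: "p \<in> {p. p permutes {..<k}} - {id}"
      then obtain i where i: "p i \<noteq> i" by (auto simp: fun_eq_iff)
      then have "i < k" using p permutes_not_in[of p "{..<k}" i] by auto
      then have "(\<Prod>i<k. if i = p i then 1 else (0::real)) = 0" using i by (intro prod_zero bexI[of _ i]) auto
      then show "of_int (sign p) * (\<Prod>i<k. if i = p i then 1 else (0::real)) = 0" by simp
    qed
  qed (auto simp: finite_permutations permutes_id)
  then show ?thesis by simp
qed

lemma leibniz_block:
  "leibniz (Suc k) (\<lambda>i j. if i < k \<and> j < k then C i j else if i = j then \<tau> else 0) = leibniz k C * \<tau>"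
proof -
  define M where "M i j = (if i < k \<and> j < k then C i j else if i = j then \<tau> else 0)" for i j
  have "leibniz (Suc k) M = (\<Sum>p | p permutes {..<k}. of_int (sign p) * (\<Prod>i<Suc k. M i (p i)))"
    unfolding leibniz_def
  proof (rule sum.mono_neutral_right)
    show "{p. p permutes {..<k}} \<subseteq> {p. p permutes {..<Suc k}}" by (auto intro: permutes_subset)
    show "\<forall>p\<in>{p. p permutes {..<Suc k}} - {p. p permutes {..<k}}. of_int (sign p) * (\<Prod>i<Suc k. M i (p i)) = 0"
    proof
      fix p assume p: "p \<in> {p. p permutes {..<Suc k}} - {p. p permutes {..<k}}"
      have "p k \<noteq> k"
      proof
        assume "p k = k"
        then have "p permutes {..<k}"
          using p permutes_superset[of p "{..<Suc k}" "{..<k}"] by (auto simp: less_Suc_eq)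
        then show False using p by simp
      qed
      then have "M k (p k) = 0" by (simp add: M_def)
      then show "of_int (sign p) * (\<Prod>i<Suc k. M i (p i)) = 0" by simp
    qed
  qed (simp add: finite_permutations)
  also have "\<dots> = (\<Sum>p | p permutes {..<k}. of_int (sign p) * (\<Prod>i<k. C i (p i)) * \<tau>)"
  proof (rule sum.cong[OF refl])
    fix p assume "p \<in> {p. p permutes {..<k}}"
    then have p: "p permutes {..<k}" by simp
    have "(\<Prod>i<k. M i (p i)) = (\<Prod>i<k. C i (p i))"
      using permutes_in_image[OF p] by (intro prod.cong) (auto simp: M_def)
    moreover have "M k (p k) = \<tau>" using permutes_not_in[OF p, of k] by (simp add: M_def)
    ultimately show "of_int (sign p) * (\<Prod>i<Suc k. M i (p i)) = of_int (sign p) * (\<Prod>i<k. C i (p i)) * \<tau>" by simp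
  qed
  finally show ?thesis by (simp add: leibniz_def sum_distrib_right M_def)
qed

section \<open>Change of basis and the sign of the neutral vector\<close>

lemma same_orientation_iff:
  "same_orientation bs cs \<longleftrightarrow> length cs = length bs \<and>
    (\<exists>C. (\<forall>j<length bs. cs ! j = (\<Sum>i<length bs. C i j *\<^sub>R bs ! i)) \<and> leibniz (length bs) C > 0)"
  by (simp add: same_orientation_def leibniz_def)

lemma ordered_basis_expand:
  assumes bs: "ordered_basis bs V" and v: "v \<in> V"
  obtains c where "v = (\<Sum>i<length bs. c i *\<^sub>R bs ! i)"
proof -
  have "v \<in> span (set bs)" "distinct bs" using bs v by (auto simp: ordered_basis_def)
  then obtain u where "v = (\<Sum>b\<in>set bs. u b *\<^sub>R b)" by (auto simp: span_finite)
  also have "\<dots> = (\<Sum>i<length bs. u (bs ! i) *\<^sub>R bs ! i)"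
    using sum.reindex_bij_betw[OF bij_betw_nth[OF \<open>distinct bs\<close> refl refl], of "\<lambda>b. u b *\<^sub>R b"] by simp
  finally show ?thesis by (rule that)
qed

lemma ordered_basis_unique:
  assumes bs: "ordered_basis bs V" and eq: "(\<Sum>i<length bs. c i *\<^sub>R bs ! i) = (\<Sum>i<length bs. c' i *\<^sub>R bs ! i)"
    and i: "i < length bs"
  shows "c i = c' i"
proof -
  have d: "distinct bs" and ind: "independent (set bs)" using bs by (auto simp: ordered_basis_def)
  have bij: "bij_betw ((!) bs) {..<length bs} (set bs)" using d by (rule bij_betw_nth) simp_all
  define u where "u b = c (the_inv_into {..<length bs} ((!) bs) b) - c' (the_inv_into {..<length bs} ((!) bs) b)" for b
  have u: "u (bs ! i) = c i - c' i" if "i < length bs" for i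
    unfolding u_def using the_inv_into_f_f[of "(!) bs" "{..<length bs}" i] bij that by (simp add: bij_betw_def)
  have "(\<Sum>b\<in>set bs. u b *\<^sub>R b) = (\<Sum>i<length bs. u (bs ! i) *\<^sub>R bs ! i)"
    using sum.reindex_bij_betw[OF bij, of "\<lambda>b. u b *\<^sub>R b"] by simp
  also have "\<dots> = (\<Sum>i<length bs. c i *\<^sub>R bs ! i - c' i *\<^sub>R bs ! i)"
    by (intro sum.cong) (simp_all add: u scaleR_left_diff_distrib)
  also have "\<dots> = 0" using eq by (simp add: sum_subtractf)
  finally have "u (bs ! i) = 0" using independentD[OF ind, of "set bs" u] i by auto
  then show ?thesis using u[OF i] by simp
qed

lemma change_of_basis:
  assumes "ordered_basis bs V" "set cs \<subseteq> V" "length cs = length bs"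
  obtains C where "\<And>j. j < length bs \<Longrightarrow> cs ! j = (\<Sum>i<length bs. C i j *\<^sub>R bs ! i)"
proof -
  have "\<forall>j\<in>{..<length bs}. \<exists>c. cs ! j = (\<Sum>i<length bs. c i *\<^sub>R bs ! i)"
  proof
    fix j assume "j \<in> {..<length bs}"
    then have "cs ! j \<in> V" using assms by (auto simp: subset_iff)
    then show "\<exists>c. cs ! j = (\<Sum>i<length bs. c i *\<^sub>R bs ! i)" using ordered_basis_expand[OF assms(1)] by blast
  qed
  from bchoice[OF this] obtain c where "\<forall>j\<in>{..<length bs}. cs ! j = (\<Sum>i<length bs. c j i *\<^sub>R bs ! i)" ..
  then show ?thesis using that[of "\<lambda>i j. c j i"] by simp
qed

lemma compose_columns:
  fixes bs :: "nat \<Rightarrow> 'a::real_vector"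
  assumes "\<And>j. j < k \<Longrightarrow> cs j = (\<Sum>i<k. C i j *\<^sub>R bs i)" "\<And>j. j < k \<Longrightarrow> ds j = (\<Sum>i<k. D i j *\<^sub>R cs i)" "j < k"
  shows "ds j = (\<Sum>i<k. (\<Sum>l<k. C i l * D l j) *\<^sub>R bs i)"
proof -
  have "ds j = (\<Sum>l<k. \<Sum>i<k. (C i l * D l j) *\<^sub>R bs i)"
    using assms by (simp add: scaleR_sum_right mult.commute)
  then show ?thesis by (subst (asm) sum.swap) (simp add: scaleR_sum_left)
qed

lemma change_of_basis_nonzero:
  assumes bs: "ordered_basis bs V" and cs: "ordered_basis cs V" and len: "length cs = length bs"
    and C: "\<And>j. j < length bs \<Longrightarrow> cs ! j = (\<Sum>i<length bs. C i j *\<^sub>R bs ! i)"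
  shows "leibniz (length bs) C \<noteq> 0"
proof -
  let ?k = "length bs"
  have "set bs \<subseteq> V" using bs span_superset by (auto simp: ordered_basis_def)
  then obtain D where D: "\<And>j. j < ?k \<Longrightarrow> bs ! j = (\<Sum>i<?k. D i j *\<^sub>R cs ! i)"
    using change_of_basis[OF cs, of bs] len by auto
  have e: "(\<Sum>l<?k. C i l * D l j) = (if i = j then 1 else 0)" if "i < ?k" "j < ?k" for i j
  proof (rule ordered_basis_unique[OF bs _ that(1)])
    have "(\<Sum>i<?k. (\<Sum>l<?k. C i l * D l j) *\<^sub>R bs ! i) = bs ! j"
      by (rule compose_columns[where cs = "(!) cs", OF C D that(2), symmetric])
    also have "\<dots> = (\<Sum>i<?k. (if i = j then 1 else 0) *\<^sub>R bs ! i)"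
    proof -
      have "(\<Sum>i<?k. (if i = j then 1 else 0) *\<^sub>R bs ! i) = (\<Sum>i<?k. if i = j then bs ! i else 0)" by (intro sum.cong) auto
      then show ?thesis using that(2) by simp
    qed
    finally show "(\<Sum>i<?k. (\<Sum>l<?k. C i l * D l j) *\<^sub>R bs ! i) = (\<Sum>i<?k. (if i = j then 1 else 0) *\<^sub>R bs ! i)" .
  qed
  have "leibniz ?k C * leibniz ?k D = leibniz ?k (\<lambda>i j. if i = j then 1 else 0)"
    unfolding leibniz_mult[symmetric] by (rule leibniz_cong) (rule e)
  then show ?thesis using leibniz_one[of ?k] by auto
qed

lemma ordered_basis_snoc:
  assumes bs: "ordered_basis bs V" and e: "e \<notin> V" and P: "P = {v + b *\<^sub>R e |v b. v \<in> V}" and \<tau>: "\<tau> \<noteq> 0"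
  shows "ordered_basis (bs @ [\<tau> *\<^sub>R e]) P"
proof -
  have V: "span (set bs) = V" and ind: "independent (set bs)" and d: "distinct bs" using bs by (auto simp: ordered_basis_def)
  have sub: "subspace V" using V subspace_span by metis
  have nV: "\<tau> *\<^sub>R e \<notin> V"
  proof
    assume "\<tau> *\<^sub>R e \<in> V"
    then have "(1 / \<tau>) *\<^sub>R \<tau> *\<^sub>R e \<in> V" by (rule subspace_scale[OF sub])
    then show False using e \<tau> by simp
  qed
  then have nb: "\<tau> *\<^sub>R e \<notin> set bs" using V span_base by blast
  have "span (insert (\<tau> *\<^sub>R e) (set bs)) = P"
  proof -
    have 1: "\<exists>k. x - k *\<^sub>R \<tau> *\<^sub>R e \<in> V" if "v \<in> V" "x = v + b *\<^sub>R e" for x v b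
      using that \<tau> by (intro exI[of _ "b / \<tau>"]) simp
    have 2: "\<exists>v b. x = v + b *\<^sub>R e \<and> v \<in> V" if "x - k *\<^sub>R \<tau> *\<^sub>R e \<in> V" for x k
      using that by (intro exI[of _ "x - k *\<^sub>R \<tau> *\<^sub>R e"] exI[of _ "k * \<tau>"]) simp
    show ?thesis unfolding span_insert V P using 1 2 by blast
  qed
  then show ?thesis using ind d nV nb V by (simp add: ordered_basis_def independent_insert)
qed

text \<open>\<tau> is the sign of the determinant of \<open>bs @ [e]\<close> against the reference
  basis of the orthogonal. Another direct basis of \<open>V\<close> multiplies this determinant by a
  positive factor, so one sign serves all the bases over which the wing quantifies.\<close>

lemma positive_wing_contains:
  fixes V :: "(real ^ 'n) set"
  assumes oV: "is_orientation V (ori V)" and oP: "is_orientation (perp Q V) (ori (perp Q V))"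
    and P: "perp Q V = {v + b *\<^sub>R e |v b. v \<in> V}" and e: "e \<notin> V"
  obtains \<tau> :: real where "\<tau> = 1 \<or> \<tau> = -1" "\<And>v x. v \<in> V \<Longrightarrow> x \<ge> 0 \<Longrightarrow> v + x *\<^sub>R \<tau> *\<^sub>R e \<in> positive_wing Q ori V"
proof -
  obtain bs where bs: "ordered_basis bs V" "ori V = {cs. ordered_basis cs V \<and> same_orientation bs cs}"
    using oV by (auto simp: is_orientation_def)
  obtain ps where ps: "ordered_basis ps (perp Q V)" "ori (perp Q V) = {cs. ordered_basis cs (perp Q V) \<and> same_orientation ps cs}"
    using oP by (auto simp: is_orientation_def)
  have be: "ordered_basis (bs @ [1 *\<^sub>R e]) (perp Q V)" by (rule ordered_basis_snoc[OF bs(1) e P]) simp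
  have len: "length bs = dim V" if "ordered_basis bs V" for bs and V :: "(real ^ 'n) set"
    using that by (metis distinct_card dim_eq_card_independent dim_span ordered_basis_def)
  have len_ps: "length ps = Suc (length bs)" using len[OF be] len[OF ps(1)] by simp
  let ?k = "length bs"
  have "set (bs @ [e]) \<subseteq> perp Q V" using be span_superset[of "set (bs @ [e])"] by (simp add: ordered_basis_def)
  then obtain C0 where C0: "\<And>j. j < length ps \<Longrightarrow> (bs @ [e]) ! j = (\<Sum>i<length ps. C0 i j *\<^sub>R ps ! i)"
    using change_of_basis[OF ps(1), of "bs @ [e]"] len_ps by auto
  have n0: "leibniz (length ps) C0 \<noteq> 0"
    by (rule change_of_basis_nonzero[OF ps(1), of "bs @ [e]"]) (use be C0 len_ps in auto)
  define \<tau> where "\<tau> = sgn (leibniz (length ps) C0)"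
  have \<tau>: "\<tau> = 1 \<or> \<tau> = -1" "leibniz (length ps) C0 * \<tau> > 0" using n0 by (auto simp: \<tau>_def sgn_if)
  have "cs @ [\<tau> *\<^sub>R e] \<in> ori (perp Q V)" if cs: "cs \<in> ori V" for cs
  proof -
    have csb: "ordered_basis cs V" "length cs = ?k" using cs bs(2) by (auto simp: same_orientation_def)
    obtain C where C: "\<And>j. j < ?k \<Longrightarrow> cs ! j = (\<Sum>i<?k. C i j *\<^sub>R bs ! i)" "leibniz ?k C > 0"
      using cs bs(2) by (auto simp: same_orientation_iff)
    define M where "M i j = (if i < ?k \<and> j < ?k then C i j else if i = j then \<tau> else 0)" for i j
    have M: "(cs @ [\<tau> *\<^sub>R e]) ! j = (\<Sum>i<Suc ?k. M i j *\<^sub>R (bs @ [e]) ! i)" if "j < Suc ?k" for j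
    proof (cases "j < ?k")
      case True
      have "(\<Sum>i<?k. M i j *\<^sub>R (bs @ [e]) ! i) = (\<Sum>i<?k. C i j *\<^sub>R bs ! i)"
        using True by (intro sum.cong) (auto simp: M_def nth_append)
      then show ?thesis using True C(1)[OF True] csb(2) by (simp add: nth_append M_def)
    next
      case False
      then have j: "j = ?k" using that by simp
      have "(\<Sum>i<?k. M i j *\<^sub>R (bs @ [e]) ! i) = 0" unfolding j by (intro sum.neutral) (auto simp: M_def)
      then show ?thesis using j csb(2) by (simp add: nth_append M_def)
    qed
    have "(cs @ [\<tau> *\<^sub>R e]) ! j = (\<Sum>i<length ps. (\<Sum>l<length ps. C0 i l * M l j) *\<^sub>R ps ! i)" if "j < length ps" for j
      by (rule compose_columns[where cs = "(!) (bs @ [e])", OF C0 M[folded len_ps] that])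
    moreover have "leibniz (length ps) (\<lambda>i j. \<Sum>l<length ps. C0 i l * M l j) > 0"
    proof -
      have "leibniz (length ps) M = leibniz ?k C * \<tau>" unfolding len_ps M_def by (rule leibniz_block)
      then have "leibniz (length ps) (\<lambda>i j. \<Sum>l<length ps. C0 i l * M l j) = (leibniz (length ps) C0 * \<tau>) * leibniz ?k C"
        by (simp add: leibniz_mult)
      then show ?thesis using \<tau>(2) C(2) by simp
    qed
    ultimately have "same_orientation ps (cs @ [\<tau> *\<^sub>R e])"
      unfolding same_orientation_iff using csb(2) len_ps by auto
    moreover have "ordered_basis (cs @ [\<tau> *\<^sub>R e]) (perp Q V)"
      by (rule ordered_basis_snoc[OF csb(1) e P]) (use \<tau> in auto)
    ultimately show ?thesis using ps(2) by simp
  qed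
  moreover have "\<tau> *\<^sub>R e \<in> perp Q V"
  proof -
    have "0 \<in> V" using bs(1) span_0 by (auto simp: ordered_basis_def)
    then show ?thesis unfolding P by force
  qed
  ultimately have "v + x *\<^sub>R \<tau> *\<^sub>R e \<in> positive_wing Q ori V" if "v \<in> V" "x \<ge> 0" for v x
    unfolding positive_wing_def using that by blast
  then show ?thesis using that \<tau>(1) by blast
qed

section \<open>Groups of words\<close>

lemma BijGroup_UNIV:
  fixes f g :: "'a \<Rightarrow> 'a"
  shows "f \<in> carrier (BijGroup UNIV) \<longleftrightarrow> bij f"
    and "\<one>\<^bsub>BijGroup UNIV\<^esub> = (id :: 'a \<Rightarrow> 'a)"
    and "bij f \<Longrightarrow> bij g \<Longrightarrow> f \<otimes>\<^bsub>BijGroup UNIV\<^esub> g = f \<circ> g"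
proof -
  show 1: "f \<in> carrier (BijGroup UNIV) \<longleftrightarrow> bij f" for f :: "'a \<Rightarrow> 'a" by (simp add: BijGroup_def Bij_def)
  show "\<one>\<^bsub>BijGroup UNIV\<^esub> = (id :: 'a \<Rightarrow> 'a)" by (simp add: BijGroup_def fun_eq_iff)
  show "bij f \<Longrightarrow> bij g \<Longrightarrow> f \<otimes>\<^bsub>BijGroup UNIV\<^esub> g = f \<circ> g"
    by (simp add: BijGroup_def Bij_def compose_def fun_eq_iff)
qed

lemma inv_BijGroup_UNIV: "bij f \<Longrightarrow> inv\<^bsub>BijGroup UNIV\<^esub> f = inv_into UNIV f"
  by (subst inv_BijGroup) (auto simp: Bij_def)

definition letter_map :: "(nat \<Rightarrow> 'a \<Rightarrow> 'a) \<Rightarrow> nat \<times> bool \<Rightarrow> 'a \<Rightarrow> 'a" where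
  "letter_map \<gamma> k = (if snd k then \<gamma> (fst k) else inv_into UNIV (\<gamma> (fst k)))"

locale transformations =
  fixes n :: nat and \<gamma> :: "nat \<Rightarrow> 'a \<Rightarrow> 'a"
  assumes bij: "i < n \<Longrightarrow> bij (\<gamma> i)"
begin

abbreviation \<alpha> where "\<alpha> \<equiv> letter_map \<gamma>"
abbreviation G where "G \<equiv> transformation_group (generated_group n \<gamma>)"

lemma bij_letter: "k \<in> letters n \<Longrightarrow> bij (\<alpha> k)"
  using bij[of "fst k"] by (simp add: letter_map_def letters_iff bij_imp_bij_inv)

lemma letter_bar: "k \<in> letters n \<Longrightarrow> \<alpha> k (\<alpha> (bar k) x) = x"
  using bij[of "fst k"] by (simp add: letter_map_def letters_iff bar_def bij_is_surj surj_f_inv_f bij_is_inj)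

lemma bij_word: "set w \<subseteq> letters n \<Longrightarrow> bij (word_map \<alpha> w)"
proof (induction w)
  case Nil
  have "word_map \<alpha> [] = id" by auto
  then show ?case by (simp only: bij_id)
next
  case (Cons k w)
  have eq: "word_map \<alpha> (k # w) = \<alpha> k \<circ> word_map \<alpha> w" by auto
  show ?case unfolding eq using Cons bij_letter by (intro bij_comp) auto
qed

lemma generated_group_eq: "generated_group n \<gamma> = word_map \<alpha> ` {w. set w \<subseteq> letters n}"
proof
  have nil: "word_map \<alpha> [] = id" by auto
  show "generated_group n \<gamma> \<subseteq> word_map \<alpha> ` {w. set w \<subseteq> letters n}"
  proof
    fix f assume "f \<in> generated_group n \<gamma>"
    then show "f \<in> word_map \<alpha> ` {w. set w \<subseteq> letters n}"
      unfolding generated_group_def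
    proof (induction rule: generate.induct)
      case one
      show ?case using nil by (intro image_eqI[of _ _ "[]"]) (auto simp: BijGroup_UNIV)
    next
      case (incl h)
      then obtain i where i: "i < n" "h = \<gamma> i" by auto
      show ?case by (rule image_eqI[of _ _ "[(i, True)]"]) (use i in \<open>auto simp: letter_map_def letters_iff\<close>)
    next
      case (inv h)
      then obtain i where i: "i < n" "h = \<gamma> i" by auto
      show ?case by (rule image_eqI[of _ _ "[(i, False)]"])
          (use i bij in \<open>auto simp: letter_map_def letters_iff inv_BijGroup_UNIV\<close>)
    next
      case (eng f1 f2)
      then obtain v w where vw: "set v \<subseteq> letters n" "f1 = word_map \<alpha> v" "set w \<subseteq> letters n" "f2 = word_map \<alpha> w" by auto
      have "f1 \<otimes>\<^bsub>BijGroup UNIV\<^esub> f2 = word_map \<alpha> (v @ w)"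
        using vw bij_word by (auto simp: BijGroup_UNIV(3) word_map_append)
      then show ?case using vw by (intro image_eqI[of _ _ "v @ w"]) auto
    qed
  qed
  have "word_map \<alpha> w \<in> generated_group n \<gamma>" if "set w \<subseteq> letters n" for w
    using that
  proof (induction w)
    case Nil
    show ?case unfolding generated_group_def nil BijGroup_UNIV(2)[symmetric] by (rule generate.one)
  next
    case (Cons k w)
    have k: "fst k < n" using Cons by (simp add: letters_iff)
    have "\<alpha> k \<in> generated_group n \<gamma>"
      using generate.incl[of "\<gamma> (fst k)" "\<gamma> ` {..<n}" "BijGroup UNIV"] generate.inv[of "\<gamma> (fst k)" "\<gamma> ` {..<n}" "BijGroup UNIV"] k bij[OF k]
      by (simp add: letter_map_def generated_group_def inv_BijGroup_UNIV)
    then have "\<alpha> k \<otimes>\<^bsub>BijGroup UNIV\<^esub> word_map \<alpha> w \<in> generated_group n \<gamma>"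
      using Cons unfolding generated_group_def by (intro generate.eng) auto
    moreover have "\<alpha> k \<otimes>\<^bsub>BijGroup UNIV\<^esub> word_map \<alpha> w = word_map \<alpha> (k # w)"
      using Cons bij_word bij_letter by (auto simp: BijGroup_UNIV(3))
    ultimately show ?case by (simp only:)
  qed
  then show "word_map \<alpha> ` {w. set w \<subseteq> letters n} \<subseteq> generated_group n \<gamma>" by blast
qed

lemma gens_carrier: "\<gamma> ` {..<n} \<subseteq> carrier (BijGroup UNIV)"
  using bij by (auto simp: BijGroup_UNIV)

lemma subgroup_generated: "subgroup (generated_group n \<gamma>) (BijGroup UNIV)"
  unfolding generated_group_def by (rule group.generate_is_subgroup[OF group_BijGroup gens_carrier])

lemma bij_generated: "f \<in> generated_group n \<gamma> \<Longrightarrow> bij f"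
  using subgroup.subset[OF subgroup_generated] BijGroup_UNIV(1) by blast

text \<open>The free basis is the set \<open>X\<close> of the generators as maps. Choosing one index
  for each map turns words over \<open>X\<close> into words over indices; the choice is injective,
  so reduced words stay reduced.\<close>

lemma free_groupI:
  assumes free: "\<And>w. w \<noteq> [] \<Longrightarrow> reduced w \<Longrightarrow> set w \<subseteq> letters n \<Longrightarrow> word_map \<alpha> w \<noteq> id"
  shows "free_group G"
proof -
  interpret BG: group "BijGroup UNIV :: ('a \<Rightarrow> 'a) monoid" by (rule group_BijGroup)
  define X where "X = \<gamma> ` {..<n}"
  have Xsub: "X \<subseteq> generated_group n \<gamma>" unfolding X_def generated_group_def by (auto intro: generate.incl)
  have gen: "generate G X = carrier G"
    using BG.generate_consistent[OF Xsub subgroup_generated] by (simp add: generated_group_def X_def)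
  define idx where "idx x = (SOME i. i < n \<and> \<gamma> i = x)" for x
  have idx: "idx x < n" "\<gamma> (idx x) = x" if "x \<in> X" for x
  proof -
    have "\<exists>i. i < n \<and> \<gamma> i = x" using that by (auto simp: X_def)
    from someI_ex[OF this] show "idx x < n" "\<gamma> (idx x) = x" by (auto simp: idx_def)
  qed
  define tr where "tr = map (\<lambda>(x, b). (idx x, b :: bool))"
  have tr_letters: "set (tr w) \<subseteq> letters n" if "set w \<subseteq> X \<times> UNIV" for w
    using that idx by (auto simp: tr_def letters_iff)
  have val: "word_value G w = word_map \<alpha> (tr w)" if "set w \<subseteq> X \<times> UNIV" for w
    using that
  proof (induction w)
    case Nil
    have "word_map \<alpha> [] = id" by auto
    then show ?case by (simp add: word_value_def BijGroup_UNIV tr_def)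
  next
    case (Cons a w)
    obtain x b where a: "a = (x, b)" by (cases a)
    have x: "x \<in> X" using Cons a by auto
    have ix: "inv\<^bsub>G\<^esub> x = inv_into UNIV x"
      using BG.m_inv_consistent[OF subgroup_generated, of x] Xsub x inv_BijGroup_UNIV[OF bij_generated] by auto
    have l: "(if b then x else inv\<^bsub>G\<^esub> x) = \<alpha> (idx x, b)"
      using idx[OF x] by (simp add: ix letter_map_def)
    have "word_value G (a # w) = (if b then x else inv\<^bsub>G\<^esub> x) \<otimes>\<^bsub>BijGroup UNIV\<^esub> word_value G w"
      by (simp add: word_value_def a)
    also have "\<dots> = \<alpha> (idx x, b) \<otimes>\<^bsub>BijGroup UNIV\<^esub> word_map \<alpha> (tr w)"
      unfolding l using Cons by simp
    also have "\<dots> = \<alpha> (idx x, b) \<circ> word_map \<alpha> (tr w)"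
      using Cons idx[OF x] by (intro BijGroup_UNIV(3) bij_letter bij_word tr_letters) (auto simp: letters_iff)
    finally show ?case by (auto simp: tr_def a)
  qed
  have red: "reduced (tr w)" if "set w \<subseteq> X \<times> UNIV" "reduced_word w" for w
    using that
  proof (induction w rule: induct_list012)
    case (3 a a' w)
    obtain x b y c where a: "a = (x, b)" "a' = (y, c)" by (cases a, cases a')
    have "x \<in> X" "y \<in> X" using 3(3) a by auto
    then have "idx x = idx y \<Longrightarrow> x = y" using idx(2) by metis
    moreover have "\<not> (x = y \<and> b \<noteq> c)" "reduced_word (a' # w)" using 3(4) by (auto simp: reduced_word_def a)
    moreover have "reduced (tr (a' # w))" using 3 \<open>reduced_word (a' # w)\<close> by simp
    ultimately show ?case by (auto simp: tr_def a bar_def)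
  qed (auto simp: tr_def)
  have "word_value G w \<noteq> \<one>\<^bsub>G\<^esub>" if "w \<noteq> []" "set w \<subseteq> X \<times> UNIV" "reduced_word w" for w
    using free[OF _ red[OF that(2,3)] tr_letters[OF that(2)]] val[OF that(2)] that(1)
    by (simp add: BijGroup_UNIV tr_def)
  moreover have "group G" by (rule BG.subgroup_imp_group[OF subgroup_generated])
  ultimately show ?thesis unfolding free_group_def using Xsub gen by (intro conjI exI[of _ X]) auto
qed

end

lemma linear_inv: assumes "linear g" "bij g" shows "linear (inv_into UNIV g)"
proof (rule linearI)
  note s = surj_f_inv_f[OF bij_is_surj[OF assms(2)]] and i = inv_f_f[OF bij_is_inj[OF assms(2)]]
  show "inv_into UNIV g (x + y) = inv_into UNIV g x + inv_into UNIV g y" for x y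
    using i[of "inv_into UNIV g x + inv_into UNIV g y"] by (simp add: linear_add[OF assms(1)] s)
  show "inv_into UNIV g (c *\<^sub>R x) = c *\<^sub>R inv_into UNIV g x" for x c
    using i[of "c *\<^sub>R inv_into UNIV g x"] by (simp add: linear_scale[OF assms(1)] s)
qed

lemma SO_grp_inv: assumes g: "g \<in> SO_grp Q" shows "inv_into UNIV g \<in> SO_grp Q"
proof -
  have g': "linear g" "bij g" "\<And>x. Q (g x) = Q x" "det (matrix g) = 1" using g by (auto simp: SO_grp_def O_grp_def)
  note s = surj_f_inv_f[OF bij_is_surj[OF g'(2)]]
  have "g \<circ> inv_into UNIV g = id" by (auto simp: s)
  then have "det (matrix g) * det (matrix (inv_into UNIV g)) = 1"
    using matrix_compose[OF linear_inv[OF g'(1,2)] g'(1)] by (metis det_mul det_I matrix_id)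
  then show ?thesis using g' linear_inv[OF g'(1,2)] g'(3)[of "inv_into UNIV g x" for x]
    by (simp add: SO_grp_def O_grp_def bij_imp_bij_inv s)
qed

lemma SO_grp_comp: assumes "f \<in> SO_grp Q" "g \<in> SO_grp Q" shows "f \<circ> g \<in> SO_grp Q"
  using assms matrix_compose[of g f] by (auto simp: SO_grp_def O_grp_def det_mul bij_comp linear_compose)

lemma SO_grp_id: "id \<in> SO_grp Q"
  by (simp add: SO_grp_def O_grp_def linear_id)

section \<open>Affine deformations of a free group\<close>

locale affine_transformations =
  fixes n :: nat and g :: "nat \<Rightarrow> real ^ 'n \<Rightarrow> real ^ 'n" and t :: "nat \<Rightarrow> real ^ 'n" and Q :: "real ^ 'n \<Rightarrow> real"
  assumes g_SO: "i < n \<Longrightarrow> g i \<in> SO_grp Q"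
    and free: "\<And>w. w \<noteq> [] \<Longrightarrow> reduced w \<Longrightarrow> set w \<subseteq> letters n \<Longrightarrow> word_map (letter_map g) w \<noteq> id"
begin

definition \<gamma> where "\<gamma> i x = g i x + t i"

lemma g: "i < n \<Longrightarrow> linear (g i)" "i < n \<Longrightarrow> bij (g i)"
  using g_SO by (auto simp: SO_grp_def O_grp_def)

lemma inv_gamma: "i < n \<Longrightarrow> bij (\<gamma> i) \<and> inv_into UNIV (\<gamma> i) x = inv_into UNIV (g i) (x - t i)"
proof -
  assume i: "i < n"
  note s = surj_f_inv_f[OF bij_is_surj[OF g(2)[OF i]]] and j = inv_f_f[OF bij_is_inj[OF g(2)[OF i]]]
  have 1: "\<gamma> i (inv_into UNIV (g i) (x - t i)) = x" for x by (simp add: \<gamma>_def s)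
  have 2: "inv_into UNIV (g i) (\<gamma> i x - t i) = x" for x by (simp add: \<gamma>_def j)
  have "bij (\<gamma> i)" by (rule o_bij[of "\<lambda>x. inv_into UNIV (g i) (x - t i)"]) (auto simp: 1 2)
  then show ?thesis using 1[of x] by (metis bij_is_inj inv_f_eq)
qed

sublocale lin: transformations n g by unfold_locales (rule g)
sublocale aff: transformations n \<gamma> by unfold_locales (use inv_gamma in blast)

lemma letter_diff: "k \<in> letters n \<Longrightarrow> letter_map \<gamma> k x - letter_map \<gamma> k y = letter_map g k (x - y)"
proof -
  assume "k \<in> letters n"
  then have k: "fst k < n" by (simp add: letters_iff)
  have "inv_into UNIV (g (fst k)) (x - t (fst k)) - inv_into UNIV (g (fst k)) (y - t (fst k)) = inv_into UNIV (g (fst k)) (x - y)"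
    using linear_diff[OF linear_inv[OF g[OF k]], of "x - t (fst k)" "y - t (fst k)"] by simp
  then show ?thesis using inv_gamma[OF k] linear_diff[OF g(1)[OF k]] by (simp add: letter_map_def \<gamma>_def)
qed

lemma word_diff: "set w \<subseteq> letters n \<Longrightarrow> word_map (letter_map \<gamma>) w x - word_map (letter_map \<gamma>) w y = word_map (letter_map g) w (x - y)"
  by (induction w) (auto simp: letter_diff)

lemma linear_part_word: "set w \<subseteq> letters n \<Longrightarrow> linear_part (word_map (letter_map \<gamma>) w) = word_map (letter_map g) w"
  by (auto simp: linear_part_def word_diff)

lemma word_SO: "set w \<subseteq> letters n \<Longrightarrow> word_map (letter_map g) w \<in> SO_grp Q"
proof (induction w)
  case Nil
  have "word_map (letter_map g) [] = id" by auto
  then show ?case by (simp only: SO_grp_id)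
next
  case (Cons k w)
  have "letter_map g k \<in> SO_grp Q" using Cons g_SO[of "fst k"] SO_grp_inv by (auto simp: letter_map_def letters_iff)
  moreover have "word_map (letter_map g) (k # w) = letter_map g k \<circ> word_map (letter_map g) w" by auto
  ultimately show ?case using Cons SO_grp_comp by (metis insert_subset list.simps(15))
qed

text \<open>By freeness of the linear group the reduced form of a word with trivial linear value is
  empty. This gives injectivity of the linear part on the affine group.\<close>

lemma trivial_word:
  assumes w: "set w \<subseteq> letters n" "word_map (letter_map g) w = id"
  shows "word_map (letter_map \<gamma>) w = id"
proof -
  obtain v where v: "reduced v" "set v \<subseteq> letters n" "word_map (letter_map \<gamma>) v = word_map (letter_map \<gamma>) w"
    using word_map_reduce[of "letters n" "letter_map \<gamma>" w] aff.letter_bar w(1) by metis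
  have "word_map (letter_map g) v = id" using linear_part_word[OF v(2)] linear_part_word[OF w(1)] v(3) w(2) by simp
  then have "v = []" using free[OF _ v(1,2)] by blast
  then have "word_map (letter_map \<gamma>) w x = x" for x using fun_cong[OF v(3), of x] by simp
  then show ?thesis by auto
qed

lemma affine_deformation: "affine_deformation Q (affine_generated_group n g t) (generated_group n g)"
proof -
  define \<Gamma> where "\<Gamma> = generated_group n \<gamma>"
  have \<Gamma>: "affine_generated_group n g t = \<Gamma>" by (simp add: affine_generated_group_def \<Gamma>_def \<gamma>_def[abs_def])
  have \<Gamma>w: "\<Gamma> = word_map (letter_map \<gamma>) ` {w. set w \<subseteq> letters n}" unfolding \<Gamma>_def by (rule aff.generated_group_eq)
  note Gw = lin.generated_group_eq
  have SO: "linear_part f \<in> SO_grp Q" if "f \<in> \<Gamma>" for f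
    using that linear_part_word word_SO by (auto simp: \<Gamma>w)
  have "linear_part \<in> hom (transformation_group \<Gamma>) (transformation_group (generated_group n g))"
  proof (rule homI)
    show "linear_part f \<in> carrier (transformation_group (generated_group n g))" if "f \<in> carrier (transformation_group \<Gamma>)" for f
      using that linear_part_word by (auto simp: \<Gamma>w Gw)
    fix f1 f2 assume "f1 \<in> carrier (transformation_group \<Gamma>)" "f2 \<in> carrier (transformation_group \<Gamma>)"
    then obtain v w where vw: "set v \<subseteq> letters n" "f1 = word_map (letter_map \<gamma>) v" "set w \<subseteq> letters n" "f2 = word_map (letter_map \<gamma>) w"
      by (auto simp: \<Gamma>w)
    have "f1 \<otimes>\<^bsub>BijGroup UNIV\<^esub> f2 = word_map (letter_map \<gamma>) (v @ w)"
      using vw aff.bij_word by (auto simp: BijGroup_UNIV(3) word_map_append)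
    moreover have "linear_part f1 \<otimes>\<^bsub>BijGroup UNIV\<^esub> linear_part f2 = word_map (letter_map g) (v @ w)"
      using vw lin.bij_word by (auto simp: BijGroup_UNIV(3) word_map_append linear_part_word)
    ultimately show "linear_part (f1 \<otimes>\<^bsub>transformation_group \<Gamma>\<^esub> f2) = linear_part f1 \<otimes>\<^bsub>transformation_group (generated_group n g)\<^esub> linear_part f2"
      using linear_part_word[of "v @ w"] vw by simp
  qed
  moreover have "inj_on linear_part \<Gamma>"
  proof (rule inj_onI)
    fix f1 f2 assume f: "f1 \<in> \<Gamma>" "f2 \<in> \<Gamma>" "linear_part f1 = linear_part f2"
    then obtain v w where vw: "set v \<subseteq> letters n" "f1 = word_map (letter_map \<gamma>) v" "set w \<subseteq> letters n" "f2 = word_map (letter_map \<gamma>) w"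
      by (auto simp: \<Gamma>w)
    define u where "u = map bar (rev w)"
    have u: "set u \<subseteq> letters n" using vw by (auto simp: u_def)
    have inv: "word_map (letter_map g) u (word_map (letter_map g) w x) = x"
      "word_map (letter_map \<gamma>) w (word_map (letter_map \<gamma>) u x) = x" for x
      unfolding u_def using word_map_inverse(2)[of "letters n" "letter_map g" w x] word_map_inverse(1)[of "letters n" "letter_map \<gamma>" w x]
        vw lin.letter_bar aff.letter_bar by auto
    have "word_map (letter_map g) (u @ v) = id"
      using inv f(3) vw by (auto simp: word_map_append linear_part_word)
    then have "word_map (letter_map \<gamma>) (u @ v) = id" using u vw by (intro trivial_word) auto
    then have "word_map (letter_map \<gamma>) u (f1 x) = x" for x using vw word_map_append[of "letter_map \<gamma>" u v x] by simp
    then show "f1 = f2" using inv(2) vw by (metis ext)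
  qed
  moreover have "linear_part ` \<Gamma> = generated_group n g"
    using linear_part_word by (force simp: \<Gamma>w Gw image_image)
  ultimately have "linear_part \<in> iso (transformation_group \<Gamma>) (transformation_group (generated_group n g))"
    by (intro isoI) (auto simp: bij_betw_def)
  then show ?thesis unfolding affine_deformation_def \<Gamma> using SO aff.subgroup_generated by (simp add: \<Gamma>_def)
qed

end

section \<open>The theorem\<close>

lemma axis_of_bar: "axis_of e (bar k) = - axis_of e k"
  by (simp add: axis_of_def bar_def)

locale schottky_frameset = signature_form Q S d for Q :: "real ^ 'n \<Rightarrow> real" and S d +
  fixes ori :: "(real ^ 'n) set \<Rightarrow> (real ^ 'n) list set" and n :: nat
    and W :: "nat \<Rightarrow> 'n subspace_pair" and g :: "nat \<Rightarrow> real ^ 'n \<Rightarrow> real ^ 'n" and \<epsilon> \<sigma> s :: real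
  assumes d_pos: "d \<ge> 1" and orient: "orientation_choice Q ori"
    and eps: "\<epsilon> > 0" and sigma: "\<sigma> = sqrt (1 - cos (min \<epsilon> (pi / 2)))" and s_def: "s = (\<sigma>\<^sup>2 / 100)\<^sup>2"
    and frameset: "is_frameset Q n W" and separated: "separation Q S ori n W \<ge> \<epsilon>"
    and gens: "i < n \<Longrightarrow> pseudohyperbolic Q (g i)" "i < n \<Longrightarrow> frame_of (g i) = W i"
      "i < n \<Longrightarrow> contraction_strength Q S (g i) \<le> s"
begin

lemma sigma_bounds: "0 < \<sigma>" "\<sigma> \<le> 1"
proof -
  define c where "c = cos (min \<epsilon> (pi / 2))"
  have th: "0 < min \<epsilon> (pi / 2)" "min \<epsilon> (pi / 2) \<le> pi / 2" using eps by auto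
  have "0 \<le> c" unfolding c_def using th by (intro cos_ge_zero) linarith+
  moreover have "c < cos 0" unfolding c_def using th pi_gt_zero by (intro cos_monotone_0_pi) linarith+
  ultimately show "0 < \<sigma>" "\<sigma> \<le> 1" by (simp_all add: sigma c_def[symmetric])
qed

lemma s_bounds: "0 < s" "s < 1"
proof -
  have "\<sigma>\<^sup>2 \<le> 1" using sigma_bounds by (simp add: power_le_one)
  then have "0 < \<sigma>\<^sup>2 / 100" "\<sigma>\<^sup>2 / 100 < 1" using sigma_bounds by auto
  then show "0 < s" "s < 1" unfolding s_def by (simp_all add: power_less_one_iff)
qed

lemma ph: "i < n \<Longrightarrow> ph_map Q S d (g i) s"
  using gens[of i] frameset s_bounds by unfold_locales (auto simp: is_frameset_def)

abbreviation V where "V \<equiv> component W"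

lemma V_False: "i < n \<Longrightarrow> V (i, False) = V_lt (g i)" and V_True: "i < n \<Longrightarrow> V (i, True) = V_gt (g i)"
  using gens(2)[of i] by (metis component.simps frame_of_def fst_conv, metis component.simps frame_of_def snd_conv)

lemma MTIS_V: "k \<in> letters n \<Longrightarrow> MTIS Q (V k)"
  using frameset by (cases k) (auto simp: is_frameset_def is_frame_def letters_iff)

lemma wing_sep:
  assumes "k \<in> letters n" "l \<in> letters n" "k \<noteq> l" "x \<in> positive_wing Q ori (V k)" "y \<in> positive_wing Q ori (V l)"
  shows "\<sigma> * \<nu> x \<le> \<nu> (x - y)"
proof (rule angle_separation[OF eps _ assms(4,5) sigma])
  let ?a = "\<lambda>(k, l). set_angle (N0 Q S) (positive_wing Q ori (V k)) (positive_wing Q ori (V l))"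
  let ?A = "{set_angle (N0 Q S) (positive_wing Q ori (V k)) (positive_wing Q ori (V l)) | k l.
    k \<in> {..<n} \<times> UNIV \<and> l \<in> {..<n} \<times> UNIV \<and> k \<noteq> l}"
  have "?A \<subseteq> ?a ` (letters n \<times> letters n)"
  proof
    fix x assume "x \<in> ?A"
    then obtain k l where "k \<in> letters n" "l \<in> letters n" "x = ?a (k, l)" unfolding letters_def by auto
    then show "x \<in> ?a ` (letters n \<times> letters n)" by blast
  qed
  then have "finite ?A" by (rule finite_subset) (intro finite_imageI finite_cartesian_product finite_letters)
  moreover have "set_angle (N0 Q S) (positive_wing Q ori (V k)) (positive_wing Q ori (V l)) \<in> ?A"
    using assms(1-3) unfolding letters_def by blast
  ultimately have "separation Q S ori n W \<le> set_angle (N0 Q S) (positive_wing Q ori (V k)) (positive_wing Q ori (V l))"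
    unfolding separation_def by (rule Min_le)
  then show "\<epsilon> \<le> set_angle (N0 Q S) (positive_wing Q ori (V k)) (positive_wing Q ori (V l))"
    using separated by linarith
qed

lemma wing_contains:
  assumes i: "i < n" and k: "k \<in> {(i, False), (i, True)}"
  obtains \<tau> :: real where "\<tau> = 1 \<or> \<tau> = -1"
    "\<And>v x. v \<in> V k \<Longrightarrow> x \<ge> 0 \<Longrightarrow> v + x *\<^sub>R \<tau> *\<^sub>R ph_map.e0 Q S (g i) \<in> positive_wing Q ori (V k)"
proof -
  interpret p: ph_map Q S d "g i" s by (rule ph[OF i])
  have kl: "k \<in> letters n" using i k by (auto simp: letters_iff)
  have P: "perp Q (V k) = {v + b *\<^sub>R p.e0 |v b. v \<in> V k}"
  proof -
    have "V k = p.L \<or> V k = p.G" using k V_False[OF i] V_True[OF i] by blast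
    then show ?thesis
    proof
      assume eq: "V k = p.L"
      show ?thesis unfolding eq by (rule p.perp_L)
    next
      assume eq: "V k = p.G"
      show ?thesis unfolding eq by (rule p.perp_G)
    qed
  qed
  have e: "p.e0 \<notin> V k"
  proof
    assume "p.e0 \<in> V k"
    then have "p.e0 \<in> p.L \<or> p.e0 \<in> p.G" using k V_False[OF i] V_True[OF i] by blast
    then have "B p.e0 p.e0 = 0" using p.B_e0_L p.B_e0_G by blast
    then show False using p.Q_e0 by (simp add: B_self)
  qed
  have o: "is_orientation (V k) (ori (V k))" "is_orientation (perp Q (V k)) (ori (perp Q (V k)))"
    using orient MTIS_V[OF kl] by (auto simp: orientation_choice_def)
  show ?thesis by (rule positive_wing_contains[OF o P e]) (rule that)
qed

text \<open>The sign is chosen to point into the wing of the contracted subspace and away from that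
  of the expanded one; hence \<open>axis_of\<close> attaches the plus sign to
  \<open>False\<close>.\<close>

definition wing_axis where
  "wing_axis i = (SOME w. (w = ph_map.e0 Q S (g i) \<or> w = - ph_map.e0 Q S (g i)) \<and>
    (\<forall>v\<in>V (i, False). \<forall>x\<ge>0. v + x *\<^sub>R w \<in> positive_wing Q ori (V (i, False))) \<and>
    (\<forall>v\<in>V (i, True). \<forall>x\<ge>0. v + x *\<^sub>R (- w) \<in> positive_wing Q ori (V (i, True))))"

text \<open>The orientations give one sign for each of the two wings. If the signs agreed, a nonzero
  neutral vector would lie in both wings, and separation would compare it with itself.\<close>

lemma wing_axis:
  assumes i: "i < n"
  shows "wing_axis i = ph_map.e0 Q S (g i) \<or> wing_axis i = - ph_map.e0 Q S (g i)"
    and "v \<in> V (i, False) \<Longrightarrow> x \<ge> 0 \<Longrightarrow> v + x *\<^sub>R wing_axis i \<in> positive_wing Q ori (V (i, False))"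
    and "v \<in> V (i, True) \<Longrightarrow> x \<ge> 0 \<Longrightarrow> v + x *\<^sub>R (- wing_axis i) \<in> positive_wing Q ori (V (i, True))"
proof -
  interpret p: ph_map Q S d "g i" s by (rule ph[OF i])
  obtain \<tau> where \<tau>: "\<tau> = 1 \<or> \<tau> = -1"
    "\<And>v x. v \<in> V (i, False) \<Longrightarrow> x \<ge> 0 \<Longrightarrow> v + x *\<^sub>R \<tau> *\<^sub>R p.e0 \<in> positive_wing Q ori (V (i, False))"
    by (rule wing_contains[OF i, of "(i, False)"]) auto
  obtain \<tau>' where \<tau>': "\<tau>' = 1 \<or> \<tau>' = -1"
    "\<And>v x. v \<in> V (i, True) \<Longrightarrow> x \<ge> 0 \<Longrightarrow> v + x *\<^sub>R \<tau>' *\<^sub>R p.e0 \<in> positive_wing Q ori (V (i, True))"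
    by (rule wing_contains[OF i, of "(i, True)"]) auto
  have z: "0 \<in> V (i, False)" "0 \<in> V (i, True)"
    using subspace_0 p.parts(1,3) V_False[OF i] V_True[OF i] by auto
  have "\<tau>' \<noteq> \<tau>"
  proof
    assume eq: "\<tau>' = \<tau>"
    define x where "x = 0 + 1 *\<^sub>R \<tau> *\<^sub>R p.e0"
    have "x \<in> positive_wing Q ori (V (i, False))" "x \<in> positive_wing Q ori (V (i, True))"
      unfolding x_def using \<tau>(2)[OF z(1), of 1] \<tau>'(2)[OF z(2), of 1] eq by auto
    then have "\<sigma> * \<nu> x \<le> \<nu> (x - x)" using i by (intro wing_sep[of "(i, False)" "(i, True)"]) (auto simp: letters_iff)
    moreover have "\<nu> x = 1" using \<tau>(1) p.e0(2) by (auto simp: x_def nu_scale)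
    moreover have "\<nu> 0 = 0" using nu_scale[of 0 0] by simp
    ultimately show False using sigma_bounds by simp
  qed
  then have "\<tau>' = - \<tau>" using \<tau>(1) \<tau>'(1) by auto
  then have "(\<tau> *\<^sub>R p.e0 = p.e0 \<or> \<tau> *\<^sub>R p.e0 = - p.e0) \<and>
    (\<forall>v\<in>V (i, False). \<forall>x\<ge>0. v + x *\<^sub>R \<tau> *\<^sub>R p.e0 \<in> positive_wing Q ori (V (i, False))) \<and>
    (\<forall>v\<in>V (i, True). \<forall>x\<ge>0. v + x *\<^sub>R (- (\<tau> *\<^sub>R p.e0)) \<in> positive_wing Q ori (V (i, True)))"
    using \<tau> \<tau>' by auto
  then have "\<exists>w. (w = ph_map.e0 Q S (g i) \<or> w = - ph_map.e0 Q S (g i)) \<and>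
    (\<forall>v\<in>V (i, False). \<forall>x\<ge>0. v + x *\<^sub>R w \<in> positive_wing Q ori (V (i, False))) \<and>
    (\<forall>v\<in>V (i, True). \<forall>x\<ge>0. v + x *\<^sub>R (- w) \<in> positive_wing Q ori (V (i, True)))" by blast
  from someI_ex[OF this] show "wing_axis i = ph_map.e0 Q S (g i) \<or> wing_axis i = - ph_map.e0 Q S (g i)"
    "v \<in> V (i, False) \<Longrightarrow> x \<ge> 0 \<Longrightarrow> v + x *\<^sub>R wing_axis i \<in> positive_wing Q ori (V (i, False))"
    "v \<in> V (i, True) \<Longrightarrow> x \<ge> 0 \<Longrightarrow> v + x *\<^sub>R (- wing_axis i) \<in> positive_wing Q ori (V (i, True))"
    unfolding wing_axis_def[symmetric] by blast+
qed

abbreviation ax where "ax \<equiv> axis_of wing_axis"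

lemma ax_cases: assumes "k \<in> letters n" obtains "ax k = ph_map.e0 Q S (g (fst k))" | "ax k = - ph_map.e0 Q S (g (fst k))"
proof -
  have "fst k < n" using assms by (simp add: letters_iff)
  from wing_axis(1)[OF this] show ?thesis using that by (cases "snd k") (auto simp: axis_of_def)
qed

lemma ax_wing: "k \<in> letters n \<Longrightarrow> v \<in> V k \<Longrightarrow> x \<ge> 0 \<Longrightarrow> v + x *\<^sub>R ax k \<in> positive_wing Q ori (V k)"
  using wing_axis(2,3)[of "fst k" v x] by (cases k, cases "snd k") (auto simp: axis_of_def letters_iff)

abbreviation gk where "gk \<equiv> letter_map g"

lemma g_SO: "i < n \<Longrightarrow> g i \<in> SO_grp Q"
  using ph_map.det_g[OF ph] ph_map.g_O[OF ph] by (auto simp: SO_grp_def)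

lemma letter_cases:
  assumes "k \<in> letters n"
  obtains i where "i < n" "k = (i, True)" "bar k = (i, False)" | i where "i < n" "k = (i, False)" "bar k = (i, True)"
  using assms that by (cases k, cases "snd k") (auto simp: letters_iff bar_def)

sublocale lin: transformations n g
  by unfold_locales (use ph_map.bij_g[OF ph] in blast)

lemma gk_h: "i < n \<Longrightarrow> gk (i, False) = ph_map.h (g i)" and gk_True: "gk (i, True) = g i"
  using ph_map.h_def[OF ph] by (auto simp: letter_map_def)

lemma letter_props:
  assumes k: "k \<in> letters n"
  shows "subspace (V k)" "dim (V k) = dim T" "v \<in> V k \<Longrightarrow> w \<in> V k \<Longrightarrow> B v w = 0" "v \<in> V k \<Longrightarrow> B v (ax k) = 0"
    "\<nu> (ax k) = 1" "B (ax k) (ax k) > 0" "linear (gk k)" "gk k (ax k) = ax k" "B (gk k x) (gk k y) = B x y"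
    "v \<in> V k \<Longrightarrow> gk k v \<in> V k" "v \<in> V (bar k) \<Longrightarrow> gk k v \<in> V (bar k)" "v \<in> V (bar k) \<Longrightarrow> \<nu> (gk k v) \<le> s * \<nu> v"
    "\<exists>a b c. a \<in> V (bar k) \<and> c \<in> V k \<and> x = a + b *\<^sub>R ax k + c"
proof -
  have i: "fst k < n" using k by (simp add: letters_iff)
  interpret p: ph_map Q S d "g (fst k)" s by (rule ph[OF i])
  have Vk: "V k = p.L \<and> V (bar k) = p.G \<and> gk k = p.h \<or> V k = p.G \<and> V (bar k) = p.L \<and> gk k = g (fst k)"
    using V_False[OF i] V_True[OF i] gk_h[OF i] gk_True[of "fst k"] by (cases k, cases "snd k") (auto simp: bar_def)
  have a: "ax k = p.e0 \<or> ax k = - p.e0" using ax_cases[OF k] by blast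
  have he: "p.h p.e0 = p.e0" using p.h(2)[of p.e0] p.g_e0 by simp
  have Bh: "B (p.h x) (p.h y) = B x y" for x y using O_grp_B[OF p.g_O, of "p.h x" "p.h y"] p.h by simp
  show "subspace (V k)" "dim (V k) = dim T" using Vk p.parts(1,3) p.dims by auto
  show "v \<in> V k \<Longrightarrow> w \<in> V k \<Longrightarrow> B v w = 0" using Vk p.isoL p.isoG by (auto simp: isotropic_def)
  show "v \<in> V k \<Longrightarrow> B v (ax k) = 0" using Vk a p.B_e0_L p.B_e0_G by (auto simp: B_lin)
  show "\<nu> (ax k) = 1" using a p.e0(2) nu_scale[of "-1" p.e0] by auto
  have "B p.e0 p.e0 > 0" using p.Q_e0 by (simp add: B_self)
  then show "B (ax k) (ax k) > 0" using a by (auto simp: B_lin)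
  show "linear (gk k)" using Vk p.lin p.lin_h by auto
  show "gk k (ax k) = ax k" using Vk a p.g_e0 he linear_neg[OF p.lin] linear_neg[OF p.lin_h] by auto
  show "B (gk k x) (gk k y) = B x y" using Vk Bh O_grp_B[OF p.g_O] by auto
  show "v \<in> V k \<Longrightarrow> gk k v \<in> V k" "v \<in> V (bar k) \<Longrightarrow> gk k v \<in> V (bar k)"
    using Vk p.parts(4,6) p.h_L p.h_G by auto
  show "v \<in> V (bar k) \<Longrightarrow> \<nu> (gk k v) \<le> s * \<nu> v" using Vk p.contr_L p.contr_G by auto
  show "\<exists>a b c. a \<in> V (bar k) \<and> c \<in> V k \<and> x = a + b *\<^sub>R ax k + c"
  proof -
    have "\<exists>a b c. a \<in> V (bar k) \<and> c \<in> V k \<and> x = a + b *\<^sub>R p.e0 + c" using Vk p.decomp[of x] p.decomp_swap[of x] by auto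
    then obtain u b c where u: "u \<in> V (bar k)" "c \<in> V k" "x = u + b *\<^sub>R p.e0 + c" by blast
    show ?thesis
      using a
    proof
      assume "ax k = - p.e0"
      then have "x = u + (- b) *\<^sub>R ax k + c" using u(3) by simp
      then show ?thesis using u(1,2) by blast
    qed (use u in auto)
  qed
qed

text \<open>The dimension parameter is \<open>dim T\<close>: the equality with \<open>d\<close>
  comes from a generator through \<open>ph_map\<close>, whereas this form makes sense for every
  \<open>n\<close>.\<close>

sublocale core: schottky_data n \<nu> B V ax gk \<sigma> s "dim T"
proof (rule schottky_data.intro, unfold letters_def[symmetric])
  show "\<nu> (x + y) \<le> \<nu> x + \<nu> y" for x y by (rule nu_add)
  show "\<nu> (c *\<^sub>R x) = \<bar>c\<bar> * \<nu> x" for c x by (rule nu_scale)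
  show "x \<noteq> 0 \<Longrightarrow> 0 < \<nu> x" for x by (rule nu_pos)
  show "0 < \<sigma>" "\<sigma> \<le> 1" by (rule sigma_bounds)+
  show "s = (\<sigma>\<^sup>2 / 100)\<^sup>2" by (rule s_def)
  show "bilinear B" by (rule bilinear_B)
  show "B x y = B y x" for x y by (rule B_sym)
  show "B x x \<le> (\<nu> x)\<^sup>2" for x by (rule B_le_nu)
  show "\<sigma> * \<nu> (v + b *\<^sub>R ax k) \<le> \<nu> (v + b *\<^sub>R ax k - (w + c *\<^sub>R ax l))"
    if "k \<in> letters n" "l \<in> letters n" "k \<noteq> l" "v \<in> V k" "w \<in> V l" "0 \<le> b" "0 \<le> c" for k l v w b c
    using that by (intro wing_sep[of k l] ax_wing) auto
  show "\<exists>v\<in>V'. (\<nu> (x - v))\<^sup>2 \<le> B x x"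
    if "subspace V'" "dim V' = dim T" "\<And>v w. v \<in> V' \<Longrightarrow> w \<in> V' \<Longrightarrow> B v w = 0" "\<And>v. v \<in> V' \<Longrightarrow> B x v = 0" for V' x
    using that by (intro isotropic_proj) (auto simp: isotropic_def)
qed (use letter_props lin.letter_bar in \<open>auto simp: axis_of_bar\<close>)

abbreviation F where "F \<equiv> core.F"

lemmas F_scale = core.F_scale[folded letters_def] and F_0 = core.F_0[folded letters_def]
  and F_shift = core.F_shift[folded letters_def] and F_g = core.F_g[folded letters_def]
  and F_lip = core.F_lip[folded letters_def] and F_disjoint = core.F_disjoint[folded letters_def]

lemma F_neg_pos: "k \<in> letters n \<Longrightarrow> l \<in> letters n \<Longrightarrow> k \<noteq> l \<Longrightarrow> F k x < 0 \<Longrightarrow> F l x > 0"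
  using F_disjoint[of k l x] F_0[of k] by force

lemma off_axis: "\<exists>v. v \<notin> span {ax k}"
proof (rule ccontr)
  assume "\<not> ?thesis"
  then have "span {ax k} = UNIV" by auto
  then have "dim (UNIV :: (real ^ 'n) set) = dim {ax k}" by (metis dim_span)
  also have "\<dots> \<le> 1" using dim_le_card'[of "{ax k}"] by simp
  finally show False using dim_UNIV d_pos by simp
qed

text \<open>A test point outside the repelling cone of the last letter, and not interior to the
  attracting cone of the first, is moved strictly into the latter. If the two cones differ, a
  nonzero boundary point of the second serves, which exists because the space is more than the axis;
  if they coincide, the opposite of the axis does.\<close>

lemma free: assumes w: "w \<noteq> []" "reduced w" "set w \<subseteq> letters n" shows "word_map gk w \<noteq> id"
proof
  assume id: "word_map gk w = id"
  define a b where "a = bar (last w)" and "b = hd w"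
  have ab: "a \<in> letters n" "b \<in> letters n" using w by (auto simp: a_def b_def)
  obtain x where x: "F a x > 0" "F b x \<ge> 0"
  proof (cases "a = b")
    case True
    have "F b (0 + (-1) *\<^sub>R ax b) = 1" using F_shift[OF ab(2), of 0 "-1"] F_0[OF ab(2)] by simp
    then show ?thesis using that[of "- ax b"] True by simp
  next
    case False
    obtain v where v: "v \<notin> span {ax b}" using off_axis by blast
    define y where "y = v + F b v *\<^sub>R ax b"
    have "F b y = 0" using F_shift[OF ab(2), of v "F b v"] by (simp add: y_def)
    moreover have "y \<noteq> 0"
    proof
      assume "y = 0"
      then have "v = (- F b v) *\<^sub>R ax b" by (simp add: y_def add_eq_0_iff2)
      then show False using v by (metis singletonI span_base span_scale)
    qed
    ultimately have "F a y > 0" using F_disjoint[OF ab False, of y] by force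
    then show ?thesis using that \<open>F b y = 0\<close> by simp
  qed
  have "F (hd w) (word_map gk w x) < 0"
    by (rule ping_pong_word[of "letters n" F gk]) (use F_g F_neg_pos w x in \<open>auto simp: a_def\<close>)
  then show False using x(2) id by (simp add: b_def)
qed

theorem free_generated: "free_group (transformation_group (generated_group n g))"
  by (rule lin.free_groupI) (rule free)

end

context schottky_frameset
begin

section \<open>Admissible translations and the resulting tessellation\<close>

lemma continuous_lipschitz:
  fixes f :: "real ^ 'n \<Rightarrow> real"
  assumes "\<And>x y. \<bar>f x - f y\<bar> \<le> L * \<nu> (x - y)" "L \<ge> 0"
  shows "continuous_on UNIV f"
proof -
  obtain C where C: "C > 0" "\<And>x. \<nu> x \<le> C * norm x" using nu_bounded by blast
  have "dist (f x) (f y) \<le> (L * C) * dist x y" for x y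
    using assms(1)[of x y] mult_left_mono[OF C(2)[of "x - y"] assms(2)] by (simp add: dist_norm)
  then have "(L * C)-lipschitz_on UNIV f" using C(1) assms(2) by (intro lipschitz_onI) auto
  then show ?thesis by (rule lipschitz_on_continuous_on)
qed

lemma continuous_nu: "continuous_on UNIV \<nu>"
proof (rule continuous_lipschitz[of _ 1])
  show "\<bar>\<nu> x - \<nu> y\<bar> \<le> 1 * \<nu> (x - y)" for x y
    using core.nu_diff2[of x y] core.nu_diff2[of y x] core.nu_diff_comm[of x y] by (simp add: abs_le_iff)
qed simp

lemma continuous_F: "k \<in> letters n \<Longrightarrow> continuous_on UNIV (F k)"
  by (rule continuous_lipschitz[of _ core.Lip]) (use F_lip core.Lip_pos in auto)

text \<open>Such a translation lowers \<open>F (i, True)\<close> by at least \<open>2\<close>; half of this is the gap between \<open>F\<close> and \<open>P\<close> at \<open>(i, False)\<close>,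
  the other half the gap at \<open>(i, True)\<close>.\<close>

definition small_shifts :: "(nat \<Rightarrow> real ^ 'n) set" where
  "small_shifts = PiE {..<n} (\<lambda>i. {t. core.Lip * \<nu> (t - 3 *\<^sub>R ax (i, True)) < 1})"

lemma open_small_shifts: "openin (product_topology (\<lambda>i. euclidean) {..<n}) small_shifts"
proof -
  have "open {t. core.Lip * \<nu> (t - 3 *\<^sub>R ax (i, True)) < 1}" for i
    by (intro open_Collect_less continuous_intros continuous_on_compose2[OF continuous_nu]) auto
  then show ?thesis unfolding small_shifts_def by (subst openin_PiE) auto
qed

lemma small_shifts_nonempty: "small_shifts \<noteq> {}"
proof -
  have "restrict (\<lambda>i. 3 *\<^sub>R ax (i, True)) {..<n} \<in> small_shifts" by (auto simp: small_shifts_def)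
  then show ?thesis by blast
qed

end

locale schottky_translations = schottky_frameset Q S d ori n W g \<epsilon> \<sigma> s
  for Q :: "real ^ 'n \<Rightarrow> real" and S d ori n W g \<epsilon> \<sigma> s +
  fixes t :: "nat \<Rightarrow> real ^ 'n"
  assumes t: "t \<in> small_shifts"
begin

sublocale affine_transformations n g t Q
  by unfold_locales (use g_SO free in auto)

abbreviation \<alpha> where "\<alpha> \<equiv> letter_map \<gamma>"

lemma t_near: "i < n \<Longrightarrow> core.Lip * \<nu> (t i - 3 *\<^sub>R ax (i, True)) < 1"
  using t by (auto simp: small_shifts_def)

text \<open>The side at \<open>(i, False)\<close> is the cone moved by one unit along its axis; the
  side at \<open>(i, True)\<close> is its partner under the affine generator, so that the pairing is
  exact. In general the latter is not a translated cone, and its gap to \<open>F\<close> has to come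
  from the translation part.\<close>

definition P :: "nat \<times> bool \<Rightarrow> real ^ 'n \<Rightarrow> real" where
  "P k x = (if snd k then - (F (bar k) (\<alpha> (bar k) x) + 1) else F k x + 1)"

lemma P_False: "P (i, False) x = F (i, False) x + 1"
  and P_True: "P (i, True) x = - P (i, False) (\<alpha> (i, False) x)"
  by (simp_all add: P_def bar_def)

lemma P_alpha: assumes k: "k \<in> letters n" shows "P k (\<alpha> k x) = - P (bar k) x"
  using k
proof (cases rule: letter_cases)
  case (1 i)
  then show ?thesis using aff.letter_bar[of "bar k" x] k by (simp add: P_True letters_iff bar_def)
next
  case (2 i)
  then show ?thesis by (simp add: P_True)
qed

lemma P_ge: assumes k: "k \<in> letters n" shows "F k x + 1 \<le> P k x"
  using k
proof (cases rule: letter_cases)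
  case (2 i)
  then show ?thesis by (simp add: P_False)
next
  case (1 i)
  define y where "y = \<alpha> (bar k) x"
  have "x = \<gamma> i y" using aff.letter_bar[OF k, of x] 1 by (simp add: y_def letter_map_def)
  then have x: "x = (g i y + (t i - 3 *\<^sub>R ax k)) + 3 *\<^sub>R ax k" by (simp add: \<gamma>_def)
  have "F k x = F k (g i y + (t i - 3 *\<^sub>R ax k)) - 3" by (subst x) (rule F_shift[OF k])
  also have "\<dots> \<le> F k (g i y) - 2"
    using F_lip[OF k, of "g i y + (t i - 3 *\<^sub>R ax k)" "g i y"] t_near[OF 1(1)] 1(2) by simp
  also have "F k (g i y) \<le> - F (bar k) y" using F_g[OF k, of y] 1 by (simp add: letter_map_def)
  finally show ?thesis using 1 by (simp add: P_def y_def)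
qed

sublocale aff_core: schottky_affine n \<nu> B V ax gk \<sigma> s "dim T" \<alpha> P
proof (rule schottky_affine.intro)
  show "schottky_data n \<nu> B V ax gk \<sigma> s (dim T)" by (rule core.schottky_data_axioms)
  show "schottky_affine_axioms n \<nu> V ax gk \<sigma> \<alpha> P"
    by (rule schottky_affine_axioms.intro, unfold letters_def[symmetric])
      (use letter_diff aff.letter_bar P_ge P_alpha in auto)
qed

lemma P_disj: assumes "k \<in> letters n" "l \<in> letters n" "k \<noteq> l" "P k x \<le> 0" shows "P l x > 0"
proof -
  have "F k x < 0" using P_ge[OF assms(1), of x] assms(4) by simp
  then have "F l x > 0" by (rule F_neg_pos[OF assms(1-3)])
  then show ?thesis using P_ge[OF assms(2), of x] by simp
qed

lemma continuous_alpha: "k \<in> letters n \<Longrightarrow> continuous_on UNIV (\<alpha> k)"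
proof -
  assume k: "k \<in> letters n"
  have eq: "\<alpha> k = (\<lambda>x. gk k x + \<alpha> k 0)"
  proof
    show "\<alpha> k x = gk k x + \<alpha> k 0" for x using letter_diff[OF k, of x 0] by (simp add: diff_eq_eq)
  qed
  have "continuous_on UNIV (gk k)"
    using letter_props(7)[OF k] by (intro linear_continuous_on) (simp add: linear_conv_bounded_linear)
  then have "continuous_on UNIV (\<lambda>x. gk k x + \<alpha> k 0)" by (intro continuous_on_add continuous_on_const)
  then show ?thesis by (rule ssubst[OF eq])
qed

lemma continuous_P: assumes k: "k \<in> letters n" shows "continuous_on UNIV (P k)"
proof (cases "snd k")
  case True
  have "continuous_on UNIV (\<lambda>x. - (F (bar k) (\<alpha> (bar k) x) + 1))"
    using k by (intro continuous_intros continuous_on_compose2[OF continuous_F continuous_alpha]) auto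
  then show ?thesis using True by (simp add: P_def[abs_def])
next
  case False
  have "continuous_on UNIV (\<lambda>x. F k x + 1)" using k by (intro continuous_intros continuous_F)
  then show ?thesis using False by (simp add: P_def[abs_def])
qed

text \<open>Passes from \<nu> to the Euclidean norm. The length is \<open>Suc m\<close> because
  every letter but one contributes a shift \<eta>.\<close>

lemma depth: "\<exists>J. \<forall>w x. length w = J \<and> reduced w \<and> set w \<subseteq> letters n \<and> norm x \<le> R \<longrightarrow> \<not> nested P \<alpha> w x"
proof -
  obtain C where C: "C > 0" "\<And>x. \<nu> x \<le> C * norm x" using nu_bounded by blast
  obtain m :: nat where m: "core.Lip * (C * R) / aff_core.\<eta> \<le> real m" using real_arch_simple by blast
  have "\<not> nested P \<alpha> w x" if "length w = Suc m" "reduced w" "set w \<subseteq> letters n" "norm x \<le> R" for w x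
  proof (rule aff_core.depth_bound)
    show "\<nu> x \<le> C * R" using C(2)[of x] mult_left_mono[OF that(4), of C] C(1) by linarith
    show "core.Lip * (C * R) \<le> (real (length w) - 1) * aff_core.\<eta>"
      using m aff_core.eta(1) that(1) by (simp add: field_simps)
  qed (use that in \<open>auto simp: letters_def\<close>)
  then show ?thesis by blast
qed

sublocale tess: tessellation "letters n" \<alpha> P
  by unfold_locales (use aff.letter_bar P_alpha P_disj continuous_alpha continuous_P depth in auto)

lemma tess_group: "tess.\<Gamma> = affine_generated_group n g t"
proof -
  have "affine_generated_group n g t = generated_group n \<gamma>" by (simp add: affine_generated_group_def \<gamma>_def[abs_def])
  then show ?thesis by (simp add: tess.\<Gamma>_def aff.generated_group_eq)
qed

lemma properly_discontinuous: "acts_properly_discontinuously (affine_generated_group n g t)"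
  using tess.properly_discontinuous by (simp add: tess_group)

section \<open>The quotient as the interior of a handlebody\<close>

definition r where "r i = norm (wing_axis i)"

lemma r_pos: "i < n \<Longrightarrow> r i > 0"
  using letter_props(5)[of "(i, False)"] core.nu_0 by (auto simp: r_def axis_of_def letters_iff)

lemma axis_scaled: assumes k: "k \<in> letters n" shows "axis_of (\<lambda>i. (1 / r i) *\<^sub>R wing_axis i) k = (1 / r (fst k)) *\<^sub>R ax k"
  by (simp add: axis_of_def)

lemma P_shift: assumes k: "k \<in> letters n" shows "P k (x + c *\<^sub>R ax k) = P k x - c"
proof (cases "snd k")
  case False
  then show ?thesis using F_shift[OF k] by (simp add: P_def)
next
  case True
  have kb: "bar k \<in> letters n" using k by simp
  have "\<alpha> (bar k) (x + c *\<^sub>R ax k) = \<alpha> (bar k) x + gk (bar k) (c *\<^sub>R ax k)"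
    using letter_diff[OF kb, of "x + c *\<^sub>R ax k" x] by (simp add: algebra_simps)
  also have "gk (bar k) (c *\<^sub>R ax k) = (- c) *\<^sub>R ax (bar k)"
    using letter_props(7,8)[OF kb] linear_scale[of "gk (bar k)" "- c" "ax (bar k)"] by (simp add: axis_of_bar)
  finally show ?thesis using True F_shift[OF kb, of "\<alpha> (bar k) x" "- c"] by (simp add: P_def)
qed

text \<open>The model works with Euclidean unit axes, while \<open>ax k\<close> has length 1 for
  \<nu>. Multiplying \<open>F\<close> and \<open>P\<close> by the Euclidean length \<open>r\<close>
  of the axis restores unit speed along the normalised axis and turns the gap 1 into
  \<open>r\<close>.\<close>

lemma handle_domain: "handle_domain n (\<lambda>i. (1 / r i) *\<^sub>R wing_axis i) (\<lambda>k x. r (fst k) * F k x)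
    (\<lambda>k x. r (fst k) * P k x) (\<lambda>k. r (fst k)) g t"
proof (rule handle_domain.intro)
  show "3 \<le> CARD('n)" using dim_UNIV d_pos by simp
  show "norm ((1 / r i) *\<^sub>R wing_axis i) = 1" if "i < n" for i using r_pos[OF that] by (simp add: r_def)
  show "linear (g i)" if "i < n" for i by (rule g(1)[OF that])
  show "g i ((1 / r i) *\<^sub>R wing_axis i) = (1 / r i) *\<^sub>R wing_axis i" if "i < n" for i
    using letter_props(8)[of "(i, True)"] that linear_scale[OF g(1)[OF that]] linear_neg[OF g(1)[OF that]]
    by (simp add: axis_of_def letters_iff letter_map_def)
  show "0 < det (matrix (g i))" if "i < n" for i using g_SO[OF that] by (simp add: SO_grp_def)
  show "r (fst (i, True)) * P (i, True) (g i x + t i) = - (r (fst (i, False)) * P (i, False) x)" if "i < n" for i x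
    using P_alpha[of "(i, True)" x] that by (simp add: letters_iff letter_map_def \<gamma>_def bar_def)
  fix k assume k: "k \<in> letters n"
  then have rk: "r (fst k) > 0" by (intro r_pos) (simp add: letters_iff)
  show "continuous_on UNIV (\<lambda>x. r (fst k) * F k x)" by (intro continuous_intros continuous_F k)
  show "continuous_on UNIV (\<lambda>x. r (fst k) * P k x)" by (intro continuous_intros continuous_P k)
  show "r (fst k) * F k (c *\<^sub>R x) = c * (r (fst k) * F k x)" if "0 \<le> c" for c x using F_scale[OF k that] by simp
  show "r (fst k) * F k (x + c *\<^sub>R axis_of (\<lambda>i. (1 / r i) *\<^sub>R wing_axis i) k) = r (fst k) * F k x - c" for x c
    using F_shift[OF k, of x "c / r (fst k)"] rk by (simp add: axis_scaled[OF k] right_diff_distrib)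
  show "r (fst k) * P k (x + c *\<^sub>R axis_of (\<lambda>i. (1 / r i) *\<^sub>R wing_axis i) k) = r (fst k) * P k x - c" for x c
    using P_shift[OF k, of x "c / r (fst k)"] rk by (simp add: axis_scaled[OF k] right_diff_distrib)
  show "0 < r (fst k)" by (rule rk)
  show "r (fst k) * F k x + r (fst k) \<le> r (fst k) * P k x" for x
    using mult_left_mono[OF P_ge[OF k, of x], of "r (fst k)"] rk by (simp add: distrib_left)
  show "x = 0" if l: "l \<in> letters n" "k \<noteq> l" "r (fst k) * F k x \<le> 0" "r (fst l) * F l x \<le> 0" for l x
  proof -
    have "r (fst l) > 0" using l(1) by (intro r_pos) (simp add: letters_iff)
    then show ?thesis using F_disjoint[OF k l(1,2), of x] l rk by (simp add: mult_le_0_iff)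
  qed
qed

text \<open>The model provides a glued map of the domain, the tessellation shows that its image is
  open, and only then is this image known to be the interior of the handlebody.\<close>

theorem quotient_handlebody:
  "\<exists>H :: (real ^ 'n) set. is_handlebody n H \<and>
    orbit_space (affine_generated_group n g t) homeomorphic_space top_of_set (interior H)"
proof -
  interpret hd: handle_domain n "\<lambda>i. (1 / r i) *\<^sub>R wing_axis i" "\<lambda>k x. r (fst k) * F k x"
    "\<lambda>k x. r (fst k) * P k x" "\<lambda>k. r (fst k)" g t by (rule handle_domain)
  have D: "hd.D = tess.D"
  proof -
    have "0 \<le> r (fst k) * P k x \<longleftrightarrow> 0 \<le> P k x" if "k \<in> letters n" for k x
      using r_pos[of "fst k"] that by (simp add: letters_iff zero_le_mult_iff)
    then show ?thesis by (simp add: hd.D_def tess.D_def)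
  qed
  obtain H :: "(real ^ 'n) set" and \<Phi> where H: "is_handlebody n H" "continuous_on tess.D \<Phi>"
    "open (\<Phi> ` tess.D) \<Longrightarrow> \<Phi> ` tess.D = interior H"
    and glue: "\<And>x y. x \<in> tess.D \<Longrightarrow> y \<in> tess.D \<Longrightarrow> \<Phi> x = \<Phi> y \<longleftrightarrow> x = y \<or>
      (\<exists>i<n. r (fst (i, False)) * P (i, False) x = 0 \<and> y = g i x + t i \<or> r (fst (i, False)) * P (i, False) y = 0 \<and> x = g i y + t i)"
    by (rule hd.handlebody_quotient[unfolded D]) (rule that)
  have \<gamma>_True: "\<alpha> (i, True) x = g i x + t i" for i x by (simp add: letter_map_def \<gamma>_def)
  \<comment> \<open>The model lists a side pairing once, in both directions; the tessellation lists
    it as the two letters \<open>(i, True)\<close> and \<open>(i, False)\<close>.\<close>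
  have pair: "(\<exists>i<n. r (fst (i, False)) * P (i, False) x = 0 \<and> y = g i x + t i \<or> r (fst (i, False)) * P (i, False) y = 0 \<and> x = g i y + t i) \<longleftrightarrow>
      (\<exists>k\<in>letters n. P (bar k) x = 0 \<and> y = \<alpha> k x)" for x y
  proof
    assume "\<exists>i<n. r (fst (i, False)) * P (i, False) x = 0 \<and> y = g i x + t i \<or> r (fst (i, False)) * P (i, False) y = 0 \<and> x = g i y + t i"
    then obtain i where i: "i < n" and c: "P (i, False) x = 0 \<and> y = g i x + t i \<or> P (i, False) y = 0 \<and> x = g i y + t i"
      using r_pos by fastforce
    have l: "(i, True) \<in> letters n" "(i, False) \<in> letters n" using i by (auto simp: letters_iff)
    from c show "\<exists>k\<in>letters n. P (bar k) x = 0 \<and> y = \<alpha> k x"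
    proof
      assume "P (i, False) x = 0 \<and> y = g i x + t i"
      then show ?thesis using l(1) \<gamma>_True by (intro bexI[of _ "(i, True)"]) (auto simp: bar_def)
    next
      assume a: "P (i, False) y = 0 \<and> x = g i y + t i"
      then have "x = \<alpha> (i, True) y" by (simp add: \<gamma>_True)
      then have "y = \<alpha> (i, False) x" "P (i, True) x = 0"
        using aff.letter_bar[OF l(2), of y] P_alpha[OF l(1), of y] a by (auto simp: bar_def)
      then show ?thesis using l(2) by (intro bexI[of _ "(i, False)"]) (auto simp: bar_def)
    qed
  next
    assume "\<exists>k\<in>letters n. P (bar k) x = 0 \<and> y = \<alpha> k x"
    then obtain k where k: "k \<in> letters n" "P (bar k) x = 0" "y = \<alpha> k x" by blast
    from k(1) show "\<exists>i<n. r (fst (i, False)) * P (i, False) x = 0 \<and> y = g i x + t i \<or> r (fst (i, False)) * P (i, False) y = 0 \<and> x = g i y + t i"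
    proof (cases rule: letter_cases)
      case (1 i)
      then show ?thesis using k \<gamma>_True by (intro exI[of _ i]) auto
    next
      case (2 i)
      have "P k y = 0" using P_alpha[OF k(1), of x] k by simp
      moreover have "x = \<alpha> (i, True) y" using aff.letter_bar[of "bar k" x] k 2 by simp
      ultimately show ?thesis using 2 \<gamma>_True by (intro exI[of _ i]) auto
    qed
  qed
  have op: "open (\<Phi> ` tess.D)" and hom: "orbit_space tess.\<Gamma> homeomorphic_space top_of_set (\<Phi> ` tess.D)"
    using tess.orbit_space_homeomorphic[OF H(2) refl] glue unfolding pair by blast+
  then show ?thesis using H(1) H(3)[OF op] by (auto simp: tess_group)
qed

end

theorem mainTheorem1:
  fixes Q :: "real ^ 'n \<Rightarrow> real"
    and S :: "(real ^ 'n) set"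
    and ori :: "(real ^ 'n) set \<Rightarrow> (real ^ 'n) list set"
    and d :: nat
  assumes "odd d"
    and "CARD('n) = 2 * d + 1"
    and "has_signature Q (d + 1) d"
    and "maximal_positive_definite Q S"
    and "orientation_choice Q ori"
  shows "\<forall>\<epsilon>>0. \<exists>s>0. \<forall>n W g.
    is_frameset Q n W \<and> separation Q S ori n W \<ge> \<epsilon> \<and>
    (\<forall>i<n. pseudohyperbolic Q (g i) \<and> frame_of (g i) = W i \<and> contraction_strength Q S (g i) \<le> s) \<longrightarrow>
      free_group (transformation_group (generated_group n g)) \<and>
      (\<exists>T. openin (product_topology (\<lambda>i. euclidean) {..<n}) T \<and> T \<noteq> {} \<and>
        (\<forall>t\<in>T. affine_deformation Q (affine_generated_group n g t) (generated_group n g) \<and>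
          acts_properly_discontinuously (affine_generated_group n g t)) \<and>
        (\<forall>t\<in>T. \<exists>H :: (real ^ 'n) set. is_handlebody n H \<and>
          orbit_space (affine_generated_group n g t) homeomorphic_space top_of_set (interior H)))"
proof (intro allI impI)
  fix \<epsilon> :: real assume eps: "\<epsilon> > 0"
  \<comment> \<open>Only \<epsilon> enters, so \<open>s\<close> is fixed before the frameset and the
    group are given.\<close>
  define \<sigma> where "\<sigma> = sqrt (1 - cos (min \<epsilon> (pi / 2)))"
  define s where "s = (\<sigma>\<^sup>2 / 100)\<^sup>2"
  have "cos (min \<epsilon> (pi / 2)) < cos 0" using eps pi_gt_zero by (intro cos_monotone_0_pi) (auto simp: min_def)
  then have "s > 0" by (simp add: s_def \<sigma>_def)
  have d: "d \<ge> 1" using \<open>odd d\<close> by (cases d) auto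
  interpret signature_form Q S d by unfold_locales (fact assms)+
  show "\<exists>s>0. \<forall>n W g.
    is_frameset Q n W \<and> separation Q S ori n W \<ge> \<epsilon> \<and>
    (\<forall>i<n. pseudohyperbolic Q (g i) \<and> frame_of (g i) = W i \<and> contraction_strength Q S (g i) \<le> s) \<longrightarrow>
      free_group (transformation_group (generated_group n g)) \<and>
      (\<exists>T. openin (product_topology (\<lambda>i. euclidean) {..<n}) T \<and> T \<noteq> {} \<and>
        (\<forall>t\<in>T. affine_deformation Q (affine_generated_group n g t) (generated_group n g) \<and>
          acts_properly_discontinuously (affine_generated_group n g t)) \<and>
        (\<forall>t\<in>T. \<exists>H :: (real ^ 'n) set. is_handlebody n H \<and>
          orbit_space (affine_generated_group n g t) homeomorphic_space top_of_set (interior H)))"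
  proof (intro exI[of _ s] conjI allI impI, rule \<open>s > 0\<close>)
    fix n W g
    assume "is_frameset Q n W \<and> separation Q S ori n W \<ge> \<epsilon> \<and>
      (\<forall>i<n. pseudohyperbolic Q (g i) \<and> frame_of (g i) = W i \<and> contraction_strength Q S (g i) \<le> s)"
    then interpret schottky_frameset Q S d ori n W g \<epsilon> \<sigma> s
      using d eps assms(5) by unfold_locales (auto simp: \<sigma>_def s_def)
    have tr: "schottky_translations Q S d ori n W g \<epsilon> \<sigma> s t" if "t \<in> small_shifts" for t
      using that by unfold_locales
    show "free_group (transformation_group (generated_group n g))" by (rule free_generated)
    show "\<exists>T. openin (product_topology (\<lambda>i. euclidean) {..<n}) T \<and> T \<noteq> {} \<and>
        (\<forall>t\<in>T. affine_deformation Q (affine_generated_group n g t) (generated_group n g) \<and>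
          acts_properly_discontinuously (affine_generated_group n g t)) \<and>
        (\<forall>t\<in>T. \<exists>H :: (real ^ 'n) set. is_handlebody n H \<and>
          orbit_space (affine_generated_group n g t) homeomorphic_space top_of_set (interior H))"
    proof (intro exI[of _ small_shifts] conjI ballI open_small_shifts small_shifts_nonempty)
      fix t assume "t \<in> small_shifts"
      then interpret schottky_translations Q S d ori n W g \<epsilon> \<sigma> s t by (rule tr)
      show "affine_deformation Q (affine_generated_group n g t) (generated_group n g)" by (rule affine_deformation)
      show "acts_properly_discontinuously (affine_generated_group n g t)" by (rule properly_discontinuous)
      show "\<exists>H :: (real ^ 'n) set. is_handlebody n H \<and>
          orbit_space (affine_generated_group n g t) homeomorphic_space top_of_set (interior H)" by (rule quotient_handlebody)
    qed
  qed
qed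

end
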